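(* Let $S$ be a codimension-two spacelike submanifold embedded in a spacetime $(M,g)$ of dimension $n+2\ge4$, and let $\xi$ be a lightlike normal vector field on $S$. Let $\Sigma=\Phi(\mathscr O)$ be the lightlike hypersurface generated from $S$ by the normal exponential map along $\xi$, with geodesic extension $U$ of $\xi$ and screen distribution $\mathcal S$ (see context). Then, for any flow-invariant vector field $X\in\mathfrak I(\Sigma)$ and any lightlike geodesic generator $\gamma$ of $\Sigma$, the vector field $J=X\circ\gamma$ is an $S$-Jacobi field along $\gamma$, which describes the variation of $\gamma$ through lightlike geodesics initially normal to $S$ (i.e. $J$ is the variation vector field of such a variation). Moreover, if $\Sigma$ is totally umbilical, then $J=X\circ\gamma$ satisfies $$J''+\frac{\widetilde{\mathrm{Ric}}(\gamma',\gamma')}{n}J=f\,\gamma',$$ where $n=\dim S$, $\widetilde{\mathrm{Ric}}$ is the Ricci tensor of $M$, and $f$ is the smooth function along $\gamma$ given by $$f=\gamma'(\tau(J))-\mu\,\tau(J),$$ where $\mu$ is the umbilicity function ($B_U=\mu g$) and $\tau$ is the rotation one-form associated with $U$ and $\mathcal S$. Primes denote covariant derivatives along $\gamma$: $J'=\widetilde\nabla_{\gamma'}J$, $J''=\widetilde\nabla_{\gamma'}\widetilde\nabla_{\gamma'}J$.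
   Context: A spacetime is a connected time-oriented Lorentzian manifold of signature $(-,+,\dots,+)$, with Levi-Civita connection $\widetilde\nabla$; lightlike vectors are nonzero null vectors; $S$ is connected of dimension $n$ with induced Riemannian metric. Curvature convention: $\widetilde R(X,Y)Z=\widetilde\nabla_X\widetilde\nabla_YZ-\widetilde\nabla_Y\widetilde\nabla_XZ-\widetilde\nabla_{[X,Y]}Z$, $\widetilde{\mathrm{Ric}}(Y,Z)=\operatorname{trace}(X\mapsto\widetilde R(X,Y)Z)$. Normal exponential construction: choose an open neighborhood $\mathscr V$ of the zero section of the normal bundle $T^\perp S$, fiberwise star-shaped about $0$, such that the normal exponential map $\exp^\perp$ restricts to a diffeomorphism from $\mathscr V$ onto an open neighborhood of $S$ in $M$. Put $\mathscr O=\{(p,t)\in S\times\mathbb R: t\xi_p\in\mathscr V\}$, $\Phi\colon\mathscr O\to M$, $\Phi(p,t)=\exp^\perp_p(t\xi_p)$, and $\Sigma=\Phi(\mathscr O)$. Then $\Phi$ is an embedding, $\Sigma$ is a lightlike hypersurface (the induced metric is everywhere degenerate) containing $S=\Phi(S\times\{0\})$; $U=\Phi_*(\partial_t)$ is a lightlike vector field on $\Sigma$ with $\widetilde\nabla_UU=0$, $U|_S=\xi$, spanning the radical of the induced metric; $\mathcal S$ is the integrable screen distribution (complementary to $\operatorname{span}\{U\}$ in $T\Sigma$) given by the images under $\Phi_*$ of the tangent spaces to the slices $\{t=\text{const}\}$ of $\mathscr O$. The lightlike geodesic generators are the integral curves $\gamma(t)=\Phi(p,t)$ of $U$, $p\in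 S$, so $\gamma(0)=p\in S$ and $\gamma'=U$ along $\gamma$. For $X\in\mathfrak X(S)$ let $\widehat X$ be its horizontal lift to $\mathscr O\subset S\times\mathbb R$ (projecting to $X$ and tangent to the slices); $\mathfrak I(\Sigma)=\{\Phi_*(\widehat X):X\in\mathfrak X(S)\}$ is the set of flow-invariant vector fields. $B_U(X,Y)=-g(\widetilde\nabla_XU,Y)$ on $\Sigma$; $\Sigma$ is totally umbilical if $B_U=\mu g$ for a smooth function $\mu$ on $\Sigma$. $V$ is the unique lightlike vector field along $\Sigma$ orthogonal to $\mathcal S$ with $g(U,V)=-1$, and the rotation one-form is $\tau(X)=-g(\widetilde\nabla_XU,V)$, $X\in\mathfrak X(\Sigma)$. A Jacobi field along $\gamma$ satisfies $J''+\widetilde R(J,\gamma')\gamma'=0$; it is an $S$-Jacobi field if in addition $J(0)\in T_{\gamma(0)}S$ and $J'(0)+A_{\gamma'(0)}J(0)\perp T_{\gamma(0)}S$, where $A_\zeta$ is the shape operator of $S$: $g(A_\zeta X,Y)=g(\mathrm{II}(X,Y),\zeta)$. *)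

theory Defs
  imports "HOL-Analysis.Analysis"
begin

section \<open>Smooth functions between Euclidean spaces\<close>

text \<open>Intended for open sets only.\<close>

primrec Ck_on :: "nat \<Rightarrow> 'a::euclidean_space set \<Rightarrow> ('a \<Rightarrow> 'b::real_normed_vector) \<Rightarrow> bool" where
  "Ck_on 0 D f \<longleftrightarrow> continuous_on D f"
| "Ck_on (Suc k) D f \<longleftrightarrow> (\<forall>x\<in>D. f differentiable (at x)) \<and>
     (\<forall>v. Ck_on k D (\<lambda>x. frechet_derivative f (at x) v))"

definition smooth_on :: "'a::euclidean_space set \<Rightarrow> ('a \<Rightarrow> 'b::real_normed_vector) \<Rightarrow> bool" where
  "smooth_on D f \<longleftrightarrow> (\<forall>k. Ck_on k D f)"


section \<open>Smooth manifolds\<close>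

text \<open>
  A chart is a pair of its domain and its coordinate map. A manifold is given by an atlas, which
  also determines the topology, together with a preferred chart around each point.
  The tangent space at \<open>p\<close> is the model space \<open>'e\<close>: a tangent vector at \<open>p\<close> is represented by its
  components in the preferred chart at \<open>p\<close>. The preferred charts need not depend continuously
  on the point, so smoothness of a vector field never means smoothness of the raw function
  \<open>'m \<Rightarrow> 'e\<close>; it is always smoothness as a map into \<open>tangent_bundle\<close> below.
\<close>

type_synonym ('m, 'e) chart = "'m set \<times> ('m \<Rightarrow> 'e)"

record ('m, 'e) manifold =
  charts :: "('m, 'e) chart set"
  chart_at :: "'m \<Rightarrow> ('m, 'e) chart"

definition chart_inv :: "('m, 'e) chart \<Rightarrow> 'e \<Rightarrow> 'm" where
  "chart_inv c = inv_into (fst c) (snd c)"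

definition transition :: "('m, 'e) chart \<Rightarrow> ('m, 'e) chart \<Rightarrow> 'e \<Rightarrow> 'e" where
  "transition c d = snd d \<circ> chart_inv c"

definition mpoints :: "('m, 'e) manifold \<Rightarrow> 'm set" where
  "mpoints M = (\<Union>c\<in>charts M. fst c)"

definition mtopology :: "('m, 'e::euclidean_space) manifold \<Rightarrow> 'm topology" where
  "mtopology M = topology (\<lambda>U. U \<subseteq> mpoints M \<and> (\<forall>c\<in>charts M. open (snd c ` (U \<inter> fst c))))"

definition injective_chart :: "('m, 'e::euclidean_space) chart \<Rightarrow> bool" where
  "injective_chart c \<longleftrightarrow> inj_on (snd c) (fst c) \<and> open (snd c ` fst c)"

definition compatible :: "('m, 'e::euclidean_space) chart \<Rightarrow> ('m, 'e) chart \<Rightarrow> bool" where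
  "compatible c d \<longleftrightarrow>
     open (snd c ` (fst c \<inter> fst d)) \<and> smooth_on (snd c ` (fst c \<inter> fst d)) (transition c d) \<and>
     open (snd d ` (fst c \<inter> fst d)) \<and> smooth_on (snd d ` (fst c \<inter> fst d)) (transition d c)"

definition smooth_atlas :: "('m, 'e::euclidean_space) manifold \<Rightarrow> bool" where
  "smooth_atlas M \<longleftrightarrow>
     (\<forall>c\<in>charts M. injective_chart c) \<and> (\<forall>c\<in>charts M. \<forall>d\<in>charts M. compatible c d) \<and>
     (\<forall>p\<in>mpoints M. chart_at M p \<in> charts M \<and> p \<in> fst (chart_at M p))"

definition smooth_manifold :: "('m, 'e::euclidean_space) manifold \<Rightarrow> bool" where
  "smooth_manifold M \<longleftrightarrow>
     smooth_atlas M \<and> Hausdorff_space (mtopology M) \<and> second_countable (mtopology M)"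

lemma openin_mtopology:
  assumes "\<forall>c\<in>charts M. injective_chart c"
  shows "openin (mtopology M) U \<longleftrightarrow>
    U \<subseteq> mpoints M \<and> (\<forall>c\<in>charts M. open (snd c ` (U \<inter> fst c)))"
proof -
  have "istopology (\<lambda>U. U \<subseteq> mpoints M \<and> (\<forall>c\<in>charts M. open (snd c ` (U \<inter> fst c))))"
    unfolding istopology_def
  proof (intro conjI allI impI ballI)
    fix U V c
    assume U: "U \<subseteq> mpoints M \<and> (\<forall>c\<in>charts M. open (snd c ` (U \<inter> fst c)))"
      and V: "V \<subseteq> mpoints M \<and> (\<forall>c\<in>charts M. open (snd c ` (V \<inter> fst c)))"
      and c: "c \<in> charts M"
    have "inj_on (snd c) (fst c)"
      using assms c by (auto simp: injective_chart_def)
    then have "snd c ` ((U \<inter> V) \<inter> fst c) = snd c ` (U \<inter> fst c) \<inter> snd c ` (V \<inter> fst c)"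
      by (auto simp: inj_on_def)
    then show "open (snd c ` ((U \<inter> V) \<inter> fst c))"
      using U V c by auto
  next
    fix K c
    assume K: "\<forall>V\<in>K. V \<subseteq> mpoints M \<and> (\<forall>c\<in>charts M. open (snd c ` (V \<inter> fst c)))"
      and c: "c \<in> charts M"
    have "snd c ` (\<Union>K \<inter> fst c) = (\<Union>V\<in>K. snd c ` (V \<inter> fst c))"
      by blast
    then show "open (snd c ` (\<Union>K \<inter> fst c))"
      using K c by auto
  qed auto
  then show ?thesis
    by (simp add: mtopology_def topology_inverse')
qed

definition euclid :: "('v, 'v::euclidean_space) manifold" where
  "euclid = \<lparr>charts = {(UNIV, \<lambda>x. x)}, chart_at = (\<lambda>_. (UNIV, \<lambda>x. x))\<rparr>"

definition prod_chart :: "('m, 'e) chart \<Rightarrow> ('n, 'f) chart \<Rightarrow> ('m \<times> 'n, 'e \<times> 'f) chart" where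
  "prod_chart c d = (fst c \<times> fst d, map_prod (snd c) (snd d))"

definition prod_manifold ::
    "('m, 'e) manifold \<Rightarrow> ('n, 'f) manifold \<Rightarrow> ('m \<times> 'n, 'e \<times> 'f) manifold" where
  "prod_manifold M N =
     \<lparr>charts = {prod_chart c d |c d. c \<in> charts M \<and> d \<in> charts N},
      chart_at = (\<lambda>(p, q). prod_chart (chart_at M p) (chart_at N q))\<rparr>"

text \<open>Change of components at \<open>p\<close> from the preferred chart to the chart \<open>c\<close>, and back.\<close>

definition to_chart :: "('m, 'e::euclidean_space) manifold \<Rightarrow> ('m, 'e) chart \<Rightarrow> 'm \<Rightarrow> 'e \<Rightarrow> 'e" where
  "to_chart M c p v =
     frechet_derivative (transition (chart_at M p) c) (at (snd (chart_at M p) p)) v"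

definition from_chart :: "('m, 'e::euclidean_space) manifold \<Rightarrow> ('m, 'e) chart \<Rightarrow> 'm \<Rightarrow> 'e \<Rightarrow> 'e" where
  "from_chart M c p u = frechet_derivative (transition c (chart_at M p)) (at (snd c p)) u"

definition tangent_chart ::
    "('m, 'e::euclidean_space) manifold \<Rightarrow> ('m, 'e) chart \<Rightarrow> ('m \<times> 'e, 'e \<times> 'e) chart" where
  "tangent_chart M c = (fst c \<times> UNIV, \<lambda>(p, v). (snd c p, to_chart M c p v))"

definition tangent_bundle ::
    "('m, 'e::euclidean_space) manifold \<Rightarrow> ('m \<times> 'e, 'e \<times> 'e) manifold" where
  "tangent_bundle M =
     \<lparr>charts = tangent_chart M ` charts M,
      chart_at = (\<lambda>(p, v). tangent_chart M (chart_at M p))\<rparr>"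

text \<open>The openness clause expresses continuity of \<open>F\<close>.\<close>

definition smooth_map_open ::
    "('m, 'e::euclidean_space) manifold \<Rightarrow> ('n, 'f::euclidean_space) manifold \<Rightarrow>
     'm set \<Rightarrow> ('m \<Rightarrow> 'n) \<Rightarrow> bool" where
  "smooth_map_open M N W F \<longleftrightarrow>
     openin (mtopology M) W \<and> F ` W \<subseteq> mpoints N \<and>
     (\<forall>c\<in>charts M. \<forall>d\<in>charts N.
        let D = snd c ` {q \<in> W \<inter> fst c. F q \<in> fst d}
        in open D \<and> smooth_on D (snd d \<circ> F \<circ> chart_inv c))"

text \<open>
  A map on an arbitrary subset is smooth if it extends smoothly to the ambient manifold near every
  point of the subset. On an embedded submanifold this is smoothness for its induced structure.
\<close>

definition smooth_map ::
    "('m, 'e::euclidean_space) manifold \<Rightarrow> ('n, 'f::euclidean_space) manifold \<Rightarrow>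
     'm set \<Rightarrow> ('m \<Rightarrow> 'n) \<Rightarrow> bool" where
  "smooth_map M N A f \<longleftrightarrow>
     (\<forall>p\<in>A. \<exists>W F. p \<in> W \<and> smooth_map_open M N W F \<and> (\<forall>q\<in>A \<inter> W. F q = f q))"

definition diffeomorphism_onto ::
    "('m, 'e::euclidean_space) manifold \<Rightarrow> ('n, 'f::euclidean_space) manifold \<Rightarrow>
     'm set \<Rightarrow> 'n set \<Rightarrow> ('m \<Rightarrow> 'n) \<Rightarrow> bool" where
  "diffeomorphism_onto M N A B f \<longleftrightarrow>
     bij_betw f A B \<and> smooth_map M N A f \<and> smooth_map N M B (inv_into A f)"

definition embedded_submanifold ::
    "('m, 'e::euclidean_space) manifold \<Rightarrow> 'm set \<Rightarrow> nat \<Rightarrow> bool" where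
  "embedded_submanifold M S k \<longleftrightarrow>
     S \<subseteq> mpoints M \<and>
     (\<forall>p\<in>S. \<exists>c L. injective_chart c \<and> fst c \<subseteq> mpoints M \<and> (\<forall>d\<in>charts M. compatible c d) \<and>
        p \<in> fst c \<and> subspace L \<and> dim L = k \<and>
        snd c ` (fst c \<inter> S) = snd c ` fst c \<inter> L)"


section \<open>Tangent vectors and vector fields\<close>

definition velocity :: "('m, 'e::euclidean_space) manifold \<Rightarrow> (real \<Rightarrow> 'm) \<Rightarrow> real \<Rightarrow> 'e" where
  "velocity M \<gamma> t = vector_derivative (\<lambda>s. snd (chart_at M (\<gamma> t)) (\<gamma> s)) (at t)"

definition curve_through ::
    "('m, 'e::euclidean_space) manifold \<Rightarrow> 'm set \<Rightarrow> 'm \<Rightarrow> 'e \<Rightarrow> (real \<Rightarrow> 'm) \<Rightarrow> bool" where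
  "curve_through M A p v \<alpha> \<longleftrightarrow>
     (\<exists>\<epsilon>>0. smooth_map euclid M {-\<epsilon><..<\<epsilon>} \<alpha> \<and> \<alpha> ` {-\<epsilon><..<\<epsilon>} \<subseteq> A \<and>
        \<alpha> 0 = p \<and> velocity M \<alpha> 0 = v)"

definition tangent_space :: "('m, 'e::euclidean_space) manifold \<Rightarrow> 'm set \<Rightarrow> 'm \<Rightarrow> 'e set" where
  "tangent_space M A p = {v. \<exists>\<alpha>. curve_through M A p v \<alpha>}"

text \<open>The differential at \<open>p\<close> of a map \<open>f\<close> that is only given on \<open>A\<close>, for \<open>v\<close> tangent to \<open>A\<close>.\<close>

definition differential ::
    "('m, 'e::euclidean_space) manifold \<Rightarrow> ('n, 'f::euclidean_space) manifold \<Rightarrow>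
     'm set \<Rightarrow> ('m \<Rightarrow> 'n) \<Rightarrow> 'm \<Rightarrow> 'e \<Rightarrow> 'f" where
  "differential M N A f p v = (THE w. \<forall>\<alpha>. curve_through M A p v \<alpha> \<longrightarrow> velocity N (f \<circ> \<alpha>) 0 = w)"

definition smooth_field_on ::
    "('m, 'e::euclidean_space) manifold \<Rightarrow> 'm set \<Rightarrow> ('m \<Rightarrow> 'e) \<Rightarrow> bool" where
  "smooth_field_on M A X \<longleftrightarrow> smooth_map M (tangent_bundle M) A (\<lambda>p. (p, X p))"

text \<open>Membership only constrains the values of a field on \<open>A\<close>.\<close>

definition vector_fields :: "('m, 'e::euclidean_space) manifold \<Rightarrow> 'm set \<Rightarrow> ('m \<Rightarrow> 'e) set" where
  "vector_fields M A = {X. smooth_field_on M A X \<and> (\<forall>p\<in>A. X p \<in> tangent_space M A p)}"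

definition smooth_along ::
    "('m, 'e::euclidean_space) manifold \<Rightarrow> real set \<Rightarrow> (real \<Rightarrow> 'm) \<Rightarrow> (real \<Rightarrow> 'e) \<Rightarrow> bool" where
  "smooth_along M I \<gamma> J \<longleftrightarrow> smooth_map euclid (tangent_bundle M) I (\<lambda>t. (\<gamma> t, J t))"

definition lie_bracket ::
    "('m, 'e::euclidean_space) manifold \<Rightarrow> ('m \<Rightarrow> 'e) \<Rightarrow> ('m \<Rightarrow> 'e) \<Rightarrow> 'm \<Rightarrow> 'e" where
  "lie_bracket M X Y p =
     (let c = chart_at M p;
          rep = (\<lambda>Z x. to_chart M c (chart_inv c x) (Z (chart_inv c x)))
      in frechet_derivative (rep Y) (at (snd c p)) (X p)
       - frechet_derivative (rep X) (at (snd c p)) (Y p))"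


section \<open>Lorentzian manifolds\<close>

text \<open>Isometric to the model form obtained from the inner product by reversing one sign.\<close>

definition lorentz_form :: "('e::euclidean_space \<Rightarrow> 'e \<Rightarrow> real) \<Rightarrow> bool" where
  "lorentz_form b \<longleftrightarrow>
     (\<exists>(h :: 'e \<Rightarrow> 'e) e0. linear h \<and> bij h \<and> e0 \<in> Basis \<and>
        (\<forall>u v. b (h u) (h v) = u \<bullet> v - 2 * (u \<bullet> e0) * (v \<bullet> e0)))"

type_synonym ('m, 'e) metric_tensor = "'m \<Rightarrow> 'e \<Rightarrow> 'e \<Rightarrow> real"

definition metric_comp ::
    "('m, 'e::euclidean_space) manifold \<Rightarrow> ('m, 'e) metric_tensor \<Rightarrow> ('m, 'e) chart \<Rightarrow>
     'e \<Rightarrow> 'e \<Rightarrow> 'e \<Rightarrow> real" where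
  "metric_comp M g c u v x =
     (let q = chart_inv c x in g q (from_chart M c q u) (from_chart M c q v))"

definition lorentzian_metric ::
    "('m, 'e::euclidean_space) manifold \<Rightarrow> ('m, 'e) metric_tensor \<Rightarrow> bool" where
  "lorentzian_metric M g \<longleftrightarrow>
     (\<forall>p\<in>mpoints M. lorentz_form (g p)) \<and>
     (\<forall>c\<in>charts M. \<forall>u v. smooth_on (snd c ` fst c) (metric_comp M g c u v))"

text \<open>The time orientation is the one containing the timelike vector field \<open>T\<close>.\<close>

definition spacetime ::
    "('m, 'e::euclidean_space) manifold \<Rightarrow> ('m, 'e) metric_tensor \<Rightarrow> ('m \<Rightarrow> 'e) \<Rightarrow> bool" where
  "spacetime M g T \<longleftrightarrow>
     smooth_manifold M \<and> connected_space (mtopology M) \<and> lorentzian_metric M g \<and>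
     smooth_field_on M (mpoints M) T \<and> (\<forall>p\<in>mpoints M. g p (T p) (T p) < 0)"

definition lightlike :: "('m, 'e::euclidean_space) metric_tensor \<Rightarrow> 'm \<Rightarrow> 'e \<Rightarrow> bool" where
  "lightlike g p v \<longleftrightarrow> v \<noteq> 0 \<and> g p v v = 0"


section \<open>Levi-Civita connection and curvature\<close>

text \<open>
  Christoffel symbols at \<open>p\<close> of the preferred chart at \<open>p\<close>, as a bilinear map: the Koszul formula
  for coordinate vector fields.
\<close>

definition christoffel ::
    "('m, 'e::euclidean_space) manifold \<Rightarrow> ('m, 'e) metric_tensor \<Rightarrow> 'm \<Rightarrow> 'e \<Rightarrow> 'e \<Rightarrow> 'e" where
  "christoffel M g p u v =
     (let c = chart_at M p;
          D = (\<lambda>a u v. frechet_derivative (metric_comp M g c u v) (at (snd c p)) a)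
      in THE w. \<forall>z. 2 * g p w z = D u v z + D v u z - D z u v)"

text \<open>
  The covariant derivative of \<open>J\<close> along \<open>\<gamma>\<close> at \<open>t\<close>, computed in the preferred chart at \<open>\<gamma> t\<close>, where
  the components of \<open>J t\<close> and of the velocity at \<open>t\<close> are these vectors themselves.
\<close>

definition cov_along ::
    "('m, 'e::euclidean_space) manifold \<Rightarrow> ('m, 'e) metric_tensor \<Rightarrow> (real \<Rightarrow> 'm) \<Rightarrow>
     (real \<Rightarrow> 'e) \<Rightarrow> real \<Rightarrow> 'e" where
  "cov_along M g \<gamma> J t =
     vector_derivative (\<lambda>s. to_chart M (chart_at M (\<gamma> t)) (\<gamma> s) (J s)) (at t)
       + christoffel M g (\<gamma> t) (velocity M \<gamma> t) (J t)"

text \<open>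
  \<open>nabla M g A Y p x\<close> is the derivative at \<open>p\<close>, in the direction \<open>x\<close> tangent to \<open>A\<close>, of a vector
  field \<open>Y\<close> of \<open>M\<close> that need only be defined along \<open>A\<close>; for open \<open>A\<close> this is the Levi-Civita
  connection of \<open>M\<close>.
\<close>

definition nabla ::
    "('m, 'e::euclidean_space) manifold \<Rightarrow> ('m, 'e) metric_tensor \<Rightarrow> 'm set \<Rightarrow>
     ('m \<Rightarrow> 'e) \<Rightarrow> 'm \<Rightarrow> 'e \<Rightarrow> 'e" where
  "nabla M g A Y p x =
     (THE w. \<forall>\<alpha>. curve_through M A p x \<alpha> \<longrightarrow> cov_along M g \<alpha> (Y \<circ> \<alpha>) 0 = w)"

text \<open>\<open>curvature M g p x y z\<close> is $R(x,y)z$, evaluated on arbitrary local extensions of the vectors.\<close>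

definition curvature ::
    "('m, 'e::euclidean_space) manifold \<Rightarrow> ('m, 'e) metric_tensor \<Rightarrow> 'm \<Rightarrow> 'e \<Rightarrow> 'e \<Rightarrow> 'e \<Rightarrow> 'e" where
  "curvature M g p x y z =
     (THE w. \<forall>W X Y Z. openin (mtopology M) W \<and> p \<in> W \<and>
        X \<in> vector_fields M W \<and> Y \<in> vector_fields M W \<and> Z \<in> vector_fields M W \<and>
        X p = x \<and> Y p = y \<and> Z p = z \<longrightarrow>
        w = nabla M g W (\<lambda>q. nabla M g W Z q (Y q)) p (X p)
          - nabla M g W (\<lambda>q. nabla M g W Z q (X q)) p (Y p)
          - nabla M g W Z p (lie_bracket M X Y p))"

definition ricci ::
    "('m, 'e::euclidean_space) manifold \<Rightarrow> ('m, 'e) metric_tensor \<Rightarrow> 'm \<Rightarrow> 'e \<Rightarrow> 'e \<Rightarrow> real" where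
  "ricci M g p y z = (\<Sum>b\<in>Basis. curvature M g p b y z \<bullet> b)"


section \<open>Geodesics and the exponential map\<close>

definition geodesic ::
    "('m, 'e::euclidean_space) manifold \<Rightarrow> ('m, 'e) metric_tensor \<Rightarrow> real set \<Rightarrow>
     (real \<Rightarrow> 'm) \<Rightarrow> bool" where
  "geodesic M g I \<gamma> \<longleftrightarrow>
     open I \<and> is_interval I \<and> smooth_map euclid M I \<gamma> \<and>
     (\<forall>t\<in>I. cov_along M g \<gamma> (velocity M \<gamma>) t = 0)"

definition unit_geodesic ::
    "('m, 'e::euclidean_space) manifold \<Rightarrow> ('m, 'e) metric_tensor \<Rightarrow> 'm \<Rightarrow> 'e \<Rightarrow>
     (real \<Rightarrow> 'm) \<Rightarrow> bool" where
  "unit_geodesic M g p v \<gamma> \<longleftrightarrow>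
     (\<exists>I. {0..1} \<subseteq> I \<and> geodesic M g I \<gamma>) \<and> \<gamma> 0 = p \<and> velocity M \<gamma> 0 = v"

definition exp_domain ::
    "('m, 'e::euclidean_space) manifold \<Rightarrow> ('m, 'e) metric_tensor \<Rightarrow> ('m \<times> 'e) set" where
  "exp_domain M g = {(p, v). p \<in> mpoints M \<and> (\<exists>\<gamma>. unit_geodesic M g p v \<gamma>)}"

definition exp_map ::
    "('m, 'e::euclidean_space) manifold \<Rightarrow> ('m, 'e) metric_tensor \<Rightarrow> 'm \<times> 'e \<Rightarrow> 'm" where
  "exp_map M g = (\<lambda>(p, v). THE q. \<exists>\<gamma>. unit_geodesic M g p v \<gamma> \<and> \<gamma> 1 = q)"


section \<open>Spacelike submanifolds\<close>

definition spacelike ::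
    "('m, 'e::euclidean_space) manifold \<Rightarrow> ('m, 'e) metric_tensor \<Rightarrow> 'm set \<Rightarrow> bool" where
  "spacelike M g S \<longleftrightarrow> (\<forall>p\<in>S. \<forall>v\<in>tangent_space M S p. v \<noteq> 0 \<longrightarrow> g p v v > 0)"

definition normal_space ::
    "('m, 'e::euclidean_space) manifold \<Rightarrow> ('m, 'e) metric_tensor \<Rightarrow> 'm set \<Rightarrow> 'm \<Rightarrow> 'e set" where
  "normal_space M g S p = {v. \<forall>w\<in>tangent_space M S p. g p v w = 0}"

definition normal_bundle ::
    "('m, 'e::euclidean_space) manifold \<Rightarrow> ('m, 'e) metric_tensor \<Rightarrow> 'm set \<Rightarrow> ('m \<times> 'e) set" where
  "normal_bundle M g S = {(p, v). p \<in> S \<and> v \<in> normal_space M g S p}"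

definition normal_part ::
    "('m, 'e::euclidean_space) manifold \<Rightarrow> ('m, 'e) metric_tensor \<Rightarrow> 'm set \<Rightarrow> 'm \<Rightarrow> 'e \<Rightarrow> 'e" where
  "normal_part M g S p v =
     (THE w. w \<in> normal_space M g S p \<and> v - w \<in> tangent_space M S p)"

definition second_fundamental_form ::
    "('m, 'e::euclidean_space) manifold \<Rightarrow> ('m, 'e) metric_tensor \<Rightarrow> 'm set \<Rightarrow> 'm \<Rightarrow>
     'e \<Rightarrow> 'e \<Rightarrow> 'e" where
  "second_fundamental_form M g S p x y =
     (THE w. \<forall>W Y. openin (mtopology M) W \<and> p \<in> W \<and> Y \<in> vector_fields M (S \<inter> W) \<and> Y p = y \<longrightarrow>
        w = normal_part M g S p (nabla M g (S \<inter> W) Y p x))"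

definition shape_operator ::
    "('m, 'e::euclidean_space) manifold \<Rightarrow> ('m, 'e) metric_tensor \<Rightarrow> 'm set \<Rightarrow> 'm \<Rightarrow>
     'e \<Rightarrow> 'e \<Rightarrow> 'e" where
  "shape_operator M g S p \<zeta> x =
     (THE a. a \<in> tangent_space M S p \<and>
        (\<forall>y\<in>tangent_space M S p. g p a y = g p (second_fundamental_form M g S p x y) \<zeta>))"

definition lightlike_normal_field ::
    "('m, 'e::euclidean_space) manifold \<Rightarrow> ('m, 'e) metric_tensor \<Rightarrow> 'm set \<Rightarrow>
     ('m \<Rightarrow> 'e) \<Rightarrow> bool" where
  "lightlike_normal_field M g S \<xi> \<longleftrightarrow>
     smooth_field_on M S \<xi> \<and> (\<forall>p\<in>S. \<xi> p \<in> normal_space M g S p \<and> lightlike g p (\<xi> p))"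


section \<open>The lightlike hypersurface generated by a lightlike normal field\<close>

definition normal_exp_neighborhood ::
    "('m, 'e::euclidean_space) manifold \<Rightarrow> ('m, 'e) metric_tensor \<Rightarrow> 'm set \<Rightarrow>
     ('m \<times> 'e) set \<Rightarrow> bool" where
  "normal_exp_neighborhood M g S \<V> \<longleftrightarrow>
     openin (subtopology (mtopology (tangent_bundle M)) (normal_bundle M g S)) \<V> \<and>
     (\<forall>p\<in>S. (p, 0) \<in> \<V>) \<and>
     (\<forall>p v s. (p, v) \<in> \<V> \<and> 0 \<le> s \<and> s \<le> 1 \<longrightarrow> (p, s *\<^sub>R v) \<in> \<V>) \<and>
     \<V> \<subseteq> exp_domain M g \<and>
     (\<exists>B. openin (mtopology M) B \<and> S \<subseteq> B \<and>
        diffeomorphism_onto (tangent_bundle M) M \<V> B (exp_map M g))"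

definition flow_domain :: "'m set \<Rightarrow> ('m \<Rightarrow> 'e::euclidean_space) \<Rightarrow> ('m \<times> 'e) set \<Rightarrow> ('m \<times> real) set" where
  "flow_domain S \<xi> \<V> = {(p, t). p \<in> S \<and> (p, t *\<^sub>R \<xi> p) \<in> \<V>}"

definition flow_map ::
    "('m, 'e::euclidean_space) manifold \<Rightarrow> ('m, 'e) metric_tensor \<Rightarrow> ('m \<Rightarrow> 'e) \<Rightarrow>
     'm \<times> real \<Rightarrow> 'm" where
  "flow_map M g \<xi> = (\<lambda>(p, t). exp_map M g (p, t *\<^sub>R \<xi> p))"

text \<open>
  The remaining notions take the flow domain \<open>\<O>\<close> (a subset of the product of \<open>M\<close> with the real
  line) and the flow map \<open>\<Phi>\<close> as parameters; \<open>\<Phi> ` \<O>\<close> is the hypersurface.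
\<close>

definition flow_differential ::
    "('m, 'e::euclidean_space) manifold \<Rightarrow> ('m \<times> real) set \<Rightarrow> ('m \<times> real \<Rightarrow> 'm) \<Rightarrow>
     'm \<times> real \<Rightarrow> 'e \<times> real \<Rightarrow> 'e" where
  "flow_differential M \<O> \<Phi> = differential (prod_manifold M euclid) M \<O> \<Phi>"

definition generator_field ::
    "('m, 'e::euclidean_space) manifold \<Rightarrow> ('m \<times> real) set \<Rightarrow> ('m \<times> real \<Rightarrow> 'm) \<Rightarrow> 'm \<Rightarrow> 'e" where
  "generator_field M \<O> \<Phi> q = flow_differential M \<O> \<Phi> (inv_into \<O> \<Phi> q) (0, 1)"

definition screen ::
    "('m, 'e::euclidean_space) manifold \<Rightarrow> 'm set \<Rightarrow> ('m \<times> real) set \<Rightarrow> ('m \<times> real \<Rightarrow> 'm) \<Rightarrow>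
     'm \<Rightarrow> 'e set" where
  "screen M S \<O> \<Phi> q =
     (let (p, t) = inv_into \<O> \<Phi> q
      in (\<lambda>x. flow_differential M \<O> \<Phi> (p, t) (x, 0)) ` tangent_space M S p)"

definition flow_invariant_fields ::
    "('m, 'e::euclidean_space) manifold \<Rightarrow> 'm set \<Rightarrow> ('m \<times> real) set \<Rightarrow> ('m \<times> real \<Rightarrow> 'm) \<Rightarrow>
     ('m \<Rightarrow> 'e) set" where
  "flow_invariant_fields M S \<O> \<Phi> =
     {Y. \<exists>X\<in>vector_fields M S.
        \<forall>(p, t)\<in>\<O>. Y (\<Phi> (p, t)) = flow_differential M \<O> \<Phi> (p, t) (X p, 0)}"

definition B_form ::
    "('m, 'e::euclidean_space) manifold \<Rightarrow> ('m, 'e) metric_tensor \<Rightarrow> ('m \<times> real) set \<Rightarrow>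
     ('m \<times> real \<Rightarrow> 'm) \<Rightarrow> 'm \<Rightarrow> 'e \<Rightarrow> 'e \<Rightarrow> real" where
  "B_form M g \<O> \<Phi> q x y = - g q (nabla M g (\<Phi> ` \<O>) (generator_field M \<O> \<Phi>) q x) y"

definition umbilicity_function ::
    "('m, 'e::euclidean_space) manifold \<Rightarrow> ('m, 'e) metric_tensor \<Rightarrow> ('m \<times> real) set \<Rightarrow>
     ('m \<times> real \<Rightarrow> 'm) \<Rightarrow> ('m \<Rightarrow> real) \<Rightarrow> bool" where
  "umbilicity_function M g \<O> \<Phi> \<mu> \<longleftrightarrow>
     smooth_map M euclid (\<Phi> ` \<O>) \<mu> \<and>
     (\<forall>q\<in>\<Phi> ` \<O>. \<forall>x\<in>tangent_space M (\<Phi> ` \<O>) q. \<forall>y\<in>tangent_space M (\<Phi> ` \<O>) q.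
        B_form M g \<O> \<Phi> q x y = \<mu> q * g q x y)"

definition transversal_field ::
    "('m, 'e::euclidean_space) manifold \<Rightarrow> ('m, 'e) metric_tensor \<Rightarrow> 'm set \<Rightarrow> ('m \<times> real) set \<Rightarrow>
     ('m \<times> real \<Rightarrow> 'm) \<Rightarrow> 'm \<Rightarrow> 'e" where
  "transversal_field M g S \<O> \<Phi> q =
     (THE v. lightlike g q v \<and> (\<forall>w\<in>screen M S \<O> \<Phi> q. g q v w = 0) \<and>
        g q (generator_field M \<O> \<Phi> q) v = -1)"

definition rotation_form ::
    "('m, 'e::euclidean_space) manifold \<Rightarrow> ('m, 'e) metric_tensor \<Rightarrow> 'm set \<Rightarrow> ('m \<times> real) set \<Rightarrow>
     ('m \<times> real \<Rightarrow> 'm) \<Rightarrow> 'm \<Rightarrow> 'e \<Rightarrow> real" where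
  "rotation_form M g S \<O> \<Phi> q x =
     - g q (nabla M g (\<Phi> ` \<O>) (generator_field M \<O> \<Phi>) q x) (transversal_field M g S \<O> \<Phi> q)"


section \<open>Jacobi fields and variations\<close>

definition jacobi_field ::
    "('m, 'e::euclidean_space) manifold \<Rightarrow> ('m, 'e) metric_tensor \<Rightarrow> real set \<Rightarrow>
     (real \<Rightarrow> 'm) \<Rightarrow> (real \<Rightarrow> 'e) \<Rightarrow> bool" where
  "jacobi_field M g I \<gamma> J \<longleftrightarrow>
     smooth_along M I \<gamma> J \<and>
     (\<forall>t\<in>I. cov_along M g \<gamma> (cov_along M g \<gamma> J) t
        + curvature M g (\<gamma> t) (J t) (velocity M \<gamma> t) (velocity M \<gamma> t) = 0)"

definition S_jacobi_field ::
    "('m, 'e::euclidean_space) manifold \<Rightarrow> ('m, 'e) metric_tensor \<Rightarrow> 'm set \<Rightarrow> real set \<Rightarrow>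
     (real \<Rightarrow> 'm) \<Rightarrow> (real \<Rightarrow> 'e) \<Rightarrow> bool" where
  "S_jacobi_field M g S I \<gamma> J \<longleftrightarrow>
     jacobi_field M g I \<gamma> J \<and> J 0 \<in> tangent_space M S (\<gamma> 0) \<and>
     cov_along M g \<gamma> J 0 + shape_operator M g S (\<gamma> 0) (velocity M \<gamma> 0) (J 0)
       \<in> normal_space M g S (\<gamma> 0)"

definition lightlike_geodesic ::
    "('m, 'e::euclidean_space) manifold \<Rightarrow> ('m, 'e) metric_tensor \<Rightarrow> real set \<Rightarrow>
     (real \<Rightarrow> 'm) \<Rightarrow> bool" where
  "lightlike_geodesic M g I \<gamma> \<longleftrightarrow>
     geodesic M g I \<gamma> \<and> (\<forall>t\<in>I. lightlike g (\<gamma> t) (velocity M \<gamma> t))"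

text \<open>
  \<open>J\<close> is the variation field of a variation \<open>H (s, t)\<close> of \<open>\<gamma>\<close> through lightlike geodesics starting
  in \<open>S\<close> orthogonally to \<open>S\<close>. As \<open>I\<close> is not compact, the parameter intervals of the nearby
  geodesics may depend on \<open>s\<close>; over any compact part of \<open>I\<close> the domain contains a rectangle.
\<close>

definition variation_through_normal_lightlike_geodesics ::
    "('m, 'e::euclidean_space) manifold \<Rightarrow> ('m, 'e) metric_tensor \<Rightarrow> 'm set \<Rightarrow> real set \<Rightarrow>
     (real \<Rightarrow> 'm) \<Rightarrow> (real \<Rightarrow> 'e) \<Rightarrow> bool" where
  "variation_through_normal_lightlike_geodesics M g S I \<gamma> J \<longleftrightarrow>
     (\<exists>\<epsilon>>0. \<exists>D H.
        open D \<and> D \<subseteq> {-\<epsilon><..<\<epsilon>} \<times> UNIV \<and> {t. (0, t) \<in> D} = I \<and>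
        smooth_map euclid M D H \<and>
        (\<forall>t\<in>I. H (0, t) = \<gamma> t \<and> velocity M (\<lambda>s. H (s, t)) 0 = J t) \<and>
        (\<forall>s\<in>{-\<epsilon><..<\<epsilon>}. (s, 0) \<in> D \<and>
           lightlike_geodesic M g {t. (s, t) \<in> D} (\<lambda>t. H (s, t)) \<and>
           H (s, 0) \<in> S \<and>
           velocity M (\<lambda>t. H (s, t)) 0 \<in> normal_space M g S (H (s, 0))))"

end

theory Submission
  imports Defs
begin

text \<open>
  Let \<open>X\<^sub>0\<close> be the vector field on \<open>S\<close> whose lift is \<open>X\<close>, and let \<open>\<alpha>\<close> be a curve in \<open>S\<close> with velocity
  \<open>X\<^sub>0 p\<close> at \<open>p\<close>. Along the generator of \<open>p\<close>, \<open>J\<close> is the variation field of the family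
  \<open>H (s, t) = \<Phi> (\<alpha> s, t)\<close> of lightlike geodesics. Commuting the covariant derivatives of \<open>H\<close> gives the Jacobi
  equation and \<open>J' = \<nabla>\<^sub>J U\<close>; at \<open>t = 0\<close> the tangential part of \<open>\<nabla>\<^sub>J \<xi>\<close> is minus the shape operator, so \<open>J\<close> is an
  \<open>S\<close>-Jacobi field.

  Since \<open>U\<close> is a null geodesic field, \<open>g (J, U)\<close> is constant along generators (Gauss lemma), hence zero, so the
  screen is a definite complement of the radical and has a unique null transversal \<open>V\<close>. If \<open>B\<^sub>U = \<mu> g\<close>, then
  \<open>\<nabla>\<^sub>J U + \<mu> J\<close> is orthogonal to \<open>T \<Sigma>\<close>, hence the multiple \<open>\<tau>(J) U\<close> of \<open>U\<close>. Differentiating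
  \<open>J' = - \<mu> J + \<tau>(J) U\<close> once more gives \<open>J'' = (\<mu>\<^sup>2 - \<mu>') J + f U\<close>. By the Jacobi equation \<open>R(\<cdot>, U)U\<close> acts on the
  screen as \<open>\<mu>' - \<mu>\<^sup>2\<close> modulo \<open>U\<close>, and the lines of \<open>U\<close> and \<open>V\<close> do not contribute to its trace, so
  \<open>Ric(U, U) = n (\<mu>' - \<mu>\<^sup>2)\<close>.
\<close>

subsection \<open>Calculus of smooth functions\<close>

text \<open>Two obstacles shape the work. Tangent vectors carry components in the preferred chart of
  their base point, which may jump from point to point, and the connection, the curvature, the
  second fundamental form and the differential of \<Phi> are \<open>THE\<close>-descriptions over
  all curves or all local extensions. Each of them is therefore computed in one fixed chart, where
  the outcome visibly does not depend on the choice. Secondly, \<O> is not open in the product and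
  \<Sigma> is not open in \<open>M\<close>, so maps and fields on them can be differentiated only
  through smooth extensions. The diffeomorphism property of the normal exponential map yields
  extensions both of \<Phi> and of its inverse; the latter makes the differential injective and
  \<open>U\<close> smooth. \<Sigma> itself is never given charts: the images of tangent vectors of
  \<O>, each realised by an explicit curve, suffice. The Ricci trace runs over the Euclidean basis
  of the model space, which has nothing to do with the metric; splitting the curvature operator into
  a multiple of the identity and maps of rank one avoids any change of frame.\<close>

abbreviation (input) FD :: "('a::real_normed_vector \<Rightarrow> 'b::real_normed_vector) \<Rightarrow> 'a \<Rightarrow> 'a \<Rightarrow> 'b" where
  "FD f x \<equiv> frechet_derivative f (at x)"

lemma differentiable_at_has_FD:
  "f differentiable (at x) \<Longrightarrow> (f has_derivative FD f x) (at x)"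
  by (simp add: frechet_derivative_works)

lemma has_derivative_FD_eq: "(f has_derivative f') (at x) \<Longrightarrow> FD f x = f'"
  by (metis frechet_derivative_at)

lemma has_derivative_cong_open:
  assumes "open U" "x \<in> U" "\<And>y. y \<in> U \<Longrightarrow> f y = g y"
  shows "(f has_derivative f') (at x) \<longleftrightarrow> (g has_derivative f') (at x)"
proof
  show "(f has_derivative f') (at x) \<Longrightarrow> (g has_derivative f') (at x)"
    by (rule has_derivative_transform_within_open[where f=f, OF _ assms])
  show "(g has_derivative f') (at x) \<Longrightarrow> (f has_derivative f') (at x)"
    by (rule has_derivative_transform_within_open[where f=g, OF _ assms(1,2)]) (simp_all add: assms(3))
qed

lemma FD_cong_open:
  assumes "open U" "x \<in> U" "\<And>y. y \<in> U \<Longrightarrow> f y = g y"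
  shows "FD f x = FD g x"
  unfolding frechet_derivative_def by (simp add: has_derivative_cong_open[where f=f, OF assms])

lemma differentiable_cong_open:
  assumes "open U" "x \<in> U" "\<And>y. y \<in> U \<Longrightarrow> f y = g y"
  shows "f differentiable (at x) \<longleftrightarrow> g differentiable (at x)"
  unfolding differentiable_def by (simp add: has_derivative_cong_open[where f=f, OF assms])

lemma Ck_on_imp_continuous_on: "Ck_on k D f \<Longrightarrow> continuous_on D f"
  by (cases k) (auto intro!: continuous_at_imp_continuous_on differentiable_imp_continuous_within)

lemma Ck_on_Suc_imp: "Ck_on (Suc k) D f \<Longrightarrow> Ck_on k D f"
proof (induction k arbitrary: f)
  case 0
  then show ?case
    by (auto intro!: continuous_at_imp_continuous_on differentiable_imp_continuous_within)
next
  case (Suc k)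
  have "Ck_on k D (\<lambda>x. FD f x v)" for v
    by (rule Suc.IH) (use Suc.prems Ck_on.simps(2)[of "Suc k" D f] in blast)
  then show ?case using Suc.prems Ck_on.simps(2)[of "Suc k" D f] by simp
qed

lemma Ck_on_subset: "Ck_on k D f \<Longrightarrow> E \<subseteq> D \<Longrightarrow> Ck_on k E f"
  by (induction k arbitrary: f) (auto intro: continuous_on_subset)

lemma Ck_on_cong:
  assumes "open D" "\<And>x. x \<in> D \<Longrightarrow> f x = g x" "Ck_on k D f"
  shows "Ck_on k D g"
  using assms(2,3)
proof (induction k arbitrary: f g)
  case 0
  then show ?case using continuous_on_cong by (metis Ck_on.simps(1))
next
  case (Suc k)
  have "FD f x = FD g x" if "x \<in> D" for x
    using FD_cong_open[OF assms(1) that] Suc.prems by blast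
  moreover have "g differentiable (at x)" if "x \<in> D" for x
    using differentiable_cong_open[OF assms(1) that, of f g] Suc.prems that by auto
  moreover have "Ck_on k D (\<lambda>x. FD g x v)" for v
    by (rule Suc.IH[of "\<lambda>x. FD f x v"]) (use calculation(1) Suc.prems in auto)
  ultimately show ?case by simp
qed

lemma Ck_on_local:
  assumes "\<And>x. x \<in> D \<Longrightarrow> \<exists>U. x \<in> U \<and> open U \<and> Ck_on k U f"
  shows "Ck_on k D f"
  using assms
proof (induction k arbitrary: f)
  case 0
  show ?case
    unfolding Ck_on.simps
  proof (rule continuous_at_imp_continuous_on, rule ballI)
    fix x assume "x \<in> D"
    then obtain U where "x \<in> U" "open U" "continuous_on U f" using 0 by auto
    then show "isCont f x" by (simp add: continuous_on_eq_continuous_at)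
  qed
next
  case (Suc k)
  have "f differentiable (at x)" if "x \<in> D" for x
    using Suc.prems[OF that] by auto
  moreover have "Ck_on k D (\<lambda>x. FD f x v)" for v
  proof (rule Suc.IH)
    fix x assume "x \<in> D"
    then obtain U where "x \<in> U" "open U" "Ck_on (Suc k) U f" using Suc.prems by blast
    then show "\<exists>U. x \<in> U \<and> open U \<and> Ck_on k U (\<lambda>x. FD f x v)" by auto
  qed
  ultimately show ?case by simp
qed

lemma Ck_on_const: "Ck_on k D (\<lambda>x. c)"
  by (induction k arbitrary: c) auto

lemma Ck_on_bounded_linear:
  assumes "bounded_linear L" "Ck_on k D f" "open D"
  shows "Ck_on k D (\<lambda>x. L (f x))"
  using assms(2)
proof (induction k arbitrary: f)
  case 0
  then show ?case using assms(1) by (auto intro: bounded_linear.continuous_on)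
next
  case (Suc k)
  have *: "((\<lambda>x. L (f x)) has_derivative (\<lambda>v. L (FD f x v))) (at x)" if "x \<in> D" for x
    by (rule bounded_linear.has_derivative[OF assms(1) differentiable_at_has_FD]) (use Suc.prems that in simp)
  have "Ck_on k D (\<lambda>x. FD (\<lambda>x. L (f x)) x v)" for v
    by (rule Ck_on_cong[OF assms(3) _ Suc.IH[of "\<lambda>x. FD f x v"]])
      (use Suc.prems in \<open>auto simp: has_derivative_FD_eq[OF *]\<close>)
  then show ?case using Derivative.differentiableI[OF *] by simp
qed

lemma Ck_on_add:
  assumes "Ck_on k D f" "Ck_on k D g" "open D"
  shows "Ck_on k D (\<lambda>x. f x + g x)"
  using assms(1,2)
proof (induction k arbitrary: f g)
  case 0
  then show ?case by (auto intro: continuous_on_add)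
next
  case (Suc k)
  have *: "((\<lambda>x. f x + g x) has_derivative (\<lambda>v. FD f x v + FD g x v)) (at x)" if "x \<in> D" for x
    using Suc.prems that by (intro has_derivative_add differentiable_at_has_FD) auto
  have "Ck_on k D (\<lambda>x. FD (\<lambda>x. f x + g x) x v)" for v
    by (rule Ck_on_cong[OF assms(3) _ Suc.IH[of "\<lambda>x. FD f x v" "\<lambda>x. FD g x v"]])
      (use Suc.prems in \<open>auto simp: has_derivative_FD_eq[OF *]\<close>)
  then show ?case using Derivative.differentiableI[OF *] by simp
qed

lemma Ck_on_bilinear:
  assumes "bounded_bilinear b" "Ck_on k D f" "Ck_on k D g" "open D"
  shows "Ck_on k D (\<lambda>x. b (f x) (g x))"
  using assms(2,3)
proof (induction k arbitrary: f g)
  case 0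
  then show ?case using assms(1) by (auto intro: bounded_bilinear.continuous_on)
next
  case (Suc k)
  have *: "((\<lambda>x. b (f x) (g x)) has_derivative (\<lambda>v. b (f x) (FD g x v) + b (FD f x v) (g x))) (at x)"
    if "x \<in> D" for x
    using Suc.prems that
    by (intro bounded_bilinear.FDERIV[OF assms(1)] differentiable_at_has_FD) auto
  have "Ck_on k D (\<lambda>x. FD (\<lambda>x. b (f x) (g x)) x v)" for v
    by (rule Ck_on_cong[OF assms(4) _ Ck_on_add[OF Suc.IH[of f "\<lambda>x. FD g x v"]
            Suc.IH[of "\<lambda>x. FD f x v" g] assms(4)]])
      (use Suc.prems Ck_on_Suc_imp[of k D f] Ck_on_Suc_imp[of k D g] in \<open>auto simp: has_derivative_FD_eq[OF *]\<close>)
  then show ?case using Derivative.differentiableI[OF *] by simp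
qed

lemma Ck_on_sum:
  assumes "\<And>i. i \<in> A \<Longrightarrow> Ck_on k D (f i)" "open D"
  shows "Ck_on k D (\<lambda>x. \<Sum>i\<in>A. f i x)"
  using assms by (induction A rule: infinite_finite_induct) (auto intro: Ck_on_const Ck_on_add)

lemma linear_Basis_sum:
  fixes L :: "'a::euclidean_space \<Rightarrow> 'b::real_vector"
  assumes "linear L" shows "L v = (\<Sum>b\<in>Basis. (v \<bullet> b) *\<^sub>R L b)"
proof -
  have "L v = L (\<Sum>b\<in>Basis. (v \<bullet> b) *\<^sub>R b)" by (simp add: euclidean_representation)
  then show ?thesis using assms by (simp add: linear_sum linear_scale)
qed

text \<open>In the chain rule the direction \<open>FD g x v\<close> varies with \<open>x\<close>, so
  \<open>FD f (g x) (FD g x v)\<close> is not a composite covered by the induction hypothesis.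
  Expanding the direction in the basis leaves scalar functions times composites
  \<open>FD f (g x) b\<close> with fixed \<open>b\<close>.\<close>

lemma Ck_on_compose:
  fixes f :: "'b::euclidean_space \<Rightarrow> 'c::real_normed_vector" and g :: "'a::euclidean_space \<Rightarrow> 'b"
  assumes "Ck_on k E f" "Ck_on k D g" "g ` D \<subseteq> E" "open D" "open E"
  shows "Ck_on k D (\<lambda>x. f (g x))"
  using assms(1,2)
proof (induction k arbitrary: f)
  case 0
  then show ?case using assms(3) by (auto intro: continuous_on_compose2)
next
  case (Suc k)
  have fd: "(f has_derivative FD f (g x)) (at (g x))" if "x \<in> D" for x
    using Suc.prems that assms(3) by (intro differentiable_at_has_FD) auto
  have *: "((\<lambda>x. f (g x)) has_derivative (\<lambda>v. FD f (g x) (FD g x v))) (at x)" if "x \<in> D" for x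
    using Suc.prems that by (intro has_derivative_compose[where g=f and f=g, OF _ fd[OF that]] differentiable_at_has_FD) auto
  have eq: "(\<Sum>b\<in>Basis. (FD g x v \<bullet> b) *\<^sub>R FD f (g x) b) = FD (\<lambda>x. f (g x)) x v" if "x \<in> D" for x v
  proof -
    have "FD f (g x) (FD g x v) = (\<Sum>b\<in>Basis. (FD g x v \<bullet> b) *\<^sub>R FD f (g x) b)"
      by (rule linear_Basis_sum[OF has_derivative_linear[OF fd[OF that]]])
    then show ?thesis by (simp add: has_derivative_FD_eq[OF *[OF that]])
  qed
  have "Ck_on k D (\<lambda>x. FD (\<lambda>x. f (g x)) x v)" for v
  proof (rule Ck_on_cong[OF assms(4) eq])
    show "Ck_on k D (\<lambda>x. \<Sum>b\<in>Basis. (FD g x v \<bullet> b) *\<^sub>R FD f (g x) b)"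
    proof (rule Ck_on_sum[OF _ assms(4)])
      fix b :: 'b
      have "Ck_on k D (\<lambda>x. FD g x v \<bullet> b)"
        using Suc.prems by (intro Ck_on_bounded_linear[OF bounded_linear_inner_left _ assms(4)]) auto
      moreover have "Ck_on k D (\<lambda>x. FD f (g x) b)"
        using Suc.prems Ck_on_Suc_imp[of k D g] by (intro Suc.IH) auto
      ultimately show "Ck_on k D (\<lambda>x. (FD g x v \<bullet> b) *\<^sub>R FD f (g x) b)"
        by (intro Ck_on_bilinear[OF bounded_bilinear_scaleR _ _ assms(4)])
    qed
  qed
  then show ?case using Derivative.differentiableI[OF *] by simp
qed

lemma Ck_on_inverse:
  fixes f :: "'a::euclidean_space \<Rightarrow> real"
  assumes "Ck_on k D f" "\<And>x. x \<in> D \<Longrightarrow> f x \<noteq> 0" "open D"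
  shows "Ck_on k D (\<lambda>x. inverse (f x))"
  using assms(1)
proof (induction k)
  case 0
  then show ?case using assms(2) by (auto intro: continuous_on_inverse)
next
  case (Suc k)
  have *: "((\<lambda>x. inverse (f x)) has_derivative (\<lambda>v. - (inverse (f x) * FD f x v * inverse (f x)))) (at x)"
    if "x \<in> D" for x
    by (rule Deriv.has_derivative_inverse[where f=f, OF assms(2)[OF that] differentiable_at_has_FD])
      (use Suc.prems that in simp)
  have i: "Ck_on k D (\<lambda>x. inverse (f x))" by (rule Suc.IH[OF Ck_on_Suc_imp[OF Suc.prems]])
  have "Ck_on k D (\<lambda>x. - (inverse (f x) * FD f x v * inverse (f x)))" for v
  proof -
    have "Ck_on k D (\<lambda>x. FD f x v)" using Suc.prems by simp
    then have "Ck_on k D (\<lambda>x. inverse (f x) * FD f x v * inverse (f x))"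
      by (intro Ck_on_bilinear[OF bounded_bilinear_mult _ _ assms(3)] i)
    then show ?thesis
      by (rule Ck_on_bounded_linear[OF bounded_linear_minus[OF bounded_linear_ident] _ assms(3)])
  qed
  then have "Ck_on k D (\<lambda>x. FD (\<lambda>x. inverse (f x)) x v)" for v
    by (rule Ck_on_cong[where f="\<lambda>x. - (inverse (f x) * FD f x v * inverse (f x))", OF assms(3), rotated])
      (simp add: has_derivative_FD_eq[OF *])
  then show ?case using Derivative.differentiableI[OF *] by simp
qed

lemma smooth_on_imp_differentiable: "smooth_on D f \<Longrightarrow> x \<in> D \<Longrightarrow> f differentiable (at x)"
  by (metis Ck_on.simps(2) smooth_on_def)

lemma smooth_on_has_derivative: "smooth_on D f \<Longrightarrow> x \<in> D \<Longrightarrow> (f has_derivative FD f x) (at x)"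
  using smooth_on_imp_differentiable differentiable_at_has_FD by blast

lemma smooth_on_linear_FD: "smooth_on D f \<Longrightarrow> x \<in> D \<Longrightarrow> linear (FD f x)"
  by (meson has_derivative_linear smooth_on_has_derivative)

lemma smooth_on_continuous_on: "smooth_on D f \<Longrightarrow> continuous_on D f"
  by (metis Ck_on_imp_continuous_on smooth_on_def)

lemma smooth_on_isCont: "smooth_on D f \<Longrightarrow> x \<in> D \<Longrightarrow> isCont f x"
  by (simp add: differentiable_imp_continuous_within smooth_on_imp_differentiable)

lemma smooth_on_subset: "smooth_on D f \<Longrightarrow> E \<subseteq> D \<Longrightarrow> smooth_on E f"
  by (auto simp: smooth_on_def intro: Ck_on_subset)

lemma smooth_on_cong: "smooth_on D f \<Longrightarrow> open D \<Longrightarrow> (\<And>x. x \<in> D \<Longrightarrow> f x = g x) \<Longrightarrow> smooth_on D g"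
  by (auto simp: smooth_on_def intro: Ck_on_cong)

lemma smooth_on_local:
  "(\<And>x. x \<in> D \<Longrightarrow> \<exists>U. x \<in> U \<and> open U \<and> smooth_on U f) \<Longrightarrow> smooth_on D f"
  unfolding smooth_on_def by (intro allI Ck_on_local) blast

lemma smooth_on_const: "smooth_on D (\<lambda>x. c)"
  by (auto simp: smooth_on_def intro: Ck_on_const)

lemma smooth_on_bounded_linear:
  "bounded_linear L \<Longrightarrow> smooth_on D f \<Longrightarrow> open D \<Longrightarrow> smooth_on D (\<lambda>x. L (f x))"
  by (auto simp: smooth_on_def intro: Ck_on_bounded_linear)

lemma smooth_on_add: "smooth_on D f \<Longrightarrow> smooth_on D g \<Longrightarrow> open D \<Longrightarrow> smooth_on D (\<lambda>x. f x + g x)"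
  by (auto simp: smooth_on_def intro: Ck_on_add)

lemma smooth_on_uminus: "smooth_on D f \<Longrightarrow> open D \<Longrightarrow> smooth_on D (\<lambda>x. - f x)"
  using smooth_on_bounded_linear[OF bounded_linear_minus[OF bounded_linear_ident]] by blast

lemma smooth_on_diff: "smooth_on D f \<Longrightarrow> smooth_on D g \<Longrightarrow> open D \<Longrightarrow> smooth_on D (\<lambda>x. f x - g x)"
  using smooth_on_add[of D f "\<lambda>x. - g x"] smooth_on_uminus[of D g] by simp

lemma smooth_on_bilinear:
  "bounded_bilinear b \<Longrightarrow> smooth_on D f \<Longrightarrow> smooth_on D g \<Longrightarrow> open D \<Longrightarrow> smooth_on D (\<lambda>x. b (f x) (g x))"
  by (auto simp: smooth_on_def intro: Ck_on_bilinear)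

lemmas smooth_on_scaleR = smooth_on_bilinear[OF bounded_bilinear_scaleR]
lemmas smooth_on_mult = smooth_on_bilinear[OF bounded_bilinear_mult]
lemmas smooth_on_inner = smooth_on_bilinear[OF bounded_bilinear_inner]

lemma smooth_on_sum:
  "(\<And>i. i \<in> A \<Longrightarrow> smooth_on D (f i)) \<Longrightarrow> open D \<Longrightarrow> smooth_on D (\<lambda>x. \<Sum>i\<in>A. f i x)"
  by (auto simp: smooth_on_def intro: Ck_on_sum)

lemma smooth_on_compose:
  fixes f :: "'b::euclidean_space \<Rightarrow> 'c::real_normed_vector" and g :: "'a::euclidean_space \<Rightarrow> 'b"
  shows "smooth_on E f \<Longrightarrow> smooth_on D g \<Longrightarrow> g ` D \<subseteq> E \<Longrightarrow> open D \<Longrightarrow> open E \<Longrightarrow> smooth_on D (\<lambda>x. f (g x))"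
  by (auto simp: smooth_on_def intro: Ck_on_compose)

lemma smooth_on_inverse:
  fixes f :: "'a::euclidean_space \<Rightarrow> real"
  shows "smooth_on D f \<Longrightarrow> (\<And>x. x \<in> D \<Longrightarrow> f x \<noteq> 0) \<Longrightarrow> open D \<Longrightarrow> smooth_on D (\<lambda>x. inverse (f x))"
  by (auto simp: smooth_on_def intro: Ck_on_inverse)

lemma smooth_on_ident: "smooth_on D (\<lambda>x. x)"
  unfolding smooth_on_def
proof
  fix k show "Ck_on k D (\<lambda>x. x)"
    by (cases k) (auto intro: Ck_on_const continuous_on_id)
qed

lemma smooth_on_linear: 
  fixes L :: "'a::euclidean_space \<Rightarrow> 'b::real_normed_vector"
  assumes "linear L" shows "smooth_on D L"
proof -
  have "smooth_on UNIV L"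
    using smooth_on_bounded_linear[of L, OF _ smooth_on_ident open_UNIV] assms
    by (simp add: linear_conv_bounded_linear)
  then show ?thesis by (rule smooth_on_subset) simp
qed

lemma smooth_on_fst: "smooth_on D fst" and smooth_on_snd: "smooth_on D snd"
  by (rule smooth_on_linear[OF linear_fst], rule smooth_on_linear[OF linear_snd])

lemma smooth_on_fstI: "smooth_on D f \<Longrightarrow> open D \<Longrightarrow> smooth_on D (\<lambda>x. fst (f x))"
  and smooth_on_sndI: "smooth_on D f \<Longrightarrow> open D \<Longrightarrow> smooth_on D (\<lambda>x. snd (f x))"
  by (rule smooth_on_bounded_linear[OF bounded_linear_fst], assumption+,
      rule smooth_on_bounded_linear[OF bounded_linear_snd], assumption+)

lemma smooth_on_Pair:
  assumes "smooth_on D f" "smooth_on D g" "open D"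
  shows "smooth_on D (\<lambda>x. (f x, g x))"
proof -
  have "smooth_on D (\<lambda>x. (f x, 0))"
    by (rule smooth_on_bounded_linear[of "\<lambda>x. (x, 0)", OF bounded_linear_Pair[OF bounded_linear_ident bounded_linear_zero] assms(1,3)])
  moreover have "smooth_on D (\<lambda>x. (0, g x))"
    by (rule smooth_on_bounded_linear[of "\<lambda>x. (0, x)", OF bounded_linear_Pair[OF bounded_linear_zero bounded_linear_ident] assms(2,3)])
  ultimately have "smooth_on D (\<lambda>x. (f x, 0) + (0, g x))"
    using smooth_on_add assms(3) by blast
  then show ?thesis by simp
qed

lemma smooth_on_FD: "smooth_on D f \<Longrightarrow> smooth_on D (\<lambda>x. FD f x v)"
  by (metis Ck_on.simps(2) smooth_on_def)

text \<open>\<open>smooth_on\<close> speaks of derivatives in one fixed direction at a time.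
  Smoothness on basis vectors is thus all that is known of a family of linear maps, and moving
  arguments are reached by expanding them in the basis. Derivatives of maps, and after a second
  application metrics and Christoffel maps, are treated in this way.\<close>

lemma smooth_on_linear_family:
  fixes F :: "'a::euclidean_space \<Rightarrow> 'b::euclidean_space \<Rightarrow> 'c::real_normed_vector"
    and h :: "'d::euclidean_space \<Rightarrow> 'a"
  assumes "\<And>x. x \<in> D \<Longrightarrow> linear (F x)" "\<And>b. b \<in> Basis \<Longrightarrow> smooth_on D (\<lambda>x. F x b)"
    and "open D" "open E" "smooth_on E h" "smooth_on E v" "h ` E \<subseteq> D"
  shows "smooth_on E (\<lambda>y. F (h y) (v y))"
proof -
  have "smooth_on E (\<lambda>y. \<Sum>b\<in>Basis. (v y \<bullet> b) *\<^sub>R F (h y) b)"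
    by (intro smooth_on_sum smooth_on_scaleR smooth_on_inner smooth_on_const assms
        smooth_on_compose[OF assms(2) assms(5)])
  then show ?thesis
    using assms(1,4,7) by (elim smooth_on_cong) (auto simp: linear_Basis_sum[symmetric])
qed

lemma smooth_on_FD_compose:
  fixes f :: "'a::euclidean_space \<Rightarrow> 'c::real_normed_vector" and h :: "'d::euclidean_space \<Rightarrow> 'a"
  assumes "smooth_on D f" "open D" "open E" "smooth_on E h" "smooth_on E v" "h ` E \<subseteq> D"
  shows "smooth_on E (\<lambda>y. FD f (h y) (v y))"
  by (rule smooth_on_linear_family[where F="FD f" and D=D])
    (use assms in \<open>auto intro: smooth_on_FD smooth_on_linear_FD\<close>)

lemma FD_chain:
  fixes f :: "'b::euclidean_space \<Rightarrow> 'c::real_normed_vector" and g :: "'a::euclidean_space \<Rightarrow> 'b"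
  assumes "f differentiable (at (g x))" "g differentiable (at x)"
  shows "FD (\<lambda>y. f (g y)) x v = FD f (g x) (FD g x v)"
  using frechet_derivative_compose[OF assms(2,1)] by (simp add: o_def)

lemma has_vector_derivative_chain_FD:
  assumes "f differentiable (at (x t))" "(x has_vector_derivative x') (at t)"
  shows "((\<lambda>s. f (x s)) has_vector_derivative FD f (x t) x') (at t)"
  using vector_derivative_diff_chain_within[of x x' t UNIV f "FD f (x t)"]
    differentiable_at_has_FD[OF assms(1)] assms(2)
  by (auto simp: o_def intro: has_derivative_at_withinI)

lemma has_vector_derivative_FD_real:
  fixes f :: "real \<Rightarrow> 'b::real_normed_vector"
  assumes "f differentiable (at t)"
  shows "(f has_vector_derivative FD f t 1) (at t)"
  using assms has_vector_derivative_chain_FD[of f "\<lambda>x. x" t 1] by simp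

subsection \<open>Symmetry of second derivatives\<close>

text \<open>The mean value theorem twice: for the increment along \<open>v\<close> as a function
  \<open>h\<close> of the step along \<open>u\<close>, then for the derivative along
  \<open>u\<close> as a function of the step along \<open>v\<close>.\<close>

lemma second_difference_mvt:
  fixes f :: "'a::euclidean_space \<Rightarrow> real"
  assumes "smooth_on D f" "s > 0"
    and D: "\<And>a b. 0 \<le> a \<Longrightarrow> a \<le> s \<Longrightarrow> 0 \<le> b \<Longrightarrow> b \<le> s \<Longrightarrow> x + a *\<^sub>R u + b *\<^sub>R v \<in> D"
  shows "\<exists>a b. 0 < a \<and> a < s \<and> 0 < b \<and> b < s \<and>
     f (x + s *\<^sub>R u + s *\<^sub>R v) - f (x + s *\<^sub>R u) - f (x + s *\<^sub>R v) + f x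
       = s * s * FD (\<lambda>y. FD f y u) (x + a *\<^sub>R u + b *\<^sub>R v) v"
proof -
  define h where "h a = f (x + a *\<^sub>R u + s *\<^sub>R v) - f (x + a *\<^sub>R u)" for a
  have d1: "((\<lambda>a. f (x + a *\<^sub>R u + b *\<^sub>R v)) has_real_derivative FD f (x + a *\<^sub>R u + b *\<^sub>R v) u) (at a)"
    if "0 \<le> a" "a \<le> s" "0 \<le> b" "b \<le> s" for a b
    unfolding has_real_derivative_iff_has_vector_derivative
    by (rule has_vector_derivative_chain_FD)
      (use that D assms(1) in \<open>auto intro!: smooth_on_imp_differentiable derivative_eq_intros\<close>)
  have "(h has_real_derivative FD f (x + a *\<^sub>R u + s *\<^sub>R v) u - FD f (x + a *\<^sub>R u) u) (at a)"
    if "0 \<le> a" "a \<le> s" for a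
    unfolding h_def using DERIV_diff[OF d1[OF that, of s] d1[OF that, of 0]] assms(2) by simp
  then obtain a where a: "0 < a" "a < s" "h s - h 0 = s * (FD f (x + a *\<^sub>R u + s *\<^sub>R v) u - FD f (x + a *\<^sub>R u) u)"
    using MVT2[of 0 s h] assms(2) by fastforce
  have d2: "((\<lambda>b. FD f (x + a *\<^sub>R u + b *\<^sub>R v) u) has_real_derivative
      FD (\<lambda>y. FD f y u) (x + a *\<^sub>R u + b *\<^sub>R v) v) (at b)" if "0 \<le> b" "b \<le> s" for b
    unfolding has_real_derivative_iff_has_vector_derivative
    by (rule has_vector_derivative_chain_FD)
      (use that D assms(1) a in \<open>auto intro!: smooth_on_imp_differentiable[of D] smooth_on_FD derivative_eq_intros\<close>)
  obtain b where "0 < b" "b < s" "FD f (x + a *\<^sub>R u + s *\<^sub>R v) u - FD f (x + a *\<^sub>R u + 0 *\<^sub>R v) u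
     = s * FD (\<lambda>y. FD f y u) (x + a *\<^sub>R u + b *\<^sub>R v) v"
    using MVT2[of 0 s "\<lambda>b. FD f (x + a *\<^sub>R u + b *\<^sub>R v) u", OF _ d2] assms(2) by fastforce
  moreover have "h s - h 0 = f (x + s *\<^sub>R u + s *\<^sub>R v) - f (x + s *\<^sub>R u) - f (x + s *\<^sub>R v) + f x"
    by (simp add: h_def)
  ultimately show ?thesis using a by (intro exI[of _ a] exI[of _ b]) auto
qed

text \<open>The second difference is symmetric in \<open>u\<close> and \<open>v\<close>. Hence the
  two mixed derivatives take a common value at two points close to \<open>x\<close>, and continuity
  forbids a gap between them at \<open>x\<close>.\<close>

lemma symmetric_second_derivative_real:
  fixes f :: "'a::euclidean_space \<Rightarrow> real"
  assumes f: "smooth_on D f" and "open D" "x \<in> D"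
  shows "FD (\<lambda>y. FD f y u) x v = FD (\<lambda>y. FD f y v) x u"
proof (rule ccontr)
  define F where "F u v y = FD (\<lambda>y. FD f y u) y v" for u v y
  assume "\<not> ?thesis"
  \<comment> \<open>Half the gap: values within \<open>?e\<close> of the two different limits cannot
    coincide.\<close>
  then have e: "\<bar>F u v x - F v u x\<bar> / 2 > 0" (is "?e > 0") by (simp add: F_def)
  have c: "isCont (F u v) x" for u v
    unfolding F_def by (rule smooth_on_isCont[OF _ assms(3)]) (intro smooth_on_FD f)
  obtain d1 where d1: "d1 > 0" "\<And>y. dist y x < d1 \<Longrightarrow> dist (F u v y) (F u v x) < ?e"
    using c[of u v] e unfolding continuous_at_eps_delta by blast
  obtain d2 where d2: "d2 > 0" "\<And>y. dist y x < d2 \<Longrightarrow> dist (F v u y) (F v u x) < ?e"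
    using c[of v u] e unfolding continuous_at_eps_delta by metis
  obtain d3 where d3: "d3 > 0" "ball x d3 \<subseteq> D" using assms openE by blast
  define d where "d = min d1 (min d2 d3)"
  have d: "d > 0" "d \<le> d1" "d \<le> d2" "d \<le> d3" using d1 d2 d3 by (auto simp: d_def)
  \<comment> \<open>Small enough for the whole parallelogram to lie within distance \<open>d\<close>
    of \<open>x\<close>; the summand 1 keeps the denominator positive when both directions
    vanish.\<close>
  define s where "s = d / (2 * (norm u + norm v + 1))"
  have s: "s > 0" using d by (simp add: s_def add_nonneg_pos)
  have "norm u + norm v + 1 > 0" using norm_ge_zero[of u] norm_ge_zero[of v] by linarith
  then have "s * (norm u + norm v + 1) = d / 2"
    unfolding s_def by (simp add: field_simps)
  then have s2: "s * (norm u + norm v) < d" using s d by (simp add: distrib_left)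
  have near: "dist (x + a *\<^sub>R u + b *\<^sub>R v) x < d" if "0 \<le> a" "a \<le> s" "0 \<le> b" "b \<le> s" for a b
  proof -
    have "dist (x + a *\<^sub>R u + b *\<^sub>R v) x = norm (a *\<^sub>R u + b *\<^sub>R v)" by (simp add: dist_norm algebra_simps)
    also have "\<dots> \<le> a * norm u + b * norm v" using that norm_triangle_ineq[of "a *\<^sub>R u" "b *\<^sub>R v"] by simp
    also have "\<dots> \<le> s * (norm u + norm v)" using that
      by (simp add: distrib_left add_mono mult_right_mono)
    finally show ?thesis using s2 by simp
  qed
  have inD: "x + a *\<^sub>R u + b *\<^sub>R v \<in> D" if "0 \<le> a" "a \<le> s" "0 \<le> b" "b \<le> s" for a b
    using near[OF that] d d3 by (auto simp: dist_commute subset_iff)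
  have inD2: "x + a *\<^sub>R v + b *\<^sub>R u \<in> D" if "0 \<le> a" "a \<le> s" "0 \<le> b" "b \<le> s" for a b
    using inD[OF that(3,4,1,2)] by (simp add: algebra_simps)
  obtain a b where ab: "0 < a" "a < s" "0 < b" "b < s"
    "f (x + s *\<^sub>R u + s *\<^sub>R v) - f (x + s *\<^sub>R u) - f (x + s *\<^sub>R v) + f x = s * s * F u v (x + a *\<^sub>R u + b *\<^sub>R v)"
    using second_difference_mvt[OF f s inD] unfolding F_def by blast
  obtain a' b' where ab': "0 < a'" "a' < s" "0 < b'" "b' < s"
    "f (x + s *\<^sub>R v + s *\<^sub>R u) - f (x + s *\<^sub>R v) - f (x + s *\<^sub>R u) + f x = s * s * F v u (x + a' *\<^sub>R v + b' *\<^sub>R u)"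
    using second_difference_mvt[OF f s inD2] unfolding F_def by blast
  have "f (x + s *\<^sub>R v + s *\<^sub>R u) = f (x + s *\<^sub>R u + s *\<^sub>R v)" by (simp add: add_ac)
  then have "s * s * F u v (x + a *\<^sub>R u + b *\<^sub>R v) = s * s * F v u (x + a' *\<^sub>R v + b' *\<^sub>R u)"
    using ab(5) ab'(5) by linarith
  then have eq: "F u v (x + a *\<^sub>R u + b *\<^sub>R v) = F v u (x + a' *\<^sub>R v + b' *\<^sub>R u)"
    using s by simp
  have "dist (F u v (x + a *\<^sub>R u + b *\<^sub>R v)) (F u v x) < ?e"
    using near[of a b] ab d by (intro d1) auto
  moreover have "dist (x + a' *\<^sub>R v + b' *\<^sub>R u) x < d" using near[of b' a'] ab' by (simp add: algebra_simps)
  then have "dist (F v u (x + a' *\<^sub>R v + b' *\<^sub>R u)) (F v u x) < ?e"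
    using d by (intro d2) auto
  ultimately show False using eq by (simp add: dist_real_def abs_if split: if_splits)
qed

lemma FD_inner:
  assumes "f differentiable (at x)"
  shows "FD (\<lambda>y. f y \<bullet> b) x u = FD f x u \<bullet> b"
  using has_derivative_FD_eq[OF has_derivative_inner_left[OF differentiable_at_has_FD[OF assms], of b]] by simp

lemma symmetric_second_derivative:
  fixes f :: "'a::euclidean_space \<Rightarrow> 'b::euclidean_space"
  assumes f: "smooth_on D f" and D: "open D" "x \<in> D"
  shows "FD (\<lambda>y. FD f y u) x v = FD (\<lambda>y. FD f y v) x u"
proof (rule euclidean_eqI)
  fix b :: 'b
  have sm: "smooth_on D (\<lambda>y. f y \<bullet> b)" by (intro smooth_on_inner f smooth_on_const D)
  have "FD (\<lambda>y. FD f y u) x v \<bullet> b = FD (\<lambda>y. FD (\<lambda>y. f y \<bullet> b) y u) x v" for u v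
  proof -
    have "FD (\<lambda>y. FD f y u) x v \<bullet> b = FD (\<lambda>y. FD f y u \<bullet> b) x v"
      by (metis FD_inner smooth_on_FD[OF f] smooth_on_imp_differentiable D(2))
    also have "\<dots> = FD (\<lambda>y. FD (\<lambda>y. f y \<bullet> b) y u) x v"
      by (subst FD_cong_open[OF D, where g="\<lambda>y. FD (\<lambda>y. f y \<bullet> b) y u"])
        (simp_all add: FD_inner smooth_on_imp_differentiable[OF f])
    finally show ?thesis .
  qed
  then show "FD (\<lambda>y. FD f y u) x v \<bullet> b = FD (\<lambda>y. FD f y v) x u \<bullet> b"
    using symmetric_second_derivative_real[OF sm D] by simp
qed

subsection \<open>Smooth families of linear and bilinear maps\<close>

text \<open>Solutions of a linear system depend smoothly on the parameter, without determinants. The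
  derivative of the inverse of \<open>(x, v) \<mapsto> (x, A x v)\<close> gives a first derivative
  of the solution. Differentiating the equation shows that this derivative solves a system with the
  same \<open>A\<close> and a right side of one order less, so induction over all right sides gives
  every order.\<close>

lemma smooth_solution:
  fixes A :: "'a::euclidean_space \<Rightarrow> 'b::euclidean_space \<Rightarrow> 'b" and w r :: "'a \<Rightarrow> 'b"
  assumes "open D" and lin: "\<And>x. x \<in> D \<Longrightarrow> linear (A x)" and inj: "\<And>x. x \<in> D \<Longrightarrow> inj (A x)"
    and A: "\<And>b. smooth_on D (\<lambda>x. A x b)" and r: "smooth_on D r"
    and w: "\<And>x. x \<in> D \<Longrightarrow> A x (w x) = r x"
  shows "smooth_on D w"
proof -
  define AF where "AF = (\<lambda>(x, v). (x, A x v))"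
  define ginv where "ginv = (\<lambda>(x, y). (x, inv (A x) y))"
  have oD: "open (D \<times> (UNIV::'b set))" using assms(1) by (simp add: open_Times)
  have smA: "smooth_on (D \<times> UNIV) (\<lambda>z. A (fst z) (snd z))"
    by (rule smooth_on_linear_family[where D=D]) (use assms oD in \<open>auto intro: smooth_on_fst smooth_on_snd\<close>)
  have "smooth_on (D \<times> UNIV) (\<lambda>z. (fst z, A (fst z) (snd z)))"
    by (intro smooth_on_Pair smA smooth_on_fst oD)
  then have smAF: "smooth_on (D \<times> UNIV) AF" by (simp add: AF_def case_prod_unfold)
  have ginv: "ginv (AF z) = z" if "z \<in> D \<times> UNIV" for z
    using that inj by (auto simp: ginv_def AF_def inv_f_f split: prod.splits)
  have dAF: "(AF has_derivative FD AF (x, v)) (at (x, v))" if "x \<in> D" for x v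
    using smooth_on_has_derivative[OF smAF] that by blast
  \<comment> \<open>The derivative of \<open>AF\<close> is block triangular, with the identity in
    the parameter and \<open>A x\<close> in the unknown; this is why it is injective.\<close>
  have f1: "fst (FD AF (x, v) z) = fst z" if "x \<in> D" for x v z
  proof -
    have "((\<lambda>z. fst (AF z)) has_derivative (\<lambda>z. fst (FD AF (x, v) z))) (at (x, v))"
      by (rule has_derivative_fst[OF dAF[OF that]])
    moreover have "((\<lambda>z. fst (AF z)) has_derivative fst) (at (x, v))"
      by (auto simp: AF_def case_prod_unfold intro!: derivative_eq_intros)
    ultimately show ?thesis using has_derivative_unique by metis
  qed
  have f2: "FD AF (x, v) (0, k) = (0, A x k)" if "x \<in> D" for x v k
  proof -
    have lb: "bounded_linear (A x)" using lin that linear_conv_bounded_linear by blast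
    have "((\<lambda>v. AF (x, v)) has_derivative (\<lambda>k. FD AF (x, v) (0, k))) (at v)"
      by (rule has_derivative_compose[where f="\<lambda>v. (x, v)" and g=AF and x=v and s=UNIV, OF _ dAF[OF that]]) (auto intro!: derivative_eq_intros)
    moreover have "((\<lambda>v. AF (x, v)) has_derivative (\<lambda>k. (0, A x k))) (at v)"
      unfolding AF_def by (auto intro!: derivative_eq_intros bounded_linear.has_derivative[OF lb])
    ultimately show ?thesis using has_derivative_unique by metis
  qed
  have ginvd: "ginv differentiable (at (x, A x v))" if x: "x \<in> D" for x v
  proof -
    have ldA: "linear (FD AF (x, v))" using dAF[OF x] has_derivative_linear by blast
    have injA: "inj (FD AF (x, v))"
    proof (rule linear_injective_0[OF ldA, THEN iffD2], intro allI impI)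
      fix z assume z: "FD AF (x, v) z = 0"
      then have "fst z = 0" using f1[OF x, of v z] by simp
      then have "A x (snd z) = 0" using f2[OF x, of v "snd z"] z by (cases z) (auto simp: zero_prod_def)
      then have "snd z = 0" using lin[OF x] inj[OF x] by (simp add: linear_injective_0)
      then show "z = 0" using \<open>fst z = 0\<close> by (simp add: prod_eq_iff)
    qed
    obtain dB where dB: "FD AF (x, v) \<circ> dB = id"
      by (metis ldA injA linear_injective_imp_surjective surj_iff)
    have "(ginv has_derivative dB) (at (AF (x, v)))"
      by (rule has_derivative_inverse_strong[OF oD _ smooth_on_continuous_on[OF smAF] ginv dAF[OF x] dB])
        (use x in auto)
    then show ?thesis by (auto simp: AF_def differentiable_def)
  qed
  \<comment> \<open>A solution for an arbitrary right side \<open>q\<close> is a component of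
    \<open>ginv\<close> composed with \<open>y \<mapsto> (y, q y)\<close>, from which it inherits
    continuity and differentiability.\<close>
  have ueq: "snd (ginv (y, q y)) = u y" if "\<And>x. x \<in> D \<Longrightarrow> A x (u x) = q x" "y \<in> D" for q u y
    unfolding that(1)[OF that(2), symmetric] by (simp add: ginv_def inj that(2))
  have "Ck_on k D u" if "Ck_on k D q" "\<And>x. x \<in> D \<Longrightarrow> A x (u x) = q x" for k u q
    using that
  proof (induction k arbitrary: u q)
    case 0
    have "isCont u x" if "x \<in> D" for x
    proof -
      have "isCont q x" using 0 that assms(1) continuous_on_eq_continuous_at by (metis Ck_on.simps(1))
      then have i: "isCont (\<lambda>y. (y, q y)) x" by (intro continuous_intros)
      have "isCont ginv (x, q x)"
        using ginvd[OF that, of "u x"] 0(2)[OF that] differentiable_imp_continuous_within by auto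
      then have "isCont (\<lambda>y. snd (ginv (y, q y))) x"
        using isCont_o2[OF i] by (intro isCont_snd) auto
      then have "((\<lambda>y. snd (ginv (y, q y))) \<longlongrightarrow> u x) (at x)"
        using ueq[of u q x] 0(2) that by (simp add: isCont_def)
      then show ?thesis
        unfolding isCont_def
        by (rule Lim_transform_within_open[OF _ assms(1) that]) (use ueq[of u q] 0(2) in auto)
    qed
    then show ?case by (auto intro!: continuous_at_imp_continuous_on)
  next
    case (Suc k)
    have ud: "u differentiable (at x)" if x: "x \<in> D" for x
    proof -
      have qd: "q differentiable (at x)" using Suc.prems x by auto
      have "ginv differentiable (at (x, q x))" using ginvd[OF x, of "u x"] Suc.prems(2)[OF x] by simp
      moreover have "(\<lambda>y. (y, q y)) differentiable (at x)"
        by (rule Derivative.differentiableI[OF has_derivative_Pair[OF has_derivative_ident differentiable_at_has_FD[OF qd]]])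
      ultimately have "(\<lambda>y. ginv (y, q y)) differentiable (at x)"
        by (metis differentiable_compose)
      then have "(\<lambda>y. snd (ginv (y, q y))) differentiable (at x)"
        unfolding differentiable_def using has_derivative_snd by blast
      then show ?thesis
        using differentiable_cong_open[OF assms(1) x, of "\<lambda>y. snd (ginv (y, q y))" u] ueq[of u q] Suc.prems(2)
        by blast
    qed
    \<comment> \<open>The product rule for \<open>A y (u y) = q y\<close>, with \<open>u\<close>
      expanded in the basis. The new right side contains \<open>u\<close> itself but no derivative
      of \<open>u\<close>, so its order is that of \<open>FD q\<close>.\<close>
    have m: "A x (FD u x h) = FD q x h - (\<Sum>b\<in>Basis. (u x \<bullet> b) *\<^sub>R FD (\<lambda>y. A y b) x h)" if x: "x \<in> D" for x h
    proof -
      have ud': "(u has_derivative FD u x) (at x)" by (rule differentiable_at_has_FD[OF ud[OF x]])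
      have "((\<lambda>y. \<Sum>b\<in>Basis. (u y \<bullet> b) *\<^sub>R A y b) has_derivative
          (\<lambda>h. \<Sum>b\<in>Basis. (u x \<bullet> b) *\<^sub>R FD (\<lambda>y. A y b) x h + (FD u x h \<bullet> b) *\<^sub>R A x b)) (at x)"
        by (intro has_derivative_sum has_derivative_scaleR has_derivative_inner_left
            smooth_on_has_derivative[OF A] x ud')
      then have "(q has_derivative (\<lambda>h. \<Sum>b\<in>Basis. (u x \<bullet> b) *\<^sub>R FD (\<lambda>y. A y b) x h + (FD u x h \<bullet> b) *\<^sub>R A x b)) (at x)"
        by (rule has_derivative_transform_within_open[OF _ assms(1) x])
          (simp add: linear_Basis_sum[OF lin, symmetric] Suc.prems)
      then have "FD q x h = (\<Sum>b\<in>Basis. (u x \<bullet> b) *\<^sub>R FD (\<lambda>y. A y b) x h + (FD u x h \<bullet> b) *\<^sub>R A x b)"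
        by (simp add: has_derivative_FD_eq)
      then show ?thesis by (simp add: sum.distrib linear_Basis_sum[OF lin[OF x], symmetric])
    qed
    have uk: "Ck_on k D u" by (rule Suc.IH[OF Ck_on_Suc_imp[OF Suc.prems(1)] Suc.prems(2)])
    have "Ck_on k D (\<lambda>x. FD q x h - (\<Sum>b\<in>Basis. (u x \<bullet> b) *\<^sub>R FD (\<lambda>y. A y b) x h))" for h
    proof -
      have "Ck_on k D (\<lambda>x. \<Sum>b\<in>Basis. (u x \<bullet> b) *\<^sub>R FD (\<lambda>y. A y b) x h)"
        using smooth_on_FD[OF A] assms(1) uk unfolding smooth_on_def
        by (intro Ck_on_sum Ck_on_bilinear[OF bounded_bilinear_scaleR] Ck_on_bilinear[OF bounded_bilinear_inner]
            Ck_on_const) auto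
      then have "Ck_on k D (\<lambda>x. - (\<Sum>b\<in>Basis. (u x \<bullet> b) *\<^sub>R FD (\<lambda>y. A y b) x h))"
        using Ck_on_bounded_linear[OF bounded_linear_minus[OF bounded_linear_ident] _ assms(1)] by blast
      then have "Ck_on k D (\<lambda>x. FD q x h + - (\<Sum>b\<in>Basis. (u x \<bullet> b) *\<^sub>R FD (\<lambda>y. A y b) x h))"
        using Suc.prems(1) by (intro Ck_on_add assms(1)) auto
      then show ?thesis by simp
    qed
    then have "Ck_on k D (\<lambda>x. FD u x h)" for h
      by (rule Suc.IH) (rule m)
    then show ?case using ud by simp
  qed
  then show ?thesis using r w unfolding smooth_on_def by blast
qed

lemma bilinear_linear_left: "bilinear B \<Longrightarrow> linear (\<lambda>x. B x y)"
  and bilinear_linear_right: "bilinear B \<Longrightarrow> linear (B x)"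
  by (simp_all add: bilinear_def)

text \<open>Smoothness is given for each fixed argument only. \<open>F\<close> is regarded as one
  smooth function of the pair of parameter and argument, whose total derivative is the sum of its
  two partial derivatives.\<close>

lemma linear_family_has_derivative:
  fixes F :: "'a::euclidean_space \<Rightarrow> 'b::euclidean_space \<Rightarrow> 'c::real_normed_vector"
    and h :: "'d::euclidean_space \<Rightarrow> 'a"
  assumes D: "open D" and lin: "\<And>x. x \<in> D \<Longrightarrow> linear (F x)"
    and sm: "\<And>b. b \<in> Basis \<Longrightarrow> smooth_on D (\<lambda>x. F x b)"
    and h: "(h has_derivative h') (at y)" and v: "(v has_derivative v') (at y)" and hD: "h y \<in> D"
  shows "((\<lambda>y. F (h y) (v y)) has_derivative
     (\<lambda>w. FD (\<lambda>z. F z (v y)) (h y) (h' w) + F (h y) (v' w))) (at y)"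
proof -
  have oD: "open (D \<times> (UNIV::'b set))" using D by (simp add: open_Times)
  have smA: "smooth_on (D \<times> UNIV) (\<lambda>z. F (fst z) (snd z))"
    by (rule smooth_on_linear_family[OF lin sm D oD]) (auto intro: smooth_on_fst smooth_on_snd)
  define f where "f = (\<lambda>z. F (fst z) (snd z))"
  have df: "(f has_derivative FD f (h y, v y)) (at (h y, v y))"
    using smooth_on_has_derivative[OF smA] hD unfolding f_def by blast
  have lb: "bounded_linear (F (h y))" using lin[OF hD] linear_conv_bounded_linear by blast
  have "((\<lambda>y. f (h y, v y)) has_derivative (\<lambda>w. FD f (h y, v y) (h' w, v' w))) (at y)"
    by (rule has_derivative_compose[where f="\<lambda>y. (h y, v y)" and g=f and x=y and s=UNIV, OF _ df])
      (intro has_derivative_Pair h v)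
  moreover have "FD f (h y, v y) (a, b) = FD (\<lambda>z. F z (v y)) (h y) a + F (h y) b" for a b
  proof -
    have "((\<lambda>z. f (z, v y)) has_derivative (\<lambda>a. FD f (h y, v y) (a, 0))) (at (h y))"
      by (rule has_derivative_compose[where f="\<lambda>z. (z, v y)" and g=f and s=UNIV, OF _ df])
        (auto intro!: derivative_eq_intros)
    then have 1: "FD (\<lambda>z. F z (v y)) (h y) a = FD f (h y, v y) (a, 0)"
      by (simp add: f_def has_derivative_FD_eq)
    have "((\<lambda>z. f (h y, z)) has_derivative (\<lambda>b. FD f (h y, v y) (0, b))) (at (v y))"
      by (rule has_derivative_compose[where f="\<lambda>z. (h y, z)" and g=f and s=UNIV, OF _ df])
        (auto intro!: derivative_eq_intros)
    moreover have "((\<lambda>z. f (h y, z)) has_derivative F (h y)) (at (v y))"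
      unfolding f_def by (auto intro!: derivative_eq_intros bounded_linear.has_derivative[OF lb])
    ultimately have 2: "F (h y) b = FD f (h y, v y) (0, b)" using has_derivative_unique by metis
    show ?thesis
      unfolding 1 2 using linear_add[OF has_derivative_linear[OF df], of "(a, 0)" "(0, b)"] by simp
  qed
  ultimately show ?thesis by (simp add: f_def)
qed

lemma smooth_on_bilinear_family:
  fixes F :: "'a::euclidean_space \<Rightarrow> 'b::euclidean_space \<Rightarrow> 'b \<Rightarrow> 'c::real_normed_vector"
    and h :: "'d::euclidean_space \<Rightarrow> 'a"
  assumes D: "open D" and E: "open E" and bil: "\<And>x. x \<in> D \<Longrightarrow> bilinear (F x)"
    and sm: "\<And>a b. smooth_on D (\<lambda>x. F x a b)"
    and h: "smooth_on E h" "h ` E \<subseteq> D" and u: "smooth_on E u" and v: "smooth_on E v"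
  shows "smooth_on E (\<lambda>y. F (h y) (u y) (v y))"
proof -
  have 1: "smooth_on E (\<lambda>y. F (h y) a (v y))" for a
    by (rule smooth_on_linear_family[where F="\<lambda>x. F x a", OF _ sm D E h(1) v h(2)])
      (use bil bilinear_linear_right in blast)
  have "smooth_on E (\<lambda>y. (\<lambda>z b. F (h z) b (v z)) y (u y))"
    by (rule smooth_on_linear_family[where F="\<lambda>z b. F (h z) b (v z)" and h="\<lambda>z. z" and D=E, OF _ 1 E E smooth_on_ident u])
      (use bil h in \<open>auto intro!: bilinear_linear_left\<close>)
  then show ?thesis by simp
qed

text \<open>The linear case for the last argument, with the pair of point and first argument as
  parameter; the linear case again gives the derivative in that parameter.\<close>

lemma bilinear_family_has_derivative:
  fixes F :: "'a::euclidean_space \<Rightarrow> 'b::euclidean_space \<Rightarrow> 'b \<Rightarrow> 'c::real_normed_vector"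
    and h :: "'d::euclidean_space \<Rightarrow> 'a"
  assumes D: "open D" and bil: "\<And>x. x \<in> D \<Longrightarrow> bilinear (F x)"
    and sm: "\<And>a b. smooth_on D (\<lambda>x. F x a b)"
    and h: "(h has_derivative h') (at y)" and u: "(u has_derivative u') (at y)"
    and v: "(v has_derivative v') (at y)" and hD: "h y \<in> D"
  shows "((\<lambda>y. F (h y) (u y) (v y)) has_derivative
     (\<lambda>w. FD (\<lambda>z. F z (u y) (v y)) (h y) (h' w) + F (h y) (u' w) (v y) + F (h y) (u y) (v' w))) (at y)"
proof -
  have oD: "open (D \<times> (UNIV::'b set))" using D by (simp add: open_Times)
  have linR: "linear (F x a)" if "x \<in> D" for x a using bil[OF that] bilinear_linear_right by blast
  have linL: "linear (\<lambda>a. F x a b)" if "x \<in> D" for x b using bil[OF that] bilinear_linear_left by blast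
  have smA: "smooth_on (D \<times> UNIV) (\<lambda>z. F (fst z) (snd z) b)" for b
    by (rule smooth_on_linear_family[where F="\<lambda>x a. F x a b", OF linL sm D oD smooth_on_fst smooth_on_snd]) auto
  have 1: "((\<lambda>z. F (fst z) (snd z) b) has_derivative
      (\<lambda>w. FD (\<lambda>z. F z (snd p) b) (fst p) (fst w) + F (fst p) (snd w) b)) (at p)" if "fst p \<in> D" for p b
    by (rule linear_family_has_derivative[where F="\<lambda>x a. F x a b" and h=fst and v=snd and y=p, OF D linL sm _ _ that])
      (auto intro!: derivative_eq_intros)
  have "((\<lambda>y. (\<lambda>z. F (fst z) (snd z)) (h y, u y) (v y)) has_derivative
     (\<lambda>w. FD (\<lambda>z. F (fst z) (snd z) (v y)) (h y, u y) (h' w, u' w) + F (fst (h y, u y)) (snd (h y, u y)) (v' w))) (at y)"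
    by (rule linear_family_has_derivative[where F="\<lambda>z. F (fst z) (snd z)", OF oD _ smA has_derivative_Pair[OF h u] v])
      (use hD linR in auto)
  then show ?thesis by (simp add: has_derivative_FD_eq[OF 1] hD)
qed

lemma linear_family_has_vector_derivative:
  fixes F :: "'a::euclidean_space \<Rightarrow> 'b::euclidean_space \<Rightarrow> 'c::real_normed_vector"
  assumes D: "open D" and lin: "\<And>x. x \<in> D \<Longrightarrow> linear (F x)"
    and sm: "\<And>b. smooth_on D (\<lambda>x. F x b)"
    and h: "(h has_vector_derivative h') (at t)" and v: "(v has_vector_derivative v') (at t)" and hD: "h t \<in> D"
  shows "((\<lambda>s. F (h s) (v s)) has_vector_derivative
     (FD (\<lambda>z. F z (v t)) (h t) h' + F (h t) v')) (at t)"
  using linear_family_has_derivative[OF D lin sm h[unfolded has_vector_derivative_def] v[unfolded has_vector_derivative_def] hD]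
    linear_scale[OF lin[OF hD]] linear_scale[OF smooth_on_linear_FD[OF sm hD]]
  by (simp add: has_vector_derivative_def scaleR_right_distrib)

lemma bilinear_family_has_vector_derivative:
  fixes F :: "'a::euclidean_space \<Rightarrow> 'b::euclidean_space \<Rightarrow> 'b \<Rightarrow> 'c::real_normed_vector"
  assumes D: "open D" and bil: "\<And>x. x \<in> D \<Longrightarrow> bilinear (F x)"
    and sm: "\<And>a b. smooth_on D (\<lambda>x. F x a b)"
    and h: "(h has_vector_derivative h') (at t)" and u: "(u has_vector_derivative u') (at t)"
    and v: "(v has_vector_derivative v') (at t)" and hD: "h t \<in> D"
  shows "((\<lambda>s. F (h s) (u s) (v s)) has_vector_derivative
     (FD (\<lambda>z. F z (u t) (v t)) (h t) h' + F (h t) u' (v t) + F (h t) (u t) v')) (at t)"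
  using bilinear_family_has_derivative[OF D bil sm h[unfolded has_vector_derivative_def]
      u[unfolded has_vector_derivative_def] v[unfolded has_vector_derivative_def] hD]
    bilinear_lmul[OF bil[OF hD]] bilinear_rmul[OF bil[OF hD]] linear_scale[OF smooth_on_linear_FD[OF sm hD]]
  by (simp add: has_vector_derivative_def scaleR_right_distrib)

lemma FD_bilinear_args:
  assumes D: "open D" and bil: "\<And>x. x \<in> D \<Longrightarrow> bilinear (F x)"
    and sm: "\<And>a b. smooth_on D (\<lambda>x. F x a b)" and x: "x \<in> D"
  shows "bilinear (\<lambda>u v. FD (\<lambda>y. F y u v) x a)"
proof -
  have d: "((\<lambda>y. F y u v) has_derivative FD (\<lambda>y. F y u v) x) (at x)" for u v
    by (rule smooth_on_has_derivative[OF sm x])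
  have add1: "FD (\<lambda>y. F y (u + u') v) x a = FD (\<lambda>y. F y u v) x a + FD (\<lambda>y. F y u' v) x a" for u u' v
    by (subst FD_cong_open[OF D x, where g="\<lambda>y. F y u v + F y u' v"])
      (simp_all add: bil bilinear_ladd has_derivative_FD_eq[OF has_derivative_add[OF d d]])
  have add2: "FD (\<lambda>y. F y u (v + v')) x a = FD (\<lambda>y. F y u v) x a + FD (\<lambda>y. F y u v') x a" for u v v'
    by (subst FD_cong_open[OF D x, where g="\<lambda>y. F y u v + F y u v'"])
      (simp_all add: bil bilinear_radd has_derivative_FD_eq[OF has_derivative_add[OF d d]])
  have mul1: "FD (\<lambda>y. F y (c *\<^sub>R u) v) x a = c *\<^sub>R FD (\<lambda>y. F y u v) x a" for c u v
    by (subst FD_cong_open[OF D x, where g="\<lambda>y. c *\<^sub>R F y u v"])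
      (simp_all add: bil bilinear_lmul has_derivative_FD_eq[OF has_derivative_scaleR_right[OF d]])
  have mul2: "FD (\<lambda>y. F y u (c *\<^sub>R v)) x a = c *\<^sub>R FD (\<lambda>y. F y u v) x a" for c u v
    by (subst FD_cong_open[OF D x, where g="\<lambda>y. c *\<^sub>R F y u v"])
      (simp_all add: bil bilinear_rmul has_derivative_FD_eq[OF has_derivative_scaleR_right[OF d]])
  show ?thesis unfolding bilinear_def by (auto intro!: linearI add1 add2 mul1 mul2)
qed

subsection \<open>Levi-Civita connection of a metric on an open set\<close>

text \<open>Nondegeneracy is kept and the signature dropped: the Koszul formula needs only that
  vectors and covectors correspond.\<close>

locale local_metric =
  fixes Om :: "'e::euclidean_space set" and G :: "'e \<Rightarrow> 'e \<Rightarrow> 'e \<Rightarrow> real"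
  assumes open_Om: "open Om"
    and bilinear_G: "x \<in> Om \<Longrightarrow> bilinear (G x)"
    and sym_G: "x \<in> Om \<Longrightarrow> G x u v = G x v u"
    and nondeg_G: "x \<in> Om \<Longrightarrow> (\<And>w. G x v w = 0) \<Longrightarrow> v = 0"
    and smooth_G: "smooth_on Om (\<lambda>x. G x u v)"
begin

definition DG :: "'e \<Rightarrow> 'e \<Rightarrow> 'e \<Rightarrow> 'e \<Rightarrow> real" where
  "DG x a u v = FD (\<lambda>x. G x u v) x a"

definition Chr :: "'e \<Rightarrow> 'e \<Rightarrow> 'e \<Rightarrow> 'e" where
  "Chr x u v = (THE w. \<forall>z. 2 * G x w z = DG x u v z + DG x v u z - DG x z u v)"

lemma DG_linear: "x \<in> Om \<Longrightarrow> linear (\<lambda>a. DG x a u v)"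
  unfolding DG_def by (rule smooth_on_linear_FD[OF smooth_G])

lemma DG_bilinear: "x \<in> Om \<Longrightarrow> bilinear (DG x a)"
  unfolding DG_def[abs_def] by (rule FD_bilinear_args[OF open_Om bilinear_G smooth_G])

lemma DG_sym: "x \<in> Om \<Longrightarrow> DG x a u v = DG x a v u"
  unfolding DG_def by (rule fun_cong[OF FD_cong_open[OF open_Om]]) (auto intro: sym_G)

lemmas G_simps = bilinear_ladd[OF bilinear_G] bilinear_radd[OF bilinear_G] bilinear_lmul[OF bilinear_G]
  bilinear_rmul[OF bilinear_G] bilinear_lsub[OF bilinear_G] bilinear_rsub[OF bilinear_G]
  bilinear_lzero[OF bilinear_G] bilinear_rzero[OF bilinear_G] bilinear_lneg[OF bilinear_G] bilinear_rneg[OF bilinear_G]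

lemma G_eqI: "x \<in> Om \<Longrightarrow> (\<And>z. G x v z = G x w z) \<Longrightarrow> v = w"
  using nondeg_G[of x "v - w"] by (simp add: G_simps)

text \<open>Lowering of an index, where a covector is stored as the vector that represents it in the
  Euclidean inner product. This makes it an endomorphism to which \<open>smooth_solution\<close>
  applies.\<close>

definition lower :: "'e \<Rightarrow> 'e \<Rightarrow> 'e" where "lower x w = (\<Sum>b\<in>Basis. G x w b *\<^sub>R b)"

lemma lower_inner: "x \<in> Om \<Longrightarrow> lower x w \<bullet> z = G x w z"
proof -
  assume x: "x \<in> Om"
  have "lower x w \<bullet> z = (\<Sum>b\<in>Basis. (z \<bullet> b) *\<^sub>R G x w b)"
    by (simp add: lower_def inner_sum_left inner_commute[of z] mult.commute)
  then show ?thesis using linear_Basis_sum[OF bilinear_linear_right[OF bilinear_G[OF x]], of w z] by simp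
qed

lemma lower_linear: "x \<in> Om \<Longrightarrow> linear (lower x)"
  unfolding lower_def
  by (intro linearI) (simp_all add: G_simps scaleR_left_distrib sum.distrib scaleR_right.sum)

lemma lower_inj: assumes x: "x \<in> Om" shows "inj (lower x)"
proof (rule linear_injective_0[OF lower_linear[OF x], THEN iffD2], intro allI impI)
  fix v assume "lower x v = 0"
  then have "G x v w = 0" for w using lower_inner[OF x, of v w] by simp
  then show "v = 0" using nondeg_G[OF x] by blast
qed

text \<open>\<open>lower x\<close> is an injective endomorphism in finite dimension, hence
  onto.\<close>

lemma Riesz: assumes x: "x \<in> Om" and "linear (f :: 'e \<Rightarrow> real)" shows "\<exists>!w. \<forall>z. G x w z = f z"
proof -
  obtain w where w: "lower x w = (\<Sum>b\<in>Basis. f b *\<^sub>R b)"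
    using linear_injective_imp_surjective[OF lower_linear[OF x] lower_inj[OF x]] by (metis surjD)
  have "G x w z = f z" for z
  proof -
    have "G x w z = (\<Sum>b\<in>Basis. f b *\<^sub>R b) \<bullet> z" using lower_inner[OF x, of w z] w by simp
    also have "\<dots> = (\<Sum>b\<in>Basis. (z \<bullet> b) *\<^sub>R f b)" by (simp add: inner_sum_left inner_commute[of z] mult.commute)
    also have "\<dots> = f z" using linear_Basis_sum[OF assms(2), of z] by simp
    finally show ?thesis .
  qed
  then show ?thesis using G_eqI[OF x] by metis
qed

lemma koszul_linear:
  "x \<in> Om \<Longrightarrow> linear (\<lambda>z. DG x u v z + DG x v u z - DG x z u v)"
  by (intro linearI)
    (simp_all add: linear_add[OF DG_linear] linear_scale[OF DG_linear] bilinear_radd[OF DG_bilinear] 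
      bilinear_rmul[OF DG_bilinear] algebra_simps)

lemma Chr_koszul:
  assumes x: "x \<in> Om" shows "2 * G x (Chr x u v) z = DG x u v z + DG x v u z - DG x z u v"
proof -
  let ?k = "\<lambda>z. DG x u v z + DG x v u z - DG x z u v"
  have "linear (\<lambda>z. (1/2) *\<^sub>R ?k z)"
    by (rule linear_compose_scale_right[OF koszul_linear[OF x]])
  then have "\<exists>!w. \<forall>z. G x w z = (1/2) *\<^sub>R ?k z" by (rule Riesz[OF x])
  then have "\<exists>!w. \<forall>z. 2 * G x w z = ?k z" by (simp add: field_simps)
  then show ?thesis unfolding Chr_def by (rule theI'[THEN spec])
qed

lemma Chr_unique:
  assumes x: "x \<in> Om" and "\<And>z. 2 * G x w z = DG x u v z + DG x v u z - DG x z u v"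
  shows "Chr x u v = w"
  using Chr_koszul[OF x, of u v] assms(2) by (intro G_eqI[OF x]) (metis mult_cancel_left zero_neq_numeral)

lemma Chr_sym: "x \<in> Om \<Longrightarrow> Chr x u v = Chr x v u"
  by (rule Chr_unique) (simp_all add: Chr_koszul DG_sym[of x _ u v])

lemma Chr_bilinear: assumes x: "x \<in> Om" shows "bilinear (Chr x)"
proof -
  have add: "Chr x (u + u') v = Chr x u v + Chr x u' v" for u u' v
    by (rule Chr_unique[OF x])
      (simp add: x G_simps distrib_left Chr_koszul linear_add[OF DG_linear]
        bilinear_radd[OF DG_bilinear] bilinear_ladd[OF DG_bilinear])
  have mul: "Chr x (c *\<^sub>R u) v = c *\<^sub>R Chr x u v" for c u v
  proof (rule Chr_unique[OF x])
    fix z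
    have "2 * G x (c *\<^sub>R Chr x u v) z = c * (2 * G x (Chr x u v) z)" by (simp add: x G_simps)
    then show "2 * G x (c *\<^sub>R Chr x u v) z = DG x (c *\<^sub>R u) v z + DG x v (c *\<^sub>R u) z - DG x z (c *\<^sub>R u) v"
      by (simp add: x Chr_koszul linear_scale[OF DG_linear]
        bilinear_rmul[OF DG_bilinear] bilinear_lmul[OF DG_bilinear] algebra_simps)
  qed
  show ?thesis
    unfolding bilinear_def using add mul Chr_sym[OF x] by (auto intro!: linearI) 
qed

text \<open>The Koszul formula is a linear system for \<open>Chr x u v\<close> with coefficient map
  \<open>lower x\<close> and a right side made of first derivatives of the metric.\<close>

lemma Chr_smooth: "smooth_on Om (\<lambda>x. Chr x u v)"
proof (rule smooth_solution[where A=lower])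
  show "smooth_on Om (\<lambda>x. lower x b)" for b
    unfolding lower_def by (intro smooth_on_sum smooth_on_scaleR smooth_G smooth_on_const open_Om)
  show "lower x (Chr x u v) = (\<Sum>b\<in>Basis. ((1/2) * (DG x u v b + DG x v u b - DG x b u v)) *\<^sub>R b)"
    if "x \<in> Om" for x
    unfolding lower_def
    by (rule sum.cong[OF refl]) (simp add: Chr_koszul[OF that, symmetric])
  show "smooth_on Om (\<lambda>x. \<Sum>b\<in>Basis. ((1/2) * (DG x u v b + DG x v u b - DG x b u v)) *\<^sub>R b)"
    unfolding DG_def
    by (intro smooth_on_sum smooth_on_scaleR smooth_on_mult smooth_on_diff smooth_on_add smooth_on_FD
        smooth_G smooth_on_const open_Om)
qed (use open_Om lower_linear lower_inj in auto)

text \<open>In the sum of the Koszul formulas for \<open>a, u\<close> tested on \<open>v\<close> and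
  for \<open>a, v\<close> tested on \<open>u\<close>, all terms but \<open>DG x a u v\<close>
  cancel.\<close>

lemma metric_compat: "x \<in> Om \<Longrightarrow> DG x a u v = G x (Chr x a u) v + G x u (Chr x a v)"
  using Chr_koszul[of x a u v] Chr_koszul[of x a v u] sym_G[of x u "Chr x a v"]
    DG_sym[of x a u v] DG_sym[of x u a v] DG_sym[of x v a u] by simp

lemmas Chr_simps = bilinear_ladd[OF Chr_bilinear] bilinear_radd[OF Chr_bilinear] bilinear_lmul[OF Chr_bilinear]
  bilinear_rmul[OF Chr_bilinear] bilinear_lsub[OF Chr_bilinear] bilinear_rsub[OF Chr_bilinear]
  bilinear_lzero[OF Chr_bilinear] bilinear_rzero[OF Chr_bilinear] bilinear_lneg[OF Chr_bilinear] bilinear_rneg[OF Chr_bilinear]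

definition DChr :: "'e \<Rightarrow> 'e \<Rightarrow> 'e \<Rightarrow> 'e \<Rightarrow> 'e" where
  "DChr x a u v = FD (\<lambda>x. Chr x u v) x a"

text \<open>The expression of R(a, b)z for fields with constant components, whose bracket
  vanishes.\<close>

definition Rm :: "'e \<Rightarrow> 'e \<Rightarrow> 'e \<Rightarrow> 'e \<Rightarrow> 'e" where
  "Rm x a b z = DChr x a b z - DChr x b a z + Chr x a (Chr x b z) - Chr x b (Chr x a z)"

lemma DChr_linear: "x \<in> Om \<Longrightarrow> linear (\<lambda>a. DChr x a u v)"
  unfolding DChr_def by (rule smooth_on_linear_FD[OF Chr_smooth])

lemma DChr_bilinear: "x \<in> Om \<Longrightarrow> bilinear (DChr x a)"
  unfolding DChr_def[abs_def] by (rule FD_bilinear_args[OF open_Om Chr_bilinear Chr_smooth])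

lemma DChr_sym: "x \<in> Om \<Longrightarrow> DChr x a u v = DChr x a v u"
  unfolding DChr_def by (rule fun_cong[OF FD_cong_open[OF open_Om]]) (auto intro: Chr_sym)

lemma Rm_linear: "x \<in> Om \<Longrightarrow> linear (\<lambda>a. Rm x a b z)"
  unfolding Rm_def
  by (intro linearI) (simp_all add: linear_add[OF DChr_linear] linear_scale[OF DChr_linear] Chr_simps
    bilinear_ladd[OF DChr_bilinear] bilinear_lmul[OF DChr_bilinear] algebra_simps)

lemma Rm_same: "Rm x a a z = 0"
  by (simp add: Rm_def)

text \<open>The second derivative of \<open>G y z z\<close> is symmetric in its two directions.
  Computed from metric compatibility, its skew part in \<open>a\<close> and \<open>b\<close> is
  \<open>2 * G x (Rm x a b z) z\<close>, because the remaining term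
  \<open>G x (Chr x b z) (Chr x a z)\<close> is symmetric.\<close>

lemma Rm_skew: assumes x: "x \<in> Om" shows "G x (Rm x a b z) z = 0"
proof -
  have h: "FD (\<lambda>y. G y z z) y b = 2 * G y (Chr y b z) z" if "y \<in> Om" for y b
    using metric_compat[OF that, of b z z] sym_G[OF that] by (simp add: DG_def)
  have hh: "FD (\<lambda>y. FD (\<lambda>y. G y z z) y b) x a =
     2 * (DG x a (Chr x b z) z + G x (DChr x a b z) z)" for a b
  proof -
    have "((\<lambda>y. G y (Chr y b z) z) has_derivative
      (\<lambda>w. FD (\<lambda>y. G y (Chr x b z) z) x w + G x (FD (\<lambda>y. Chr y b z) x w) z + G x (Chr x b z) 0)) (at x)"
      by (rule bilinear_family_has_derivative[OF open_Om bilinear_G smooth_G])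
        (auto intro: smooth_on_has_derivative[OF Chr_smooth] x)
    then have "((\<lambda>y. 2 * G y (Chr y b z) z) has_derivative
      (\<lambda>w. 2 * (DG x w (Chr x b z) z + G x (DChr x w b z) z))) (at x)"
      by (auto intro!: derivative_eq_intros simp: DG_def DChr_def G_simps x)
    then have "FD (\<lambda>y. 2 * G y (Chr y b z) z) x a = 2 * (DG x a (Chr x b z) z + G x (DChr x a b z) z)"
      by (simp add: has_derivative_FD_eq)
    then show ?thesis by (subst FD_cong_open[OF open_Om x h])
  qed
  have "FD (\<lambda>y. FD (\<lambda>y. G y z z) y b) x a = FD (\<lambda>y. FD (\<lambda>y. G y z z) y a) x b"
    by (rule symmetric_second_derivative_real[OF smooth_G open_Om x])
  then show ?thesis
    unfolding hh Rm_def using x by (simp add: metric_compat G_simps sym_G[OF x, of "Chr x a z" "Chr x b z"])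
qed

text \<open>\<open>A\<close> is the covariant derivative of the variation field \<open>J\<close> in
  the second parameter. The geodesic equation is differentiated in the first parameter; after the
  partial derivatives are exchanged, the leftover derivatives and products of Christoffel maps are
  exactly \<open>Rm\<close>.\<close>

lemma jacobi_local:
  fixes H :: "real \<times> real \<Rightarrow> 'e"
  assumes N: "open N" "z0 \<in> N" and H: "smooth_on N H" "H ` N \<subseteq> Om"
    and geo: "\<And>z. z \<in> N \<Longrightarrow> FD (\<lambda>z. FD H z (0, 1)) z (0, 1) + Chr (H z) (FD H z (0, 1)) (FD H z (0, 1)) = 0"
  defines "T \<equiv> \<lambda>z. FD H z (0, 1)" and "J \<equiv> \<lambda>z. FD H z (1, 0)"
  defines "A \<equiv> \<lambda>z. FD J z (0, 1) + Chr (H z) (T z) (J z)"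
  shows "FD A z0 (0, 1) + Chr (H z0) (T z0) (A z0) + Rm (H z0) (J z0) (T z0) (T z0) = 0"
proof -
  have smT: "smooth_on N T" and smJ: "smooth_on N J"
    unfolding T_def J_def by (intro smooth_on_FD H(1))+
  have Om: "H z \<in> Om" if "z \<in> N" for z using that H by blast
  have x: "H z0 \<in> Om" using Om N by blast
  have sd: "FD T z (1, 0) = FD J z (0, 1)" if "z \<in> N" for z
    unfolding T_def J_def by (rule symmetric_second_derivative[OF H(1) N(1) that])
  have chain: "FD (\<lambda>z. Chr (H z) (u z) (v z)) z0 w =
      DChr (H z0) (FD H z0 w) (u z0) (v z0) + Chr (H z0) (FD u z0 w) (v z0) + Chr (H z0) (u z0) (FD v z0 w)"
    if "smooth_on N u" "smooth_on N v" for u v w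
    unfolding DChr_def
    by (rule has_derivative_FD_eq[THEN fun_cong])
      (rule bilinear_family_has_derivative[OF open_Om Chr_bilinear Chr_smooth
        smooth_on_has_derivative[OF H(1) N(2)] smooth_on_has_derivative[OF that(1) N(2)]
        smooth_on_has_derivative[OF that(2) N(2)] x], assumption)
  have smC: "smooth_on N (\<lambda>z. Chr (H z) (u z) (v z))" if "smooth_on N u" "smooth_on N v" for u v
    by (rule smooth_on_bilinear_family[OF open_Om N(1) Chr_bilinear Chr_smooth H that])
  have "FD A z0 (0, 1) = FD (\<lambda>z. FD J z (0, 1)) z0 (0, 1) + FD (\<lambda>z. Chr (H z) (T z) (J z)) z0 (0, 1)"
    unfolding A_def
    by (rule has_derivative_FD_eq[THEN fun_cong])
      (intro has_derivative_add smooth_on_has_derivative[OF smooth_on_FD[OF smJ] N(2)]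
        smooth_on_has_derivative[OF smC[OF smT smJ] N(2)])
  \<comment> \<open>The derivative in the variation parameter is moved outermost in two exchanges,
    so that it can act on the geodesic equation.\<close>
  moreover have "FD (\<lambda>z. FD J z (0, 1)) z0 (0, 1) = FD (\<lambda>z. FD T z (0, 1)) z0 (1, 0)"
  proof -
    have "FD (\<lambda>z. FD J z (0, 1)) z0 (0, 1) = FD (\<lambda>z. FD T z (1, 0)) z0 (0, 1)"
      by (rule fun_cong[OF FD_cong_open[OF N]]) (simp add: sd)
    also have "\<dots> = FD (\<lambda>z. FD T z (0, 1)) z0 (1, 0)"
      by (rule symmetric_second_derivative[OF smT N])
    finally show ?thesis .
  qed
  moreover have "FD (\<lambda>z. FD T z (0, 1)) z0 (1, 0) = - FD (\<lambda>z. Chr (H z) (T z) (T z)) z0 (1, 0)"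
  proof -
    have "FD (\<lambda>z. FD T z (0, 1)) z0 = FD (\<lambda>z. - Chr (H z) (T z) (T z)) z0"
      by (rule FD_cong_open[OF N]) (use geo in \<open>simp add: T_def eq_neg_iff_add_eq_0\<close>)
    also have "\<dots> = (\<lambda>w. - FD (\<lambda>z. Chr (H z) (T z) (T z)) z0 w)"
      by (rule has_derivative_FD_eq)
        (rule has_derivative_minus[OF smooth_on_has_derivative[OF smC[OF smT smT] N(2)]])
    finally show ?thesis by simp
  qed
  moreover have "FD T z0 (0, 1) = - Chr (H z0) (T z0) (T z0)"
    using geo[OF N(2)] by (simp add: T_def eq_neg_iff_add_eq_0)
  moreover have "FD H z0 (0, 1) = T z0" "FD H z0 (1, 0) = J z0" by (simp_all add: T_def J_def)
  moreover have "Chr (H z0) (J z0) (Chr (H z0) (T z0) (T z0)) = Chr (H z0) (Chr (H z0) (T z0) (T z0)) (J z0)"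
    "Chr (H z0) (FD J z0 (0, 1)) (T z0) = Chr (H z0) (T z0) (FD J z0 (0, 1))"
    "Chr (H z0) (J z0) (T z0) = Chr (H z0) (T z0) (J z0)"
    "DChr (H z0) (T z0) (J z0) (T z0) = DChr (H z0) (T z0) (T z0) (J z0)"
    by (rule Chr_sym[OF x] DChr_sym[OF x])+
  ultimately show ?thesis
    unfolding Rm_def chain[OF smT smJ] chain[OF smT smT] sd[OF N(2)]
    by (simp add: A_def Chr_simps x)
qed

end

subsection \<open>Charts and smooth maps\<close>

lemma chart_inv_left: "injective_chart c \<Longrightarrow> p \<in> fst c \<Longrightarrow> chart_inv c (snd c p) = p"
  by (simp add: chart_inv_def injective_chart_def)

lemma chart_inv_in: "x \<in> snd c ` fst c \<Longrightarrow> chart_inv c x \<in> fst c"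
  and chart_inv_right: "x \<in> snd c ` fst c \<Longrightarrow> snd c (chart_inv c x) = x"
  by (simp_all add: chart_inv_def inv_into_into f_inv_into_f)

lemma transition_snd: "injective_chart c \<Longrightarrow> p \<in> fst c \<Longrightarrow> transition c d (snd c p) = snd d p"
  by (simp add: transition_def chart_inv_left)

lemma chart_image_iff: "injective_chart c \<Longrightarrow> q \<in> fst c \<Longrightarrow> U \<subseteq> fst c \<Longrightarrow> snd c q \<in> snd c ` U \<longleftrightarrow> q \<in> U"
  by (meson inj_on_image_mem_iff injective_chart_def)

text \<open>The part of \<open>smooth_atlas\<close> without preferred charts. It suffices for the
  topology and for smooth maps, so that nothing more has to be proved about the tangent
  bundle.\<close>

definition compatible_charts :: "('m, 'e::euclidean_space) chart set \<Rightarrow> bool" where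
  "compatible_charts C \<longleftrightarrow> (\<forall>c\<in>C. injective_chart c) \<and> (\<forall>c\<in>C. \<forall>d\<in>C. compatible c d)"

lemma compatible_charts_inj: "compatible_charts C \<Longrightarrow> c \<in> C \<Longrightarrow> injective_chart c"
  by (simp add: compatible_charts_def)

lemma compatible_charts_imageI:
  assumes "\<And>c. c \<in> C \<Longrightarrow> injective_chart (h c)"
    and "\<And>c d. c \<in> C \<Longrightarrow> d \<in> C \<Longrightarrow> open (snd (h c) ` (fst (h c) \<inter> fst (h d))) \<and>
      smooth_on (snd (h c) ` (fst (h c) \<inter> fst (h d))) (transition (h c) (h d))"
  shows "compatible_charts (h ` C)"
proof -
  have "compatible (h c) (h d)" if "c \<in> C" "d \<in> C" for c d
    using assms(2)[OF that] assms(2)[OF that(2,1)] unfolding compatible_def Int_commute[of "fst (h d)"] by blast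
  then show ?thesis using assms(1) unfolding compatible_charts_def by blast
qed

lemma compatible_charts_open: "compatible_charts C \<Longrightarrow> c \<in> C \<Longrightarrow> open (snd c ` fst c)"
  by (simp add: compatible_charts_def injective_chart_def)

lemma compatible_charts_overlap:
  assumes "compatible_charts C" "c \<in> C" "d \<in> C"
  shows "open (snd c ` (fst c \<inter> fst d))" "smooth_on (snd c ` (fst c \<inter> fst d)) (transition c d)"
  using assms by (auto simp: compatible_charts_def compatible_def)

text \<open>A map on an arbitrary subset has no derivative of its own. What can be differentiated is
  a smooth function on an open set of coordinates that agrees with it on the subset; all later
  differentials pass through such representatives.\<close>

lemma smooth_mapD:
  assumes f: "smooth_map M N A f" "p \<in> A" and c: "c \<in> charts M" "injective_chart c" "p \<in> fst c"
    and d: "d \<in> charts N" "f p \<in> fst d"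
  obtains D F where "open D" "snd c p \<in> D" "D \<subseteq> snd c ` fst c" "smooth_on D F" "F ` D \<subseteq> snd d ` fst d"
    "\<And>q. q \<in> A \<Longrightarrow> q \<in> fst c \<Longrightarrow> snd c q \<in> D \<Longrightarrow> f q \<in> fst d \<and> snd d (f q) = F (snd c q)"
proof -
  obtain W F where W: "p \<in> W" "smooth_map_open M N W F" "\<forall>q\<in>A \<inter> W. F q = f q"
    using f unfolding smooth_map_def by blast
  define D where "D = snd c ` {q \<in> W \<inter> fst c. F q \<in> fst d}"
  have D: "open D" "smooth_on D (snd d \<circ> F \<circ> chart_inv c)"
    using W(2) c(1) d(1) unfolding smooth_map_open_def D_def Let_def by blast+
  have Fc: "F (chart_inv c (snd c q)) = F q" if "q \<in> fst c" for q using c that by (simp add: chart_inv_left)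
  show ?thesis
  proof (rule that[OF D(1) _ _ D(2)])
    show "snd c p \<in> D" using W f c d by (auto simp: D_def)
    show "D \<subseteq> snd c ` fst c" by (auto simp: D_def)
    show "(snd d \<circ> F \<circ> chart_inv c) ` D \<subseteq> snd d ` fst d" using Fc by (auto simp: D_def)
    fix q assume q: "q \<in> A" "q \<in> fst c" "snd c q \<in> D"
    then obtain q' where "q' \<in> W" "q' \<in> fst c" "F q' \<in> fst d" "snd c q = snd c q'" by (auto simp: D_def)
    moreover then have "q = q'" using c q by (auto simp: injective_chart_def inj_on_def)
    ultimately show "f q \<in> fst d \<and> snd d (f q) = (snd d \<circ> F \<circ> chart_inv c) (snd c q)"
      using W(3) q Fc by auto
  qed
qed

lemma openin_mtopology_charts:
  "compatible_charts (charts M) \<Longrightarrow> openin (mtopology M) U \<longleftrightarrow>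
    U \<subseteq> mpoints M \<and> (\<forall>c\<in>charts M. open (snd c ` (U \<inter> fst c)))"
  by (rule openin_mtopology) (simp add: compatible_charts_def)

lemma chart_preimage_image:
  assumes C: "compatible_charts C" "c \<in> C" "c' \<in> C"
  shows "snd c' ` {q \<in> fst c \<inter> fst c'. P (snd c q)} =
    snd c' ` (fst c \<inter> fst c') \<inter> {y. P (transition c' c y)}"
  using transition_snd[OF compatible_charts_inj[OF C(1,3)], of _ c] by force

lemma open_chart_preimage:
  assumes C: "compatible_charts C" "c \<in> C" "c' \<in> C" and D: "open D"
  shows "open (snd c' ` {q \<in> fst c \<inter> fst c'. snd c q \<in> D})"
proof -
  have "open (snd c' ` (fst c \<inter> fst c') \<inter> transition c' c -` D)"
    using compatible_charts_overlap[OF C(1,3,2)] D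
    by (intro continuous_open_preimage smooth_on_continuous_on) (simp_all add: Int_commute)
  then show ?thesis by (subst chart_preimage_image[OF C, of "\<lambda>x. x \<in> D"]) (simp only: vimage_def)
qed

lemma openin_chart_preimage:
  assumes C: "compatible_charts (charts M)" "c \<in> charts M" and D: "open D"
  shows "openin (mtopology M) {q \<in> fst c. snd c q \<in> D}"
  unfolding openin_mtopology_charts[OF C(1)]
proof (intro conjI ballI)
  show "{q \<in> fst c. snd c q \<in> D} \<subseteq> mpoints M" using C(2) by (auto simp: mpoints_def)
  fix c' assume "c' \<in> charts M"
  moreover have "{q \<in> fst c. snd c q \<in> D} \<inter> fst c' = {q \<in> fst c \<inter> fst c'. snd c q \<in> D}" by auto
  ultimately show "open (snd c' ` ({q \<in> fst c. snd c q \<in> D} \<inter> fst c'))"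
    using open_chart_preimage[OF C _ D] by simp
qed

lemma smooth_mapI:
  assumes M: "compatible_charts (charts M)" and N: "compatible_charts (charts N)"
    and loc: "\<And>p. p \<in> A \<Longrightarrow> \<exists>c\<in>charts M. \<exists>d\<in>charts N. \<exists>D F. p \<in> fst c \<and> open D \<and> snd c p \<in> D \<and> smooth_on D F \<and>
       (\<forall>q\<in>A \<inter> fst c. snd c q \<in> D \<longrightarrow> f q \<in> fst d \<and> snd d (f q) = F (snd c q))"
  shows "smooth_map M N A f"
  unfolding smooth_map_def
proof
  fix p assume p: "p \<in> A"
  obtain c d D F where c: "c \<in> charts M" "p \<in> fst c" and d: "d \<in> charts N" and D: "open D" "snd c p \<in> D" "smooth_on D F"
    and f: "\<And>q. q \<in> A \<Longrightarrow> q \<in> fst c \<Longrightarrow> snd c q \<in> D \<Longrightarrow> f q \<in> fst d \<and> snd d (f q) = F (snd c q)"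
    using loc[OF p] by blast
  \<comment> \<open>Off \<open>A\<close> the function \<open>F\<close> may leave the coordinate
    range of \<open>d\<close>. On \<open>D1\<close> it stays inside, so \<open>chart_inv d\<close>
    turns it into an extension with values in \<open>N\<close>.\<close>
  define D1 where "D1 = D \<inter> F -` (snd d ` fst d)"
  have D1: "open D1" unfolding D1_def
    by (rule continuous_open_preimage[OF smooth_on_continuous_on[OF D(3)] D(1) compatible_charts_open[OF N d]])
  have pD1: "snd c p \<in> D1" using D f[OF p c(2)] unfolding D1_def by (metis IntI image_eqI vimageI)
  have smF: "smooth_on D1 F" by (rule smooth_on_subset[OF D(3)]) (simp add: D1_def)
  define W where "W = {q \<in> fst c. snd c q \<in> D1}"
  define G where "G q = chart_inv d (F (snd c q))" for q
  have Gin: "G q \<in> fst d" "snd d (G q) = F (snd c q)" if "q \<in> W" for q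
    using that by (auto simp: W_def D1_def G_def intro: chart_inv_in chart_inv_right)
  have "smooth_map_open M N W G"
    unfolding smooth_map_open_def Let_def
  proof (intro conjI ballI)
    show "openin (mtopology M) W" unfolding W_def by (rule openin_chart_preimage[OF M c(1) D1])
    show "G ` W \<subseteq> mpoints N" using Gin d by (auto simp: mpoints_def)
    fix c' d' assume c': "c' \<in> charts M" and d': "d' \<in> charts N"
    define O' where "O' = {x \<in> D1. F x \<in> snd d ` (fst d \<inter> fst d')}"
    have O': "open O'"
    proof -
      have "open (D1 \<inter> F -` (snd d ` (fst d \<inter> fst d')))"
        by (rule continuous_open_preimage[OF smooth_on_continuous_on[OF smF] D1 compatible_charts_overlap(1)[OF N d d']])
      then show ?thesis by (simp add: O'_def vimage_def Int_def)
    qed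
    have jd: "injective_chart d" using compatible_charts_inj[OF N d] .
    have eq: "{q \<in> W \<inter> fst c'. G q \<in> fst d'} = {q \<in> fst c \<inter> fst c'. snd c q \<in> O'}"
    proof -
      have "G q \<in> fst d' \<longleftrightarrow> F (snd c q) \<in> snd d ` (fst d \<inter> fst d')" if "q \<in> W" for q
        using Gin[OF that] jd by (metis (no_types, lifting) G_def IntD2 IntI chart_inv_left image_iff IntD1)
      then show ?thesis by (auto simp: W_def O'_def)
    qed
    show op: "open (snd c' ` {q \<in> W \<inter> fst c'. G q \<in> fst d'})"
      unfolding eq by (rule open_chart_preimage[OF M c(1) c' O'])
    have sub: "snd c' ` {q \<in> W \<inter> fst c'. G q \<in> fst d'} \<subseteq> snd c' ` (fst c' \<inter> fst c)"
      unfolding eq by auto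
    have tr: "transition c' c y \<in> O'" if "y \<in> snd c' ` {q \<in> W \<inter> fst c'. G q \<in> fst d'}" for y
      using that transition_snd[OF compatible_charts_inj[OF M c'], of _ c] unfolding eq by auto
    have sm1: "smooth_on (snd c' ` {q \<in> W \<inter> fst c'. G q \<in> fst d'}) (transition c' c)"
      by (rule smooth_on_subset[OF compatible_charts_overlap(2)[OF M c' c(1)] sub])
    have sm2: "smooth_on (snd c' ` {q \<in> W \<inter> fst c'. G q \<in> fst d'}) (\<lambda>y. F (transition c' c y))"
      by (rule smooth_on_compose[OF smF sm1 _ op D1]) (use tr in \<open>auto simp: O'_def\<close>)
    have "smooth_on (snd c' ` {q \<in> W \<inter> fst c'. G q \<in> fst d'}) (\<lambda>y. transition d d' (F (transition c' c y)))"
      by (rule smooth_on_compose[OF compatible_charts_overlap(2)[OF N d d'] sm2 _ op compatible_charts_overlap(1)[OF N d d']])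
        (use tr in \<open>auto simp: O'_def\<close>)
    then show "smooth_on (snd c' ` {q \<in> W \<inter> fst c'. G q \<in> fst d'}) (snd d' \<circ> G \<circ> chart_inv c')"
    proof (rule smooth_on_cong[OF _ op])
      fix y assume "y \<in> snd c' ` {q \<in> W \<inter> fst c'. G q \<in> fst d'}"
      then obtain q where q: "q \<in> fst c" "q \<in> fst c'" "q \<in> W" "y = snd c' q" using eq by auto
      have jc': "injective_chart c'" using compatible_charts_inj[OF M c'] .
      show "transition d d' (F (transition c' c y)) = (snd d' \<circ> G \<circ> chart_inv c') y"
        using q Gin[OF q(3)] transition_snd[OF jd, of "G q" d']
        by (simp add: transition_snd[OF jc'] chart_inv_left[OF jc'])
    qed
  qed
  moreover have "\<forall>q\<in>A \<inter> W. G q = f q"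
  proof
    fix q assume q: "q \<in> A \<inter> W"
    then have "f q \<in> fst d" "snd d (f q) = F (snd c q)" using f[of q] by (auto simp: W_def D1_def)
    then show "G q = f q" using Gin(1)[of q] compatible_charts_inj[OF N d] by (metis G_def chart_inv_left)
  qed
  moreover have "p \<in> W" using c pD1 by (simp add: W_def)
  ultimately show "\<exists>W F. p \<in> W \<and> smooth_map_open M N W F \<and> (\<forall>q\<in>A \<inter> W. F q = f q)" by blast
qed

subsection \<open>Smooth maps out of open sets of Euclidean space\<close>

lemma charts_euclid: "charts euclid = {(UNIV, \<lambda>x. x)}" "chart_at euclid x = (UNIV, \<lambda>x. x)"
  by (simp_all add: euclid_def)

lemma compatible_charts_euclid: "compatible_charts (charts euclid)"
proof -
  have t: "transition (UNIV, \<lambda>x. x) (UNIV, \<lambda>x. x) = (\<lambda>x::'a::euclidean_space. x)"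
    by (simp add: transition_def chart_inv_def fun_eq_iff inv_into_def)
  show ?thesis
    by (auto simp: compatible_charts_def charts_euclid injective_chart_def compatible_def t smooth_on_ident)
qed

lemma smooth_map_euclidD:
  fixes \<alpha> :: "'v::euclidean_space \<Rightarrow> 'n"
  assumes "smooth_map euclid N I \<alpha>" "open I" "t \<in> I" "d \<in> charts N" "\<alpha> t \<in> fst d"
  obtains D where "open D" "t \<in> D" "D \<subseteq> I" "\<alpha> ` D \<subseteq> fst d" "smooth_on D (\<lambda>s. snd d (\<alpha> s))"
proof -
  have jc: "injective_chart (UNIV, \<lambda>x. x :: 'v)" 
    using compatible_charts_inj[OF compatible_charts_euclid] by (simp add: charts_euclid)
  obtain D F where "open D" "snd (UNIV, \<lambda>x. x) t \<in> D" "smooth_on D F"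
    "\<And>q. q \<in> I \<Longrightarrow> q \<in> fst (UNIV, \<lambda>x. x) \<Longrightarrow> snd (UNIV, \<lambda>x. x) q \<in> D \<Longrightarrow>
       \<alpha> q \<in> fst d \<and> snd d (\<alpha> q) = F (snd (UNIV, \<lambda>x. x) q)"
    by (rule smooth_mapD[OF assms(1,3) _ jc _ assms(4,5)]) (simp_all add: charts_euclid)
  then have D: "open D" "t \<in> D" "smooth_on D F" 
    "\<And>q. q \<in> I \<Longrightarrow> q \<in> D \<Longrightarrow> \<alpha> q \<in> fst d \<and> snd d (\<alpha> q) = F q" by simp_all
  show ?thesis
  proof (rule that[of "D \<inter> I"])
    show "smooth_on (D \<inter> I) (\<lambda>s. snd d (\<alpha> s))"
      by (rule smooth_on_cong[OF smooth_on_subset[OF D(3)]]) (use D assms(2) in auto)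
  qed (use D assms in auto)
qed

lemma smooth_map_euclidI:
  fixes \<alpha> :: "'v::euclidean_space \<Rightarrow> 'n"
  assumes N: "compatible_charts (charts N)"
    and loc: "\<And>t. t \<in> I \<Longrightarrow> \<exists>d\<in>charts N. \<exists>D. open D \<and> t \<in> D \<and> \<alpha> ` D \<subseteq> fst d \<and> smooth_on D (\<lambda>s. snd d (\<alpha> s))"
  shows "smooth_map euclid N I \<alpha>"
proof (rule smooth_mapI[OF compatible_charts_euclid N])
  fix t assume "t \<in> I"
  then obtain d D where d: "d \<in> charts N" "open D" "t \<in> D" "\<alpha> ` D \<subseteq> fst d" "smooth_on D (\<lambda>s. snd d (\<alpha> s))"
    using loc by blast
  then show "\<exists>c\<in>charts euclid. \<exists>d\<in>charts N. \<exists>D F. t \<in> fst c \<and> open D \<and> snd c t \<in> D \<and> smooth_on D F \<and>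
       (\<forall>q\<in>I \<inter> fst c. snd c q \<in> D \<longrightarrow> \<alpha> q \<in> fst d \<and> snd d (\<alpha> q) = F (snd c q))"
    by (intro bexI[of _ "(UNIV, \<lambda>x. x)"] bexI[of _ d] exI[of _ D] exI[of _ "\<lambda>s. snd d (\<alpha> s)"])
      (auto simp: charts_euclid)
qed

subsection \<open>Tangent vectors in charts\<close>

locale atlas =
  fixes M :: "('m, 'e::euclidean_space) manifold"
  assumes atlas: "smooth_atlas M"
begin

lemma charts_compatible: "compatible_charts (charts M)"
  using atlas by (simp add: smooth_atlas_def compatible_charts_def)

lemma chart_at_in: "p \<in> mpoints M \<Longrightarrow> chart_at M p \<in> charts M" "p \<in> mpoints M \<Longrightarrow> p \<in> fst (chart_at M p)"
  using atlas by (auto simp: smooth_atlas_def)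

lemma chart_mpoints: "c \<in> charts M \<Longrightarrow> p \<in> fst c \<Longrightarrow> p \<in> mpoints M"
  by (auto simp: mpoints_def)

lemmas chart_inj = compatible_charts_inj[OF charts_compatible]
lemmas chart_open = compatible_charts_open[OF charts_compatible]
lemmas overlap_open = compatible_charts_overlap(1)[OF charts_compatible]
lemmas transition_smooth = compatible_charts_overlap(2)[OF charts_compatible]
lemmas transition_coord = transition_snd[OF chart_inj]
lemmas inv_coord = chart_inv_left[OF chart_inj]

text \<open>The chain rule for transition maps. With \<open>c\<close> as the middle chart it makes
  \<open>to_chart\<close> and \<open>from_chart\<close> inverse to each other.\<close>

lemma transition_cocycle:
  assumes b: "b \<in> charts M" "p \<in> fst b" and c: "c \<in> charts M" "p \<in> fst c" and d: "d \<in> charts M" "p \<in> fst d"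
  shows "FD (transition c d) (snd c p) (FD (transition b c) (snd b p) v) = FD (transition b d) (snd b p) v"
proof -
  define U where "U = snd b ` {q \<in> fst c \<inter> fst b. snd c q \<in> snd c ` (fst c \<inter> fst d)}"
  have U: "open U" unfolding U_def by (rule open_chart_preimage[OF charts_compatible c(1) b(1) overlap_open[OF c(1) d(1)]])
  have pU: "snd b p \<in> U" using b c d by (auto simp: U_def)
  have eq: "transition c d (transition b c y) = transition b d y" if y: "y \<in> U" for y
  proof -
    obtain q where q: "q \<in> fst c" "q \<in> fst b" "snd c q \<in> snd c ` (fst c \<inter> fst d)" "y = snd b q"
      using y unfolding U_def by blast
    then have "q \<in> fst d" using chart_image_iff[OF chart_inj[OF c(1)], of q "fst c \<inter> fst d"] by blast
    then show ?thesis using q b c by (simp add: transition_coord)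
  qed
  have "FD (transition b d) (snd b p) v = FD (\<lambda>y. transition c d (transition b c y)) (snd b p) v"
    by (rule fun_cong[OF FD_cong_open[OF U pU]]) (simp add: eq)
  also have "\<dots> = FD (transition c d) (transition b c (snd b p)) (FD (transition b c) (snd b p) v)"
    by (rule FD_chain)
      (use smooth_on_imp_differentiable[OF transition_smooth[OF c(1) d(1)]]
        smooth_on_imp_differentiable[OF transition_smooth[OF b(1) c(1)]] b c d in \<open>auto simp: transition_coord\<close>)
  finally show ?thesis using b by (simp add: transition_coord)
qed

lemma transition_self:
  assumes "c \<in> charts M" "p \<in> fst c" shows "FD (transition c c) (snd c p) v = v"
proof -
  have "FD (transition c c) (snd c p) = FD (\<lambda>x. x) (snd c p)"
    by (rule FD_cong_open[OF chart_open[OF assms(1)]]) (use assms in \<open>auto simp: transition_coord\<close>)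
  then show ?thesis by simp
qed

lemma transition_linear:
  "c \<in> charts M \<Longrightarrow> d \<in> charts M \<Longrightarrow> p \<in> fst c \<Longrightarrow> p \<in> fst d \<Longrightarrow> linear (FD (transition c d) (snd c p))"
  by (rule smooth_on_linear_FD[OF transition_smooth]) auto

lemma to_chart_linear: "c \<in> charts M \<Longrightarrow> p \<in> fst c \<Longrightarrow> linear (to_chart M c p)"
  unfolding to_chart_def[abs_def] using transition_linear chart_at_in chart_mpoints by metis

lemma from_chart_linear: "c \<in> charts M \<Longrightarrow> p \<in> fst c \<Longrightarrow> linear (from_chart M c p)"
  unfolding from_chart_def[abs_def] using transition_linear chart_at_in chart_mpoints by metis

lemma to_chart_transition:
  assumes "c \<in> charts M" "p \<in> fst c" "d \<in> charts M" "p \<in> fst d"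
  shows "FD (transition c d) (snd c p) (to_chart M c p v) = to_chart M d p v"
  unfolding to_chart_def by (rule transition_cocycle) (use assms chart_at_in chart_mpoints in auto)

lemma to_chart_self: "p \<in> mpoints M \<Longrightarrow> to_chart M (chart_at M p) p v = v"
  unfolding to_chart_def using transition_self chart_at_in by metis

lemma from_chart_self: "p \<in> mpoints M \<Longrightarrow> from_chart M (chart_at M p) p v = v"
  unfolding from_chart_def using transition_self chart_at_in by metis

lemma from_to_chart: "c \<in> charts M \<Longrightarrow> p \<in> fst c \<Longrightarrow> from_chart M c p (to_chart M c p v) = v"
  unfolding from_chart_def to_chart_def using transition_cocycle transition_self chart_at_in chart_mpoints by metis

lemma to_from_chart: "c \<in> charts M \<Longrightarrow> p \<in> fst c \<Longrightarrow> to_chart M c p (from_chart M c p v) = v"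
  unfolding from_chart_def to_chart_def using transition_cocycle transition_self chart_at_in chart_mpoints by metis

lemma to_chart_inj: "c \<in> charts M \<Longrightarrow> p \<in> fst c \<Longrightarrow> to_chart M c p v = to_chart M c p w \<longleftrightarrow> v = w"
  by (metis from_to_chart)

lemma to_chart_simps:
  assumes "c \<in> charts M" "p \<in> fst c"
  shows "to_chart M c p (v + w) = to_chart M c p v + to_chart M c p w"
    "to_chart M c p (v - w) = to_chart M c p v - to_chart M c p w"
    "to_chart M c p (r *\<^sub>R v) = r *\<^sub>R to_chart M c p v" "to_chart M c p (- v) = - to_chart M c p v"
    "to_chart M c p 0 = 0"
  using to_chart_linear[OF assms] by (simp_all add: linear_add linear_diff linear_scale linear_neg linear_0)

lemma to_chart_0_iff: "c \<in> charts M \<Longrightarrow> p \<in> fst c \<Longrightarrow> to_chart M c p v = 0 \<longleftrightarrow> v = 0"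
  by (metis to_chart_inj to_chart_simps(5))

lemma overlap_neighborhood:
  assumes "isCont (\<lambda>s. snd c (\<gamma> s)) t" and c: "c \<in> charts M" and d: "d \<in> charts M"
    and D: "open D" "t \<in> D" "\<gamma> ` D \<subseteq> fst c" and "\<gamma> t \<in> fst d"
  obtains D' where "open D'" "t \<in> D'" "D' \<subseteq> D" "\<gamma> ` D' \<subseteq> fst c \<inter> fst d"
proof -
  have "snd c (\<gamma> t) \<in> snd c ` (fst c \<inter> fst d)" using assms by auto
  moreover from topological_tendstoD[OF assms(1)[unfolded isCont_def] overlap_open[OF c d] this]
  obtain E where "open E" "t \<in> E" "\<forall>s\<in>E. s \<noteq> t \<longrightarrow> s \<in> UNIV \<longrightarrow> snd c (\<gamma> s) \<in> snd c ` (fst c \<inter> fst d)"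
    unfolding eventually_at_topological by blast
  ultimately have E: "open E" "t \<in> E" "\<And>s. s \<in> E \<Longrightarrow> snd c (\<gamma> s) \<in> snd c ` (fst c \<inter> fst d)"
    by auto
  show ?thesis
  proof (rule that[of "D \<inter> E"])
    show "\<gamma> ` (D \<inter> E) \<subseteq> fst c \<inter> fst d"
    proof
      fix q assume "q \<in> \<gamma> ` (D \<inter> E)"
      then obtain s where s: "s \<in> D" "s \<in> E" "q = \<gamma> s" by auto
      then obtain q' where "q' \<in> fst c \<inter> fst d" "snd c q = snd c q'" "q \<in> fst c" using E(3)[of s] D(3) by auto
      then show "q \<in> fst c \<inter> fst d" using chart_inj[OF c] by (auto simp: injective_chart_def inj_on_def)
    qed
  qed (use E D in auto)
qed

lemma velocity_chart:
  assumes c: "c \<in> charts M" and D: "open D" "t \<in> D" "\<gamma> ` D \<subseteq> fst c"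
    and v: "((\<lambda>s. snd c (\<gamma> s)) has_vector_derivative x') (at t)"
  shows "to_chart M c (\<gamma> t) (velocity M \<gamma> t) = x'"
    "((\<lambda>s. snd (chart_at M (\<gamma> t)) (\<gamma> s)) has_vector_derivative velocity M \<gamma> t) (at t)"
proof -
  let ?d = "chart_at M (\<gamma> t)"
  have p: "\<gamma> t \<in> mpoints M" "\<gamma> t \<in> fst c" using D chart_mpoints[OF c] by auto
  note d = chart_at_in[OF p(1)]
  obtain D' where D': "open D'" "t \<in> D'" "D' \<subseteq> D" "\<gamma> ` D' \<subseteq> fst c \<inter> fst ?d"
    using overlap_neighborhood[OF has_vector_derivative_continuous[OF v] c d(1) D d(2)] by auto
  have td: "transition c ?d differentiable (at (snd c (\<gamma> t)))"
    by (rule smooth_on_imp_differentiable[OF transition_smooth[OF c d(1)]]) (use p d in auto)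
  have "((\<lambda>s. transition c ?d (snd c (\<gamma> s))) has_vector_derivative FD (transition c ?d) (snd c (\<gamma> t)) x') (at t)"
    by (rule has_vector_derivative_chain_FD[OF td v])
  then have *: "((\<lambda>s. snd ?d (\<gamma> s)) has_vector_derivative FD (transition c ?d) (snd c (\<gamma> t)) x') (at t)"
    by (rule has_vector_derivative_transform_within_open[OF _ D'(1,2)]) (use D'(4) c in \<open>auto simp: transition_coord\<close>)
  then have vel: "velocity M \<gamma> t = FD (transition c ?d) (snd c (\<gamma> t)) x'"
    unfolding velocity_def by (rule vector_derivative_at)
  show "to_chart M c (\<gamma> t) (velocity M \<gamma> t) = x'"
    unfolding vel to_chart_def using transition_cocycle[OF c p(2) d c p(2)] transition_self[OF c p(2)] by simp
  show "((\<lambda>s. snd ?d (\<gamma> s)) has_vector_derivative velocity M \<gamma> t) (at t)" using * vel by simp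
qed

lemma velocity_in_chart:
  assumes "smooth_map euclid M I \<gamma>" "open I" "t \<in> I" "c \<in> charts M" "\<gamma> t \<in> fst c"
  shows "((\<lambda>s. snd c (\<gamma> s)) has_vector_derivative to_chart M c (\<gamma> t) (velocity M \<gamma> t)) (at t)"
proof -
  obtain D where D: "open D" "t \<in> D" "D \<subseteq> I" "\<gamma> ` D \<subseteq> fst c" "smooth_on D (\<lambda>s. snd c (\<gamma> s))"
    using smooth_map_euclidD[OF assms] .
  have "((\<lambda>s. snd c (\<gamma> s)) has_vector_derivative FD (\<lambda>s. snd c (\<gamma> s)) t 1) (at t)"
    by (rule has_vector_derivative_FD_real[OF smooth_on_imp_differentiable[OF D(5,2)]])
  then show ?thesis using velocity_chart(1)[OF assms(4) D(1,2,4)] by simp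
qed

subsection \<open>The atlases of the tangent bundle and of the product with the real line\<close>

lemma tangent_chart_simps: "fst (tangent_chart M c) = fst c \<times> UNIV"
  "snd (tangent_chart M c) (p, v) = (snd c p, to_chart M c p v)"
  by (simp_all add: tangent_chart_def)

lemma tangent_chart_image:
  assumes "c \<in> charts M" "U \<subseteq> fst c" shows "snd (tangent_chart M c) ` (U \<times> UNIV) = snd c ` U \<times> UNIV"
proof (intro equalityI subsetI)
  fix z assume "z \<in> snd c ` U \<times> (UNIV :: 'e set)"
  then obtain p where p: "p \<in> U" "fst z = snd c p" by auto
  then have "z = snd (tangent_chart M c) (p, from_chart M c p (snd z))"
    using assms by (auto simp: tangent_chart_simps to_from_chart prod_eq_iff subset_iff)
  then show "z \<in> snd (tangent_chart M c) ` (U \<times> UNIV)" using p by blast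
qed (auto simp: tangent_chart_simps)

lemma tangent_charts: "charts (tangent_bundle M) = tangent_chart M ` charts M"
  by (simp add: tangent_bundle_def)

lemma tangent_chart_injective: assumes c: "c \<in> charts M" shows "injective_chart (tangent_chart M c)"
  unfolding injective_chart_def
proof
  show "inj_on (snd (tangent_chart M c)) (fst (tangent_chart M c))"
  proof (rule inj_onI)
    fix z w assume "z \<in> fst (tangent_chart M c)" "w \<in> fst (tangent_chart M c)"
      and e: "snd (tangent_chart M c) z = snd (tangent_chart M c) w"
    then have zw: "fst z \<in> fst c" "fst w \<in> fst c" by (auto simp: tangent_chart_simps)
    have e': "snd c (fst z) = snd c (fst w)" "to_chart M c (fst z) (snd z) = to_chart M c (fst w) (snd w)"
      using e tangent_chart_simps(2)[of c "fst z" "snd z"] tangent_chart_simps(2)[of c "fst w" "snd w"] by simp_all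
    then have "fst z = fst w" using zw chart_inj[OF c] by (metis chart_inv_left)
    then show "z = w" using e'(2) zw to_chart_inj[OF c, of "fst z"] by (simp add: prod_eq_iff)
  qed
  show "open (snd (tangent_chart M c) ` fst (tangent_chart M c))"
    using chart_open[OF c] by (simp add: tangent_chart_simps tangent_chart_image[OF c] open_Times)
qed

text \<open>The transition of two tangent charts pairs the transition of the base with its
  derivative, which is again smooth.\<close>

lemma tangent_charts_compatible: "compatible_charts (charts (tangent_bundle M))"
proof -
  have "open (snd (tangent_chart M c) ` (fst (tangent_chart M c) \<inter> fst (tangent_chart M d))) \<and>
     smooth_on (snd (tangent_chart M c) ` (fst (tangent_chart M c) \<inter> fst (tangent_chart M d)))
        (transition (tangent_chart M c) (tangent_chart M d))" 
    if c: "c \<in> charts M" and d: "d \<in> charts M" for c d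
  proof
    have eq: "snd (tangent_chart M c) ` (fst (tangent_chart M c) \<inter> fst (tangent_chart M d)) =
      snd c ` (fst c \<inter> fst d) \<times> UNIV"
      using tangent_chart_image[OF c, of "fst c \<inter> fst d"] by (simp add: tangent_chart_simps Times_Int_distrib1[symmetric])
    note op = overlap_open[OF c d]
    have op': "open (snd c ` (fst c \<inter> fst d) \<times> (UNIV::'e set))" using op by (simp add: open_Times)
    then show "open (snd (tangent_chart M c) ` (fst (tangent_chart M c) \<inter> fst (tangent_chart M d)))"
      unfolding eq .
    have "smooth_on (snd c ` (fst c \<inter> fst d) \<times> UNIV) (\<lambda>z. (transition c d (fst z), FD (transition c d) (fst z) (snd z)))"
      by (intro smooth_on_Pair smooth_on_compose[OF transition_smooth[OF c d] smooth_on_fst _ op' op]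
          smooth_on_FD_compose[OF transition_smooth[OF c d] op op' smooth_on_fst smooth_on_snd] op') auto
    then show "smooth_on (snd (tangent_chart M c) ` (fst (tangent_chart M c) \<inter> fst (tangent_chart M d)))
        (transition (tangent_chart M c) (tangent_chart M d))"
      unfolding eq
    proof (rule smooth_on_cong[OF _ op'])
      fix z assume "z \<in> snd c ` (fst c \<inter> fst d) \<times> (UNIV::'e set)"
      then obtain p where p: "p \<in> fst c" "p \<in> fst d" "fst z = snd c p" by auto
      then have z: "z = snd (tangent_chart M c) (p, from_chart M c p (snd z))"
        using c by (auto simp: tangent_chart_simps to_from_chart prod_eq_iff)
      have "transition (tangent_chart M c) (tangent_chart M d) z
         = snd (tangent_chart M d) (p, from_chart M c p (snd z))"
        by (subst z, rule transition_snd[OF tangent_chart_injective[OF c]]) (simp add: tangent_chart_simps p)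
      also have "\<dots> = (snd d p, FD (transition c d) (snd c p) (snd z))"
        using to_chart_transition[OF c p(1) d p(2), of "from_chart M c p (snd z)"]
        by (simp add: tangent_chart_simps to_from_chart c p)
      finally show "(transition c d (fst z), FD (transition c d) (fst z) (snd z)) =
          transition (tangent_chart M c) (tangent_chart M d) z"
        using p c by (simp add: transition_coord)
    qed
  qed
  then show ?thesis
    unfolding tangent_charts
    by (intro compatible_charts_imageI[where h="tangent_chart M" and C="charts M"] tangent_chart_injective)
qed

abbreviation (input) MR :: "('m \<times> real, 'e \<times> real) manifold" where "MR \<equiv> prod_manifold M euclid"

definition rchart :: "('m, 'e) chart \<Rightarrow> ('m \<times> real, 'e \<times> real) chart" where
  "rchart c = prod_chart c (UNIV, \<lambda>x. x)"

lemma rchart_simps: "fst (rchart c) = fst c \<times> UNIV" "snd (rchart c) (p, t) = (snd c p, t)"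
  by (simp_all add: rchart_def prod_chart_def)

lemma rcharts: "charts MR = rchart ` charts M" "chart_at MR (p, t) = rchart (chart_at M p)"
  by (auto simp: prod_manifold_def charts_euclid rchart_def)

lemma rcharts_compatible: "compatible_charts (charts MR)"
proof -
  have img: "snd (rchart c) ` (U \<times> UNIV) = snd c ` U \<times> UNIV" for c U
  proof (intro equalityI subsetI)
    fix z assume "z \<in> snd c ` U \<times> (UNIV :: real set)"
    then obtain p where "p \<in> U" "z = snd (rchart c) (p, snd z)" by (auto simp: rchart_simps)
    then show "z \<in> snd (rchart c) ` (U \<times> UNIV)" by blast
  qed (auto simp: rchart_simps)
  have inj: "injective_chart (rchart c)" if "c \<in> charts M" for c
    using chart_inj[OF that] 
    unfolding injective_chart_def rchart_simps img
  proof (intro conjI inj_onI)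
    fix z w assume "z \<in> fst c \<times> (UNIV :: real set)" "w \<in> fst c \<times> (UNIV :: real set)" "snd (rchart c) z = snd (rchart c) w"
    moreover assume "inj_on (snd c) (fst c) \<and> open (snd c ` fst c)"
    ultimately show "z = w"
      using rchart_simps(2)[of c "fst z" "snd z"] rchart_simps(2)[of c "fst w" "snd w"]
      by (auto simp: prod_eq_iff inj_on_def)
  qed (simp add: open_Times)
  have "open (snd (rchart c) ` (fst (rchart c) \<inter> fst (rchart d))) \<and>
     smooth_on (snd (rchart c) ` (fst (rchart c) \<inter> fst (rchart d))) (transition (rchart c) (rchart d))" 
    if c: "c \<in> charts M" and d: "d \<in> charts M" for c d
  proof
    have eq: "snd (rchart c) ` (fst (rchart c) \<inter> fst (rchart d)) = snd c ` (fst c \<inter> fst d) \<times> UNIV"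
      using img[of c "fst c \<inter> fst d"] by (simp add: rchart_simps Times_Int_distrib1[symmetric])
    note op = overlap_open[OF c d]
    have op': "open (snd c ` (fst c \<inter> fst d) \<times> (UNIV::real set))" using op by (simp add: open_Times)
    then show "open (snd (rchart c) ` (fst (rchart c) \<inter> fst (rchart d)))" unfolding eq .
    have "smooth_on (snd c ` (fst c \<inter> fst d) \<times> (UNIV::real set)) (\<lambda>z. (transition c d (fst z), snd z))"
      by (intro smooth_on_Pair smooth_on_compose[OF transition_smooth[OF c d] smooth_on_fst _ op' op]
          smooth_on_snd op') auto
    then show "smooth_on (snd (rchart c) ` (fst (rchart c) \<inter> fst (rchart d))) (transition (rchart c) (rchart d))"
      unfolding eq
    proof (rule smooth_on_cong[OF _ op'])
      fix z assume "z \<in> snd c ` (fst c \<inter> fst d) \<times> (UNIV::real set)"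
      then obtain p t where p: "p \<in> fst c" "p \<in> fst d" "z = (snd c p, t)" by auto
      have "transition (rchart c) (rchart d) (snd (rchart c) (p, t)) = snd (rchart d) (p, t)"
        by (rule transition_snd[OF inj[OF c]]) (simp add: rchart_simps p)
      then show "(transition c d (fst z), snd z) = transition (rchart c) (rchart d) z"
        using p c by (simp add: rchart_simps transition_coord)
    qed
  qed
  then show ?thesis
    unfolding rcharts by (intro compatible_charts_imageI[where h=rchart and C="charts M"] inj)
qed

end

subsection \<open>Change of coordinates for the connection\<close>

text \<open>Differentiating \<open>iso\<close> by the product rule gives two terms with the second
  derivative \<open>Q\<close> for each derivative of the metric. Of the six in the Koszul
  combination four cancel by symmetry of \<open>Q\<close>, and the other two are the inhomogeneous
  term. Surjectivity lets every test vector be written as an image \<open>P z'\<close>.\<close>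

lemma Chr_transform:
  assumes m1: "local_metric Om1 G1" and m2: "local_metric Om2 G2"
    and U: "open U" "x \<in> U" "U \<subseteq> Om1" and phi: "smooth_on U \<phi>" "\<phi> ` U \<subseteq> Om2"
    and iso: "\<And>y u v. y \<in> U \<Longrightarrow> G1 y u v = G2 (\<phi> y) (FD \<phi> y u) (FD \<phi> y v)"
    and surj: "surj (FD \<phi> x)"
  shows "FD \<phi> x (local_metric.Chr G1 x u v) =
     local_metric.Chr G2 (\<phi> x) (FD \<phi> x u) (FD \<phi> x v) + FD (\<lambda>y. FD \<phi> y v) x u"
proof -
  interpret m1: local_metric Om1 G1 by fact
  interpret m2: local_metric Om2 G2 by fact
  have x1: "x \<in> Om1" and x2: "\<phi> x \<in> Om2" using U phi by auto
  define P where "P = FD \<phi> x"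
  define Q where "Q u v = FD (\<lambda>y. FD \<phi> y v) x u" for u v
  have Qsym: "Q u v = Q v u" for u v
    unfolding Q_def by (rule symmetric_second_derivative[OF phi(1) U(1,2)])
  have dg: "m1.DG x a u v = m2.DG (\<phi> x) (P a) (P u) (P v) + G2 (\<phi> x) (Q a u) (P v) + G2 (\<phi> x) (P u) (Q a v)" for a u v
  proof -
    have "m1.DG x a u v = FD (\<lambda>y. G2 (\<phi> y) (FD \<phi> y u) (FD \<phi> y v)) x a"
      unfolding m1.DG_def by (rule fun_cong[OF FD_cong_open[OF U(1,2)]]) (rule iso)
    also have "\<dots> = FD (\<lambda>z. G2 z (FD \<phi> x u) (FD \<phi> x v)) (\<phi> x) (FD \<phi> x a) + G2 (\<phi> x) (FD (\<lambda>y. FD \<phi> y u) x a) (FD \<phi> x v)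
        + G2 (\<phi> x) (FD \<phi> x u) (FD (\<lambda>y. FD \<phi> y v) x a)"
      by (rule has_derivative_FD_eq[THEN fun_cong])
        (rule bilinear_family_has_derivative[OF m2.open_Om m2.bilinear_G m2.smooth_G
          smooth_on_has_derivative[OF phi(1) U(2)] smooth_on_has_derivative[OF smooth_on_FD[OF phi(1)] U(2)]
          smooth_on_has_derivative[OF smooth_on_FD[OF phi(1)] U(2)] x2], assumption)
    finally show ?thesis by (simp add: m2.DG_def P_def Q_def)
  qed
  show ?thesis
    unfolding P_def[symmetric] Q_def[symmetric]
  proof (rule m2.G_eqI[OF x2])
    fix z
    obtain z' where z: "z = P z'" using surj unfolding P_def by (metis surjD)
    have "2 * G2 (\<phi> x) (P (m1.Chr x u v)) (P z') = 2 * G1 x (m1.Chr x u v) z'"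
      using iso[OF U(2)] by (simp add: P_def)
    also have "\<dots> = m1.DG x u v z' + m1.DG x v u z' - m1.DG x z' u v" by (rule m1.Chr_koszul[OF x1])
    also have "\<dots> = 2 * G2 (\<phi> x) (m2.Chr (\<phi> x) (P u) (P v)) (P z') + 2 * G2 (\<phi> x) (Q u v) (P z')"
      unfolding m2.Chr_koszul[OF x2] dg
      using Qsym[of v u] Qsym[of z' u] Qsym[of z' v] m2.sym_G[OF x2, of "P v" "Q u z'"] m2.sym_G[OF x2, of "P u" "Q v z'"]
      by simp
    finally show "G2 (\<phi> x) (P (m1.Chr x u v)) z = G2 (\<phi> x) (m2.Chr (\<phi> x) (P u) (P v) + Q u v) z"
      by (simp add: z m2.G_simps x2)
  qed
qed

subsection \<open>Algebra of Lorentzian forms\<close>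

lemma lorentz_formE:
  fixes b :: "'a::euclidean_space \<Rightarrow> 'a \<Rightarrow> real"
  assumes "lorentz_form b"
  obtains k :: "'a \<Rightarrow> 'a" and e0 :: 'a where "linear k" "bij k" "e0 \<in> Basis"
    "\<And>u v. b u v = k u \<bullet> k v - 2 * (k u \<bullet> e0) * (k v \<bullet> e0)"
proof -
  obtain h :: "'a \<Rightarrow> 'a" and e0 where h: "linear h" "bij h" "e0 \<in> Basis"
    "\<And>u v. b (h u) (h v) = u \<bullet> v - 2 * (u \<bullet> e0) * (v \<bullet> e0)"
    using assms unfolding lorentz_form_def by blast
  have hk: "h (inv h u) = u" for u using h(2) by (simp add: bij_is_surj surj_f_inv_f)
  show ?thesis
  proof (rule that[of "inv h" e0])
    show "linear (inv h)" by (rule inj_linear_imp_inv_linear[OF h(1) bij_is_inj[OF h(2)]])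
    show "bij (inv h)" by (rule bij_imp_bij_inv[OF h(2)])
    show "b u v = inv h u \<bullet> inv h v - 2 * (inv h u \<bullet> e0) * (inv h v \<bullet> e0)" for u v
      using h(4)[of "inv h u" "inv h v"] by (simp add: hk)
  qed (rule h(3))
qed

lemma lorentz_form_bilinear:
  fixes b :: "'a::euclidean_space \<Rightarrow> 'a \<Rightarrow> real"
  assumes "lorentz_form b" shows "bilinear b"
proof -
  obtain k :: "'a \<Rightarrow> 'a" and e0 where k: "linear k" "bij k" "e0 \<in> Basis"
    "\<And>u v. b u v = k u \<bullet> k v - 2 * (k u \<bullet> e0) * (k v \<bullet> e0)"
    by (rule lorentz_formE[OF assms]) (rule that)
  have "b = (\<lambda>u v. k u \<bullet> k v - 2 * (k u \<bullet> e0) * (k v \<bullet> e0))" using k(4) by blast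
  then show ?thesis
    unfolding bilinear_def using k(1)
    by (auto intro!: linearI simp: linear_add linear_scale inner_add_left inner_add_right algebra_simps)
qed

lemma lorentz_form_sym:
  fixes b :: "'a::euclidean_space \<Rightarrow> 'a \<Rightarrow> real"
  assumes "lorentz_form b" shows "b u v = b v u"
  by (rule lorentz_formE[OF assms]) (simp add: inner_commute)

lemma lorentz_form_nondegenerate:
  fixes b :: "'a::euclidean_space \<Rightarrow> 'a \<Rightarrow> real"
  assumes "lorentz_form b" "\<And>w. b v w = 0" shows "v = 0"
proof -
  obtain k :: "'a \<Rightarrow> 'a" and e0 where k: "linear k" "bij k" "e0 \<in> Basis"
    "\<And>u v. b u v = k u \<bullet> k v - 2 * (k u \<bullet> e0) * (k v \<bullet> e0)"
    by (rule lorentz_formE[OF assms(1)]) (rule that)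
  \<comment> \<open>The vector whose model coordinates are those of \<open>v\<close> with the
    timelike one reversed: paired with it, the form becomes the Euclidean square of
    \<open>k v\<close>.\<close>
  obtain w where w: "k w = k v - (2 * (k v \<bullet> e0)) *\<^sub>R e0" using k(2) by (metis bij_pointE)
  have "e0 \<bullet> e0 = 1" using k(3) by simp
  then have "b v w = k v \<bullet> k v"
    unfolding k(4) w by (simp add: inner_diff_left inner_diff_right algebra_simps)
  then have "k v = 0" using assms(2)[of w] by simp
  then show "v = 0" using k(1,2) by (metis bij_is_inj linear_injective_0)
qed

text \<open>The witness is the scalar that makes the model coordinate along the reversed axis vanish.\<close>

lemma lorentz_form_null_orthogonal:
  fixes b :: "'a::euclidean_space \<Rightarrow> 'a \<Rightarrow> real"
  assumes "lorentz_form b" "u \<noteq> 0" "b u u = 0" "b w u = 0"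
  shows "\<exists>c. b w w \<ge> 0 \<and> (b w w = 0 \<longrightarrow> w = c *\<^sub>R u)"
proof -
  obtain k :: "'a \<Rightarrow> 'a" and e0 where k: "linear k" "bij k" "e0 \<in> Basis"
    "\<And>u v. b u v = k u \<bullet> k v - 2 * (k u \<bullet> e0) * (k v \<bullet> e0)"
    by (rule lorentz_formE[OF assms(1)]) (rule that)
  define a where "a = k u \<bullet> e0"
  define c where "c = (k w \<bullet> e0) / a"
  have uu: "k u \<bullet> k u = 2 * a * a" using assms(3) k(4) by (simp add: a_def)
  have "k u \<noteq> 0" using assms(2) k(1,2) by (metis bij_is_inj linear_injective_0)
  then have a: "a \<noteq> 0" using uu by auto
  have ca: "c * a = k w \<bullet> e0" using a by (simp add: c_def)
  have "k w \<bullet> k u = 2 * (k w \<bullet> e0) * a" using assms(4) k(4)[of w u] by (simp add: a_def)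
  then have wu: "k w \<bullet> k u = 2 * (c * a) * a" by (simp only: ca)
  have "(k w - c *\<^sub>R k u) \<bullet> (k w - c *\<^sub>R k u) = k w \<bullet> k w - 2 * c * (k w \<bullet> k u) + c * c * (k u \<bullet> k u)"
    by (simp add: inner_diff_left inner_diff_right inner_commute algebra_simps)
  also have "\<dots> = k w \<bullet> k w - 2 * (c * a) * (c * a)" unfolding uu wu by (simp add: algebra_simps)
  also have "\<dots> = b w w" by (simp add: k(4) ca)
  finally have *: "b w w = (k w - c *\<^sub>R k u) \<bullet> (k w - c *\<^sub>R k u)" by simp
  have "w = c *\<^sub>R u" if "b w w = 0"
  proof -
    have "k w = k (c *\<^sub>R u)" using * that k(1) by (simp add: linear_scale)
    then show ?thesis using k(2) by (metis bij_is_inj injD)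
  qed
  then show ?thesis using * by (metis inner_ge_zero)
qed

subsection \<open>Covariant derivatives in charts\<close>

lemma (in atlas) smooth_alongD:
  fixes \<gamma> :: "'v::euclidean_space \<Rightarrow> 'm"
  assumes "smooth_map euclid (tangent_bundle M) I (\<lambda>t. (\<gamma> t, J t))" "open I" "t \<in> I" "c \<in> charts M" "\<gamma> t \<in> fst c"
  obtains D where "open D" "t \<in> D" "D \<subseteq> I" "\<gamma> ` D \<subseteq> fst c" "smooth_on D (\<lambda>s. snd c (\<gamma> s))"
    "smooth_on D (\<lambda>s. to_chart M c (\<gamma> s) (J s))"
proof -
  obtain D where D: "open D" "t \<in> D" "D \<subseteq> I" "(\<lambda>t. (\<gamma> t, J t)) ` D \<subseteq> fst (tangent_chart M c)"
    "smooth_on D (\<lambda>s. snd (tangent_chart M c) (\<gamma> s, J s))"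
    by (rule smooth_map_euclidD[OF assms(1-3), of "tangent_chart M c"])
      (use assms(4,5) in \<open>auto simp: tangent_charts tangent_chart_simps\<close>)
  show ?thesis
    by (rule that[OF D(1-3)])
      (use D smooth_on_fstI[OF D(5,1)] smooth_on_sndI[OF D(5,1)] in \<open>auto simp: tangent_chart_simps\<close>)
qed

lemma (in atlas) smooth_alongI:
  fixes \<gamma> :: "'v::euclidean_space \<Rightarrow> 'm"
  assumes "\<And>t. t \<in> I \<Longrightarrow> \<exists>c\<in>charts M. \<exists>D. open D \<and> t \<in> D \<and> \<gamma> ` D \<subseteq> fst c \<and> smooth_on D (\<lambda>s. snd c (\<gamma> s)) \<and>
    smooth_on D (\<lambda>s. to_chart M c (\<gamma> s) (J s))"
  shows "smooth_map euclid (tangent_bundle M) I (\<lambda>t. (\<gamma> t, J t))"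
proof (rule smooth_map_euclidI[OF tangent_charts_compatible])
  fix t assume "t \<in> I"
  then obtain c D where "c \<in> charts M" "open D" "t \<in> D" "\<gamma> ` D \<subseteq> fst c" "smooth_on D (\<lambda>s. snd c (\<gamma> s))"
    "smooth_on D (\<lambda>s. to_chart M c (\<gamma> s) (J s))" using assms by blast
  then show "\<exists>d\<in>charts (tangent_bundle M). \<exists>D. open D \<and> t \<in> D \<and> (\<lambda>t. (\<gamma> t, J t)) ` D \<subseteq> fst d \<and>
     smooth_on D (\<lambda>s. snd d (\<gamma> s, J s))"
    by (intro bexI[of _ "tangent_chart M c"] exI[of _ D])
      (auto simp: tangent_charts tangent_chart_simps intro!: smooth_on_Pair)
qed

lemma vector_derivative_cong_open:
  assumes "open D" "t \<in> D" "\<And>s. s \<in> D \<Longrightarrow> f s = h s"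
  shows "vector_derivative f (at t) = vector_derivative h (at t)"
proof -
  have "(\<lambda>f'. (f has_vector_derivative f') (at t)) = (\<lambda>f'. (h has_vector_derivative f') (at t))"
    unfolding has_vector_derivative_def using has_derivative_cong_open[where f=f, OF assms] by blast
  then show ?thesis unfolding vector_derivative_def by simp
qed

locale lorentz = atlas M for M :: "('m, 'e::euclidean_space) manifold" +
  fixes g :: "('m, 'e) metric_tensor"
  assumes lorentzian: "lorentzian_metric M g"
begin

lemma g_lorentz: "p \<in> mpoints M \<Longrightarrow> lorentz_form (g p)"
  using lorentzian by (simp add: lorentzian_metric_def)

lemmas g_bilinear = lorentz_form_bilinear[OF g_lorentz]
lemmas g_sym = lorentz_form_sym[OF g_lorentz]
lemmas g_nondeg = lorentz_form_nondegenerate[OF g_lorentz]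
lemmas g_simps = bilinear_ladd[OF g_bilinear] bilinear_radd[OF g_bilinear] bilinear_lmul[OF g_bilinear]
  bilinear_rmul[OF g_bilinear] bilinear_lsub[OF g_bilinear] bilinear_rsub[OF g_bilinear]
  bilinear_lzero[OF g_bilinear] bilinear_rzero[OF g_bilinear] bilinear_lneg[OF g_bilinear] bilinear_rneg[OF g_bilinear]

abbreviation Gc :: "('m, 'e) chart \<Rightarrow> 'e \<Rightarrow> 'e \<Rightarrow> 'e \<Rightarrow> real" where
  "Gc c \<equiv> \<lambda>x u v. metric_comp M g c u v x"

abbreviation Gam :: "('m, 'e) chart \<Rightarrow> 'e \<Rightarrow> 'e \<Rightarrow> 'e \<Rightarrow> 'e" where
  "Gam c \<equiv> local_metric.Chr (Gc c)"

lemma Gc_coord: "c \<in> charts M \<Longrightarrow> p \<in> fst c \<Longrightarrow> Gc c (snd c p) u v = g p (from_chart M c p u) (from_chart M c p v)"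
  by (simp add: metric_comp_def inv_coord)

lemma g_Gc: "c \<in> charts M \<Longrightarrow> p \<in> fst c \<Longrightarrow> g p u v = Gc c (snd c p) (to_chart M c p u) (to_chart M c p v)"
  by (simp add: Gc_coord from_to_chart)

lemma local_metric: assumes c: "c \<in> charts M" shows "local_metric (snd c ` fst c) (Gc c)"
proof
  show "open (snd c ` fst c)" by (rule chart_open[OF c])
  fix x assume "x \<in> snd c ` fst c"
  then obtain p where p: "p \<in> fst c" "x = snd c p" by auto
  have pm: "p \<in> mpoints M" by (rule chart_mpoints[OF c p(1)])
  have lin: "linear (from_chart M c p)" by (rule from_chart_linear[OF c p(1)])
  show "bilinear (Gc c x)"
    unfolding bilinear_def
    by (auto intro!: linearI simp: p Gc_coord[OF c] linear_add[OF lin] linear_scale[OF lin] g_simps[OF pm])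
  show "Gc c x u v = Gc c x v u" for u v by (simp add: p Gc_coord[OF c] g_sym[OF pm])
  show "v = 0" if "\<And>w. Gc c x v w = 0" for v
  proof -
    have "g p (from_chart M c p v) w = 0" for w
      using that[of "to_chart M c p w"] by (simp add: p Gc_coord[OF c] from_to_chart[OF c p(1)])
    then have "from_chart M c p v = 0" using g_nondeg[OF pm] by blast
    then show ?thesis by (metis to_from_chart[OF c p(1)] to_chart_simps(5)[OF c p(1)])
  qed
next
  show "smooth_on (snd c ` fst c) (\<lambda>x. Gc c x u v)" for u v
    using lorentzian c by (simp add: lorentzian_metric_def)
qed

lemma christoffel_Gam:
  assumes "p \<in> mpoints M"
  shows "christoffel M g p u v = Gam (chart_at M p) (snd (chart_at M p) p) u v"
proof -
  let ?c = "chart_at M p"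
  interpret local_metric "snd ?c ` fst ?c" "Gc ?c" by (rule local_metric[OF chart_at_in(1)[OF assms]])
  have "Gc ?c (snd ?c p) u v = g p u v" for u v
    by (simp add: Gc_coord chart_at_in[OF assms] from_chart_self[OF assms])
  then show ?thesis unfolding christoffel_def Let_def Chr_def DG_def by simp
qed

lemma Gc_transition:
  assumes c: "c \<in> charts M" and d: "d \<in> charts M" and y: "y \<in> snd c ` (fst c \<inter> fst d)"
  shows "Gc c y u v = Gc d (transition c d y) (FD (transition c d) y u) (FD (transition c d) y v)"
proof -
  obtain p where p: "p \<in> fst c" "p \<in> fst d" "y = snd c p" using y by auto
  have "from_chart M d p (FD (transition c d) y u) = from_chart M c p u" for u
    using to_chart_transition[OF c p(1) d p(2), of "from_chart M c p u"] p
    by (metis from_to_chart[OF d p(2)] to_from_chart[OF c p(1)])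
  then show ?thesis using p c d by (simp add: transition_coord Gc_coord)
qed

lemma Gam_transition:
  assumes c: "c \<in> charts M" "p \<in> fst c" and d: "d \<in> charts M" "p \<in> fst d"
  shows "FD (transition c d) (snd c p) (Gam c (snd c p) u v) =
     Gam d (snd d p) (FD (transition c d) (snd c p) u) (FD (transition c d) (snd c p) v)
     + FD (\<lambda>y. FD (transition c d) y v) (snd c p) u"
proof -
  have im: "transition c d ` (snd c ` (fst c \<inter> fst d)) \<subseteq> snd d ` fst d" using c by (auto simp: transition_coord)
  have "surj (FD (transition c d) (snd c p))"
    by (rule surjI[where f="FD (transition d c) (snd d p)"])
      (use transition_cocycle[OF d c d] transition_self[OF d] in simp)
  from Chr_transform[OF local_metric[OF c(1)] local_metric[OF d(1)] overlap_open[OF c(1) d(1)] _ _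
      transition_smooth[OF c(1) d(1)] im Gc_transition[OF c(1) d(1)] this, of u v]
  show ?thesis using c d by (auto simp: transition_coord)
qed

text \<open>\<open>cov_along\<close> is defined in the preferred chart at \<open>\<gamma> t\<close>.
  Passing to \<open>c\<close>, the components are multiplied by the derivative of the transition,
  and differentiating this factor along the curve gives a second derivative that cancels the
  inhomogeneous term of the Christoffel map. From here on one chart serves a whole piece of the
  curve.\<close>

lemma cov_along_chart:
  fixes \<gamma> :: "real \<Rightarrow> 'm"
  assumes c: "c \<in> charts M" and D: "open D" "t \<in> D" "\<gamma> ` D \<subseteq> fst c"
    and x: "((\<lambda>s. snd c (\<gamma> s)) has_vector_derivative x') (at t)"
    and v: "((\<lambda>s. to_chart M c (\<gamma> s) (J s)) has_vector_derivative v') (at t)"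
  shows "to_chart M c (\<gamma> t) (cov_along M g \<gamma> J t) = v' + Gam c (snd c (\<gamma> t)) x' (to_chart M c (\<gamma> t) (J t))"
proof -
  let ?d = "chart_at M (\<gamma> t)" and ?p = "\<gamma> t"
  have p: "?p \<in> mpoints M" "?p \<in> fst c" using D chart_mpoints[OF c] by auto
  note d = chart_at_in[OF p(1)]
  let ?V = "snd c ` (fst c \<inter> fst ?d)" and ?\<phi> = "transition c ?d"
  let ?P = "FD ?\<phi> (snd c ?p)"
  obtain D' where D': "open D'" "t \<in> D'" "D' \<subseteq> D" "\<gamma> ` D' \<subseteq> fst c \<inter> fst ?d"
    using overlap_neighborhood[OF has_vector_derivative_continuous[OF x] c d(1) D d(2)] by auto
  have "((\<lambda>s. FD ?\<phi> (snd c (\<gamma> s)) (to_chart M c (\<gamma> s) (J s))) has_vector_derivative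
      (FD (\<lambda>z. FD ?\<phi> z (to_chart M c ?p (J t))) (snd c ?p) x' + ?P v')) (at t)"
    by (rule linear_family_has_vector_derivative[where F="FD ?\<phi>" and D="?V", OF overlap_open[OF c d(1)] _ _ x v])
      (use p d in \<open>auto intro: smooth_on_linear_FD[OF transition_smooth[OF c d(1)]] smooth_on_FD[OF transition_smooth[OF c d(1)]]\<close>)
  then have "((\<lambda>s. to_chart M ?d (\<gamma> s) (J s)) has_vector_derivative
      (FD (\<lambda>z. FD ?\<phi> z (to_chart M c ?p (J t))) (snd c ?p) x' + ?P v')) (at t)"
    by (rule has_vector_derivative_transform_within_open[OF _ D'(1,2)])
      (rule to_chart_transition; use D'(4) c d in blast)
  then have "cov_along M g \<gamma> J t = FD (\<lambda>z. FD ?\<phi> z (to_chart M c ?p (J t))) (snd c ?p) x' + ?P v'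
      + Gam ?d (snd ?d ?p) (velocity M \<gamma> t) (J t)"
    unfolding cov_along_def christoffel_Gam[OF p(1)] by (simp add: vector_derivative_at)
  moreover have "velocity M \<gamma> t = ?P x'"
    using velocity_chart(1)[OF c D x] to_chart_transition[OF c p(2) d, of "velocity M \<gamma> t"] to_chart_self[OF p(1)]
    by simp
  moreover have "J t = ?P (to_chart M c ?p (J t))"
    using to_chart_transition[OF c p(2) d, of "J t"] to_chart_self[OF p(1)] by simp
  ultimately have "cov_along M g \<gamma> J t = ?P v' + (FD (\<lambda>z. FD ?\<phi> z (to_chart M c ?p (J t))) (snd c ?p) x'
      + Gam ?d (snd ?d ?p) (?P x') (?P (to_chart M c ?p (J t))))" by simp
  also have "\<dots> = ?P (v' + Gam c (snd c ?p) x' (to_chart M c ?p (J t)))"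
    using Gam_transition[OF c p(2) d, of x' "to_chart M c ?p (J t)"]
    by (simp add: linear_add[OF transition_linear[OF c d(1) p(2) d(2)]])
  finally have "to_chart M c ?p (cov_along M g \<gamma> J t) =
      FD (transition ?d c) (snd ?d ?p) (?P (v' + Gam c (snd c ?p) x' (to_chart M c ?p (J t))))"
    by (simp add: to_chart_def)
  then show ?thesis using transition_cocycle[OF c p(2) d c p(2)] transition_self[OF c p(2)] by simp
qed

lemma cov_along_chart_smooth:
  fixes \<gamma> :: "real \<Rightarrow> 'm"
  assumes c: "c \<in> charts M" and D: "open D" "\<gamma> ` D \<subseteq> fst c" "smooth_on D (\<lambda>s. snd c (\<gamma> s))"
    "smooth_on D (\<lambda>s. to_chart M c (\<gamma> s) (J s))" and t: "t \<in> D"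
  shows "to_chart M c (\<gamma> t) (cov_along M g \<gamma> J t) = FD (\<lambda>s. to_chart M c (\<gamma> s) (J s)) t 1
    + Gam c (snd c (\<gamma> t)) (FD (\<lambda>s. snd c (\<gamma> s)) t 1) (to_chart M c (\<gamma> t) (J t))"
    "to_chart M c (\<gamma> t) (velocity M \<gamma> t) = FD (\<lambda>s. snd c (\<gamma> s)) t 1"
  using cov_along_chart[OF c D(1) t D(2)
      has_vector_derivative_FD_real[OF smooth_on_imp_differentiable[OF D(3) t]]
      has_vector_derivative_FD_real[OF smooth_on_imp_differentiable[OF D(4) t]]]
    velocity_chart(1)[OF c D(1) t D(2) has_vector_derivative_FD_real[OF smooth_on_imp_differentiable[OF D(3) t]]]
  by auto

text \<open>The defining formula changes its chart with the parameter. In the chart of one centre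
  the derivative is a smooth expression on a whole neighbourhood.\<close>

lemma smooth_along_cov:
  assumes "smooth_along M I \<gamma> J" "open I" "\<gamma> ` I \<subseteq> mpoints M"
  shows "smooth_along M I \<gamma> (cov_along M g \<gamma> J)"
  unfolding smooth_along_def
proof (rule smooth_alongI)
  fix t assume t: "t \<in> I"
  then have p: "\<gamma> t \<in> mpoints M" using assms by blast
  let ?c = "chart_at M (\<gamma> t)"
  note c = chart_at_in[OF p]
  interpret m: local_metric "snd ?c ` fst ?c" "Gc ?c" by (rule local_metric[OF c(1)])
  obtain D where D: "open D" "t \<in> D" "D \<subseteq> I" "\<gamma> ` D \<subseteq> fst ?c" "smooth_on D (\<lambda>s. snd ?c (\<gamma> s))"
    "smooth_on D (\<lambda>s. to_chart M ?c (\<gamma> s) (J s))"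
    using smooth_alongD[OF assms(1)[unfolded smooth_along_def] assms(2) t c] .
  have "smooth_on D (\<lambda>t. FD (\<lambda>s. to_chart M ?c (\<gamma> s) (J s)) t 1
    + Gam ?c (snd ?c (\<gamma> t)) (FD (\<lambda>s. snd ?c (\<gamma> s)) t 1) (to_chart M ?c (\<gamma> t) (J t)))"
    by (intro smooth_on_add smooth_on_FD D
        smooth_on_bilinear_family[OF m.open_Om D(1) m.Chr_bilinear m.Chr_smooth]) (use D in auto)
  then have "smooth_on D (\<lambda>t. to_chart M ?c (\<gamma> t) (cov_along M g \<gamma> J t))"
    by (rule smooth_on_cong[OF _ D(1)]) (simp add: cov_along_chart_smooth(1)[OF c(1) D(1,4,5,6)])
  then show "\<exists>c\<in>charts M. \<exists>D. open D \<and> t \<in> D \<and> \<gamma> ` D \<subseteq> fst c \<and> smooth_on D (\<lambda>s. snd c (\<gamma> s)) \<and>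
    smooth_on D (\<lambda>s. to_chart M c (\<gamma> s) (cov_along M g \<gamma> J s))"
    using c(1) D by blast
qed

lemma smooth_along_velocity:
  assumes "smooth_map euclid M I \<gamma>" "open I" "\<gamma> ` I \<subseteq> mpoints M"
  shows "smooth_along M I \<gamma> (velocity M \<gamma>)"
  unfolding smooth_along_def
proof (rule smooth_alongI)
  fix t assume t: "t \<in> I"
  then have p: "\<gamma> t \<in> mpoints M" using assms by blast
  let ?c = "chart_at M (\<gamma> t)"
  note c = chart_at_in[OF p]
  obtain D where D: "open D" "t \<in> D" "D \<subseteq> I" "\<gamma> ` D \<subseteq> fst ?c" "smooth_on D (\<lambda>s. snd ?c (\<gamma> s))"
    using smooth_map_euclidD[OF assms(1,2) t c] .
  have "smooth_on D (\<lambda>t. to_chart M ?c (\<gamma> t) (velocity M \<gamma> t))"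
  proof (rule smooth_on_cong[OF smooth_on_FD[OF D(5)] D(1)])
    fix s assume s: "s \<in> D"
    show "FD (\<lambda>s. snd ?c (\<gamma> s)) s 1 = to_chart M ?c (\<gamma> s) (velocity M \<gamma> s)"
      using velocity_chart(1)[OF c(1) D(1) s D(4) has_vector_derivative_FD_real[OF smooth_on_imp_differentiable[OF D(5) s]]]
      by simp
  qed
  then show "\<exists>c\<in>charts M. \<exists>D. open D \<and> t \<in> D \<and> \<gamma> ` D \<subseteq> fst c \<and> smooth_on D (\<lambda>s. snd c (\<gamma> s)) \<and>
    smooth_on D (\<lambda>s. to_chart M c (\<gamma> s) (velocity M \<gamma> s))"
    using c(1) D by blast
qed

text \<open>The product rule in a chart, where \<open>metric_compat\<close> distributes the
  derivative of the metric coefficients over the two fields.\<close>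

lemma metric_along_derivative:
  assumes "smooth_along M I \<gamma> J" "smooth_along M I \<gamma> K" "open I" "\<gamma> ` I \<subseteq> mpoints M" and t: "t \<in> I"
  shows "((\<lambda>s. g (\<gamma> s) (J s) (K s)) has_real_derivative
     g (\<gamma> t) (cov_along M g \<gamma> J t) (K t) + g (\<gamma> t) (J t) (cov_along M g \<gamma> K t)) (at t)"
proof -
  have p: "\<gamma> t \<in> mpoints M" using assms by blast
  let ?c = "chart_at M (\<gamma> t)"
  note c = chart_at_in[OF p]
  interpret m: local_metric "snd ?c ` fst ?c" "Gc ?c" by (rule local_metric[OF c(1)])
  obtain D where D: "open D" "t \<in> D" "D \<subseteq> I" "\<gamma> ` D \<subseteq> fst ?c" "smooth_on D (\<lambda>s. snd ?c (\<gamma> s))"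
    "smooth_on D (\<lambda>s. to_chart M ?c (\<gamma> s) (J s))"
    using smooth_alongD[OF assms(1)[unfolded smooth_along_def] assms(3) t c] .
  obtain D' where D': "open D'" "t \<in> D'" "smooth_on D' (\<lambda>s. to_chart M ?c (\<gamma> s) (K s))"
    using smooth_alongD[OF assms(2)[unfolded smooth_along_def] assms(3) t c] by metis
  define E where "E = D \<inter> D'"
  have E: "open E" "t \<in> E" "\<gamma> ` E \<subseteq> fst ?c" "smooth_on E (\<lambda>s. snd ?c (\<gamma> s))"
    "smooth_on E (\<lambda>s. to_chart M ?c (\<gamma> s) (J s))" "smooth_on E (\<lambda>s. to_chart M ?c (\<gamma> s) (K s))"
    using D D' by (auto simp: E_def intro: smooth_on_subset)
  let ?x = "snd ?c (\<gamma> t)"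
  have x: "?x \<in> snd ?c ` fst ?c" using c by blast
  have hd: "(f has_vector_derivative FD f t 1) (at t)" if "smooth_on E f" for f :: "real \<Rightarrow> 'e"
    by (rule has_vector_derivative_FD_real[OF smooth_on_imp_differentiable[OF that E(2)]])
  let ?j = "to_chart M ?c (\<gamma> t) (J t)" and ?k = "to_chart M ?c (\<gamma> t) (K t)"
  let ?j' = "FD (\<lambda>s. to_chart M ?c (\<gamma> s) (J s)) t 1" and ?k' = "FD (\<lambda>s. to_chart M ?c (\<gamma> s) (K s)) t 1"
    and ?x' = "FD (\<lambda>s. snd ?c (\<gamma> s)) t 1"
  have "((\<lambda>s. Gc ?c (snd ?c (\<gamma> s)) (to_chart M ?c (\<gamma> s) (J s)) (to_chart M ?c (\<gamma> s) (K s))) has_vector_derivative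
     (FD (\<lambda>z. Gc ?c z ?j ?k) ?x ?x' + Gc ?c ?x ?j' ?k + Gc ?c ?x ?j ?k')) (at t)"
    by (rule bilinear_family_has_vector_derivative[OF m.open_Om m.bilinear_G m.smooth_G hd[OF E(4)] hd[OF E(5)] hd[OF E(6)] x])
  moreover have "FD (\<lambda>z. Gc ?c z ?j ?k) ?x ?x' + Gc ?c ?x ?j' ?k + Gc ?c ?x ?j ?k'
     = Gc ?c ?x (?j' + Gam ?c ?x ?x' ?j) ?k + Gc ?c ?x ?j (?k' + Gam ?c ?x ?x' ?k)"
    using m.metric_compat[OF x, of ?x' ?j ?k] unfolding m.DG_def by (simp add: m.G_simps[OF x])
  moreover have "\<dots> = g (\<gamma> t) (cov_along M g \<gamma> J t) (K t) + g (\<gamma> t) (J t) (cov_along M g \<gamma> K t)"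
    unfolding g_Gc[OF c] cov_along_chart_smooth(1)[OF c(1) E(1,3,4,5,2)] cov_along_chart_smooth(1)[OF c(1) E(1,3,4,6,2)] ..
  ultimately have "((\<lambda>s. Gc ?c (snd ?c (\<gamma> s)) (to_chart M ?c (\<gamma> s) (J s)) (to_chart M ?c (\<gamma> s) (K s))) has_vector_derivative
     (g (\<gamma> t) (cov_along M g \<gamma> J t) (K t) + g (\<gamma> t) (J t) (cov_along M g \<gamma> K t))) (at t)" by simp
  then show ?thesis
    unfolding has_real_derivative_iff_has_vector_derivative
    by (rule has_vector_derivative_transform_within_open[OF _ E(1,2)])
      (use E(3) c in \<open>auto simp: g_Gc[OF c(1)]\<close>)
qed

lemma velocity_cong:
  assumes "open D" "t \<in> D" "\<And>s. s \<in> D \<Longrightarrow> \<gamma> s = \<delta> s"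
  shows "velocity M \<gamma> t = velocity M \<delta> t"
  unfolding velocity_def assms(3)[OF assms(2)]
  by (rule vector_derivative_cong_open[OF assms(1,2)]) (simp add: assms(3))

lemma cov_along_cong:
  assumes "open D" "t \<in> D" "\<And>s. s \<in> D \<Longrightarrow> \<gamma> s = \<delta> s" "\<And>s. s \<in> D \<Longrightarrow> J s = K s"
  shows "cov_along M g \<gamma> J t = cov_along M g \<delta> K t"
proof -
  have "vector_derivative (\<lambda>s. to_chart M (chart_at M (\<delta> t)) (\<gamma> s) (J s)) (at t) =
     vector_derivative (\<lambda>s. to_chart M (chart_at M (\<delta> t)) (\<delta> s) (K s)) (at t)"
    by (rule vector_derivative_cong_open[OF assms(1,2)]) (simp add: assms(3,4))
  moreover have "velocity M \<gamma> t = velocity M \<delta> t" by (rule velocity_cong[OF assms(1-3)])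
  ultimately show ?thesis
    unfolding cov_along_def assms(3)[OF assms(2)] assms(4)[OF assms(2)] by simp
qed

lemma cov_along_combination:
  fixes h k :: "real \<Rightarrow> real"
  assumes "smooth_along M I \<gamma> J" "smooth_along M I \<gamma> K" "open I" "\<gamma> ` I \<subseteq> mpoints M" and t: "t \<in> I"
    and h: "(h has_real_derivative h') (at t)" and k: "(k has_real_derivative k') (at t)"
  shows "cov_along M g \<gamma> (\<lambda>s. h s *\<^sub>R J s + k s *\<^sub>R K s) t =
    h' *\<^sub>R J t + h t *\<^sub>R cov_along M g \<gamma> J t + (k' *\<^sub>R K t + k t *\<^sub>R cov_along M g \<gamma> K t)"
proof -
  have p: "\<gamma> t \<in> mpoints M" using assms by blast
  let ?c = "chart_at M (\<gamma> t)"
  note c = chart_at_in[OF p]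
  interpret m: local_metric "snd ?c ` fst ?c" "Gc ?c" by (rule local_metric[OF c(1)])
  obtain D where D: "open D" "t \<in> D" "D \<subseteq> I" "\<gamma> ` D \<subseteq> fst ?c" "smooth_on D (\<lambda>s. snd ?c (\<gamma> s))"
    "smooth_on D (\<lambda>s. to_chart M ?c (\<gamma> s) (J s))"
    using smooth_alongD[OF assms(1)[unfolded smooth_along_def] assms(3) t c] .
  obtain D' where D': "open D'" "t \<in> D'" "smooth_on D' (\<lambda>s. to_chart M ?c (\<gamma> s) (K s))"
    using smooth_alongD[OF assms(2)[unfolded smooth_along_def] assms(3) t c] by metis
  define E where "E = D \<inter> D'"
  have E: "open E" "t \<in> E" "\<gamma> ` E \<subseteq> fst ?c" "smooth_on E (\<lambda>s. snd ?c (\<gamma> s))"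
    "smooth_on E (\<lambda>s. to_chart M ?c (\<gamma> s) (J s))" "smooth_on E (\<lambda>s. to_chart M ?c (\<gamma> s) (K s))"
    using D D' by (auto simp: E_def intro: smooth_on_subset)
  let ?x = "snd ?c (\<gamma> t)"
  have x: "?x \<in> snd ?c ` fst ?c" using c by blast
  have hd: "(f has_vector_derivative FD f t 1) (at t)" if "smooth_on E f" for f :: "real \<Rightarrow> 'e"
    by (rule has_vector_derivative_FD_real[OF smooth_on_imp_differentiable[OF that E(2)]])
  let ?j = "\<lambda>s. to_chart M ?c (\<gamma> s) (J s)" and ?k = "\<lambda>s. to_chart M ?c (\<gamma> s) (K s)"
  have "((\<lambda>s. h s *\<^sub>R ?j s + k s *\<^sub>R ?k s) has_vector_derivative
     ((h t *\<^sub>R FD ?j t 1 + h' *\<^sub>R ?j t) + (k t *\<^sub>R FD ?k t 1 + k' *\<^sub>R ?k t))) (at t)"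
    by (intro has_vector_derivative_add has_vector_derivative_scaleR hd E h k)
  then have "((\<lambda>s. to_chart M ?c (\<gamma> s) (h s *\<^sub>R J s + k s *\<^sub>R K s)) has_vector_derivative
     ((h t *\<^sub>R FD ?j t 1 + h' *\<^sub>R ?j t) + (k t *\<^sub>R FD ?k t 1 + k' *\<^sub>R ?k t))) (at t)"
    by (rule has_vector_derivative_transform_within_open[OF _ E(1,2)])
      (use E(3) c in \<open>auto simp: to_chart_simps\<close>)
  from cov_along_chart[OF c(1) E(1-3) hd[OF E(4)] this]
  have "to_chart M ?c (\<gamma> t) (cov_along M g \<gamma> (\<lambda>s. h s *\<^sub>R J s + k s *\<^sub>R K s) t) =
    to_chart M ?c (\<gamma> t) (h' *\<^sub>R J t + h t *\<^sub>R cov_along M g \<gamma> J t + (k' *\<^sub>R K t + k t *\<^sub>R cov_along M g \<gamma> K t))"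
    unfolding to_chart_simps[OF c]
      cov_along_chart_smooth(1)[OF c(1) E(1,3,4,5,2)] cov_along_chart_smooth(1)[OF c(1) E(1,3,4,6,2)]
    by (simp add: m.Chr_simps[OF x] algebra_simps)
  then show ?thesis by (simp add: to_chart_inj[OF c])
qed

lemma smooth_along_combination:
  assumes "smooth_along M I \<gamma> J" "smooth_along M I \<gamma> K" "open I" "\<gamma> ` I \<subseteq> mpoints M"
    and "smooth_on I h" "smooth_on I k"
  shows "smooth_along M I \<gamma> (\<lambda>s. h s *\<^sub>R J s + k s *\<^sub>R K s)"
  unfolding smooth_along_def
proof (rule smooth_alongI)
  fix t assume t: "t \<in> I"
  then have p: "\<gamma> t \<in> mpoints M" using assms by blast
  let ?c = "chart_at M (\<gamma> t)"
  note c = chart_at_in[OF p]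
  obtain D where D: "open D" "t \<in> D" "D \<subseteq> I" "\<gamma> ` D \<subseteq> fst ?c" "smooth_on D (\<lambda>s. snd ?c (\<gamma> s))"
    "smooth_on D (\<lambda>s. to_chart M ?c (\<gamma> s) (J s))"
    using smooth_alongD[OF assms(1)[unfolded smooth_along_def] assms(3) t c] .
  obtain D' where D': "open D'" "t \<in> D'" "smooth_on D' (\<lambda>s. to_chart M ?c (\<gamma> s) (K s))"
    using smooth_alongD[OF assms(2)[unfolded smooth_along_def] assms(3) t c] by metis
  have E: "open (D \<inter> D')" using D D' by blast
  have "smooth_on (D \<inter> D') (\<lambda>s. h s *\<^sub>R to_chart M ?c (\<gamma> s) (J s) + k s *\<^sub>R to_chart M ?c (\<gamma> s) (K s))"
    by (intro smooth_on_add smooth_on_scaleR E smooth_on_subset[OF assms(5)] smooth_on_subset[OF assms(6)]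
        smooth_on_subset[OF D(6)] smooth_on_subset[OF D'(3)]) (use D in auto)
  then have "smooth_on (D \<inter> D') (\<lambda>s. to_chart M ?c (\<gamma> s) (h s *\<^sub>R J s + k s *\<^sub>R K s))"
    by (rule smooth_on_cong[OF _ E]) (use D(4) c in \<open>auto simp: to_chart_simps\<close>)
  then show "\<exists>c\<in>charts M. \<exists>D. open D \<and> t \<in> D \<and> \<gamma> ` D \<subseteq> fst c \<and> smooth_on D (\<lambda>s. snd c (\<gamma> s)) \<and>
    smooth_on D (\<lambda>s. to_chart M c (\<gamma> s) (h s *\<^sub>R J s + k s *\<^sub>R K s))"
    using c(1) D D' E smooth_on_subset[OF D(5)] by (intro bexI[of _ ?c] exI[of _ "D \<inter> D'"]) auto
qed

end

subsection \<open>Curves and the connection on fields along a subset\<close>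

lemma smooth_map_mpoints: "smooth_map M N A f \<Longrightarrow> f ` A \<subseteq> mpoints N"
proof
  fix y assume f: "smooth_map M N A f" and "y \<in> f ` A"
  then obtain p where p: "p \<in> A" "y = f p" by blast
  obtain W F where "p \<in> W" "smooth_map_open M N W F" "\<forall>q\<in>A \<inter> W. F q = f q"
    using f p(1) unfolding smooth_map_def by blast
  then show "y \<in> mpoints N" using p unfolding smooth_map_open_def by (metis IntI image_subset_iff)
qed

lemma smooth_map_subset: "smooth_map M N A f \<Longrightarrow> B \<subseteq> A \<Longrightarrow> smooth_map M N B f"
  unfolding smooth_map_def by (meson IntD1 IntD2 IntI subsetD)

context atlas
begin

lemma curve_throughI:
  assumes c: "c \<in> charts M" and e: "\<epsilon> > 0" and "\<alpha> ` {-\<epsilon><..<\<epsilon>} \<subseteq> A" "\<alpha> ` {-\<epsilon><..<\<epsilon>} \<subseteq> fst c"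
    and sm: "smooth_on {-\<epsilon><..<\<epsilon>} (\<lambda>s. snd c (\<alpha> s))"
    and d: "((\<lambda>s. snd c (\<alpha> s)) has_vector_derivative to_chart M c q v) (at 0)" and q: "\<alpha> 0 = q"
  shows "curve_through M A q v \<alpha>"
proof -
  have "smooth_map euclid M {-\<epsilon><..<\<epsilon>} \<alpha>"
    by (rule smooth_map_euclidI[OF charts_compatible])
      (use c assms(4) sm in \<open>intro bexI[OF _ c] exI[of _ "{-\<epsilon><..<\<epsilon>}"], auto\<close>)
  moreover have "velocity M \<alpha> 0 = v"
  proof -
    have "\<alpha> 0 \<in> \<alpha> ` {-\<epsilon><..<\<epsilon>}" using e by (intro imageI) auto
    then have qc: "q \<in> fst c" using assms(4) q by blast
    have "0 \<in> {-\<epsilon><..<\<epsilon>}" using e by simp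
    from velocity_chart(1)[OF c open_greaterThanLessThan this assms(4) d]
    show ?thesis by (simp add: q to_chart_inj[OF c qc])
  qed
  ultimately show ?thesis unfolding curve_through_def using e q assms(3) by blast
qed

lemma curve_throughD:
  assumes \<alpha>: "curve_through M A q v \<alpha>" and c: "c \<in> charts M" "q \<in> fst c"
  obtains \<epsilon> where "\<epsilon> > 0" "\<alpha> ` {-\<epsilon><..<\<epsilon>} \<subseteq> A" "\<alpha> ` {-\<epsilon><..<\<epsilon>} \<subseteq> fst c"
    "smooth_on {-\<epsilon><..<\<epsilon>} (\<lambda>s. snd c (\<alpha> s))"
    "((\<lambda>s. snd c (\<alpha> s)) has_vector_derivative to_chart M c q v) (at 0)" "\<alpha> 0 = q"
proof -
  obtain e where e: "e > 0" "smooth_map euclid M {-e<..<e} \<alpha>" "\<alpha> ` {-e<..<e} \<subseteq> A" "\<alpha> 0 = q" "velocity M \<alpha> 0 = v"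
    using \<alpha> unfolding curve_through_def by blast
  obtain D where D: "open D" "0 \<in> D" "D \<subseteq> {-e<..<e}" "\<alpha> ` D \<subseteq> fst c" "smooth_on D (\<lambda>s. snd c (\<alpha> s))"
    by (rule smooth_map_euclidD[OF e(2) _ _ c(1)]) (use e c in auto)
  obtain r where r: "r > 0" "ball 0 r \<subseteq> D" using D(1,2) openE by blast
  have b: "ball (0::real) r = {-r<..<r}" by (auto simp: ball_def dist_real_def)
  show ?thesis
  proof (rule that[of r])
    show "((\<lambda>s. snd c (\<alpha> s)) has_vector_derivative to_chart M c q v) (at 0)"
      using velocity_in_chart[OF e(2) _ _ c(1), of 0] e c by auto
    show "smooth_on {-r<..<r} (\<lambda>s. snd c (\<alpha> s))" using smooth_on_subset[OF D(5)] r b by auto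
  qed (use r b e D in \<open>auto simp: image_subset_iff subset_iff\<close>)
qed

lemma smooth_fieldD:
  assumes "smooth_field_on M A Y" "p \<in> A" and c: "c \<in> charts M" "p \<in> fst c"
  obtains D Yh where "open D" "snd c p \<in> D" "D \<subseteq> snd c ` fst c" "smooth_on D Yh"
    "\<And>q. q \<in> A \<Longrightarrow> q \<in> fst c \<Longrightarrow> snd c q \<in> D \<Longrightarrow> to_chart M c q (Y q) = Yh (snd c q)"
proof -
  obtain D F where D: "open D" "snd c p \<in> D" "D \<subseteq> snd c ` fst c" "smooth_on D F"
    "\<And>q. q \<in> A \<Longrightarrow> q \<in> fst c \<Longrightarrow> snd c q \<in> D \<Longrightarrow>
      (q, Y q) \<in> fst (tangent_chart M c) \<and> snd (tangent_chart M c) (q, Y q) = F (snd c q)"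
    by (rule smooth_mapD[OF assms(1)[unfolded smooth_field_on_def] assms(2) c(1) chart_inj[OF c(1)] c(2), of "tangent_chart M c"])
      (use c in \<open>auto simp: tangent_charts tangent_chart_simps\<close>)
  show ?thesis
    by (rule that[OF D(1-3) smooth_on_sndI[OF D(4,1)]]) (use D(5) in \<open>metis tangent_chart_simps(2) snd_conv\<close>)
qed

lemma smooth_fieldI:
  assumes "\<And>p. p \<in> A \<Longrightarrow> \<exists>c\<in>charts M. \<exists>D Yh. p \<in> fst c \<and> open D \<and> snd c p \<in> D \<and> smooth_on D Yh \<and>
    (\<forall>q\<in>A \<inter> fst c. snd c q \<in> D \<longrightarrow> to_chart M c q (Y q) = Yh (snd c q))"
  shows "smooth_field_on M A Y"
  unfolding smooth_field_on_def
proof (rule smooth_mapI[OF charts_compatible tangent_charts_compatible])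
  fix p assume "p \<in> A"
  then obtain c D Yh where c: "c \<in> charts M" "p \<in> fst c" and D: "open D" "snd c p \<in> D" "smooth_on D Yh"
    "\<forall>q\<in>A \<inter> fst c. snd c q \<in> D \<longrightarrow> to_chart M c q (Y q) = Yh (snd c q)" using assms by meson
  show "\<exists>c\<in>charts M. \<exists>d\<in>charts (tangent_bundle M). \<exists>D F. p \<in> fst c \<and> open D \<and> snd c p \<in> D \<and> smooth_on D F \<and>
     (\<forall>q\<in>A \<inter> fst c. snd c q \<in> D \<longrightarrow> (q, Y q) \<in> fst d \<and> snd d (q, Y q) = F (snd c q))"
    by (rule bexI[OF _ c(1)], rule bexI[of _ "tangent_chart M c"], rule exI[of _ D], rule exI[of _ "\<lambda>x. (x, Yh x)"])
      (use c D in \<open>auto simp: tangent_charts tangent_chart_simps intro: smooth_on_Pair smooth_on_ident\<close>)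
qed

text \<open>A coordinate line in the preferred chart at \<open>q\<close>, where the components of
  \<open>v\<close> are \<open>v\<close> itself.\<close>

lemma curve_in_open:
  assumes W: "openin (mtopology M) W" "q \<in> W"
  shows "\<exists>\<alpha>. curve_through M W q v \<alpha>"
proof -
  have qm: "q \<in> mpoints M" using W openin_mtopology_charts[OF charts_compatible] by blast
  let ?c = "chart_at M q"
  note c = chart_at_in[OF qm]
  have op: "open (snd ?c ` (W \<inter> fst ?c))" using W(1) c openin_mtopology_charts[OF charts_compatible] by blast
  define l where "l s = snd ?c q + s *\<^sub>R v" for s :: real
  have "open (l -` (snd ?c ` (W \<inter> fst ?c)))"
    unfolding l_def by (intro open_vimage op continuous_intros)
  moreover have "0 \<in> l -` (snd ?c ` (W \<inter> fst ?c))" using W c by (auto simp: l_def)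
  ultimately obtain e where e: "e > 0" "ball 0 e \<subseteq> l -` (snd ?c ` (W \<inter> fst ?c))" using openE by blast
  have b: "ball (0::real) e = {-e<..<e}" by (auto simp: ball_def dist_real_def)
  define \<alpha> where "\<alpha> s = chart_inv ?c (l s)" for s
  have l: "l s \<in> snd ?c ` (W \<inter> fst ?c)" if "s \<in> {-e<..<e}" for s using e b that by auto
  have \<alpha>: "\<alpha> s \<in> W" "\<alpha> s \<in> fst ?c" "snd ?c (\<alpha> s) = l s" if s: "s \<in> {-e<..<e}" for s
    using l[OF s] inv_coord[OF c(1)] by (auto simp: \<alpha>_def)
  have "curve_through M W q v \<alpha>"
  proof (rule curve_throughI[OF c(1) e(1)])
    show "smooth_on {-e<..<e} (\<lambda>s. snd ?c (\<alpha> s))"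
    proof (rule smooth_on_cong[OF _ open_greaterThanLessThan])
      show "smooth_on {-e<..<e} l" unfolding l_def
        by (intro smooth_on_add smooth_on_scaleR smooth_on_ident smooth_on_const open_greaterThanLessThan)
    qed (use \<alpha> in auto)
    have "(l has_vector_derivative v) (at 0)" unfolding l_def by (auto intro!: derivative_eq_intros)
    then show "((\<lambda>s. snd ?c (\<alpha> s)) has_vector_derivative to_chart M ?c q v) (at 0)"
      unfolding to_chart_self[OF qm]
      by (rule has_vector_derivative_transform_within_open[OF _ open_greaterThanLessThan[of "-e" e]]) (use \<alpha> e in auto)
    show "\<alpha> 0 = q" using inv_coord[OF c] by (simp add: \<alpha>_def l_def)
  qed (use \<alpha> in auto)
  then show ?thesis by blast
qed

lemma tangent_space_open: "openin (mtopology M) W \<Longrightarrow> q \<in> W \<Longrightarrow> tangent_space M W q = UNIV"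
  unfolding tangent_space_def using curve_in_open by blast

end

context lorentz
begin

text \<open>The derivative along a curve depends on the field only through its values on
  \<open>A\<close>. Computed with a differentiable extension \<open>Yh\<close>, it depends on the
  curve only through the velocity. Together these make the description \<open>nabla\<close>
  meaningful without regularity of \<open>A\<close>, as soon as some curve has the velocity
  \<open>x\<close>.\<close>

lemma nabla_chart:
  assumes c: "c \<in> charts M" "p \<in> fst c"
    and D: "open D" "snd c p \<in> D" "Yh differentiable (at (snd c p))"
    and ext: "\<And>q. q \<in> A \<Longrightarrow> q \<in> fst c \<Longrightarrow> snd c q \<in> D \<Longrightarrow> to_chart M c q (Y q) = Yh (snd c q)"
    and \<alpha>: "curve_through M A p x \<alpha>"
  shows "nabla M g A Y p x = cov_along M g \<alpha> (Y \<circ> \<alpha>) 0"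
    "to_chart M c p (nabla M g A Y p x) =
       FD Yh (snd c p) (to_chart M c p x) + Gam c (snd c p) (to_chart M c p x) (to_chart M c p (Y p))"
proof -
  have *: "to_chart M c p (cov_along M g \<beta> (Y \<circ> \<beta>) 0) =
       FD Yh (snd c p) (to_chart M c p x) + Gam c (snd c p) (to_chart M c p x) (to_chart M c p (Y p))"
    if \<beta>: "curve_through M A p x \<beta>" for \<beta>
  proof -
    obtain e where e: "e > 0" "\<beta> ` {-e<..<e} \<subseteq> A" "\<beta> ` {-e<..<e} \<subseteq> fst c" "smooth_on {-e<..<e} (\<lambda>s. snd c (\<beta> s))"
      "((\<lambda>s. snd c (\<beta> s)) has_vector_derivative to_chart M c p x) (at 0)" "\<beta> 0 = p"
      using curve_throughD[OF \<beta> c] .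
    define E where "E = {-e<..<e} \<inter> (\<lambda>s. snd c (\<beta> s)) -` D"
    have E: "open E" unfolding E_def
      by (rule continuous_open_preimage[OF smooth_on_continuous_on[OF e(4)] open_greaterThanLessThan D(1)])
    have E0: "0 \<in> E" using e D by (auto simp: E_def)
    have Ec: "\<beta> ` E \<subseteq> fst c" using e by (auto simp: E_def)
    have "((\<lambda>s. Yh (snd c (\<beta> s))) has_vector_derivative FD Yh (snd c (\<beta> 0)) (to_chart M c p x)) (at 0)"
      by (rule has_vector_derivative_chain_FD) (use D e in auto)
    then have "((\<lambda>s. to_chart M c (\<beta> s) ((Y \<circ> \<beta>) s)) has_vector_derivative FD Yh (snd c (\<beta> 0)) (to_chart M c p x)) (at 0)"
      by (rule has_vector_derivative_transform_within_open[OF _ E E0]) (use ext e in \<open>auto simp: E_def image_subset_iff\<close>)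
    from cov_along_chart[OF c(1) E E0 Ec e(5) this] show ?thesis by (simp add: e(6) comp_def)
  qed
  show eq: "nabla M g A Y p x = cov_along M g \<alpha> (Y \<circ> \<alpha>) 0"
    unfolding nabla_def
  proof (rule the_equality)
    show "\<forall>\<beta>. curve_through M A p x \<beta> \<longrightarrow> cov_along M g \<beta> (Y \<circ> \<beta>) 0 = cov_along M g \<alpha> (Y \<circ> \<alpha>) 0"
      using * \<alpha> to_chart_inj[OF c] by metis
  qed (use \<alpha> in blast)
  show "to_chart M c p (nabla M g A Y p x) =
       FD Yh (snd c p) (to_chart M c p x) + Gam c (snd c p) (to_chart M c p x) (to_chart M c p (Y p))"
    unfolding eq by (rule *[OF \<alpha>])
qed

lemma nabla_curve:
  assumes "smooth_field_on M A Y" "p \<in> A" "p \<in> mpoints M" "curve_through M A p x \<alpha>"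
  shows "nabla M g A Y p x = cov_along M g \<alpha> (Y \<circ> \<alpha>) 0"
proof -
  note c = chart_at_in[OF assms(3)]
  obtain D Yh where D: "open D" "snd (chart_at M p) p \<in> D" "D \<subseteq> snd (chart_at M p) ` fst (chart_at M p)" "smooth_on D Yh"
    "\<And>q. q \<in> A \<Longrightarrow> q \<in> fst (chart_at M p) \<Longrightarrow> snd (chart_at M p) q \<in> D \<Longrightarrow> to_chart M (chart_at M p) q (Y q) = Yh (snd (chart_at M p) q)"
    by (rule smooth_fieldD[OF assms(1,2) c]) (rule that)
  show ?thesis
    by (rule nabla_chart(1)[OF c D(1,2) smooth_on_imp_differentiable[OF D(4,2)] D(5) assms(4)])
qed

subsection \<open>The curvature tensor in coordinates\<close>

definition rep :: "('m, 'e) chart \<Rightarrow> ('m \<Rightarrow> 'e) \<Rightarrow> 'e \<Rightarrow> 'e" where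
  "rep c Z x = to_chart M c (chart_inv c x) (Z (chart_inv c x))"

lemma rep_coord: "c \<in> charts M \<Longrightarrow> q \<in> fst c \<Longrightarrow> rep c Z (snd c q) = to_chart M c q (Z q)"
  by (simp add: rep_def inv_coord)

lemma rep_smooth:
  assumes W: "openin (mtopology M) W" and Z: "smooth_field_on M W Z" and c: "c \<in> charts M"
  shows "smooth_on (snd c ` (W \<inter> fst c)) (rep c Z)"
proof (rule smooth_on_local)
  fix x assume "x \<in> snd c ` (W \<inter> fst c)"
  then obtain p where p: "p \<in> W" "p \<in> fst c" "x = snd c p" by auto
  have op: "open (snd c ` (W \<inter> fst c))" using W c openin_mtopology_charts[OF charts_compatible] by blast
  obtain D Zh where D: "open D" "snd c p \<in> D" "D \<subseteq> snd c ` fst c" "smooth_on D Zh"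
    "\<And>q. q \<in> W \<Longrightarrow> q \<in> fst c \<Longrightarrow> snd c q \<in> D \<Longrightarrow> to_chart M c q (Z q) = Zh (snd c q)"
    by (rule smooth_fieldD[OF Z p(1) c p(2)]) (rule that)
  have o: "open (D \<inter> snd c ` (W \<inter> fst c))" using op D by blast
  have "smooth_on (D \<inter> snd c ` (W \<inter> fst c)) (rep c Z)"
    by (rule smooth_on_cong[OF smooth_on_subset[OF D(4)] o]) (use D(5) c in \<open>auto simp: rep_coord\<close>)
  then show "\<exists>U. x \<in> U \<and> open U \<and> smooth_on U (rep c Z)"
    using o p D by (intro exI[of _ "D \<inter> snd c ` (W \<inter> fst c)"]) auto
qed

lemma nabla_open:
  assumes W: "openin (mtopology M) W" "q \<in> W" and c: "c \<in> charts M" "q \<in> fst c"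
    and Z: "open D" "snd c q \<in> D" "rep c Z differentiable (at (snd c q))"
  shows "to_chart M c q (nabla M g W Z q v) =
    FD (rep c Z) (snd c q) (to_chart M c q v) + Gam c (snd c q) (to_chart M c q v) (rep c Z (snd c q))"
proof -
  obtain \<alpha> where "curve_through M W q v \<alpha>" using curve_in_open[OF W] by blast
  from nabla_chart(2)[OF c Z _ this, of Z] show ?thesis using c by (simp add: rep_coord)
qed

text \<open>Tensoriality. The second derivatives of \<open>Z\<close> cancel by symmetry, its first
  derivatives in the directions of derivatives of \<open>X\<close> and \<open>Y\<close> cancel
  against the bracket term, and only values at \<open>p\<close> remain.\<close>

lemma curvature_formula:
  assumes W: "openin (mtopology M) W" "p \<in> W"
    and X: "smooth_field_on M W X" and Y: "smooth_field_on M W Y" and Z: "smooth_field_on M W Z"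
  shows "nabla M g W (\<lambda>q. nabla M g W Z q (Y q)) p (X p)
          - nabla M g W (\<lambda>q. nabla M g W Z q (X q)) p (Y p)
          - nabla M g W Z p (lie_bracket M X Y p) =
     local_metric.Rm (Gc (chart_at M p)) (snd (chart_at M p) p) (X p) (Y p) (Z p)"
proof -
  have pm: "p \<in> mpoints M" using W openin_mtopology_charts[OF charts_compatible] by blast
  let ?c = "chart_at M p"
  note c = chart_at_in[OF pm]
  interpret m: local_metric "snd ?c ` fst ?c" "Gc ?c" by (rule local_metric[OF c(1)])
  define U where "U = snd ?c ` (W \<inter> fst ?c)"
  define x0 where "x0 = snd ?c p"
  have U: "open U" using W c openin_mtopology_charts[OF charts_compatible] by (auto simp: U_def)
  have x0: "x0 \<in> U" "x0 \<in> snd ?c ` fst ?c" using W c by (auto simp: U_def x0_def)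
  have UO: "U \<subseteq> snd ?c ` fst ?c" by (auto simp: U_def)
  let ?X = "rep ?c X" and ?Y = "rep ?c Y" and ?Z = "rep ?c Z"
  note sX = rep_smooth[OF W(1) X c(1), folded U_def] and sY = rep_smooth[OF W(1) Y c(1), folded U_def]
    and sZ = rep_smooth[OF W(1) Z c(1), folded U_def]
  have r0: "rep ?c V x0 = V p" for V using rep_coord[OF c] by (simp add: x0_def to_chart_self[OF pm])
  have n1: "rep ?c (\<lambda>q. nabla M g W Z q (V q)) x = FD ?Z x (rep ?c V x) + Gam ?c x (rep ?c V x) (?Z x)"
    if x: "x \<in> U" for V x
  proof -
    obtain q where q: "q \<in> W" "q \<in> fst ?c" "x = snd ?c q" using x by (auto simp: U_def)
    show ?thesis
      using nabla_open[OF W(1) q(1) c(1) q(2) U _ smooth_on_imp_differentiable[OF sZ], of "V q"] x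
      by (simp add: q rep_coord[OF c(1) q(2)])
  qed
  have main: "nabla M g W (\<lambda>q. nabla M g W Z q (V q)) p (A p) =
      FD (\<lambda>y. FD ?Z y (V p)) x0 (A p) + FD ?Z x0 (FD (rep ?c V) x0 (A p))
      + (m.DChr x0 (A p) (V p) (Z p) + Gam ?c x0 (FD (rep ?c V) x0 (A p)) (Z p) + Gam ?c x0 (V p) (FD ?Z x0 (A p)))
      + Gam ?c x0 (A p) (FD ?Z x0 (V p) + Gam ?c x0 (V p) (Z p))"
    if V: "smooth_on U (rep ?c V)" for V A
  proof -
    let ?N = "rep ?c (\<lambda>q. nabla M g W Z q (V q))"
    let ?F = "\<lambda>x. FD ?Z x (rep ?c V x) + Gam ?c x (rep ?c V x) (?Z x)"
    have d1: "((\<lambda>y. FD ?Z y (rep ?c V y)) has_derivative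
       (\<lambda>w. FD (\<lambda>z. FD ?Z z (rep ?c V x0)) x0 w + FD ?Z x0 (FD (rep ?c V) x0 w))) (at x0)"
      by (rule linear_family_has_derivative[where F="FD ?Z" and h="\<lambda>y. y" and v="rep ?c V" and y=x0, OF U smooth_on_linear_FD[OF sZ] smooth_on_FD[OF sZ] _ smooth_on_has_derivative[OF V x0(1)] x0(1)])
        (auto intro!: derivative_eq_intros)
    have d2: "((\<lambda>y. Gam ?c y (rep ?c V y) (?Z y)) has_derivative
       (\<lambda>w. FD (\<lambda>z. Gam ?c z (rep ?c V x0) (?Z x0)) x0 w + Gam ?c x0 (FD (rep ?c V) x0 w) (?Z x0)
         + Gam ?c x0 (rep ?c V x0) (FD ?Z x0 w))) (at x0)"
      by (rule bilinear_family_has_derivative[where F="Gam ?c" and h="\<lambda>y. y" and u="rep ?c V" and v="?Z" and y=x0, OF m.open_Om m.Chr_bilinear m.Chr_smooth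
            _ smooth_on_has_derivative[OF V x0(1)] smooth_on_has_derivative[OF sZ x0(1)] x0(2)])
        (auto intro!: derivative_eq_intros)
    note d = has_derivative_add[OF d1 d2]
    have dN: "?N differentiable (at x0)"
      using differentiable_cong_open[OF U x0(1), of ?N ?F] n1 Derivative.differentiableI[OF d] by blast
    have "FD ?N x0 = FD ?F x0" by (rule FD_cong_open[OF U x0(1) n1])
    also have "\<dots> = (\<lambda>w. FD (\<lambda>z. FD ?Z z (rep ?c V x0)) x0 w + FD ?Z x0 (FD (rep ?c V) x0 w) +
        (FD (\<lambda>z. Gam ?c z (rep ?c V x0) (?Z x0)) x0 w + Gam ?c x0 (FD (rep ?c V) x0 w) (?Z x0)
         + Gam ?c x0 (rep ?c V x0) (FD ?Z x0 w)))"
      by (rule has_derivative_FD_eq[OF d])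
    finally have "FD ?N x0 (A p) = FD (\<lambda>y. FD ?Z y (V p)) x0 (A p) + FD ?Z x0 (FD (rep ?c V) x0 (A p))
      + (m.DChr x0 (A p) (V p) (Z p) + Gam ?c x0 (FD (rep ?c V) x0 (A p)) (Z p) + Gam ?c x0 (V p) (FD ?Z x0 (A p)))"
      by (simp add: r0 m.DChr_def)
    moreover have "to_chart M ?c p (nabla M g W (\<lambda>q. nabla M g W Z q (V q)) p (A p)) =
      FD ?N (snd ?c p) (to_chart M ?c p (A p)) + Gam ?c (snd ?c p) (to_chart M ?c p (A p)) (?N (snd ?c p))"
      by (rule nabla_open[OF W c U]) (use x0 dN in \<open>auto simp: x0_def\<close>)
    ultimately show ?thesis
      using n1[OF x0(1), of V] by (simp add: to_chart_self[OF pm] x0_def[symmetric] r0)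
  qed
  have lb: "lie_bracket M X Y p = FD ?Y x0 (X p) - FD ?X x0 (Y p)"
    by (simp add: lie_bracket_def Let_def rep_def[abs_def] x0_def)
  have "to_chart M ?c p (nabla M g W Z p v) = FD ?Z (snd ?c p) (to_chart M ?c p v) + Gam ?c (snd ?c p) (to_chart M ?c p v) (?Z (snd ?c p))" for v
    by (rule nabla_open[OF W c U]) (use x0 smooth_on_imp_differentiable[OF sZ] in \<open>auto simp: x0_def\<close>)
  then have nZ: "nabla M g W Z p v = FD ?Z x0 v + Gam ?c x0 v (Z p)" for v
    by (simp add: to_chart_self[OF pm] x0_def[symmetric] r0)
  have sym: "FD (\<lambda>y. FD ?Z y (Y p)) x0 (X p) = FD (\<lambda>y. FD ?Z y (X p)) x0 (Y p)"
    by (rule symmetric_second_derivative[OF sZ U x0(1)])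
  show ?thesis
    unfolding main[OF sX] main[OF sY] nZ lb m.Rm_def x0_def[symmetric] sym
    by (simp add: m.Chr_simps[OF x0(2)] linear_diff[OF smooth_on_linear_FD[OF sZ x0(1)]])
qed

text \<open>Fields with constant components in \<open>c\<close> extend any vector at
  \<open>p\<close>. They show that the condition defining \<open>curvature\<close> is not vacuous,
  so that it determines its value.\<close>

lemma constant_field:
  assumes c: "c \<in> charts M" "p \<in> fst c"
  shows "(\<lambda>q. from_chart M c q (to_chart M c p x)) \<in> vector_fields M (fst c)"
    and "openin (mtopology M) (fst c)"
proof -
  show o: "openin (mtopology M) (fst c)"
    using openin_chart_preimage[OF charts_compatible c(1) open_UNIV] by simp
  have "smooth_field_on M (fst c) (\<lambda>q. from_chart M c q (to_chart M c p x))"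
    by (rule smooth_fieldI, rule bexI[OF _ c(1)], rule exI[of _ "UNIV"], rule exI[of _ "\<lambda>_. to_chart M c p x"])
      (auto simp: to_from_chart[OF c(1)] smooth_on_const)
  then show "(\<lambda>q. from_chart M c q (to_chart M c p x)) \<in> vector_fields M (fst c)"
    by (simp add: vector_fields_def tangent_space_open[OF o])
qed

lemma curvature_eq:
  assumes pm: "p \<in> mpoints M"
  shows "curvature M g p x y z = local_metric.Rm (Gc (chart_at M p)) (snd (chart_at M p) p) x y z"
  unfolding curvature_def
proof (rule the_equality)
  let ?c = "chart_at M p"
  note c = chart_at_in[OF pm]
  show "\<forall>W X Y Z. openin (mtopology M) W \<and> p \<in> W \<and> X \<in> vector_fields M W \<and> Y \<in> vector_fields M W \<and>
        Z \<in> vector_fields M W \<and> X p = x \<and> Y p = y \<and> Z p = z \<longrightarrow>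
      local_metric.Rm (Gc ?c) (snd ?c p) x y z = nabla M g W (\<lambda>q. nabla M g W Z q (Y q)) p (X p)
          - nabla M g W (\<lambda>q. nabla M g W Z q (X q)) p (Y p) - nabla M g W Z p (lie_bracket M X Y p)"
    using curvature_formula by (auto simp: vector_fields_def)
  fix w
  assume w: "\<forall>W X Y Z. openin (mtopology M) W \<and> p \<in> W \<and> X \<in> vector_fields M W \<and> Y \<in> vector_fields M W \<and>
        Z \<in> vector_fields M W \<and> X p = x \<and> Y p = y \<and> Z p = z \<longrightarrow>
      w = nabla M g W (\<lambda>q. nabla M g W Z q (Y q)) p (X p)
          - nabla M g W (\<lambda>q. nabla M g W Z q (X q)) p (Y p) - nabla M g W Z p (lie_bracket M X Y p)"
  let ?F = "\<lambda>x q. from_chart M ?c q (to_chart M ?c p x)"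
  have p: "?F x p = x" for x by (simp add: from_to_chart[OF c])
  have v: "?F x \<in> vector_fields M (fst ?c)" for x by (rule constant_field(1)[OF c])
  then have s: "smooth_field_on M (fst ?c) (?F x)" for x by (simp add: vector_fields_def)
  have o: "openin (mtopology M) (fst ?c)" by (rule constant_field(2)[OF c])
  have "w = nabla M g (fst ?c) (\<lambda>q. nabla M g (fst ?c) (?F z) q (?F y q)) p (?F x p)
          - nabla M g (fst ?c) (\<lambda>q. nabla M g (fst ?c) (?F z) q (?F x q)) p (?F y p)
          - nabla M g (fst ?c) (?F z) p (lie_bracket M (?F x) (?F y) p)"
    by (rule w[rule_format]) (intro conjI o c(2) v p)
  also have "\<dots> = local_metric.Rm (Gc ?c) (snd ?c p) (?F x p) (?F y p) (?F z p)"
    by (rule curvature_formula[OF o c(2) s s s])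
  finally show "w = local_metric.Rm (Gc ?c) (snd ?c p) x y z" by (simp only: p)
qed

end

subsection \<open>Uniqueness of solutions of ordinary differential equations\<close>

text \<open>The derivatives along the basis vectors are continuous, hence bounded near
  \<open>x0\<close>. The sum of their bounds dominates the operator norm of the derivative on a
  ball, which is convex.\<close>

lemma smooth_on_locally_lipschitz:
  fixes F :: "'a::euclidean_space \<Rightarrow> 'b::real_normed_vector"
  assumes F: "smooth_on D F" and D: "open D" "x0 \<in> D"
  obtains r L where "r > 0" "L \<ge> 0" "ball x0 r \<subseteq> D"
    "\<And>x y. x \<in> ball x0 r \<Longrightarrow> y \<in> ball x0 r \<Longrightarrow> norm (F x - F y) \<le> L * norm (x - y)"
proof -
  \<comment> \<open>The summand 1 leaves room for a strict bound that persists near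
    \<open>x0\<close> by continuity.\<close>
  define K where "K b = norm (FD F x0 b) + 1" for b
  have "eventually (\<lambda>x. norm (FD F x b) < K b) (nhds x0)" for b
  proof -
    have "isCont (\<lambda>x. norm (FD F x b)) x0"
      by (intro isCont_norm smooth_on_isCont[OF smooth_on_FD[OF F] D(2)])
    then have "((\<lambda>x. norm (FD F x b)) \<longlongrightarrow> norm (FD F x0 b)) (nhds x0)"
      using isCont_def tendsto_at_iff_tendsto_nhds by metis
    then show ?thesis by (rule order_tendstoD(2)) (simp add: K_def)
  qed
  then have "eventually (\<lambda>x. \<forall>b\<in>Basis. norm (FD F x b) < K b) (nhds x0)"
    by (intro eventually_ball_finite) auto
  then obtain U where U: "open U" "x0 \<in> U" "\<And>x b. x \<in> U \<Longrightarrow> b \<in> Basis \<Longrightarrow> norm (FD F x b) < K b"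
    unfolding eventually_nhds by blast
  have "open (U \<inter> D)" "x0 \<in> U \<inter> D" using U D by auto
  then obtain r where r: "r > 0" "ball x0 r \<subseteq> U \<inter> D" using openE by metis
  define L where "L = (\<Sum>b\<in>(Basis::'a set). K b)"
  have "norm (F x - F y) \<le> L * norm (x - y)" if xy: "x \<in> ball x0 r" "y \<in> ball x0 r" for x y
  proof (rule differentiable_bound[OF convex_ball _ _ xy])
    fix z assume z: "z \<in> ball x0 r"
    then have zD: "z \<in> D" and zU: "z \<in> U" using r by auto
    show "(F has_derivative FD F z) (at z within ball x0 r)"
      using smooth_on_has_derivative[OF F zD] has_derivative_at_withinI by blast
    show "onorm (FD F z) \<le> L"
    proof (rule onorm_le)
      fix h
      have "norm (FD F z h) = norm (\<Sum>b\<in>Basis. (h \<bullet> b) *\<^sub>R FD F z b)"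
        by (simp add: linear_Basis_sum[OF smooth_on_linear_FD[OF F zD], symmetric])
      also have "\<dots> \<le> (\<Sum>b\<in>Basis. norm h * K b)"
        using U(3)[OF zU]
        by (intro sum_norm_le) (auto intro!: mult_mono simp: Basis_le_norm order.strict_implies_order)
      also have "\<dots> = L * norm h" unfolding L_def sum_distrib_left[symmetric] by (rule mult.commute)
      finally show "norm (FD F z h) \<le> L * norm h" .
    qed
  qed
  moreover have "L \<ge> 0" unfolding L_def K_def by (intro sum_nonneg) auto
  ultimately show ?thesis using that[of r L] r by auto
qed

text \<open>A contraction argument instead of Gronwall. On a short interval the maximum of the norm
  of \<open>z - w\<close> is, by the mean value inequality starting from the common value, at most
  half of itself.\<close>

lemma ode_local_uniqueness:
  fixes z w :: "real \<Rightarrow> 'a::euclidean_space"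
  assumes F: "smooth_on D F" "open D" and N: "open N" "t0 \<in> N"
    and z: "\<And>t. t \<in> N \<Longrightarrow> (z has_vector_derivative F (z t)) (at t)"
    and w: "\<And>t. t \<in> N \<Longrightarrow> (w has_vector_derivative F (w t)) (at t)"
    and eq: "z t0 = w t0" "z t0 \<in> D"
  obtains \<epsilon> where "\<epsilon> > 0" "{t0-\<epsilon><..<t0+\<epsilon>} \<subseteq> N" "\<And>t. t \<in> {t0-\<epsilon><..<t0+\<epsilon>} \<Longrightarrow> z t = w t"
proof -
  obtain r L where rL: "r > 0" "L \<ge> 0" "ball (z t0) r \<subseteq> D"
    "\<And>x y. x \<in> ball (z t0) r \<Longrightarrow> y \<in> ball (z t0) r \<Longrightarrow> norm (F x - F y) \<le> L * norm (x - y)"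
    using smooth_on_locally_lipschitz[OF F eq(2)] by blast
  have c: "isCont z t" "isCont w t" if "t \<in> N" for t
    using has_vector_derivative_continuous z w that by blast+
  obtain \<eta>1 where \<eta>1: "\<eta>1 > 0" "ball t0 \<eta>1 \<subseteq> N" using N openE by blast
  obtain \<eta>2 where \<eta>2: "\<eta>2 > 0" "\<And>t. dist t t0 < \<eta>2 \<Longrightarrow> dist (z t) (z t0) < r"
    using c(1)[OF N(2)] rL(1) unfolding continuous_at_eps_delta by metis
  obtain \<eta>3 where \<eta>3: "\<eta>3 > 0" "\<And>t. dist t t0 < \<eta>3 \<Longrightarrow> dist (w t) (w t0) < r"
    using c(2)[OF N(2)] rL(1) unfolding continuous_at_eps_delta by metis
  define \<eta> where "\<eta> = min \<eta>1 (min \<eta>2 \<eta>3)"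
  have \<eta>: "\<eta> > 0" "\<eta> \<le> \<eta>1" "\<eta> \<le> \<eta>2" "\<eta> \<le> \<eta>3" using \<eta>1 \<eta>2 \<eta>3 by (auto simp: \<eta>_def)
  \<comment> \<open>The first bound puts the closed interval inside the region where both solutions
    stay in the Lipschitz ball. The second makes \<open>\<epsilon> * L\<close> at most 1/2;
    \<open>L + 1\<close> covers the case \<open>L = 0\<close>.\<close>
  define \<epsilon> where "\<epsilon> = min (\<eta> / 2) (1 / (2 * (L + 1)))"
  have \<epsilon>: "\<epsilon> > 0" "\<epsilon> < \<eta>" using \<eta> rL by (auto simp: \<epsilon>_def min_def)
  have "\<epsilon> * L \<le> 1 / (2 * (L + 1)) * L" using rL(2) by (intro mult_right_mono) (auto simp: \<epsilon>_def)
  also have "\<dots> \<le> 1 / 2" using rL(2) by (simp add: field_simps)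
  finally have \<epsilon>L: "\<epsilon> * L \<le> 1 / 2" .
  have in_N: "t \<in> N" and in_b: "z t \<in> ball (z t0) r" "w t \<in> ball (z t0) r" if "t \<in> {t0-\<epsilon>..t0+\<epsilon>}" for t
  proof -
    have d: "dist t t0 < \<eta>" using that \<epsilon> by (auto simp: dist_real_def abs_le_iff)
    show "t \<in> N" using d \<eta> \<eta>1 by (auto simp: dist_commute subset_iff)
    show "z t \<in> ball (z t0) r" using \<eta>2(2)[of t] d \<eta> by (auto simp: dist_commute)
    show "w t \<in> ball (z t0) r" using \<eta>3(2)[of t] d \<eta> eq by (auto simp: dist_commute)
  qed
  define f where "f t = z t - w t" for t
  have fd: "(f has_vector_derivative (F (z t) - F (w t))) (at t)" if "t \<in> N" for t
    unfolding f_def by (intro has_vector_derivative_diff z w that)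
  have fc: "isCont f t" if "t \<in> N" for t unfolding f_def using c[OF that] by (intro continuous_intros)
  have "continuous_on {t0-\<epsilon>..t0+\<epsilon>} (\<lambda>t. norm (f t))"
    using fc in_N by (intro continuous_at_imp_continuous_on ballI isCont_norm) auto
  moreover have "{t0-\<epsilon>..t0+\<epsilon>} \<noteq> {}" using \<epsilon> by auto
  ultimately obtain s where s: "s \<in> {t0-\<epsilon>..t0+\<epsilon>}" "\<And>t. t \<in> {t0-\<epsilon>..t0+\<epsilon>} \<Longrightarrow> norm (f t) \<le> norm (f s)"
    using continuous_attains_sup[OF compact_Icc] by metis
  have step: "norm (f b - f a) \<le> norm (f s) / 2"
    if ab: "a < b" "b - a \<le> \<epsilon>" "a \<in> {t0-\<epsilon>..t0+\<epsilon>}" "b \<in> {t0-\<epsilon>..t0+\<epsilon>}" for a b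
  proof -
    have sub: "x \<in> {t0-\<epsilon>..t0+\<epsilon>}" if "a \<le> x" "x \<le> b" for x using that ab by auto
    have "\<exists>x\<in>{a<..<b}. norm (f b - f a) \<le> norm ((b - a) *\<^sub>R (F (z x) - F (w x)))"
    proof (rule mvt_general[OF ab(1), of f "\<lambda>x h. h *\<^sub>R (F (z x) - F (w x))"])
      show "continuous_on {a..b} f"
        using fc sub in_N by (intro continuous_at_imp_continuous_on) auto
      show "(f has_derivative (\<lambda>h. h *\<^sub>R (F (z x) - F (w x)))) (at x)" if "a < x" "x < b" for x
        using fd[OF in_N[OF sub]] that unfolding has_vector_derivative_def by simp
    qed
    then obtain x where x: "x \<in> {a<..<b}" "norm (f b - f a) \<le> norm ((b - a) *\<^sub>R (F (z x) - F (w x)))" ..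
    have xs: "x \<in> {t0-\<epsilon>..t0+\<epsilon>}" using x sub by auto
    have "norm (f b - f a) \<le> (b - a) * norm (F (z x) - F (w x))" using x(2) ab(1) by simp
    also have "\<dots> \<le> \<epsilon> * (L * norm (f s))"
    proof (rule mult_mono[OF ab(2)])
      have "norm (F (z x) - F (w x)) \<le> L * norm (f x)" unfolding f_def by (rule rL(4)[OF in_b[OF xs]])
      also have "\<dots> \<le> L * norm (f s)" by (rule mult_left_mono[OF s(2)[OF xs] rL(2)])
      finally show "norm (F (z x) - F (w x)) \<le> L * norm (f s)" .
    qed (use \<epsilon> in auto)
    also have "\<dots> \<le> norm (f s) / 2" using mult_right_mono[OF \<epsilon>L, of "norm (f s)"] by (simp add: mult.assoc)
    finally show ?thesis .
  qed
  have f0: "f t0 = 0" by (simp add: f_def eq)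
  have bound: "norm (f t) \<le> norm (f s) / 2" if t: "t \<in> {t0-\<epsilon>..t0+\<epsilon>}" for t
  proof (cases t t0 rule: linorder_cases)
    case less
    then have "norm (f t0 - f t) \<le> norm (f s) / 2" using t \<epsilon> by (intro step) auto
    then show ?thesis by (simp add: f0)
  next
    case greater
    then have "norm (f t - f t0) \<le> norm (f s) / 2" using t \<epsilon> by (intro step) auto
    then show ?thesis by (simp add: f0)
  qed (simp add: f0)
  have "norm (f s) = 0" using bound[OF s(1)] norm_ge_zero[of "f s"] by linarith
  then have "f t = 0" if "t \<in> {t0-\<epsilon>..t0+\<epsilon>}" for t using bound[OF that] by simp
  then have "z t = w t" if "t \<in> {t0-\<epsilon><..<t0+\<epsilon>}" for t using that by (auto simp: f_def)
  moreover have "{t0-\<epsilon><..<t0+\<epsilon>} \<subseteq> N" using in_N by (auto simp: subset_iff)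
  ultimately show ?thesis using that \<epsilon>(1) by blast
qed

subsection \<open>Geodesics\<close>

context atlas
begin

lemma smooth_map_euclid_preimage:
  fixes \<gamma> :: "'v::euclidean_space \<Rightarrow> 'm"
  assumes \<gamma>: "smooth_map euclid M I \<gamma>" "open I" "t \<in> I" and U: "openin (mtopology M) U" "\<gamma> t \<in> U"
  obtains D where "open D" "t \<in> D" "D \<subseteq> I" "\<gamma> ` D \<subseteq> U"
proof -
  have pm: "\<gamma> t \<in> mpoints M" using smooth_map_mpoints[OF \<gamma>(1)] \<gamma>(3) by blast
  let ?c = "chart_at M (\<gamma> t)"
  note c = chart_at_in[OF pm]
  obtain D where D: "open D" "t \<in> D" "D \<subseteq> I" "\<gamma> ` D \<subseteq> fst ?c" "smooth_on D (\<lambda>s. snd ?c (\<gamma> s))"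
    using smooth_map_euclidD[OF \<gamma> c] .
  have op: "open (snd ?c ` (U \<inter> fst ?c))" using U(1) c openin_mtopology_charts[OF charts_compatible] by blast
  show ?thesis
  proof (rule that[of "D \<inter> (\<lambda>s. snd ?c (\<gamma> s)) -` (snd ?c ` (U \<inter> fst ?c))"])
    show "open (D \<inter> (\<lambda>s. snd ?c (\<gamma> s)) -` (snd ?c ` (U \<inter> fst ?c)))"
      by (rule continuous_open_preimage[OF smooth_on_continuous_on[OF D(5)] D(1) op])
    show "\<gamma> ` (D \<inter> (\<lambda>s. snd ?c (\<gamma> s)) -` (snd ?c ` (U \<inter> fst ?c))) \<subseteq> U"
    proof
      fix q assume "q \<in> \<gamma> ` (D \<inter> (\<lambda>s. snd ?c (\<gamma> s)) -` (snd ?c ` (U \<inter> fst ?c)))"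
      then have "snd ?c q \<in> snd ?c ` (U \<inter> fst ?c)" "q \<in> fst ?c" using D(4) by auto
      then show "q \<in> U" using chart_image_iff[OF chart_inj[OF c(1)], of q "U \<inter> fst ?c"] by blast
    qed
  qed (use D U c in auto)
qed

end

context lorentz
begin

lemma geodesicD:
  assumes "geodesic M g I \<gamma>"
  shows "open I" "is_interval I" "smooth_map euclid M I \<gamma>" "\<gamma> ` I \<subseteq> mpoints M"
    "\<And>t. t \<in> I \<Longrightarrow> cov_along M g \<gamma> (velocity M \<gamma>) t = 0"
  using assms smooth_map_mpoints[of euclid M I \<gamma>] unfolding geodesic_def by simp_all

lemma geodesic_chart:
  assumes \<gamma>: "geodesic M g I \<gamma>" "t \<in> I" and c: "c \<in> charts M" "\<gamma> t \<in> fst c"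
  obtains D where "open D" "t \<in> D" "D \<subseteq> I" "\<gamma> ` D \<subseteq> fst c" "smooth_on D (\<lambda>s. snd c (\<gamma> s))"
    "smooth_on D (\<lambda>s. to_chart M c (\<gamma> s) (velocity M \<gamma> s))"
    "\<And>s. s \<in> D \<Longrightarrow> ((\<lambda>s. snd c (\<gamma> s)) has_vector_derivative to_chart M c (\<gamma> s) (velocity M \<gamma> s)) (at s)"
    "\<And>s. s \<in> D \<Longrightarrow> ((\<lambda>s. to_chart M c (\<gamma> s) (velocity M \<gamma> s)) has_vector_derivative
        - Gam c (snd c (\<gamma> s)) (to_chart M c (\<gamma> s) (velocity M \<gamma> s)) (to_chart M c (\<gamma> s) (velocity M \<gamma> s))) (at s)"
proof -
  note g = geodesicD[OF \<gamma>(1)]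
  obtain D where D: "open D" "t \<in> D" "D \<subseteq> I" "\<gamma> ` D \<subseteq> fst c" "smooth_on D (\<lambda>s. snd c (\<gamma> s))"
    "smooth_on D (\<lambda>s. to_chart M c (\<gamma> s) (velocity M \<gamma> s))"
    using smooth_alongD[OF smooth_along_velocity[OF g(3,1,4), unfolded smooth_along_def] g(1) \<gamma>(2) c] .
  have v: "((\<lambda>s. snd c (\<gamma> s)) has_vector_derivative to_chart M c (\<gamma> s) (velocity M \<gamma> s)) (at s)"
    if s: "s \<in> D" for s
    by (rule velocity_in_chart[OF g(3,1) _ c(1)]) (use s D in auto)
  have "((\<lambda>s. to_chart M c (\<gamma> s) (velocity M \<gamma> s)) has_vector_derivative
        - Gam c (snd c (\<gamma> s)) (to_chart M c (\<gamma> s) (velocity M \<gamma> s)) (to_chart M c (\<gamma> s) (velocity M \<gamma> s))) (at s)"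
    if s: "s \<in> D" for s
  proof -
    have sc: "\<gamma> s \<in> fst c" using s D(4) by blast
    have d: "((\<lambda>s. to_chart M c (\<gamma> s) (velocity M \<gamma> s)) has_vector_derivative
      FD (\<lambda>s. to_chart M c (\<gamma> s) (velocity M \<gamma> s)) s 1) (at s)"
      by (rule has_vector_derivative_FD_real[OF smooth_on_imp_differentiable[OF D(6) s]])
    have "cov_along M g \<gamma> (velocity M \<gamma>) s = 0" using g(5) s D(3) by blast
    then have "FD (\<lambda>s. to_chart M c (\<gamma> s) (velocity M \<gamma> s)) s 1 =
      - Gam c (snd c (\<gamma> s)) (to_chart M c (\<gamma> s) (velocity M \<gamma> s)) (to_chart M c (\<gamma> s) (velocity M \<gamma> s))"
      using cov_along_chart[OF c(1) D(1) s D(4) v[OF s] d] to_chart_simps(5)[OF c(1) sc]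
      by (simp add: eq_neg_iff_add_eq_0)
    then show ?thesis using d by simp
  qed
  then show ?thesis using that D v by blast
qed

text \<open>In one chart position and velocity solve the autonomous first-order system with right
  side \<open>F\<close>, smooth on the chart image times the model space. Equal coordinates then
  give equal points because the chart is injective.\<close>

lemma geodesic_local_uniqueness:
  assumes \<gamma>: "geodesic M g I \<gamma>" "t0 \<in> I" and \<delta>: "geodesic M g I' \<delta>" "t0 \<in> I'"
    and eq: "\<gamma> t0 = \<delta> t0" "velocity M \<gamma> t0 = velocity M \<delta> t0"
  obtains \<epsilon> where "\<epsilon> > 0" "\<And>t. t \<in> {t0-\<epsilon><..<t0+\<epsilon>} \<Longrightarrow> t \<in> I \<and> t \<in> I' \<and> \<gamma> t = \<delta> t"
proof -
  have pm: "\<gamma> t0 \<in> mpoints M" using geodesicD(4)[OF \<gamma>(1)] \<gamma>(2) by blast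
  let ?c = "chart_at M (\<gamma> t0)"
  note c = chart_at_in[OF pm]
  have c': "\<delta> t0 \<in> fst ?c" using c eq by simp
  interpret m: local_metric "snd ?c ` fst ?c" "Gc ?c" by (rule local_metric[OF c(1)])
  let ?P = "\<lambda>\<gamma> s. (snd ?c (\<gamma> s), to_chart M ?c (\<gamma> s) (velocity M \<gamma> s))"
  define F where "F z = (snd z, - Gam ?c (fst z) (snd z) (snd z))" for z
  obtain D where D: "open D" "t0 \<in> D" "D \<subseteq> I" "\<gamma> ` D \<subseteq> fst ?c"
    "\<And>s. s \<in> D \<Longrightarrow> ((\<lambda>s. snd ?c (\<gamma> s)) has_vector_derivative to_chart M ?c (\<gamma> s) (velocity M \<gamma> s)) (at s)"
    "\<And>s. s \<in> D \<Longrightarrow> ((\<lambda>s. to_chart M ?c (\<gamma> s) (velocity M \<gamma> s)) has_vector_derivative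
        - Gam ?c (snd ?c (\<gamma> s)) (to_chart M ?c (\<gamma> s) (velocity M \<gamma> s)) (to_chart M ?c (\<gamma> s) (velocity M \<gamma> s))) (at s)"
    by (rule geodesic_chart[OF \<gamma> c]) (rule that)
  obtain D' where D': "open D'" "t0 \<in> D'" "D' \<subseteq> I'" "\<delta> ` D' \<subseteq> fst ?c"
    "\<And>s. s \<in> D' \<Longrightarrow> ((\<lambda>s. snd ?c (\<delta> s)) has_vector_derivative to_chart M ?c (\<delta> s) (velocity M \<delta> s)) (at s)"
    "\<And>s. s \<in> D' \<Longrightarrow> ((\<lambda>s. to_chart M ?c (\<delta> s) (velocity M \<delta> s)) has_vector_derivative
        - Gam ?c (snd ?c (\<delta> s)) (to_chart M ?c (\<delta> s) (velocity M \<delta> s)) (to_chart M ?c (\<delta> s) (velocity M \<delta> s))) (at s)"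
    by (rule geodesic_chart[OF \<delta> c(1) c']) (rule that)
  have oD: "open (snd ?c ` fst ?c \<times> (UNIV::'e set))" using m.open_Om by (simp add: open_Times)
  have smF: "smooth_on (snd ?c ` fst ?c \<times> UNIV) F"
    unfolding F_def
    by (intro smooth_on_Pair smooth_on_uminus smooth_on_snd oD
        smooth_on_bilinear_family[OF m.open_Om oD m.Chr_bilinear m.Chr_smooth] smooth_on_fst) auto
  have zd: "(?P \<gamma> has_vector_derivative F (?P \<gamma> t)) (at t)" if "t \<in> D \<inter> D'" for t
    unfolding F_def using has_vector_derivative_Pair[OF D(5,6)] that by auto
  have wd: "(?P \<delta> has_vector_derivative F (?P \<delta> t)) (at t)" if "t \<in> D \<inter> D'" for t
    unfolding F_def using has_vector_derivative_Pair[OF D'(5,6)] that by auto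
  have N: "open (D \<inter> D')" "t0 \<in> D \<inter> D'" using D D' by auto
  have z0: "?P \<gamma> t0 = ?P \<delta> t0" "?P \<gamma> t0 \<in> snd ?c ` fst ?c \<times> UNIV" using eq c by auto
  obtain \<epsilon> where e: "\<epsilon> > 0" "{t0-\<epsilon><..<t0+\<epsilon>} \<subseteq> D \<inter> D'" "\<And>t. t \<in> {t0-\<epsilon><..<t0+\<epsilon>} \<Longrightarrow> ?P \<gamma> t = ?P \<delta> t"
    by (rule ode_local_uniqueness[OF smF oD N zd wd z0], assumption, assumption, rule that)
  have "t \<in> I \<and> t \<in> I' \<and> \<gamma> t = \<delta> t" if t: "t \<in> {t0-\<epsilon><..<t0+\<epsilon>}" for t
  proof -
    have tD: "t \<in> D" "t \<in> D'" using e(2) t by auto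
    then have "\<gamma> t \<in> fst ?c" "\<delta> t \<in> fst ?c" using D(4) D'(4) by blast+
    moreover have "snd ?c (\<gamma> t) = snd ?c (\<delta> t)" using e(3)[OF t] by simp
    ultimately show ?thesis using chart_inj[OF c(1)] D(3) D'(3) using tD by (metis chart_inv_left subsetD)
  qed
  then show ?thesis using that e(1) by blast
qed

lemma const_geodesic:
  assumes "p \<in> mpoints M" shows "geodesic M g UNIV (\<lambda>_. p)" "velocity M (\<lambda>_. p) t = 0"
proof -
  let ?c = "chart_at M p"
  note c = chart_at_in[OF assms]
  interpret m: local_metric "snd ?c ` fst ?c" "Gc ?c" by (rule local_metric[OF c(1)])
  have v: "velocity M (\<lambda>_. p) t = 0" for t by (simp add: velocity_def)
  have "smooth_map euclid M UNIV (\<lambda>_::real. p)"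
    by (rule smooth_map_euclidI[OF charts_compatible], rule bexI[OF _ c(1)], rule exI[of _ UNIV])
      (use c in \<open>auto simp: smooth_on_const\<close>)
  moreover have "cov_along M g (\<lambda>_. p) (velocity M (\<lambda>_. p)) t = 0" for t
    using c by (simp add: cov_along_def christoffel_Gam[OF assms] v m.Chr_simps)
  ultimately show "geodesic M g UNIV (\<lambda>_. p)" by (auto simp: geodesic_def)
  show "velocity M (\<lambda>_. p) t = 0" by (rule v)
qed

text \<open>The velocity scales by \<open>k\<close> and both terms of the geodesic equation by the
  square of \<open>k\<close>. Negative \<open>k\<close> is included because generators are also
  followed to negative parameters.\<close>

lemma geodesic_rescale:
  assumes \<gamma>: "geodesic M g I \<gamma>" and k: "k \<noteq> 0"
  shows "geodesic M g {s. k * s \<in> I} (\<lambda>s. \<gamma> (k * s))"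
    "\<And>s. k * s \<in> I \<Longrightarrow> velocity M (\<lambda>s. \<gamma> (k * s)) s = k *\<^sub>R velocity M \<gamma> (k * s)"
proof -
  note g = geodesicD[OF \<gamma>]
  have oI: "open {s. k * s \<in> I}"
    using open_vimage[OF g(1), of "\<lambda>s. k * s"] by (simp add: vimage_def continuous_intros)
  have sc: "((\<lambda>s. f (k * s)) has_vector_derivative k *\<^sub>R f') (at s)"
    if "(f has_vector_derivative f') (at (k * s))" for f :: "real \<Rightarrow> 'e" and f' s
  proof -
    have "((\<lambda>s. k * s) has_vector_derivative k) (at s)" by (auto intro!: derivative_eq_intros)
    from vector_diff_chain_at[OF this that] show ?thesis by (simp add: o_def)
  qed
  have chart: "\<exists>c\<in>charts M. \<exists>D. open D \<and> s \<in> D \<and> (\<lambda>s. \<gamma> (k * s)) ` D \<subseteq> fst c \<and> smooth_on D (\<lambda>s. snd c (\<gamma> (k * s))) \<and>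
     (\<forall>s\<in>D. to_chart M c (\<gamma> (k * s)) (velocity M (\<lambda>s. \<gamma> (k * s)) s) = k *\<^sub>R to_chart M c (\<gamma> (k * s)) (velocity M \<gamma> (k * s))) \<and>
     to_chart M c (\<gamma> (k * s)) (cov_along M g (\<lambda>s. \<gamma> (k * s)) (velocity M (\<lambda>s. \<gamma> (k * s))) s) = 0"
    if s: "k * s \<in> I" for s
  proof -
    have pm: "\<gamma> (k * s) \<in> mpoints M" using g(4) s by blast
    let ?c = "chart_at M (\<gamma> (k * s))"
    note c = chart_at_in[OF pm]
    interpret m: local_metric "snd ?c ` fst ?c" "Gc ?c" by (rule local_metric[OF c(1)])
    obtain D where D: "open D" "k * s \<in> D" "D \<subseteq> I" "\<gamma> ` D \<subseteq> fst ?c" "smooth_on D (\<lambda>s. snd ?c (\<gamma> s))"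
      "smooth_on D (\<lambda>s. to_chart M ?c (\<gamma> s) (velocity M \<gamma> s))"
      "\<And>s. s \<in> D \<Longrightarrow> ((\<lambda>s. snd ?c (\<gamma> s)) has_vector_derivative to_chart M ?c (\<gamma> s) (velocity M \<gamma> s)) (at s)"
      "\<And>s. s \<in> D \<Longrightarrow> ((\<lambda>s. to_chart M ?c (\<gamma> s) (velocity M \<gamma> s)) has_vector_derivative
        - Gam ?c (snd ?c (\<gamma> s)) (to_chart M ?c (\<gamma> s) (velocity M \<gamma> s)) (to_chart M ?c (\<gamma> s) (velocity M \<gamma> s))) (at s)"
      by (rule geodesic_chart[OF \<gamma> s c]) (rule that)
    define E where "E = {s. k * s \<in> D}"
    have E: "open E" unfolding E_def
      using open_vimage[OF D(1), of "\<lambda>s. k * s"] by (simp add: vimage_def continuous_intros)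
    have sE: "s \<in> E" using D by (simp add: E_def)
    have gE: "(\<lambda>s. \<gamma> (k * s)) ` E \<subseteq> fst ?c" using D(4) by (auto simp: E_def)
    have smE: "smooth_on E (\<lambda>s. snd ?c (\<gamma> (k * s)))"
      by (rule smooth_on_compose[OF D(5) _ _ E D(1)])
        (auto simp: E_def intro!: smooth_on_mult smooth_on_const smooth_on_ident E[unfolded E_def])
    have xd: "((\<lambda>s. snd ?c (\<gamma> (k * s))) has_vector_derivative k *\<^sub>R to_chart M ?c (\<gamma> (k * s)) (velocity M \<gamma> (k * s))) (at s)"
      if "s \<in> E" for s
      by (rule sc[OF D(7)]) (use that in \<open>simp add: E_def\<close>)
    have ve: "to_chart M ?c (\<gamma> (k * s)) (velocity M (\<lambda>s. \<gamma> (k * s)) s) = k *\<^sub>R to_chart M ?c (\<gamma> (k * s)) (velocity M \<gamma> (k * s))"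
      if "s \<in> E" for s
      by (rule velocity_chart(1)[OF c(1) E that gE xd[OF that]])
    let ?v = "to_chart M ?c (\<gamma> (k * s)) (velocity M \<gamma> (k * s))"
    have "((\<lambda>s. k *\<^sub>R to_chart M ?c (\<gamma> (k * s)) (velocity M \<gamma> (k * s))) has_vector_derivative
        k *\<^sub>R (k *\<^sub>R (- Gam ?c (snd ?c (\<gamma> (k * s))) ?v ?v))) (at s)"
      using bounded_linear.has_vector_derivative[OF bounded_linear_scaleR_right sc[OF D(8)[OF D(2)]]] by simp
    then have "((\<lambda>s. to_chart M ?c (\<gamma> (k * s)) (velocity M (\<lambda>s. \<gamma> (k * s)) s)) has_vector_derivative
        k *\<^sub>R (k *\<^sub>R (- Gam ?c (snd ?c (\<gamma> (k * s))) ?v ?v))) (at s)"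
      by (rule has_vector_derivative_transform_within_open[OF _ E sE]) (simp add: ve)
    from cov_along_chart[OF c(1) E sE gE xd[OF sE] this]
    have "to_chart M ?c (\<gamma> (k * s)) (cov_along M g (\<lambda>s. \<gamma> (k * s)) (velocity M (\<lambda>s. \<gamma> (k * s))) s) = 0"
      using c by (simp add: ve[OF sE] m.Chr_simps)
    then show ?thesis
      using c E sE gE smE ve by (intro bexI[of _ ?c] exI[of _ E]) auto
  qed
  show v: "velocity M (\<lambda>s. \<gamma> (k * s)) s = k *\<^sub>R velocity M \<gamma> (k * s)" if s: "k * s \<in> I" for s
  proof -
    obtain c D where c: "c \<in> charts M" "s \<in> D" "(\<lambda>s. \<gamma> (k * s)) ` D \<subseteq> fst c"
      "\<forall>s\<in>D. to_chart M c (\<gamma> (k * s)) (velocity M (\<lambda>s. \<gamma> (k * s)) s) = k *\<^sub>R to_chart M c (\<gamma> (k * s)) (velocity M \<gamma> (k * s))"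
      using chart[OF s] by blast
    then have "\<gamma> (k * s) \<in> fst c" by blast
    then show ?thesis using c by (metis to_chart_inj to_chart_simps(3))
  qed
  have "smooth_map euclid M {s. k * s \<in> I} (\<lambda>s. \<gamma> (k * s))"
    by (rule smooth_map_euclidI[OF charts_compatible]) (use chart in blast)
  moreover have "cov_along M g (\<lambda>s. \<gamma> (k * s)) (velocity M (\<lambda>s. \<gamma> (k * s))) s = 0" if s: "k * s \<in> I" for s
  proof -
    obtain c D where c: "c \<in> charts M" "s \<in> D" "(\<lambda>s. \<gamma> (k * s)) ` D \<subseteq> fst c"
      "to_chart M c (\<gamma> (k * s)) (cov_along M g (\<lambda>s. \<gamma> (k * s)) (velocity M (\<lambda>s. \<gamma> (k * s))) s) = 0"
      using chart[OF s] by blast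
    then have "\<gamma> (k * s) \<in> fst c" by blast
    then show ?thesis using c to_chart_0_iff by blast
  qed
  moreover have "is_interval {s. k * s \<in> I}"
  proof -
    have "s \<in> {s. k * s \<in> I}" if "k * a \<in> I" "k * b \<in> I" "a \<le> s" "s \<le> b" for a b s
    proof (cases "k > 0")
      case True
      then show ?thesis using g(2) that mem_is_interval_1_I[of I "k * a" "k * b" "k * s"] by auto
    next
      case False
      then show ?thesis using g(2) that k mem_is_interval_1_I[of I "k * b" "k * a" "k * s"] by auto
    qed
    then show ?thesis unfolding is_interval_1 by blast
  qed
  ultimately show "geodesic M g {s. k * s \<in> I} (\<lambda>s. \<gamma> (k * s))"
    using oI by (simp add: geodesic_def)
qed

lemma geodesic_speed_constant:
  assumes \<gamma>: "geodesic M g I \<gamma>" and "s \<in> I" "t \<in> I"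
  shows "g (\<gamma> s) (velocity M \<gamma> s) (velocity M \<gamma> s) = g (\<gamma> t) (velocity M \<gamma> t) (velocity M \<gamma> t)"
proof -
  note gd = geodesicD[OF \<gamma>]
  note sv = smooth_along_velocity[OF gd(3,1,4)]
  have "((\<lambda>t. g (\<gamma> t) (velocity M \<gamma> t) (velocity M \<gamma> t)) has_real_derivative 0) (at t)" if t: "t \<in> I" for t
  proof -
    have pm: "\<gamma> t \<in> mpoints M" using gd(4) t by blast
    show ?thesis
      using metric_along_derivative[OF sv sv gd(1,4) t] gd(5)[OF t] by (simp add: g_simps[OF pm])
  qed
  then obtain c where "\<forall>t\<in>I. g (\<gamma> t) (velocity M \<gamma> t) (velocity M \<gamma> t) = c"
    using has_field_derivative_zero_constant[of I "\<lambda>t. g (\<gamma> t) (velocity M \<gamma> t) (velocity M \<gamma> t)"]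
      is_interval_convex[OF gd(2)] has_field_derivative_at_within by blast
  then show ?thesis using assms by simp
qed

end

section \<open>Global uniqueness of geodesics and the values of the exponential map\<close>

locale lorentz_manifold = lorentz +
  assumes hausdorff: "Hausdorff_space (mtopology M)"
begin

lemma topspace_mtopology: "topspace (mtopology M) = mpoints M"
proof -
  have "openin (mtopology M) (mpoints M)"
    unfolding openin_mtopology_charts[OF charts_compatible]
  proof (intro conjI ballI subset_refl)
    fix c assume c: "c \<in> charts M"
    then have "mpoints M \<inter> fst c = fst c" by (auto simp: mpoints_def)
    then show "open (snd c ` (mpoints M \<inter> fst c))" using chart_open[OF c] by simp
  qed
  then have "mpoints M \<subseteq> topspace (mtopology M)" by (rule openin_subset)
  moreover have "topspace (mtopology M) \<subseteq> mpoints M"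
    using openin_topspace openin_mtopology_charts[OF charts_compatible] by blast
  ultimately show ?thesis by blast
qed

text \<open>A connectedness argument. The set of times with equal points and velocities is open by
  local uniqueness. Its complement is open too: distinct points are separated by the Hausdorff
  property, and distinct velocities at a common point stay distinct by continuity in a
  chart.\<close>

lemma geodesic_uniqueness:
  assumes \<gamma>: "geodesic M g I \<gamma>" and \<delta>: "geodesic M g I' \<delta>" and "t0 \<in> I \<inter> I'"
    and eq: "\<gamma> t0 = \<delta> t0" "velocity M \<gamma> t0 = velocity M \<delta> t0" and t: "t \<in> I \<inter> I'"
  shows "\<gamma> t = \<delta> t"
proof -
  note g = geodesicD[OF \<gamma>] and d = geodesicD[OF \<delta>]
  define E where "E = {t \<in> I \<inter> I'. \<gamma> t = \<delta> t \<and> velocity M \<gamma> t = velocity M \<delta> t}"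
  have oI: "open (I \<inter> I')" using g d by blast
  have "open E"
  proof (subst open_subopen, intro ballI)
    fix t assume "t \<in> E"
    then have t: "t \<in> I" "t \<in> I'" "\<gamma> t = \<delta> t" "velocity M \<gamma> t = velocity M \<delta> t" by (auto simp: E_def)
    obtain e where e: "e > 0" "\<And>s. s \<in> {t-e<..<t+e} \<Longrightarrow> s \<in> I \<and> s \<in> I' \<and> \<gamma> s = \<delta> s"
      by (rule geodesic_local_uniqueness[OF \<gamma> t(1) \<delta> t(2) t(3,4)]) (rule that)
    have "velocity M \<gamma> s = velocity M \<delta> s" if "s \<in> {t-e<..<t+e}" for s
      by (rule velocity_cong[OF open_greaterThanLessThan that]) (use e in blast)
    then show "\<exists>T. open T \<and> t \<in> T \<and> T \<subseteq> E"
      using e by (intro exI[of _ "{t-e<..<t+e}"]) (auto simp: E_def)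
  qed
  moreover have "open ((I \<inter> I') - E)"
  proof (subst open_subopen, intro ballI)
    fix t assume t: "t \<in> (I \<inter> I') - E"
    then have tI: "t \<in> I" "t \<in> I'" by auto
    show "\<exists>T. open T \<and> t \<in> T \<and> T \<subseteq> (I \<inter> I') - E"
    proof (cases "\<gamma> t = \<delta> t")
      case False
      have "\<gamma> t \<in> topspace (mtopology M)" "\<delta> t \<in> topspace (mtopology M)"
        using g(4) d(4) tI by (auto simp: topspace_mtopology)
      then obtain U V where UV: "openin (mtopology M) U" "openin (mtopology M) V" "\<gamma> t \<in> U" "\<delta> t \<in> V" "disjnt U V"
        using hausdorff False unfolding Hausdorff_space_def by meson
      obtain D where D: "open D" "t \<in> D" "D \<subseteq> I" "\<gamma> ` D \<subseteq> U"
        using smooth_map_euclid_preimage[OF g(3,1) tI(1) UV(1,3)] .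
      obtain D' where D': "open D'" "t \<in> D'" "D' \<subseteq> I'" "\<delta> ` D' \<subseteq> V"
        using smooth_map_euclid_preimage[OF d(3,1) tI(2) UV(2,4)] .
      have "\<gamma> s \<noteq> \<delta> s" if "s \<in> D \<inter> D'" for s using that D(4) D'(4) UV(5) by (auto simp: disjnt_def)
      then show ?thesis using D D' by (intro exI[of _ "D \<inter> D'"]) (auto simp: E_def)
    next
      case True
      then have v: "velocity M \<gamma> t \<noteq> velocity M \<delta> t" using t by (auto simp: E_def)
      have pm: "\<gamma> t \<in> mpoints M" using g(4) tI by blast
      let ?c = "chart_at M (\<gamma> t)"
      note c = chart_at_in[OF pm]
      have c': "\<delta> t \<in> fst ?c" using c True by simp
      obtain D where D: "open D" "t \<in> D" "D \<subseteq> I" "\<gamma> ` D \<subseteq> fst ?c"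
         "smooth_on D (\<lambda>s. to_chart M ?c (\<gamma> s) (velocity M \<gamma> s))"
        by (rule geodesic_chart[OF \<gamma> tI(1) c]) (rule that)
      obtain D' where D': "open D'" "t \<in> D'" "D' \<subseteq> I'" "\<delta> ` D' \<subseteq> fst ?c"
         "smooth_on D' (\<lambda>s. to_chart M ?c (\<delta> s) (velocity M \<delta> s))"
        by (rule geodesic_chart[OF \<delta> tI(2) c(1) c']) (rule that)
      define h where "h s = to_chart M ?c (\<gamma> s) (velocity M \<gamma> s) - to_chart M ?c (\<delta> s) (velocity M \<delta> s)" for s
      have oDD: "open (D \<inter> D')" using D D' by blast
      have "smooth_on (D \<inter> D') h" unfolding h_def
        by (intro smooth_on_diff oDD smooth_on_subset[OF D(5)] smooth_on_subset[OF D'(5)]) auto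
      then have "open ((D \<inter> D') \<inter> h -` (- {0}))"
        by (intro continuous_open_preimage smooth_on_continuous_on oDD) auto
      moreover have "h t \<noteq> 0" using v True to_chart_inj[OF c] by (simp add: h_def)
      moreover have "s \<notin> E" if "h s \<noteq> 0" for s using that by (auto simp: E_def h_def)
      ultimately show ?thesis
        using D D' by (intro exI[of _ "(D \<inter> D') \<inter> h -` (- {0})"]) auto
    qed
  qed
  moreover have "connected (I \<inter> I')"
    using is_interval_Int[OF g(2) d(2)] is_interval_connected by blast
  ultimately have "E \<inter> (I \<inter> I') = {} \<or> ((I \<inter> I') - E) \<inter> (I \<inter> I') = {}"
    by (intro connectedD) auto
  moreover have "t0 \<in> E" using assms by (auto simp: E_def)
  ultimately have "t \<in> E" using t assms(3) by auto
  then show ?thesis by (simp add: E_def)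
qed

lemma exp_map_eq: assumes \<gamma>: "unit_geodesic M g p v \<gamma>" shows "exp_map M g (p, v) = \<gamma> 1"
proof -
  have "\<delta> 1 = \<gamma> 1" if \<delta>: "unit_geodesic M g p v \<delta>" for \<delta>
  proof -
    obtain I where I: "{0..1} \<subseteq> I" "geodesic M g I \<gamma>" using \<gamma> unfolding unit_geodesic_def by blast
    obtain I' where I': "{0..1} \<subseteq> I'" "geodesic M g I' \<delta>" using \<delta> unfolding unit_geodesic_def by blast
    show ?thesis
      by (rule geodesic_uniqueness[OF I'(2) I(2), of 0]) (use I I' \<gamma> \<delta> in \<open>auto simp: unit_geodesic_def\<close>)
  qed
  then have "(THE q. \<exists>\<gamma>. unit_geodesic M g p v \<gamma> \<and> \<gamma> 1 = q) = \<gamma> 1"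
    by (intro the_equality) (use \<gamma> in blast)+
  then show ?thesis by (simp add: exp_map_def)
qed

lemma exp_map_zero: "p \<in> mpoints M \<Longrightarrow> exp_map M g (p, 0) = p"
  using exp_map_eq[of p 0 "\<lambda>_. p"] const_geodesic[of p] unfolding unit_geodesic_def by blast

text \<open>Rescaling \<gamma> by \<open>s / k\<close> gives the geodesic with initial velocity
  \<open>s *\<^sub>R v\<close>, whose value at time 1 is the claim. A zero factor is not a
  rescaling, so \<open>s = 0\<close> is settled by the constant geodesic.\<close>

lemma exp_map_ray:
  assumes \<gamma>: "geodesic M g I \<gamma>" "{0..1} \<subseteq> I" "\<gamma> 0 = p" "velocity M \<gamma> 0 = k *\<^sub>R v" and k: "k \<noteq> 0" and s: "s / k \<in> I"
  shows "exp_map M g (p, s *\<^sub>R v) = \<gamma> (s / k)"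
proof (cases "s = 0")
  case True
  have "p \<in> mpoints M" using geodesicD(4)[OF \<gamma>(1)] \<gamma>(2,3) by force
  then show ?thesis using True \<gamma>(3) exp_map_zero by simp
next
  case False
  then have sk: "s / k \<noteq> 0" using k by simp
  have "0 \<in> I" using \<gamma>(2) by auto
  have "{0..1} \<subseteq> {r. s / k * r \<in> I}"
  proof
    fix r :: real assume r: "r \<in> {0..1}"
    show "r \<in> {r. s / k * r \<in> I}"
    proof (cases "s / k \<ge> 0")
      case True
      then have "0 \<le> s / k * r" by (rule mult_nonneg_nonneg) (use r in simp)
      moreover have "s / k * r \<le> s / k" using True r mult_left_le[of r "s / k"] by simp
      ultimately      show ?thesis using mem_is_interval_1_I[OF geodesicD(2)[OF \<gamma>(1)] \<open>0 \<in> I\<close> s] by blast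
    next
      case False
      then have "s / k * r \<le> 0" by (intro mult_nonpos_nonneg) (use r in auto)
      moreover have "s / k \<le> s / k * r" using False r mult_left_le[of r "- (s / k)"] by simp
      ultimately show ?thesis using mem_is_interval_1_I[OF geodesicD(2)[OF \<gamma>(1)] s \<open>0 \<in> I\<close>] by blast
    qed
  qed
  moreover have "velocity M (\<lambda>r. \<gamma> (s / k * r)) 0 = s *\<^sub>R v"
    using geodesic_rescale(2)[OF \<gamma>(1) sk, of 0] \<open>0 \<in> I\<close> \<gamma>(4) k by simp
  ultimately have "unit_geodesic M g p (s *\<^sub>R v) (\<lambda>r. \<gamma> (s / k * r))"
    using geodesic_rescale(1)[OF \<gamma>(1) sk] \<gamma>(3) unfolding unit_geodesic_def by auto
  then show ?thesis using exp_map_eq by fastforce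
qed

end

subsection \<open>Linear algebra of definite subspaces and traces\<close>

text \<open>Nothing is assumed of \<open>b\<close> outside \<open>W\<close>. In a Euclidean
  orthonormal basis of \<open>W\<close>, restricting \<open>b w\<close> to \<open>W\<close> becomes
  an endomorphism of \<open>W\<close>; definiteness makes it injective, hence onto.\<close>

lemma definite_subspace_Riesz:
  fixes b :: "'a::euclidean_space \<Rightarrow> 'a \<Rightarrow> real"
  assumes b: "bilinear b" and W: "subspace W" and pos: "\<And>w. w \<in> W \<Longrightarrow> w \<noteq> 0 \<Longrightarrow> b w w > 0"
    and f: "linear (f :: 'a \<Rightarrow> real)"
  shows "\<exists>w\<in>W. \<forall>z\<in>W. b w z = f z"
proof -
  obtain B where B: "B \<subseteq> W" "pairwise orthogonal B" "\<And>x. x \<in> B \<Longrightarrow> norm x = 1" "independent B" "span B = W"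
    by (rule orthonormal_basis_subspace[OF W]) (rule that)
  have fin: "finite B" using B(4) by (simp add: independent_imp_finite)
  define T where "T h = (\<Sum>e\<in>B. h e *\<^sub>R e)" for h :: "'a \<Rightarrow> real"
  have T: "T h \<bullet> e = h e" if e: "e \<in> B" for h e
  proof -
    have "T h \<bullet> e = (\<Sum>e'\<in>B. h e' * (e' \<bullet> e))" by (simp add: T_def inner_sum_left)
    also have "\<dots> = (\<Sum>e'\<in>B. if e' = e then h e else 0)"
      using B(2,3) e by (intro sum.cong refl) (auto simp: pairwise_def orthogonal_def norm_eq_1)
    also have "\<dots> = h e" using fin e by simp
    finally show ?thesis .
  qed
  have TW: "T h \<in> W" for h unfolding T_def using B(1) W by (intro subspace_sum subspace_scale) auto
  have lin: "linear (\<lambda>w. T (b w))"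
    unfolding T_def by (intro linearI)
      (simp_all add: bilinear_ladd[OF b] bilinear_lmul[OF b] scaleR_left_distrib sum.distrib scaleR_right.sum)
  have ext: "b w z = h z" if "linear h" "\<And>e. e \<in> B \<Longrightarrow> b w e = h e" "z \<in> W" for w h z
    using linear_eq_on_span[OF bilinear_linear_right[OF b, of w] that(1), of B z] that B(5) by blast
  have "w = 0" if w: "w \<in> W" and "T (b w) = 0" for w
  proof -
    have "b w e = 0" if "e \<in> B" for e using T[OF that, of "b w"] \<open>T (b w) = 0\<close> by simp
    then have "b w w = 0" using ext[of "\<lambda>_. 0" w w] w by (simp add: linear_zero)
    then show "w = 0" using pos[OF w] by fastforce
  qed
  then have inj: "inj_on (\<lambda>w. T (b w)) W"
    using linear_inj_on_iff_eq_0[OF lin W] by simp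
  have "(\<lambda>w. T (b w)) ` W = W"
  proof (rule subspace_dim_equal)
    show "subspace ((\<lambda>w. T (b w)) ` W)" by (rule linear_subspace_image[OF lin W])
    have "dim ((\<lambda>w. T (b w)) ` W) = dim W" by (rule dim_image_eq[OF lin]) (use inj W in \<open>simp add: span_eq_iff[THEN iffD2]\<close>)
    then show "dim W \<le> dim ((\<lambda>w. T (b w)) ` W)" by simp
  qed (use W TW in auto)
  then obtain w where w: "w \<in> W" "T (b w) = T f" using TW[of f] by (metis imageE)
  then have "b w e = f e" if "e \<in> B" for e using T[OF that] by metis
  then show ?thesis using ext[OF f] w(1) by blast
qed

lemma trace_rank_one:
  fixes a :: "'a::euclidean_space"
  assumes "linear (l :: 'a \<Rightarrow> real)"
  shows "(\<Sum>e\<in>Basis. (l e *\<^sub>R a) \<bullet> e) = l a"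
  using linear_Basis_sum[OF assms, of a] by (simp add: mult.commute)

text \<open>The plane spanned by \<open>U\<close> and \<open>V\<close> is nondegenerate, so its
  orthogonal complement \<open>K\<close> has codimension two. \<open>W\<close> is contained in
  \<open>K\<close> and has the same dimension.\<close>

lemma null_pair_complement:
  fixes b :: "'a::euclidean_space \<Rightarrow> 'a \<Rightarrow> real"
  assumes b: "bilinear b" and sym: "\<And>x y. b x y = b y x"
    and UV: "b U U = 0" "b V V = 0" "b U V = -1"
    and W: "subspace W" "\<And>w. w \<in> W \<Longrightarrow> b w U = 0" "\<And>w. w \<in> W \<Longrightarrow> b w V = 0"
    and dim: "dim W + 2 = DIM('a)" and z: "b z U = 0" "b z V = 0"
  shows "z \<in> W"
proof -
  note bs = bilinear_ladd[OF b] bilinear_radd[OF b] bilinear_lmul[OF b] bilinear_rmul[OF b] bilinear_lzero[OF b] bilinear_rzero[OF b]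
  define K where "K = {v. b v U = 0 \<and> b v V = 0}"
  have K: "subspace K" unfolding K_def subspace_def by (auto simp: bs)
  have VU: "b V U = -1" using UV sym by simp
  have sp: "x \<in> span {U, V} \<longleftrightarrow> (\<exists>a c. x = a *\<^sub>R U + c *\<^sub>R V)" for x
    unfolding span_insert span_singleton by (auto simp: algebra_simps)
  have "U \<noteq> V" "U \<noteq> 0" "V \<noteq> 0" using UV by (auto simp: bs)
  have "independent {U, V}"
  proof -
    have "U \<notin> span {V}"
    proof
      assume "U \<in> span {V}"
      then obtain c where "U = c *\<^sub>R V" by (auto simp: span_singleton)
      then have "b U V = c * b V V" by (simp add: bs)
      then show False using UV by simp
    qed
    then show ?thesis using \<open>V \<noteq> 0\<close> by (simp add: independent_insert)
  qed
  then have d2: "dim (span {U, V}) = 2" using \<open>U \<noteq> V\<close> by (simp add: dim_eq_card_independent)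
  have "K \<inter> span {U, V} = {0}"
  proof (intro equalityI subsetI)
    fix x assume x: "x \<in> K \<inter> span {U, V}"
    then obtain a c where ac: "x = a *\<^sub>R U + c *\<^sub>R V" using sp by blast
    have "b x U = - c" "b x V = - a" unfolding ac by (simp_all add: bs UV VU)
    then show "x \<in> {0}" using x ac by (simp add: K_def)
  qed (simp add: subspace_0 K)
  moreover have "{x + y |x y. x \<in> K \<and> y \<in> span {U, V}} = UNIV"
  proof -
    have "v \<in> {x + y |x y. x \<in> K \<and> y \<in> span {U, V}}" for v
    proof -
      \<comment> \<open>The component of \<open>v\<close> in the plane of \<open>U\<close> and
        \<open>V\<close>. The coefficients are crossed and negated because \<open>b U V = -1\<close>
        while both vectors are null.\<close>
      define y where "y = (- b v V) *\<^sub>R U + (- b v U) *\<^sub>R V"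
      have "y \<in> span {U, V}" unfolding sp y_def by blast
      moreover have "v - y \<in> K" unfolding K_def y_def
        by (simp add: bilinear_lsub[OF b] bilinear_lneg[OF b] bs UV VU)
      ultimately show ?thesis by (metis (mono_tags, lifting) diff_add_cancel mem_Collect_eq)
    qed
    then show ?thesis by blast
  qed
  ultimately have "dim K + 2 = DIM('a)"
    using dim_sums_Int[OF K subspace_span[of "{U, V}"]] d2 by simp
  then have "W = K"
    by (intro subspace_dim_equal W K) (use W dim in \<open>auto simp: K_def\<close>)
  then show ?thesis using z by (simp add: K_def)
qed

text \<open>Relative to the splitting by \<open>W\<close>, \<open>U\<close> and \<open>V\<close>, the diagonal of \<open>A\<close> is \<open>lam\<close> on \<open>W\<close> and zero on \<open>U\<close> and \<open>V\<close>.\<close>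

lemma trace_null_decomposition:
  fixes b :: "'a::euclidean_space \<Rightarrow> 'a \<Rightarrow> real" and A :: "'a \<Rightarrow> 'a"
  assumes b: "bilinear b" and sym: "\<And>x y. b x y = b y x"
    and UV: "b U U = 0" "b V V = 0" "b U V = -1"
    and W: "\<And>z. b z U = 0 \<Longrightarrow> b z V = 0 \<Longrightarrow> z \<in> W"
    and A: "linear A" "A U = 0" "b (A V) U = 0"
    and AW: "\<And>w. w \<in> W \<Longrightarrow> b w V = 0" "\<And>w. w \<in> W \<Longrightarrow> \<exists>f. A w = lam *\<^sub>R w - f *\<^sub>R U"
  shows "(\<Sum>e\<in>Basis. A e \<bullet> e) = lam * (real DIM('a) - 2)"
proof -
  note bs = bilinear_ladd[OF b] bilinear_radd[OF b] bilinear_lmul[OF b] bilinear_rmul[OF b] bilinear_lzero[OF b] bilinear_rzero[OF b]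
    bilinear_lsub[OF b]
  have VU: "b V U = -1" using UV sym by simp
  have AF: "A w = lam *\<^sub>R w - b (A w) V *\<^sub>R U" if w: "w \<in> W" for w
  proof -
    obtain f where f: "A w = lam *\<^sub>R w - f *\<^sub>R U" using AW(2)[OF w] by blast
    then have "b (A w) V = f" by (simp add: bs UV AW(1)[OF w])
    then show ?thesis using f by simp
  qed
  \<comment> \<open>The projection onto \<open>W\<close> along \<open>U\<close> and
    \<open>V\<close>; the plus signs again come from \<open>b U V = -1\<close>.\<close>
  define P where "P v = v + b v V *\<^sub>R U + b v U *\<^sub>R V" for v
  have lP: "linear P" unfolding P_def by (intro linearI) (simp_all add: bs algebra_simps)
  have PW: "P v \<in> W" for v by (rule W) (simp_all add: P_def bs UV VU)
  have PU: "P U = 0" by (simp add: P_def UV)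
  have lb: "linear (\<lambda>v. b v x)" for x by (rule bilinear_linear_left[OF b])
  have lF: "linear (\<lambda>v. b (A (P v)) V)"
    using linear_compose[OF linear_compose[OF lP A(1)] lb[of V]] by (simp add: o_def)
  \<comment> \<open>\<open>A\<close> becomes \<open>lam\<close> times the identity plus four maps of
    rank one, whose traces in the Euclidean basis \<open>trace_rank_one\<close> evaluates although
    that basis is not adapted to \<open>W\<close>, \<open>U\<close> and \<open>V\<close>.\<close>
  have Av: "A v = lam *\<^sub>R v + lam *\<^sub>R (b v V *\<^sub>R U) + lam *\<^sub>R (b v U *\<^sub>R V) - b (A (P v)) V *\<^sub>R U - b v U *\<^sub>R A V" for v
  proof -
    have "A (P v) = A v + b v U *\<^sub>R A V"
      by (simp add: P_def linear_add[OF A(1)] linear_scale[OF A(1)] A(2))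
    then have "A v = A (P v) - b v U *\<^sub>R A V" by simp
    also have "A (P v) = lam *\<^sub>R P v - b (A (P v)) V *\<^sub>R U" by (rule AF[OF PW])
    finally show ?thesis by (simp add: P_def scaleR_right_distrib)
  qed
  have "(\<Sum>e\<in>Basis. A e \<bullet> e) = (\<Sum>e\<in>Basis. lam * (e \<bullet> e) + lam * ((b e V *\<^sub>R U) \<bullet> e) + lam * ((b e U *\<^sub>R V) \<bullet> e)
      - (b (A (P e)) V *\<^sub>R U) \<bullet> e - (b e U *\<^sub>R A V) \<bullet> e)"
    by (rule sum.cong[OF refl], subst Av) (simp add: inner_add_left inner_diff_left)
  also have "\<dots> = lam * (\<Sum>e\<in>(Basis::'a set). e \<bullet> e) + lam * (\<Sum>e\<in>Basis. (b e V *\<^sub>R U) \<bullet> e) + lam * (\<Sum>e\<in>Basis. (b e U *\<^sub>R V) \<bullet> e)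
      - (\<Sum>e\<in>Basis. (b (A (P e)) V *\<^sub>R U) \<bullet> e) - (\<Sum>e\<in>Basis. (b e U *\<^sub>R A V) \<bullet> e)"
    unfolding sum_subtractf sum.distrib sum_distrib_left ..
  also have "\<dots> = lam * real DIM('a) + lam * b U V + lam * b V U - b (A (P U)) V - b (A V) U"
    unfolding trace_rank_one[OF lb] trace_rank_one[OF lF] by simp
  finally show ?thesis by (simp add: UV VU PU A linear_0[OF A(1)] bs algebra_simps)
qed

text \<open>Every vector Euclidean orthogonal to \<open>L\<close> is orthogonal to the curve and
  hence to its derivative; the double orthogonal complement of \<open>L\<close> is
  \<open>L\<close>.\<close>

lemma derivative_in_subspace:
  fixes L :: "'a::euclidean_space set"
  assumes L: "subspace L" and D: "open D" "t \<in> D" "\<And>s. s \<in> D \<Longrightarrow> f s \<in> L"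
    and f: "(f has_vector_derivative f') (at t)"
  shows "f' \<in> L"
proof -
  have "orthogonal w f'" if w: "w \<in> L\<^sup>\<bottom>" for w
  proof -
    have z: "w \<bullet> f s = 0" if "s \<in> D" for s
      using w D(3)[OF that] unfolding orthogonal_comp_def orthogonal_def by (auto simp: inner_commute)
    have "((\<lambda>s. w \<bullet> f s) has_vector_derivative w \<bullet> f') (at t)"
      by (rule bounded_linear.has_vector_derivative[OF bounded_linear_inner_right f])
    then have "((\<lambda>s. 0) has_vector_derivative w \<bullet> f') (at t)"
      by (rule has_vector_derivative_transform_within_open[OF _ D(1,2)]) (simp add: z)
    then show ?thesis using vector_derivative_unique_at[OF _ has_vector_derivative_const] by (auto simp: orthogonal_def)
  qed
  then have "f' \<in> L\<^sup>\<bottom>\<^sup>\<bottom>" unfolding orthogonal_comp_def by (auto simp: orthogonal_commute)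
  then show ?thesis using orthogonal_comp_self[OF L] by simp
qed

subsection \<open>Embedded submanifolds\<close>

context atlas
begin

lemma smooth_field_along_curve:
  fixes \<alpha> :: "'v::euclidean_space \<Rightarrow> 'm"
  assumes Y: "smooth_field_on M A Y" and \<alpha>: "smooth_map euclid M I \<alpha>" "open I" "\<alpha> ` I \<subseteq> A"
  shows "smooth_map euclid (tangent_bundle M) I (\<lambda>t. (\<alpha> t, Y (\<alpha> t)))"
proof (rule smooth_alongI)
  fix t assume t: "t \<in> I"
  then have pm: "\<alpha> t \<in> mpoints M" using smooth_map_mpoints[OF \<alpha>(1)] by blast
  let ?c = "chart_at M (\<alpha> t)"
  note c = chart_at_in[OF pm]
  obtain D where D: "open D" "t \<in> D" "D \<subseteq> I" "\<alpha> ` D \<subseteq> fst ?c" "smooth_on D (\<lambda>s. snd ?c (\<alpha> s))"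
    using smooth_map_euclidD[OF \<alpha>(1,2) t c] .
  have "\<alpha> t \<in> A" using \<alpha>(3) t by blast
  obtain E Yh where E: "open E" "snd ?c (\<alpha> t) \<in> E" "smooth_on E Yh"
    "\<And>q. q \<in> A \<Longrightarrow> q \<in> fst ?c \<Longrightarrow> snd ?c q \<in> E \<Longrightarrow> to_chart M ?c q (Y q) = Yh (snd ?c q)"
    by (rule smooth_fieldD[OF Y \<open>\<alpha> t \<in> A\<close> c]) (rule that)
  define F where "F = D \<inter> (\<lambda>s. snd ?c (\<alpha> s)) -` E"
  have F: "open F" unfolding F_def
    by (rule continuous_open_preimage[OF smooth_on_continuous_on[OF D(5)] D(1) E(1)])
  have smF: "smooth_on F (\<lambda>s. snd ?c (\<alpha> s))" by (rule smooth_on_subset[OF D(5)]) (auto simp: F_def)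
  have "smooth_on F (\<lambda>s. Yh (snd ?c (\<alpha> s)))"
    by (rule smooth_on_compose[OF E(3) smF _ F E(1)]) (auto simp: F_def)
  then have "smooth_on F (\<lambda>s. to_chart M ?c (\<alpha> s) (Y (\<alpha> s)))"
  proof (rule smooth_on_cong[OF _ F])
    fix s assume "s \<in> F"
    then have "\<alpha> s \<in> A" "\<alpha> s \<in> fst ?c" "snd ?c (\<alpha> s) \<in> E" using D \<alpha>(3) by (auto simp: F_def)
    then show "Yh (snd ?c (\<alpha> s)) = to_chart M ?c (\<alpha> s) (Y (\<alpha> s))" using E(4) by simp
  qed
  moreover have "t \<in> F" "\<alpha> ` F \<subseteq> fst ?c" using D E by (auto simp: F_def)
  ultimately show "\<exists>c\<in>charts M. \<exists>D. open D \<and> t \<in> D \<and> \<alpha> ` D \<subseteq> fst c \<and> smooth_on D (\<lambda>s. snd c (\<alpha> s)) \<and>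
    smooth_on D (\<lambda>s. to_chart M c (\<alpha> s) (Y (\<alpha> s)))"
    using c(1) F smF by blast
qed

lemma curve_through_Int:
  assumes \<alpha>: "curve_through M A q v \<alpha>" and W: "openin (mtopology M) W" "q \<in> W"
  shows "curve_through M (A \<inter> W) q v \<alpha>"
proof -
  obtain e where e: "e > 0" "smooth_map euclid M {-e<..<e} \<alpha>" "\<alpha> ` {-e<..<e} \<subseteq> A" "\<alpha> 0 = q" "velocity M \<alpha> 0 = v"
    using \<alpha> unfolding curve_through_def by blast
  have 0: "0 \<in> {-e<..<e}" "\<alpha> 0 \<in> W" using e W by auto
  obtain D where D: "open D" "0 \<in> D" "D \<subseteq> {-e<..<e}" "\<alpha> ` D \<subseteq> W"
    using smooth_map_euclid_preimage[OF e(2) open_greaterThanLessThan 0(1) W(1) 0(2)] .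
  obtain r where r: "r > 0" "ball 0 r \<subseteq> D" using D(1,2) openE by blast
  have b: "ball (0::real) r = {-r<..<r}" by (auto simp: ball_def dist_real_def)
  have sub: "{-r<..<r} \<subseteq> D" "{-r<..<r} \<subseteq> {-e<..<e}" using r D b by auto
  show ?thesis unfolding curve_through_def
    by (rule exI[of _ r]) (use r e D sub smooth_map_subset[OF e(2) sub(2)] in \<open>auto simp: image_subset_iff subset_iff\<close>)
qed

lemma curve_through_mono: "curve_through M A q v \<alpha> \<Longrightarrow> A \<subseteq> B \<Longrightarrow> curve_through M B q v \<alpha>"
  unfolding curve_through_def by blast

lemma tangent_space_Int:
  assumes "openin (mtopology M) W" "q \<in> W"
  shows "tangent_space M (A \<inter> W) q = tangent_space M A q"
  unfolding tangent_space_def using curve_through_Int[OF _ assms, of A] curve_through_mono[of "A \<inter> W"] by blast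

text \<open>Adapted charts, transported to a given chart \<open>c\<close> of the atlas.\<close>

definition flattening ::
    "('m, 'e) chart \<Rightarrow> 'm set \<Rightarrow> nat \<Rightarrow> 'e set \<Rightarrow> 'e set \<Rightarrow> ('e \<Rightarrow> 'e) \<Rightarrow> ('e \<Rightarrow> 'e) \<Rightarrow> 'e set \<Rightarrow> bool" where
  "flattening c S k D V \<phi> \<psi> L \<longleftrightarrow> open D \<and> open V \<and> V \<subseteq> snd c ` fst c \<and> smooth_on D \<phi> \<and> smooth_on V \<psi> \<and>
    \<phi> ` D \<subseteq> V \<and> \<psi> ` V \<subseteq> D \<and> (\<forall>x\<in>V. \<phi> (\<psi> x) = x) \<and> (\<forall>y\<in>D. \<psi> (\<phi> y) = y) \<and>
    subspace L \<and> dim L = k \<and> (\<forall>q\<in>fst c. snd c q \<in> V \<longrightarrow> (q \<in> S \<longleftrightarrow> \<psi> (snd c q) \<in> L))"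

lemma flatteningD:
  assumes "flattening c S k D V \<phi> \<psi> L"
  shows "open D" "open V" "V \<subseteq> snd c ` fst c" "smooth_on D \<phi>" "smooth_on V \<psi>" "\<phi> ` D \<subseteq> V" "\<psi> ` V \<subseteq> D"
    "\<And>x. x \<in> V \<Longrightarrow> \<phi> (\<psi> x) = x" "\<And>y. y \<in> D \<Longrightarrow> \<psi> (\<phi> y) = y" "subspace L"
    "\<And>q. q \<in> fst c \<Longrightarrow> snd c q \<in> V \<Longrightarrow> q \<in> S \<longleftrightarrow> \<psi> (snd c q) \<in> L" "dim L = k"
  using assms unfolding flattening_def by blast+

lemma submanifold_flattening:
  assumes S: "embedded_submanifold M S k" and p: "p \<in> S" and c: "c \<in> charts M" "p \<in> fst c"
  obtains D V \<phi> \<psi> L where "flattening c S k D V \<phi> \<psi> L" "snd c p \<in> V"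
proof -
  obtain e L where e: "injective_chart e" "\<forall>d\<in>charts M. compatible e d" "p \<in> fst e" "subspace L" "dim L = k"
    "snd e ` (fst e \<inter> S) = snd e ` fst e \<inter> L"
    using S p unfolding embedded_submanifold_def by meson
  have cp: "compatible e c" using e c by blast
  have jc: "injective_chart c" by (rule chart_inj[OF c(1)])
  have "flattening c S k (snd e ` (fst e \<inter> fst c)) (snd c ` (fst e \<inter> fst c)) (transition e c) (transition c e) L"
    unfolding flattening_def
  proof (intro conjI ballI impI)
    show "open (snd e ` (fst e \<inter> fst c))" "open (snd c ` (fst e \<inter> fst c))"
      "smooth_on (snd e ` (fst e \<inter> fst c)) (transition e c)" "smooth_on (snd c ` (fst e \<inter> fst c)) (transition c e)"
      using cp unfolding compatible_def by (auto simp: Int_commute)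
    fix q assume q: "q \<in> fst c" "snd c q \<in> snd c ` (fst e \<inter> fst c)"
    then have qe: "q \<in> fst e" using chart_image_iff[OF jc, of q "fst e \<inter> fst c"] by blast
    have "q \<in> S \<longleftrightarrow> snd e q \<in> snd e ` (fst e \<inter> S)"
      using chart_image_iff[OF e(1) qe, of "fst e \<inter> S"] qe by blast
    then show "q \<in> S \<longleftrightarrow> transition c e (snd c q) \<in> L"
      unfolding e(6) transition_snd[OF jc q(1)] using qe by blast
  qed (use c e in \<open>auto simp: transition_snd[OF jc, of _ e] transition_snd[OF e(1), of _ c]\<close>)
  then show ?thesis by (rule that) (use e c in blast)
qed

text \<open>The flattened image of a curve in \<open>S\<close> runs in \<open>L\<close>, and so does
  its derivative. Conversely a straight line in \<open>L\<close>, bent back by \<phi>, is a curve in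
  \<open>S\<close> with the prescribed velocity. The two inverse relations are the chain
  rule.\<close>

lemma tangent_space_flattened:
  assumes c: "c \<in> charts M" and F: "flattening c S k D V \<phi> \<psi> L"
    and q: "q \<in> S" "q \<in> fst c" "snd c q \<in> V"
  shows "v \<in> tangent_space M S q \<longleftrightarrow> FD \<psi> (snd c q) (to_chart M c q v) \<in> L"
    and "FD \<phi> (\<psi> (snd c q)) (FD \<psi> (snd c q) w) = w"
    and "FD \<psi> (snd c q) (FD \<phi> (\<psi> (snd c q)) w) = w"
proof -
  note D = flatteningD[OF F]
  let ?x = "snd c q" and ?y = "\<psi> (snd c q)"
  have y: "?y \<in> D" using D(7) q(3) by blast
  have dphi: "\<phi> differentiable (at ?y)" by (rule smooth_on_imp_differentiable[OF D(4) y])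
  have dpsi: "\<psi> differentiable (at ?x)" by (rule smooth_on_imp_differentiable[OF D(5) q(3)])
  show inv1: "FD \<phi> ?y (FD \<psi> ?x w) = w" for w
  proof -
    have "FD (\<lambda>x. \<phi> (\<psi> x)) ?x = FD (\<lambda>x. x) ?x" by (rule FD_cong_open[OF D(2) q(3)]) (rule D(8))
    then show ?thesis using FD_chain[of \<phi> \<psi> ?x w] dphi dpsi by simp
  qed
  show "FD \<psi> ?x (FD \<phi> ?y w) = w" for w
  proof -
    have "FD (\<lambda>x. \<psi> (\<phi> x)) ?y = FD (\<lambda>x. x) ?y" by (rule FD_cong_open[OF D(1) y]) (rule D(9))
    then show ?thesis using FD_chain[of \<psi> \<phi> ?y w] dphi dpsi D(8)[OF q(3)] by simp
  qed
  show "v \<in> tangent_space M S q \<longleftrightarrow> FD \<psi> ?x (to_chart M c q v) \<in> L"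
  proof
    assume "v \<in> tangent_space M S q"
    then obtain \<alpha> where \<alpha>: "curve_through M S q v \<alpha>" by (auto simp: tangent_space_def)
    obtain e where e: "e > 0" "\<alpha> ` {-e<..<e} \<subseteq> S" "\<alpha> ` {-e<..<e} \<subseteq> fst c"
      "smooth_on {-e<..<e} (\<lambda>s. snd c (\<alpha> s))" "((\<lambda>s. snd c (\<alpha> s)) has_vector_derivative to_chart M c q v) (at 0)" "\<alpha> 0 = q"
      using curve_throughD[OF \<alpha> c q(2)] .
    define E where "E = {-e<..<e} \<inter> (\<lambda>s. snd c (\<alpha> s)) -` V"
    have E: "open E" unfolding E_def
      by (rule continuous_open_preimage[OF smooth_on_continuous_on[OF e(4)] open_greaterThanLessThan D(2)])
    show "FD \<psi> ?x (to_chart M c q v) \<in> L"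
    proof (rule derivative_in_subspace[OF D(10) E])
      show "((\<lambda>s. \<psi> (snd c (\<alpha> s))) has_vector_derivative FD \<psi> ?x (to_chart M c q v)) (at 0)"
        using has_vector_derivative_chain_FD[of \<psi> "\<lambda>s. snd c (\<alpha> s)" 0] dpsi e by simp
      show "0 \<in> E" using e q by (simp add: E_def)
      fix s assume s: "s \<in> E"
      then have "\<alpha> s \<in> S" "\<alpha> s \<in> fst c" "snd c (\<alpha> s) \<in> V" using e by (auto simp: E_def)
      then show "\<psi> (snd c (\<alpha> s)) \<in> L" using D(11)[of "\<alpha> s"] by blast
    qed
  next
    assume L: "FD \<psi> ?x (to_chart M c q v) \<in> L"
    define l where "l s = ?y + s *\<^sub>R FD \<psi> ?x (to_chart M c q v)" for s :: real
    have "open (l -` D)" unfolding l_def by (intro open_vimage D(1) continuous_intros)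
    moreover have "0 \<in> l -` D" using y by (simp add: l_def)
    ultimately obtain e where e: "e > 0" "ball 0 e \<subseteq> l -` D" using openE by blast
    have b: "ball (0::real) e = {-e<..<e}" by (auto simp: ball_def dist_real_def)
    have lD: "l s \<in> D" if "s \<in> {-e<..<e}" for s using e b that by auto
    have yL: "?y \<in> L" using D(11)[of q] q by blast
    define \<alpha> where "\<alpha> s = chart_inv c (\<phi> (l s))" for s
    have \<alpha>: "\<alpha> s \<in> S" "\<alpha> s \<in> fst c" "snd c (\<alpha> s) = \<phi> (l s)" if s: "s \<in> {-e<..<e}" for s
    proof -
      have V: "\<phi> (l s) \<in> V" using lD[OF s] D(6) by blast
      then show 1: "\<alpha> s \<in> fst c" "snd c (\<alpha> s) = \<phi> (l s)"
        unfolding \<alpha>_def using chart_inv_in[of "\<phi> (l s)" c] chart_inv_right[of "\<phi> (l s)" c] D(3) by blast+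
      have "l s \<in> L" unfolding l_def
        using L yL D(10) by (simp add: subspace_add subspace_scale)
      then have "\<psi> (\<phi> (l s)) \<in> L" by (simp add: D(9)[OF lD[OF s]])
      then show "\<alpha> s \<in> S" using D(11)[OF 1(1)] 1(2) V by simp
    qed
    have l': "(l has_vector_derivative FD \<psi> ?x (to_chart M c q v)) (at 0)"
      unfolding l_def by (auto intro!: derivative_eq_intros)
    have l0: "l 0 = ?y" by (simp add: l_def)
    have "curve_through M S q v \<alpha>"
    proof (rule curve_throughI[OF c e(1)])
      have sl: "smooth_on {-e<..<e} l" unfolding l_def
        by (intro smooth_on_add smooth_on_scaleR smooth_on_ident smooth_on_const open_greaterThanLessThan)
      have "smooth_on {-e<..<e} (\<lambda>s. \<phi> (l s))"
        by (rule smooth_on_compose[OF D(4) sl _ open_greaterThanLessThan D(1)]) (use lD in auto)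
      then show "smooth_on {-e<..<e} (\<lambda>s. snd c (\<alpha> s))"
        by (rule smooth_on_cong[OF _ open_greaterThanLessThan]) (simp add: \<alpha>)
      have "((\<lambda>s. \<phi> (l s)) has_vector_derivative FD \<phi> (l 0) (FD \<psi> ?x (to_chart M c q v))) (at 0)"
        by (rule has_vector_derivative_chain_FD[OF _ l']) (simp add: l0 dphi)
      then have "((\<lambda>s. \<phi> (l s)) has_vector_derivative to_chart M c q v) (at 0)" by (simp add: l0 inv1)
      then show "((\<lambda>s. snd c (\<alpha> s)) has_vector_derivative to_chart M c q v) (at 0)"
        by (rule has_vector_derivative_transform_within_open[OF _ open_greaterThanLessThan[of "-e" e]]) (use e(1) in \<open>simp_all add: \<alpha>(3)\<close>)
      show "\<alpha> 0 = q" using q by (simp add: \<alpha>_def l0 D(8) inv_coord[OF c])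
    qed (use \<alpha> in auto)
    then show "v \<in> tangent_space M S q" by (auto simp: tangent_space_def)
  qed
qed

lemma submanifold_mpoints: "embedded_submanifold M S k \<Longrightarrow> S \<subseteq> mpoints M"
  by (simp add: embedded_submanifold_def)

lemma tangent_space_submanifold:
  assumes S: "embedded_submanifold M S k" and p: "p \<in> S"
  shows "subspace (tangent_space M S p)" "dim (tangent_space M S p) = k"
proof -
  have pm: "p \<in> mpoints M" using S p submanifold_mpoints by blast
  let ?c = "chart_at M p"
  note c = chart_at_in[OF pm]
  obtain D V \<phi> \<psi> L where fl: "flattening ?c S k D V \<phi> \<psi> L" "snd ?c p \<in> V"
    by (rule submanifold_flattening[OF S p c]) (rule that)
  note F = flatteningD[OF fl(1)]
  note ts = tangent_space_flattened[OF c(1) fl(1) p c(2) fl(2)]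
  let ?x = "snd ?c p" and ?y = "\<psi> (snd ?c p)"
  have lphi: "linear (FD \<phi> ?y)" using smooth_on_linear_FD[OF F(4)] F(7) fl(2) by blast
  have "tangent_space M S p = FD \<phi> ?y ` L"
  proof (intro equalityI subsetI)
    fix v assume "v \<in> tangent_space M S p"
    then have "FD \<psi> ?x v \<in> L" using ts(1)[of v] by (simp add: to_chart_self[OF pm])
    then show "v \<in> FD \<phi> ?y ` L" using ts(2)[of v] by (metis imageI)
  next
    fix v assume "v \<in> FD \<phi> ?y ` L"
    then obtain l where "l \<in> L" "v = FD \<phi> ?y l" by blast
    then show "v \<in> tangent_space M S p" using ts(1)[of v] ts(3)[of l] by (simp add: to_chart_self[OF pm])
  qed
  moreover have "inj (FD \<phi> ?y)" using ts(3) by (metis injI)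
  ultimately show "subspace (tangent_space M S p)" "dim (tangent_space M S p) = k"
    using linear_subspace_image[OF lphi F(10)] dim_image_eq[OF lphi, of L] F(12) by (auto intro: inj_on_subset)
qed

end

subsection \<open>Second fundamental form and shape operator\<close>

locale spacelike_submanifold = lorentz_manifold +
  fixes S :: "'a set" and k :: nat
  assumes S: "embedded_submanifold M S k" and S_spacelike: "spacelike M g S"
begin

abbreviation TS :: "'a \<Rightarrow> 'b set" where "TS \<equiv> tangent_space M S"

lemma S_mpoints: "p \<in> S \<Longrightarrow> p \<in> mpoints M"
  using submanifold_mpoints[OF S] by blast

lemmas TS_subspace = tangent_space_submanifold(1)[OF S]
lemmas TS_dim = tangent_space_submanifold(2)[OF S]

lemma TS_pos: "p \<in> S \<Longrightarrow> v \<in> TS p \<Longrightarrow> v \<noteq> 0 \<Longrightarrow> g p v v > 0"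
  using S_spacelike by (simp add: spacelike_def)

lemma TS_Riesz: "p \<in> S \<Longrightarrow> linear f \<Longrightarrow> \<exists>a\<in>TS p. \<forall>z\<in>TS p. g p a z = f z"
  by (rule definite_subspace_Riesz[OF g_bilinear[OF S_mpoints] TS_subspace TS_pos])

lemma TS_eqI:
  assumes p: "p \<in> S" and a: "a \<in> TS p" "a' \<in> TS p" "\<And>z. z \<in> TS p \<Longrightarrow> g p a z = g p a' z"
  shows "a = a'"
proof -
  have d: "a - a' \<in> TS p" using a TS_subspace[OF p] by (simp add: subspace_diff)
  have "g p (a - a') (a - a') = 0" using a(3)[OF d] by (simp add: g_simps[OF S_mpoints[OF p]])
  then show ?thesis using TS_pos[OF p d] by fastforce
qed

text \<open>The metric is definite on the tangent space, so a vector has a tangential part by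
  \<open>TS_Riesz\<close>, and a vector both tangent and normal is zero. The third claim removes
  tangential ambiguities, on which the second fundamental form depends.\<close>

lemma normal_part:
  assumes p: "p \<in> S"
  shows "normal_part M g S p v \<in> normal_space M g S p" "v - normal_part M g S p v \<in> TS p"
    and "v - v' \<in> TS p \<Longrightarrow> normal_part M g S p v = normal_part M g S p v'"
proof -
  note gs = g_simps[OF S_mpoints[OF p]]
  have un: "w = w'" if "w \<in> normal_space M g S p" "v - w \<in> TS p" "w' \<in> normal_space M g S p" "v - w' \<in> TS p" for v w w'
  proof -
    have "(v - w') - (v - w) \<in> TS p" using that TS_subspace[OF p] by (blast intro: subspace_diff)
    then have d: "w - w' \<in> TS p" by simp
    have "w - w' = 0"
      by (rule TS_eqI[OF p d subspace_0[OF TS_subspace[OF p]]])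
        (use that in \<open>simp add: normal_space_def gs\<close>)
    then show ?thesis by simp
  qed
  have ex: "\<exists>w. w \<in> normal_space M g S p \<and> v - w \<in> TS p" for v
  proof -
    obtain a where a: "a \<in> TS p" "\<forall>z\<in>TS p. g p a z = g p v z"
      using TS_Riesz[OF p bilinear_linear_right[OF g_bilinear[OF S_mpoints[OF p]]]] by blast
    then have "v - a \<in> normal_space M g S p" by (simp add: normal_space_def gs)
    then show ?thesis using a(1) by (intro exI[of _ "v - a"]) simp
  qed
  have *: "normal_part M g S p v \<in> normal_space M g S p \<and> v - normal_part M g S p v \<in> TS p" for v
    unfolding normal_part_def by (rule theI') (use ex[of v] un[where v=v] in blast)
  then show "normal_part M g S p v \<in> normal_space M g S p" "v - normal_part M g S p v \<in> TS p" by blast+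
  assume d: "v - v' \<in> TS p"
  have "v' - normal_part M g S p v' \<in> TS p" using * by blast
  from subspace_add[OF TS_subspace[OF p] d this] have "v - normal_part M g S p v' \<in> TS p" by simp
  then show "normal_part M g S p v = normal_part M g S p v'" using un * by blast
qed

text \<open>The condition on local extensions over which \<open>second_fundamental_form\<close>
  quantifies.\<close>

definition tangent_extension :: "'a \<Rightarrow> 'b \<Rightarrow> 'a set \<Rightarrow> ('a \<Rightarrow> 'b) \<Rightarrow> bool" where
  "tangent_extension p y W Y \<longleftrightarrow> openin (mtopology M) W \<and> p \<in> W \<and> Y \<in> vector_fields M (S \<inter> W) \<and> Y p = y"

text \<open>A constant vector \<open>l\<close> of \<open>L\<close> in flattened coordinates, carried
  back to the chart by the derivative of \<phi>, is tangent to \<open>S\<close> throughout.\<close>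

lemma tangent_extension_exists:
  assumes p: "p \<in> S" and y: "y \<in> TS p"
  shows "\<exists>W Y. tangent_extension p y W Y"
proof -
  let ?c = "chart_at M p"
  note pm = S_mpoints[OF p] note c = chart_at_in[OF pm]
  obtain D V \<phi> \<psi> L where fl: "flattening ?c S k D V \<phi> \<psi> L" "snd ?c p \<in> V"
    by (rule submanifold_flattening[OF S p c]) (rule that)
  note F = flatteningD[OF fl(1)]
  define l where "l = FD \<psi> (snd ?c p) (to_chart M ?c p y)"
  have l: "l \<in> L" using tangent_space_flattened(1)[OF c(1) fl(1) p c(2) fl(2)] y by (simp add: l_def)
  define W where "W = {q \<in> fst ?c. snd ?c q \<in> V}"
  define Yh where "Yh x = FD \<phi> (\<psi> x) l" for x
  define Y where "Y q = from_chart M ?c q (Yh (snd ?c q))" for q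
  have W: "openin (mtopology M) W" unfolding W_def by (rule openin_chart_preimage[OF charts_compatible c(1) F(2)])
  have sm: "smooth_on V Yh" unfolding Yh_def
    by (rule smooth_on_FD_compose[OF F(4,1,2,5) smooth_on_const F(7)])
  have "smooth_field_on M (S \<inter> W) Y"
    by (rule smooth_fieldI, rule bexI[OF _ c(1)], rule exI[of _ V], rule exI[of _ Yh])
      (use sm F(2) in \<open>auto simp: W_def Y_def to_from_chart[OF c(1)]\<close>)
  moreover have "Y q \<in> tangent_space M (S \<inter> W) q" if q: "q \<in> S \<inter> W" for q
  proof -
    have q': "q \<in> S" "q \<in> fst ?c" "snd ?c q \<in> V" using q by (auto simp: W_def)
    have "FD \<psi> (snd ?c q) (to_chart M ?c q (Y q)) = l"
      unfolding Y_def Yh_def to_from_chart[OF c(1) q'(2)]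
      by (rule tangent_space_flattened(3)[OF c(1) fl(1) q'])
    then show ?thesis
      using tangent_space_flattened(1)[OF c(1) fl(1) q'] l tangent_space_Int[OF W, of q S] q by simp
  qed
  moreover have "Y p = y"
    using tangent_space_flattened(2)[OF c(1) fl(1) p c(2) fl(2), of "to_chart M ?c p y"]
    by (simp add: Y_def Yh_def l_def from_to_chart[OF c])
  ultimately have "tangent_extension p y W Y"
    using W c fl(2) by (simp add: tangent_extension_def vector_fields_def W_def)
  then show ?thesis by blast
qed

text \<open>Tangency says that \<open>FD \<psi>\<close> maps the field into \<open>L\<close> along a
  curve. Differentiating this, the second derivative of \<psi> and the Christoffel term involve only
  the vectors \<open>x\<close> and \<open>y\<close>, so they drop out when two extensions are
  compared.\<close>

lemma tangent_extension_nabla: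
  assumes p: "p \<in> S" and x: "x \<in> TS p" and Y: "tangent_extension p y W Y" and Y': "tangent_extension p y W' Y'"
  shows "nabla M g (S \<inter> W) Y p x - nabla M g (S \<inter> W') Y' p x \<in> TS p"
proof -
  let ?c = "chart_at M p" and ?x = "snd (chart_at M p) p"
  note pm = S_mpoints[OF p] note c = chart_at_in[OF pm]
  obtain D V \<phi> \<psi> L where fl: "flattening ?c S k D V \<phi> \<psi> L" "?x \<in> V"
    by (rule submanifold_flattening[OF S p c]) (rule that)
  note F = flatteningD[OF fl(1)]
  have lpsi: "linear (FD \<psi> ?x)" by (rule smooth_on_linear_FD[OF F(5) fl(2)])
  obtain \<alpha> where \<alpha>: "curve_through M S p x \<alpha>" using x by (auto simp: tangent_space_def)
  have *: "FD (\<lambda>z. FD \<psi> z y) ?x x + FD \<psi> ?x (nabla M g (S \<inter> W) Y p x - Gam ?c ?x x y) \<in> L"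
    if ext: "tangent_extension p y W Y" for W Y
  proof -
    have W: "openin (mtopology M) W" "p \<in> W" and Y: "smooth_field_on M (S \<inter> W) Y"
      "\<And>q. q \<in> S \<inter> W \<Longrightarrow> Y q \<in> tangent_space M (S \<inter> W) q" "Y p = y"
      using ext by (auto simp: tangent_extension_def vector_fields_def)
    have pW: "p \<in> S \<inter> W" using p W by blast
    have \<alpha>W: "curve_through M (S \<inter> W) p x \<alpha>" by (rule curve_through_Int[OF \<alpha> W])
    obtain E Yh where E: "open E" "?x \<in> E" "smooth_on E Yh"
      "\<And>q. q \<in> S \<inter> W \<Longrightarrow> q \<in> fst ?c \<Longrightarrow> snd ?c q \<in> E \<Longrightarrow> to_chart M ?c q (Y q) = Yh (snd ?c q)"
      by (rule smooth_fieldD[OF Y(1) pW c]) (rule that)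
    have dY: "Yh differentiable (at ?x)" by (rule smooth_on_imp_differentiable[OF E(3,2)])
    have nab: "nabla M g (S \<inter> W) Y p x = FD Yh ?x x + Gam ?c ?x x y"
      using nabla_chart(2)[OF c E(1,2) dY E(4) \<alpha>W] by (simp add: to_chart_self[OF pm] Y(3))
    obtain e where e: "e > 0" "\<alpha> ` {-e<..<e} \<subseteq> S \<inter> W" "\<alpha> ` {-e<..<e} \<subseteq> fst ?c"
      "smooth_on {-e<..<e} (\<lambda>s. snd ?c (\<alpha> s))" "((\<lambda>s. snd ?c (\<alpha> s)) has_vector_derivative to_chart M ?c p x) (at 0)" "\<alpha> 0 = p"
      using curve_throughD[OF \<alpha>W c] .
    define N where "N = {-e<..<e} \<inter> (\<lambda>s. snd ?c (\<alpha> s)) -` (V \<inter> E)"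
    have N: "open N" unfolding N_def
      by (rule continuous_open_preimage[OF smooth_on_continuous_on[OF e(4)] open_greaterThanLessThan open_Int[OF F(2) E(1)]])
    have N0: "0 \<in> N" using e E fl(2) by (simp add: N_def)
    have xd: "((\<lambda>s. snd ?c (\<alpha> s)) has_vector_derivative x) (at 0)" using e(5) by (simp add: to_chart_self[OF pm])
    have Yd: "((\<lambda>s. Yh (snd ?c (\<alpha> s))) has_vector_derivative FD Yh (snd ?c (\<alpha> 0)) x) (at 0)"
      by (rule has_vector_derivative_chain_FD[OF _ xd]) (use e dY in simp)
    have d: "((\<lambda>s. FD \<psi> (snd ?c (\<alpha> s)) (Yh (snd ?c (\<alpha> s)))) has_vector_derivative
      (FD (\<lambda>z. FD \<psi> z (Yh (snd ?c (\<alpha> 0)))) (snd ?c (\<alpha> 0)) x + FD \<psi> (snd ?c (\<alpha> 0)) (FD Yh (snd ?c (\<alpha> 0)) x))) (at 0)"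
      by (rule linear_family_has_vector_derivative[where F="FD \<psi>", OF F(2) smooth_on_linear_FD[OF F(5)] smooth_on_FD[OF F(5)] xd Yd])
        (simp_all add: e(6) fl(2))
    have "FD (\<lambda>z. FD \<psi> z (Yh (snd ?c (\<alpha> 0)))) (snd ?c (\<alpha> 0)) x + FD \<psi> (snd ?c (\<alpha> 0)) (FD Yh (snd ?c (\<alpha> 0)) x) \<in> L"
    proof (rule derivative_in_subspace[OF F(10) N N0 _ d])
      fix s assume s: "s \<in> N"
      then have q: "\<alpha> s \<in> S" "\<alpha> s \<in> W" "\<alpha> s \<in> fst ?c" "snd ?c (\<alpha> s) \<in> V" "snd ?c (\<alpha> s) \<in> E"
        using e(2,3) by (auto simp: N_def)
      have "Y (\<alpha> s) \<in> TS (\<alpha> s)" using Y(2)[of "\<alpha> s"] tangent_space_Int[OF W(1) q(2), of S] q by simp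
      then have "FD \<psi> (snd ?c (\<alpha> s)) (to_chart M ?c (\<alpha> s) (Y (\<alpha> s))) \<in> L"
        using tangent_space_flattened(1)[OF c(1) fl(1) q(1,3,4)] by simp
      then show "FD \<psi> (snd ?c (\<alpha> s)) (Yh (snd ?c (\<alpha> s))) \<in> L" using E(4)[of "\<alpha> s"] q by simp
    qed
    moreover have "Yh ?x = y" using E(4)[OF pW c(2) E(2)] by (simp add: to_chart_self[OF pm] Y(3))
    ultimately show ?thesis by (simp add: e(6) nab)
  qed
  have "FD \<psi> ?x (nabla M g (S \<inter> W) Y p x - nabla M g (S \<inter> W') Y' p x) \<in> L"
    using subspace_diff[OF F(10) *[OF Y] *[OF Y']] by (simp add: linear_diff[OF lpsi] algebra_simps)
  then show ?thesis
    using tangent_space_flattened(1)[OF c(1) fl(1) p c(2) fl(2)] by (simp add: to_chart_self[OF pm])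
qed

lemma second_fundamental_form_eq:
  assumes p: "p \<in> S" and x: "x \<in> TS p" and Y: "tangent_extension p y W Y"
  shows "second_fundamental_form M g S p x y = normal_part M g S p (nabla M g (S \<inter> W) Y p x)"
proof -
  have *: "normal_part M g S p (nabla M g (S \<inter> W) Y p x) = normal_part M g S p (nabla M g (S \<inter> W') Y' p x)"
    if "tangent_extension p y W' Y'" for W' Y'
    by (rule normal_part(3)[OF p tangent_extension_nabla[OF p x Y that]])
  show ?thesis
    unfolding second_fundamental_form_def
  proof (rule the_equality)
    show "\<forall>W' Y'. openin (mtopology M) W' \<and> p \<in> W' \<and> Y' \<in> vector_fields M (S \<inter> W') \<and> Y' p = y \<longrightarrow>
        normal_part M g S p (nabla M g (S \<inter> W) Y p x) = normal_part M g S p (nabla M g (S \<inter> W') Y' p x)"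
      using * unfolding tangent_extension_def by blast
  next
    fix w
    assume "\<forall>W Y. openin (mtopology M) W \<and> p \<in> W \<and> Y \<in> vector_fields M (S \<inter> W) \<and> Y p = y \<longrightarrow>
        w = normal_part M g S p (nabla M g (S \<inter> W) Y p x)"
    then show "w = normal_part M g S p (nabla M g (S \<inter> W) Y p x)"
      using Y unfolding tangent_extension_def by blast
  qed
qed

text \<open>Differentiate \<open>g (Y, \<xi>) = 0\<close> along a curve in \<open>S\<close>.\<close>

lemma second_fundamental_form_normal:
  assumes p: "p \<in> S" and x: "x \<in> TS p" and y: "y \<in> TS p"
    and \<xi>: "smooth_field_on M S \<xi>" "\<And>q. q \<in> S \<Longrightarrow> \<xi> q \<in> normal_space M g S q"
  shows "g p (second_fundamental_form M g S p x y) (\<xi> p) = - g p (nabla M g S \<xi> p x) y"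
proof -
  note pm = S_mpoints[OF p] note gs = g_simps[OF pm]
  obtain W Y where ext: "tangent_extension p y W Y" using tangent_extension_exists[OF p y] by blast
  have W: "openin (mtopology M) W" "p \<in> W" and Y: "smooth_field_on M (S \<inter> W) Y"
      "\<And>q. q \<in> S \<inter> W \<Longrightarrow> Y q \<in> tangent_space M (S \<inter> W) q" "Y p = y"
    using ext by (auto simp: tangent_extension_def vector_fields_def)
  have pW: "p \<in> S \<inter> W" using p W by blast
  obtain \<alpha> where \<alpha>: "curve_through M S p x \<alpha>" using x by (auto simp: tangent_space_def)
  have \<alpha>W: "curve_through M (S \<inter> W) p x \<alpha>" by (rule curve_through_Int[OF \<alpha> W])
  obtain e where e: "e > 0" "smooth_map euclid M {-e<..<e} \<alpha>" "\<alpha> ` {-e<..<e} \<subseteq> S \<inter> W" "\<alpha> 0 = p"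
    using \<alpha>W unfolding curve_through_def by blast
  let ?n = "nabla M g (S \<inter> W) Y p x"
  have n: "?n = cov_along M g \<alpha> (Y \<circ> \<alpha>) 0" by (rule nabla_curve[OF Y(1) pW pm \<alpha>W])
  have n': "nabla M g S \<xi> p x = cov_along M g \<alpha> (\<xi> \<circ> \<alpha>) 0" by (rule nabla_curve[OF \<xi>(1) p pm \<alpha>])
  have im: "\<alpha> ` {-e<..<e} \<subseteq> mpoints M" using e(3) S_mpoints by blast
  have sY: "smooth_along M {-e<..<e} \<alpha> (Y \<circ> \<alpha>)"
    unfolding smooth_along_def o_def by (rule smooth_field_along_curve[OF Y(1) e(2) open_greaterThanLessThan e(3)])
  have sx: "smooth_along M {-e<..<e} \<alpha> (\<xi> \<circ> \<alpha>)"
    unfolding smooth_along_def o_def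
    by (rule smooth_field_along_curve[OF \<xi>(1) e(2) open_greaterThanLessThan]) (use e(3) in blast)
  have 0: "0 \<in> {-e<..<e}" using e(1) by simp
  have "((\<lambda>s. g (\<alpha> s) ((Y \<circ> \<alpha>) s) ((\<xi> \<circ> \<alpha>) s)) has_real_derivative
     g (\<alpha> 0) ?n ((\<xi> \<circ> \<alpha>) 0) + g (\<alpha> 0) ((Y \<circ> \<alpha>) 0) (nabla M g S \<xi> p x)) (at 0)"
    unfolding n n' by (rule metric_along_derivative[OF sY sx open_greaterThanLessThan im 0])
  moreover have "((\<lambda>s. g (\<alpha> s) ((Y \<circ> \<alpha>) s) ((\<xi> \<circ> \<alpha>) s)) has_real_derivative 0) (at 0)"
  proof (rule has_field_derivative_transform_within_open[OF DERIV_const open_greaterThanLessThan 0])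
    fix s assume s: "s \<in> {-e<..<e}"
    then have q: "\<alpha> s \<in> S" "\<alpha> s \<in> W" using e(3) by auto
    then have "Y (\<alpha> s) \<in> TS (\<alpha> s)" using Y(2)[of "\<alpha> s"] tangent_space_Int[OF W(1) q(2), of S] by simp
    then show "0 = g (\<alpha> s) ((Y \<circ> \<alpha>) s) ((\<xi> \<circ> \<alpha>) s)"
      using \<xi>(2)[OF q(1)] g_sym[OF S_mpoints[OF q(1)]] by (simp add: normal_space_def)
  qed
  ultimately have "g p ?n (\<xi> p) + g p y (nabla M g S \<xi> p x) = 0"
    using DERIV_unique e(4) Y(3) by fastforce
  moreover have "g p (?n - normal_part M g S p ?n) (\<xi> p) = 0"
  proof -
    have "g p (\<xi> p) (?n - normal_part M g S p ?n) = 0"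
      using \<xi>(2)[OF p] normal_part(2)[OF p, of ?n] unfolding normal_space_def by blast
    then show ?thesis using g_sym[OF pm, of "\<xi> p"] by metis
  qed
  ultimately show ?thesis
    unfolding second_fundamental_form_eq[OF p x ext] using g_sym[OF pm, of y] by (simp add: gs)
qed

text \<open>By \<open>second_fundamental_form_normal\<close> the functional that defines the shape
  operator is the linear map sending \<open>y\<close> to minus the product of the derivative of
  \<xi> with \<open>y\<close>. It is represented by a unique tangent vector, and adding that vector
  cancels the tangential part of the derivative.\<close>

lemma shape_operator:
  assumes p: "p \<in> S" and x: "x \<in> TS p"
    and \<xi>: "smooth_field_on M S \<xi>" "\<And>q. q \<in> S \<Longrightarrow> \<xi> q \<in> normal_space M g S q"
  shows "nabla M g S \<xi> p x + shape_operator M g S p (\<xi> p) x \<in> normal_space M g S p"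
proof -
  note pm = S_mpoints[OF p] note gs = g_simps[OF pm]
  let ?P = "\<lambda>a. a \<in> TS p \<and> (\<forall>y\<in>TS p. g p a y = g p (second_fundamental_form M g S p x y) (\<xi> p))"
  have sff: "g p (second_fundamental_form M g S p x y) (\<xi> p) = - g p (nabla M g S \<xi> p x) y" if "y \<in> TS p" for y
    by (rule second_fundamental_form_normal[OF p x that \<xi>])
  have "linear (\<lambda>y. - g p (nabla M g S \<xi> p x) y)"
    by (intro linearI) (simp_all add: gs)
  from TS_Riesz[OF p this] obtain a where "?P a" using sff by auto
  moreover have "b = a" if "?P b" for b by (rule TS_eqI[OF p]) (use that \<open>?P a\<close> in auto)
  ultimately have "?P (shape_operator M g S p (\<xi> p) x)"
    unfolding shape_operator_def by (rule theI)
  then show ?thesis using sff by (simp add: normal_space_def gs)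
qed

end

subsection \<open>Two-parameter families of curves\<close>

context lorentz
begin

text \<open>The curve \<open>l\<close> stands for a coordinate line in either parameter, so that one
  statement covers the velocities and covariant derivatives in both directions of a family.\<close>

lemma slice_chart:
  fixes H :: "'v::euclidean_space \<Rightarrow> 'm" and l :: "real \<Rightarrow> 'v"
  assumes c: "c \<in> charts M" and N: "open N" "H ` N \<subseteq> fst c" "smooth_on N (\<lambda>z. snd c (H z))"
    and l: "continuous_on UNIV l" "(l has_vector_derivative e) (at r)" "l r \<in> N"
  shows "to_chart M c (H (l r)) (velocity M (\<lambda>r. H (l r)) r) = FD (\<lambda>z. snd c (H z)) (l r) e"
    and "smooth_on N (\<lambda>z. to_chart M c (H z) (K z)) \<Longrightarrow>
      to_chart M c (H (l r)) (cov_along M g (\<lambda>r. H (l r)) (\<lambda>r. K (l r)) r) =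
        FD (\<lambda>z. to_chart M c (H z) (K z)) (l r) e
        + Gam c (snd c (H (l r))) (FD (\<lambda>z. snd c (H z)) (l r) e) (to_chart M c (H (l r)) (K (l r)))"
proof -
  have E: "open (l -` N)" using open_vimage[OF N(1) l(1)] by simp
  have rE: "r \<in> l -` N" using l by simp
  have im: "(\<lambda>r. H (l r)) ` (l -` N) \<subseteq> fst c" using N(2) by auto
  have x: "((\<lambda>r. snd c (H (l r))) has_vector_derivative FD (\<lambda>z. snd c (H z)) (l r) e) (at r)"
    by (rule has_vector_derivative_chain_FD[OF smooth_on_imp_differentiable[OF N(3) l(3)] l(2)])
  show "to_chart M c (H (l r)) (velocity M (\<lambda>r. H (l r)) r) = FD (\<lambda>z. snd c (H z)) (l r) e"
    by (rule velocity_chart(1)[OF c E rE im x])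
  assume K: "smooth_on N (\<lambda>z. to_chart M c (H z) (K z))"
  have "((\<lambda>r. to_chart M c (H (l r)) (K (l r))) has_vector_derivative FD (\<lambda>z. to_chart M c (H z) (K z)) (l r) e) (at r)"
    by (rule has_vector_derivative_chain_FD[OF smooth_on_imp_differentiable[OF K l(3)] l(2)])
  from cov_along_chart[OF c E rE im x this]
  show "to_chart M c (H (l r)) (cov_along M g (\<lambda>r. H (l r)) (\<lambda>r. K (l r)) r) =
        FD (\<lambda>z. to_chart M c (H z) (K z)) (l r) e
        + Gam c (snd c (H (l r))) (FD (\<lambda>z. snd c (H z)) (l r) e) (to_chart M c (H (l r)) (K (l r)))" .
qed

definition d_s :: "(real \<times> real \<Rightarrow> 'm) \<Rightarrow> real \<times> real \<Rightarrow> 'e" where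
  "d_s H z = velocity M (\<lambda>r. H (r, snd z)) (fst z)"

definition d_t :: "(real \<times> real \<Rightarrow> 'm) \<Rightarrow> real \<times> real \<Rightarrow> 'e" where
  "d_t H z = velocity M (\<lambda>r. H (fst z, r)) (snd z)"

lemma two_parameter_chart:
  assumes H: "smooth_map euclid M D H" "open D" "z0 \<in> D" and c: "c \<in> charts M" "H z0 \<in> fst c"
  obtains N where "open N" "z0 \<in> N" "N \<subseteq> D" "H ` N \<subseteq> fst c" "smooth_on N (\<lambda>z. snd c (H z))"
    "\<And>z. z \<in> N \<Longrightarrow> to_chart M c (H z) (d_s H z) = FD (\<lambda>z. snd c (H z)) z (1, 0)"
    "\<And>z. z \<in> N \<Longrightarrow> to_chart M c (H z) (d_t H z) = FD (\<lambda>z. snd c (H z)) z (0, 1)"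
    "smooth_on N (\<lambda>z. to_chart M c (H z) (d_s H z))" "smooth_on N (\<lambda>z. to_chart M c (H z) (d_t H z))"
proof -
  obtain N where N: "open N" "z0 \<in> N" "N \<subseteq> D" "H ` N \<subseteq> fst c" "smooth_on N (\<lambda>z. snd c (H z))"
    using smooth_map_euclidD[OF H c] .
  have ls: "continuous_on UNIV (\<lambda>r. (r, snd z))" "((\<lambda>r. (r, snd z)) has_vector_derivative (1, 0)) (at (fst z))"
    and lt: "continuous_on UNIV (\<lambda>r. (fst z, r))" "((\<lambda>r. (fst z, r)) has_vector_derivative (0, 1)) (at (snd z))"
    for z :: "real \<times> real"
    by (auto intro!: continuous_intros derivative_eq_intros has_vector_derivative_Pair)
  have s: "to_chart M c (H z) (d_s H z) = FD (\<lambda>z. snd c (H z)) z (1, 0)" if z: "z \<in> N" for z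
    using slice_chart(1)[OF c(1) N(1,4,5) ls[of z]] z by (simp add: d_s_def)
  have t: "to_chart M c (H z) (d_t H z) = FD (\<lambda>z. snd c (H z)) z (0, 1)" if z: "z \<in> N" for z
    using slice_chart(1)[OF c(1) N(1,4,5) lt[of z]] z by (simp add: d_t_def)
  have "smooth_on N (\<lambda>z. to_chart M c (H z) (d_s H z))"
    by (rule smooth_on_cong[OF smooth_on_FD[OF N(5)] N(1)]) (rule s[symmetric])
  moreover have "smooth_on N (\<lambda>z. to_chart M c (H z) (d_t H z))"
    by (rule smooth_on_cong[OF smooth_on_FD[OF N(5)] N(1)]) (rule t[symmetric])
  ultimately show ?thesis using that[OF N s t] by blast
qed

lemma two_parameter_along:
  assumes H: "smooth_map euclid M D H" "open D"
  shows "smooth_along M {t. (s, t) \<in> D} (\<lambda>t. H (s, t)) (\<lambda>t. d_s H (s, t))"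
  unfolding smooth_along_def
proof (rule smooth_alongI)
  fix t assume t: "t \<in> {t. (s, t) \<in> D}"
  then have zD: "(s, t) \<in> D" by simp
  have pm: "H (s, t) \<in> mpoints M" using smooth_map_mpoints[OF H(1)] zD by blast
  let ?c = "chart_at M (H (s, t))"
  note c = chart_at_in[OF pm]
  obtain N where N: "open N" "(s, t) \<in> N" "H ` N \<subseteq> fst ?c" "smooth_on N (\<lambda>z. snd ?c (H z))"
    "smooth_on N (\<lambda>z. to_chart M ?c (H z) (d_s H z))"
    by (rule two_parameter_chart[OF H zD c]) (rule that)
  have E: "open ((\<lambda>r. (s, r)) -` N)" by (intro open_vimage N continuous_intros)
  have l: "smooth_on ((\<lambda>r. (s, r)) -` N) (\<lambda>r. (s, r))"
    by (intro smooth_on_Pair smooth_on_const smooth_on_ident E)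
  have "smooth_on ((\<lambda>r. (s, r)) -` N) (\<lambda>r. snd ?c (H (s, r)))"
    by (rule smooth_on_compose[OF N(4) l _ E N(1)]) auto
  moreover have "smooth_on ((\<lambda>r. (s, r)) -` N) (\<lambda>r. to_chart M ?c (H (s, r)) (d_s H (s, r)))"
    by (rule smooth_on_compose[OF N(5) l _ E N(1)]) auto
  ultimately show "\<exists>c\<in>charts M. \<exists>D. open D \<and> t \<in> D \<and> (\<lambda>t. H (s, t)) ` D \<subseteq> fst c \<and> smooth_on D (\<lambda>r. snd c (H (s, r))) \<and>
    smooth_on D (\<lambda>r. to_chart M c (H (s, r)) (d_s H (s, r)))"
    using c(1) E N(2,3) by (intro bexI[of _ ?c] exI[of _ "(\<lambda>r. (s, r)) -` N"]) auto
qed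

text \<open>The absence of torsion: second partial derivatives commute and the Christoffel map is
  symmetric.\<close>

lemma two_parameter_symmetry:
  assumes H: "smooth_map euclid M D H" "open D" "(s, t) \<in> D"
  shows "cov_along M g (\<lambda>t. H (s, t)) (\<lambda>t. d_s H (s, t)) t = cov_along M g (\<lambda>s. H (s, t)) (\<lambda>s. d_t H (s, t)) s"
proof -
  have pm: "H (s, t) \<in> mpoints M" using smooth_map_mpoints[OF H(1)] H(3) by blast
  let ?c = "chart_at M (H (s, t))"
  note c = chart_at_in[OF pm]
  interpret m: local_metric "snd ?c ` fst ?c" "Gc ?c" by (rule local_metric[OF c(1)])
  let ?h = "\<lambda>z. snd ?c (H z)"
  obtain N where N: "open N" "(s, t) \<in> N" "H ` N \<subseteq> fst ?c" "smooth_on N ?h"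
    "\<And>z. z \<in> N \<Longrightarrow> to_chart M ?c (H z) (d_s H z) = FD ?h z (1, 0)"
    "\<And>z. z \<in> N \<Longrightarrow> to_chart M ?c (H z) (d_t H z) = FD ?h z (0, 1)"
    "smooth_on N (\<lambda>z. to_chart M ?c (H z) (d_s H z))" "smooth_on N (\<lambda>z. to_chart M ?c (H z) (d_t H z))"
    by (rule two_parameter_chart[OF H c]) (rule that)
  have lt: "continuous_on UNIV (\<lambda>r. (s, r))" "((\<lambda>r. (s, r)) has_vector_derivative (0, 1)) (at t)"
    and ls: "continuous_on UNIV (\<lambda>r. (r, t))" "((\<lambda>r. (r, t)) has_vector_derivative (1, 0)) (at s)"
    by (auto intro!: continuous_intros derivative_eq_intros has_vector_derivative_Pair)
  have "FD (\<lambda>z. to_chart M ?c (H z) (d_s H z)) (s, t) (0, 1) = FD (\<lambda>z. FD ?h z (1, 0)) (s, t) (0, 1)"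
    by (rule fun_cong[OF FD_cong_open[OF N(1,2) N(5)]])
  also have "\<dots> = FD (\<lambda>z. FD ?h z (0, 1)) (s, t) (1, 0)"
    by (rule symmetric_second_derivative[OF N(4,1,2)])
  also have "\<dots> = FD (\<lambda>z. to_chart M ?c (H z) (d_t H z)) (s, t) (1, 0)"
    by (rule fun_cong[OF FD_cong_open[OF N(1,2) N(6)], symmetric])
  finally have "to_chart M ?c (H (s, t)) (cov_along M g (\<lambda>t. H (s, t)) (\<lambda>t. d_s H (s, t)) t) =
    to_chart M ?c (H (s, t)) (cov_along M g (\<lambda>s. H (s, t)) (\<lambda>s. d_t H (s, t)) s)"
    using slice_chart(2)[OF c(1) N(1,3,4) lt N(2) N(7)] slice_chart(2)[OF c(1) N(1,3,4) ls N(2) N(8)]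
      N(5,6)[OF N(2)] m.Chr_sym c(2) by simp
  then show ?thesis by (simp add: to_chart_inj[OF c])
qed

text \<open>\<open>jacobi_local\<close> in the preferred chart at \<open>H (s, t)\<close>, where
  vectors and their components coincide, so that the resulting identity is already the claim for the
  vectors themselves.\<close>

lemma two_parameter_jacobi:
  assumes H: "smooth_map euclid M D H" "open D" "(s, t) \<in> D"
    and geo: "\<And>s t. (s, t) \<in> D \<Longrightarrow> cov_along M g (\<lambda>t. H (s, t)) (\<lambda>t. d_t H (s, t)) t = 0"
  shows "cov_along M g (\<lambda>t. H (s, t)) (cov_along M g (\<lambda>t. H (s, t)) (\<lambda>t. d_s H (s, t))) t
     + curvature M g (H (s, t)) (d_s H (s, t)) (d_t H (s, t)) (d_t H (s, t)) = 0"
proof -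
  have pm: "H (s, t) \<in> mpoints M" using smooth_map_mpoints[OF H(1)] H(3) by blast
  let ?c = "chart_at M (H (s, t))"
  note c = chart_at_in[OF pm]
  interpret m: local_metric "snd ?c ` fst ?c" "Gc ?c" by (rule local_metric[OF c(1)])
  let ?h = "\<lambda>z. snd ?c (H z)"
  obtain N where N: "open N" "(s, t) \<in> N" "N \<subseteq> D" "H ` N \<subseteq> fst ?c" "smooth_on N ?h"
    "\<And>z. z \<in> N \<Longrightarrow> to_chart M ?c (H z) (d_s H z) = FD ?h z (1, 0)"
    "\<And>z. z \<in> N \<Longrightarrow> to_chart M ?c (H z) (d_t H z) = FD ?h z (0, 1)"
    "smooth_on N (\<lambda>z. to_chart M ?c (H z) (d_s H z))" "smooth_on N (\<lambda>z. to_chart M ?c (H z) (d_t H z))"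
    by (rule two_parameter_chart[OF H c]) (rule that)
  have lt: "continuous_on UNIV (\<lambda>r. (s, r))" "((\<lambda>r. (s, r)) has_vector_derivative (0, 1)) (at t)" for s t :: real
    by (auto intro!: continuous_intros derivative_eq_intros has_vector_derivative_Pair)
  have hO: "?h ` N \<subseteq> snd ?c ` fst ?c" using N(4) by blast
  have geo': "FD (\<lambda>z. FD ?h z (0, 1)) z (0, 1) + Gam ?c (?h z) (FD ?h z (0, 1)) (FD ?h z (0, 1)) = 0" if z: "z \<in> N" for z
  proof -
    obtain a b where ab: "z = (a, b)" by force
    have zD: "(a, b) \<in> N" "(a, b) \<in> D" using z ab N(3) by auto
    have Hc: "H (a, b) \<in> fst ?c" using N(4) zD by blast
    have "FD (\<lambda>z. to_chart M ?c (H z) (d_t H z)) (a, b) (0, 1) = FD (\<lambda>z. FD ?h z (0, 1)) (a, b) (0, 1)"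
      by (rule fun_cong[OF FD_cong_open[OF N(1) zD(1) N(7)]])
    then show ?thesis
      using slice_chart(2)[OF c(1) N(1,4,5) lt zD(1) N(9)] geo[OF zD(2)] to_chart_simps(5)[OF c(1) Hc] N(7)[OF zD(1)]
      by (simp add: ab)
  qed
  let ?A = "\<lambda>z. FD (\<lambda>z. FD ?h z (1, 0)) z (0, 1) + Gam ?c (?h z) (FD ?h z (0, 1)) (FD ?h z (1, 0))"
  have jac: "FD ?A (s, t) (0, 1) + Gam ?c (?h (s, t)) (FD ?h (s, t) (0, 1)) (?A (s, t))
      + m.Rm (?h (s, t)) (FD ?h (s, t) (1, 0)) (FD ?h (s, t) (0, 1)) (FD ?h (s, t) (0, 1)) = 0"
    by (rule m.jacobi_local[OF N(1,2) N(5) hO geo'])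
  \<comment> \<open>The inner covariant derivative as a field over the whole parameter domain. Its
    components must be known on a neighbourhood, in this one chart, before
    \<open>slice_chart\<close> can be applied to it again.\<close>
  define K where "K z = cov_along M g (\<lambda>t. H (fst z, t)) (\<lambda>t. d_s H (fst z, t)) (snd z)" for z
  have K: "to_chart M ?c (H z) (K z) = ?A z" if z: "z \<in> N" for z
  proof -
    obtain a b where ab: "z = (a, b)" by force
    have zN: "(a, b) \<in> N" using z ab by simp
    have "FD (\<lambda>z. to_chart M ?c (H z) (d_s H z)) (a, b) (0, 1) = FD (\<lambda>z. FD ?h z (1, 0)) (a, b) (0, 1)"
      by (rule fun_cong[OF FD_cong_open[OF N(1) zN N(6)]])
    then show ?thesis
      using slice_chart(2)[OF c(1) N(1,4,5) lt zN N(8)] N(6)[OF zN] by (simp add: ab K_def)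
  qed
  have smA: "smooth_on N ?A"
    by (intro smooth_on_add smooth_on_FD N(1,5) smooth_on_bilinear_family[OF m.open_Om N(1) m.Chr_bilinear m.Chr_smooth N(5) hO])
  have smK: "smooth_on N (\<lambda>z. to_chart M ?c (H z) (K z))"
    by (rule smooth_on_cong[OF smA N(1)]) (rule K[symmetric])
  have "FD (\<lambda>z. to_chart M ?c (H z) (K z)) (s, t) (0, 1) = FD ?A (s, t) (0, 1)"
    by (rule fun_cong[OF FD_cong_open[OF N(1,2) K]])
  with slice_chart(2)[OF c(1) N(1,4,5) lt N(2) smK]
  have "to_chart M ?c (H (s, t)) (cov_along M g (\<lambda>t. H (s, t)) (\<lambda>t. K (s, t)) t) =
     FD ?A (s, t) (0, 1) + Gam ?c (?h (s, t)) (FD ?h (s, t) (0, 1)) (?A (s, t))"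
    by (simp add: K[OF N(2)])
  then have "cov_along M g (\<lambda>t. H (s, t)) (\<lambda>t. K (s, t)) t =
     FD ?A (s, t) (0, 1) + Gam ?c (?h (s, t)) (FD ?h (s, t) (0, 1)) (?A (s, t))"
    by (simp add: to_chart_self[OF pm])
  moreover have "curvature M g (H (s, t)) (d_s H (s, t)) (d_t H (s, t)) (d_t H (s, t)) =
     m.Rm (?h (s, t)) (FD ?h (s, t) (1, 0)) (FD ?h (s, t) (0, 1)) (FD ?h (s, t) (0, 1))"
    using N(6,7)[OF N(2)] by (simp add: curvature_eq[OF pm] to_chart_self[OF pm])
  ultimately show ?thesis using jac by (simp add: K_def)
qed

lemma curvature_linear: "p \<in> mpoints M \<Longrightarrow> linear (\<lambda>x. curvature M g p x y z)"
  and curvature_same: "p \<in> mpoints M \<Longrightarrow> curvature M g p y y z = 0"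
  and curvature_skew: "p \<in> mpoints M \<Longrightarrow> g p (curvature M g p x y z) z = 0"
proof -
  assume p: "p \<in> mpoints M"
  let ?c = "chart_at M p"
  note c = chart_at_in[OF p]
  interpret m: local_metric "snd ?c ` fst ?c" "Gc ?c" by (rule local_metric[OF c(1)])
  have x: "snd ?c p \<in> snd ?c ` fst ?c" using c by blast
  show "linear (\<lambda>x. curvature M g p x y z)" unfolding curvature_eq[OF p] by (rule m.Rm_linear[OF x])
  show "curvature M g p y y z = 0" unfolding curvature_eq[OF p] by (rule m.Rm_same)
  have "g p u v = Gc ?c (snd ?c p) u v" for u v using g_Gc[OF c] by (simp add: to_chart_self[OF p])
  then show "g p (curvature M g p x y z) z = 0" unfolding curvature_eq[OF p] using m.Rm_skew[OF x] by simp
qed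

end

subsection \<open>The product with the real line\<close>

context atlas
begin

text \<open>Makes the lemmas on curves and velocities available in the product that contains
  \<O>.\<close>

lemma atlas_MR: "atlas MR"
proof (rule atlas.intro)
  have "chart_at MR p \<in> charts MR \<and> p \<in> fst (chart_at MR p)" if "p \<in> mpoints MR" for p
  proof -
    obtain q t where p: "p = (q, t)" by force
    have "q \<in> mpoints M" using that by (auto simp: p mpoints_def rcharts rchart_simps)
    then show ?thesis using chart_at_in by (auto simp: p rcharts rchart_simps)
  qed
  then show "smooth_atlas MR"
    using rcharts_compatible by (auto simp: smooth_atlas_def compatible_charts_def)
qed

lemma to_chart_rchart:
  assumes c: "c \<in> charts M" "p \<in> fst c"
  shows "to_chart MR (rchart c) (p, t) (x, a) = (to_chart M c p x, a)"
proof -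
  have pm: "p \<in> mpoints M" by (rule chart_mpoints[OF c])
  let ?d = "chart_at M p"
  note d = chart_at_in[OF pm]
  interpret r: atlas MR by (rule atlas_MR)
  let ?U = "snd ?d ` (fst ?d \<inter> fst c) \<times> (UNIV :: real set)"
  have U: "open ?U" using overlap_open[OF d(1) c(1)] by (simp add: open_Times)
  have eq: "transition (rchart ?d) (rchart c) z = (transition ?d c (fst z), snd z)" if z: "z \<in> ?U" for z
  proof -
    obtain q b where q: "q \<in> fst ?d" "q \<in> fst c" "z = (snd ?d q, b)" using z by auto
    then show ?thesis
      using r.transition_coord[of "rchart ?d" "(q, b)" "rchart c"] d(1)
      by (simp add: rcharts rchart_simps transition_coord)
  qed
  have zU: "(snd ?d p, t) \<in> ?U" using c d by auto
  have "(transition ?d c has_derivative FD (transition ?d c) (snd ?d p)) (at (fst (snd ?d p, t)))"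
    using smooth_on_has_derivative[OF transition_smooth[OF d(1) c(1)]] c d by auto
  then have "((\<lambda>z. (transition ?d c (fst z), snd z)) has_derivative (\<lambda>w. (FD (transition ?d c) (snd ?d p) (fst w), snd w))) (at (snd ?d p, t))"
    by (intro has_derivative_Pair has_derivative_compose[OF has_derivative_fst[OF has_derivative_ident]]
        has_derivative_snd[OF has_derivative_ident])
  then have "FD (\<lambda>z. (transition ?d c (fst z), snd z)) (snd ?d p, t) (x, a) = (FD (transition ?d c) (snd ?d p) x, a)"
    by (simp add: has_derivative_FD_eq)
  then have "FD (transition (rchart ?d) (rchart c)) (snd ?d p, t) (x, a) = (FD (transition ?d c) (snd ?d p) x, a)"
    using FD_cong_open[OF U zU eq] by simp
  then show ?thesis unfolding to_chart_def rcharts by (simp add: rchart_simps)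
qed

end

subsection \<open>The normal exponential flow\<close>

locale lightlike_flow = spacelike_submanifold M g S n
  for M :: "('m, 'e::euclidean_space) manifold" and g :: "('m, 'e) metric_tensor" and S :: "'m set" and n :: nat +
  fixes \<xi> :: "'m \<Rightarrow> 'e" and V :: "('m \<times> 'e) set"
  assumes xi: "lightlike_normal_field M g S \<xi>" and V: "normal_exp_neighborhood M g S V"
begin

abbreviation Fd :: "('m \<times> real) set" where "Fd \<equiv> flow_domain S \<xi> V"
abbreviation Phi :: "'m \<times> real \<Rightarrow> 'm" where "Phi \<equiv> flow_map M g \<xi>"
abbreviation Sig :: "'m set" where "Sig \<equiv> Phi ` Fd"
abbreviation dPhi :: "'m \<times> real \<Rightarrow> 'e \<times> real \<Rightarrow> 'e" where "dPhi \<equiv> flow_differential M Fd Phi"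
abbreviation U :: "'m \<Rightarrow> 'e" where "U \<equiv> generator_field M Fd Phi"

lemma xi_smooth: "smooth_field_on M S \<xi>"
  and xi_normal: "p \<in> S \<Longrightarrow> \<xi> p \<in> normal_space M g S p"
  and xi_null: "p \<in> S \<Longrightarrow> g p (\<xi> p) (\<xi> p) = 0"
  and xi_nonzero: "p \<in> S \<Longrightarrow> \<xi> p \<noteq> 0"
  using xi by (auto simp: lightlike_normal_field_def lightlike_def)

lemma Fd_iff: "(p, t) \<in> Fd \<longleftrightarrow> p \<in> S \<and> (p, t *\<^sub>R \<xi> p) \<in> V"
  by (simp add: flow_domain_def)

lemma Fd_S: "(p, t) \<in> Fd \<Longrightarrow> p \<in> S"
  by (simp add: Fd_iff)

lemma Phi_exp: "Phi (p, t) = exp_map M g (p, t *\<^sub>R \<xi> p)"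
  by (simp add: flow_map_def)

lemma Fd_zero: "p \<in> S \<Longrightarrow> (p, 0) \<in> Fd"
  using V by (simp add: Fd_iff normal_exp_neighborhood_def)

lemma Fd_star: assumes "(p, t) \<in> Fd" "0 \<le> s" "s \<le> 1" shows "(p, s * t) \<in> Fd"
proof -
  have "\<And>p v s. (p, v) \<in> V \<and> 0 \<le> s \<and> s \<le> 1 \<longrightarrow> (p, s *\<^sub>R v) \<in> V"
    using V unfolding normal_exp_neighborhood_def by blast
  from this[of p "t *\<^sub>R \<xi> p" s] show ?thesis using assms by (simp add: Fd_iff)
qed

lemma exp_diffeo:
  obtains B where "openin (mtopology M) B" "bij_betw (exp_map M g) V B"
    "smooth_map (tangent_bundle M) M V (exp_map M g)" "smooth_map M (tangent_bundle M) B (inv_into V (exp_map M g))"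
  using V unfolding normal_exp_neighborhood_def diffeomorphism_onto_def by blast

text \<open>The set \<open>E\<close> is shrunk until the extension \<open>Xh\<close> has no zero
  there: recovering \<open>t\<close> from \<open>t *\<^sub>R \<xi> q\<close> will require division
  by its square.\<close>

lemma xi_chart:
  assumes p: "p \<in> S" and c: "c \<in> charts M" "p \<in> fst c"
  obtains E Xh where "open E" "snd c p \<in> E" "smooth_on E Xh" "\<And>x. x \<in> E \<Longrightarrow> Xh x \<noteq> 0"
    "\<And>q. q \<in> S \<Longrightarrow> q \<in> fst c \<Longrightarrow> snd c q \<in> E \<Longrightarrow> to_chart M c q (\<xi> q) = Xh (snd c q)"
proof -
  obtain D Xh where D: "open D" "snd c p \<in> D" "smooth_on D Xh"
    "\<And>q. q \<in> S \<Longrightarrow> q \<in> fst c \<Longrightarrow> snd c q \<in> D \<Longrightarrow> to_chart M c q (\<xi> q) = Xh (snd c q)"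
    by (rule smooth_fieldD[OF xi_smooth p c]) (rule that)
  have o: "open (D \<inter> Xh -` (- {0}))"
    by (rule continuous_open_preimage[OF smooth_on_continuous_on[OF D(3)] D(1)]) auto
  have "Xh (snd c p) \<noteq> 0" using D(4)[OF p c(2) D(2)] xi_nonzero[OF p] to_chart_0_iff[OF c] by metis
  then show ?thesis
    using that[of "D \<inter> Xh -` (- {0})" Xh] o D(2,4) smooth_on_subset[OF D(3)] by auto
qed

lemma scaled_field_smooth:
  fixes Xh :: "'e \<Rightarrow> 'e"
  assumes "open E" "smooth_on E Xh"
  shows "smooth_on (E \<times> (UNIV::real set)) (\<lambda>z. (fst z, snd z *\<^sub>R Xh (fst z)))"
proof -
  have o: "open (E \<times> (UNIV::real set))" using assms by (simp add: open_Times)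
  show ?thesis
    by (intro smooth_on_Pair smooth_on_scaleR smooth_on_fst smooth_on_snd o smooth_on_compose[OF assms(2) smooth_on_fst _ o assms(1)]) auto
qed

text \<open>The flow domain is relatively open in the product of \<open>S\<close> with the line: in
  coordinates it is the preimage of the open set \<open>T\<close> that cuts \<open>V\<close> out of
  the normal bundle, under the smooth map from \<open>(x, t)\<close> to
  \<open>(x, t *\<^sub>R Xh x)\<close>.\<close>

lemma Fd_open:
  assumes pt: "(p, t) \<in> Fd" and c: "c \<in> charts M" "p \<in> fst c"
  obtains D where "open D" "(snd c p, t) \<in> D"
    "\<And>q t'. q \<in> S \<Longrightarrow> q \<in> fst c \<Longrightarrow> (snd c q, t') \<in> D \<Longrightarrow> (q, t') \<in> Fd"
proof -
  have p: "p \<in> S" by (rule Fd_S[OF pt])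
  obtain T where T: "openin (mtopology (tangent_bundle M)) T" "V = T \<inter> normal_bundle M g S"
    using V unfolding normal_exp_neighborhood_def openin_subtopology by blast
  let ?tc = "tangent_chart M c"
  have tc: "?tc \<in> charts (tangent_bundle M)" using c(1) by (simp add: tangent_charts)
  define P where "P = snd ?tc ` (T \<inter> fst ?tc)"
  have P: "open P" using T(1) tc openin_mtopology_charts[OF tangent_charts_compatible] unfolding P_def by blast
  obtain E Xh where E: "open E" "snd c p \<in> E" "smooth_on E Xh"
    "\<And>q. q \<in> S \<Longrightarrow> q \<in> fst c \<Longrightarrow> snd c q \<in> E \<Longrightarrow> to_chart M c q (\<xi> q) = Xh (snd c q)"
    by (rule xi_chart[OF p c]) (rule that)
  let ?h = "\<lambda>z. (fst z, snd z *\<^sub>R Xh (fst z))"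
  define D where "D = (E \<times> (UNIV::real set)) \<inter> ?h -` P"
  have D: "open D" unfolding D_def
    by (rule continuous_open_preimage[OF smooth_on_continuous_on[OF scaled_field_smooth[OF E(1,3)]] _ P])
      (simp add: open_Times E)
  have h: "snd ?tc (q, t' *\<^sub>R \<xi> q) = ?h (snd c q, t')" if "q \<in> S" "q \<in> fst c" "snd c q \<in> E" for q t'
    using E(4)[OF that] to_chart_simps(3)[OF c(1) that(2)] by (simp add: tangent_chart_simps)
  have *: "(q, t') \<in> Fd" if q: "q \<in> S" "q \<in> fst c" and qD: "(snd c q, t') \<in> D" for q t'
  proof -
    have qE: "snd c q \<in> E" "?h (snd c q, t') \<in> P" using qD by (auto simp: D_def)
    have "(q, t' *\<^sub>R \<xi> q) \<in> fst ?tc" using q by (simp add: tangent_chart_simps)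
    then have "(q, t' *\<^sub>R \<xi> q) \<in> T"
      using chart_image_iff[OF tangent_chart_injective[OF c(1)], of "(q, t' *\<^sub>R \<xi> q)" "T \<inter> fst ?tc"] h[OF q qE(1), of t'] qE(2)
      unfolding P_def by auto
    \<comment> \<open>Membership in the open set \<open>T\<close> gives membership in
      \<open>V\<close> only for normal vectors, and multiples of \<xi> are normal.\<close>
    moreover have "t' *\<^sub>R \<xi> q \<in> normal_space M g S q"
      using xi_normal[OF q(1)] by (simp add: normal_space_def g_simps[OF S_mpoints[OF q(1)]])
    ultimately have "(q, t' *\<^sub>R \<xi> q) \<in> T \<inter> normal_bundle M g S" using q(1) by (simp add: normal_bundle_def)
    then show ?thesis using q(1) unfolding Fd_iff T(2)[symmetric] by blast
  qed
  have "(p, t *\<^sub>R \<xi> p) \<in> V" using pt by (simp add: Fd_iff)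
  then have "(p, t *\<^sub>R \<xi> p) \<in> T" using T(2) by blast
  then have "(p, t *\<^sub>R \<xi> p) \<in> T \<inter> fst ?tc" using c by (simp add: tangent_chart_simps)
  then have "?h (snd c p, t) \<in> P" unfolding P_def h[OF p c(2) E(2), symmetric] by blast
  then have "(snd c p, t) \<in> D" using E(2) by (simp add: D_def)
  then show ?thesis using that[OF D] * by blast
qed

text \<open>A smooth extension \<open>F\<close> of the flow map in coordinates: it is defined on an
  open set of the model space times the line, although the flow map is prescribed only over
  \<open>S\<close>. The clause on \<open>Fd\<close> records that near \<open>(p, t)\<close> every
  pair with first component in \<open>S\<close> belongs to the flow domain.\<close>

definition Phi_rep :: "('m, 'e) chart \<Rightarrow> ('m, 'e) chart \<Rightarrow> 'm \<Rightarrow> real \<Rightarrow> ('e \<times> real) set \<Rightarrow> ('e \<times> real \<Rightarrow> 'e) \<Rightarrow> bool" where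
  "Phi_rep c d p t D F \<longleftrightarrow> open D \<and> (snd c p, t) \<in> D \<and> smooth_on D F \<and>
     (\<forall>q t'. q \<in> S \<longrightarrow> q \<in> fst c \<longrightarrow> (snd c q, t') \<in> D \<longrightarrow>
        (q, t') \<in> Fd \<and> Phi (q, t') \<in> fst d \<and> snd d (Phi (q, t')) = F (snd c q, t'))"

text \<open>A smooth left inverse \<open>P\<close> of the flow map in coordinates, defined on an
  open set of coordinates of \<open>M\<close> and so also at points off \<Sigma>.\<close>

definition Psi_rep :: "('m, 'e) chart \<Rightarrow> ('m, 'e) chart \<Rightarrow> 'm \<Rightarrow> real \<Rightarrow> 'e set \<Rightarrow> ('e \<Rightarrow> 'e \<times> real) \<Rightarrow> bool" where
  "Psi_rep c d p t E P \<longleftrightarrow> open E \<and> snd d (Phi (p, t)) \<in> E \<and> smooth_on E P \<and>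
     (\<forall>q t'. (q, t') \<in> Fd \<longrightarrow> Phi (q, t') \<in> fst d \<longrightarrow> snd d (Phi (q, t')) \<in> E \<longrightarrow>
        q \<in> fst c \<and> P (snd d (Phi (q, t'))) = (snd c q, t'))"

text \<open>A representative of the exponential map in a tangent chart, composed with scaling the
  extension \<open>Xh\<close> of \<xi> by \<open>t\<close>.\<close>

lemma Phi_rep_exists:
  assumes pt: "(p, t) \<in> Fd" and c: "c \<in> charts M" "p \<in> fst c" and d: "d \<in> charts M" "Phi (p, t) \<in> fst d"
  shows "\<exists>D F. Phi_rep c d p t D F"
proof -
  have p: "p \<in> S" by (rule Fd_S[OF pt])
  obtain B where B: "smooth_map (tangent_bundle M) M V (exp_map M g)" by (rule exp_diffeo)
  let ?tc = "tangent_chart M c"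
  have tc: "?tc \<in> charts (tangent_bundle M)" using c(1) by (simp add: tangent_charts)
  have ptV: "(p, t *\<^sub>R \<xi> p) \<in> V" using pt by (simp add: Fd_iff)
  have ptc: "(p, t *\<^sub>R \<xi> p) \<in> fst ?tc" using c by (simp add: tangent_chart_simps)
  have ptd: "exp_map M g (p, t *\<^sub>R \<xi> p) \<in> fst d" using d by (simp add: Phi_exp)
  obtain D1 F0 where F0: "open D1" "snd ?tc (p, t *\<^sub>R \<xi> p) \<in> D1" "smooth_on D1 F0"
    "\<And>q. q \<in> V \<Longrightarrow> q \<in> fst ?tc \<Longrightarrow> snd ?tc q \<in> D1 \<Longrightarrow> exp_map M g q \<in> fst d \<and> snd d (exp_map M g q) = F0 (snd ?tc q)"
    by (rule smooth_mapD[OF B ptV tc tangent_chart_injective[OF c(1)] ptc d(1) ptd]) (rule that)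
  obtain E Xh where E: "open E" "snd c p \<in> E" "smooth_on E Xh"
    "\<And>q. q \<in> S \<Longrightarrow> q \<in> fst c \<Longrightarrow> snd c q \<in> E \<Longrightarrow> to_chart M c q (\<xi> q) = Xh (snd c q)"
    by (rule xi_chart[OF p c]) (rule that)
  obtain D0 where D0: "open D0" "(snd c p, t) \<in> D0"
    "\<And>q t'. q \<in> S \<Longrightarrow> q \<in> fst c \<Longrightarrow> (snd c q, t') \<in> D0 \<Longrightarrow> (q, t') \<in> Fd"
    by (rule Fd_open[OF pt c]) (rule that)
  let ?h = "\<lambda>z. (fst z, snd z *\<^sub>R Xh (fst z))"
  have h: "snd ?tc (q, t' *\<^sub>R \<xi> q) = ?h (snd c q, t')" if "q \<in> S" "q \<in> fst c" "snd c q \<in> E" for q t'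
    using E(4)[OF that] to_chart_simps(3)[OF c(1) that(2)] by (simp add: tangent_chart_simps)
  define D where "D = D0 \<inter> ((E \<times> (UNIV::real set)) \<inter> ?h -` D1)"
  have "open ((E \<times> (UNIV::real set)) \<inter> ?h -` D1)"
    by (rule continuous_open_preimage[OF smooth_on_continuous_on[OF scaled_field_smooth[OF E(1,3)]] _ F0(1)])
      (simp add: open_Times E)
  then have D: "open D" using D0(1) by (simp add: D_def open_Int)
  have "smooth_on D ?h" by (rule smooth_on_subset[OF scaled_field_smooth[OF E(1,3)]]) (auto simp: D_def)
  from smooth_on_compose[OF F0(3) this _ D F0(1)] have "smooth_on D (\<lambda>z. F0 (?h z))" by (auto simp: D_def)
  moreover have "(snd c p, t) \<in> D" using D0(2) E(2) F0(2) h[OF p c(2) E(2), of t] by (simp add: D_def)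
  moreover have "(q, t') \<in> Fd \<and> Phi (q, t') \<in> fst d \<and> snd d (Phi (q, t')) = F0 (?h (snd c q, t'))"
    if q: "q \<in> S" "q \<in> fst c" "(snd c q, t') \<in> D" for q t'
  proof -
    have qE: "snd c q \<in> E" "?h (snd c q, t') \<in> D1" "(snd c q, t') \<in> D0" using q(3) by (auto simp: D_def)
    have fd: "(q, t') \<in> Fd" by (rule D0(3)[OF q(1,2) qE(3)])
    then have "(q, t' *\<^sub>R \<xi> q) \<in> V" by (simp add: Fd_iff)
    moreover have "(q, t' *\<^sub>R \<xi> q) \<in> fst ?tc" using q by (simp add: tangent_chart_simps)
    ultimately show ?thesis using F0(4)[of "(q, t' *\<^sub>R \<xi> q)"] h[OF q(1,2) qE(1), of t'] qE(2) fd by (simp add: Phi_exp)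
  qed
  ultimately have "Phi_rep c d p t D (\<lambda>z. F0 (?h z))" unfolding Phi_rep_def using D by blast
  then show ?thesis by blast
qed

text \<open>The inverse of the exponential map on \<open>V\<close> returns the foot point together
  with \<open>t *\<^sub>R \<xi> q\<close>. The scalar \<open>t\<close> is then extracted from this
  vector.\<close>

lemma Psi_rep_exists:
  assumes pt: "(p, t) \<in> Fd" and c: "c \<in> charts M" "p \<in> fst c" and d: "d \<in> charts M" "Phi (p, t) \<in> fst d"
  shows "\<exists>E P. Psi_rep c d p t E P"
proof -
  have p: "p \<in> S" by (rule Fd_S[OF pt])
  let ?e = "exp_map M g"
  obtain B where B: "bij_betw ?e V B" "smooth_map M (tangent_bundle M) B (inv_into V ?e)" by (rule exp_diffeo)
  have VB: "?e z \<in> B" "inv_into V ?e (?e z) = z" if "z \<in> V" for z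
    using B(1) that by (auto simp: bij_betw_def inv_into_f_f)
  let ?tc = "tangent_chart M c"
  have tc: "?tc \<in> charts (tangent_bundle M)" using c(1) by (simp add: tangent_charts)
  have ptV: "(p, t *\<^sub>R \<xi> p) \<in> V" using pt by (simp add: Fd_iff)
  have qB: "Phi (p, t) \<in> B" "inv_into V ?e (Phi (p, t)) = (p, t *\<^sub>R \<xi> p)" unfolding Phi_exp using VB[OF ptV] by simp_all
  have ptc: "inv_into V ?e (Phi (p, t)) \<in> fst ?tc" using c by (simp add: qB tangent_chart_simps)
  obtain D2 F2 where F2: "open D2" "snd d (Phi (p, t)) \<in> D2" "smooth_on D2 F2"
    "\<And>q. q \<in> B \<Longrightarrow> q \<in> fst d \<Longrightarrow> snd d q \<in> D2 \<Longrightarrow> inv_into V ?e q \<in> fst ?tc \<and> snd ?tc (inv_into V ?e q) = F2 (snd d q)"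
    by (rule smooth_mapD[OF B(2) qB(1) d(1) chart_inj[OF d(1)] d(2) tc ptc]) (rule that)
  obtain E Xh where E: "open E" "snd c p \<in> E" "smooth_on E Xh" "\<And>x. x \<in> E \<Longrightarrow> Xh x \<noteq> 0"
    "\<And>q. q \<in> S \<Longrightarrow> q \<in> fst c \<Longrightarrow> snd c q \<in> E \<Longrightarrow> to_chart M c q (\<xi> q) = Xh (snd c q)"
    by (rule xi_chart[OF p c]) (rule that)
  define E2 where "E2 = D2 \<inter> (\<lambda>y. fst (F2 y)) -` E"
  have sf: "smooth_on D2 (\<lambda>y. fst (F2 y))" by (rule smooth_on_fstI[OF F2(3,1)])
  have E2: "open E2" unfolding E2_def by (rule continuous_open_preimage[OF smooth_on_continuous_on[OF sf] F2(1) E(1)])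
  have sF: "smooth_on E2 F2" by (rule smooth_on_subset[OF F2(3)]) (auto simp: E2_def)
  have sX: "smooth_on E2 (\<lambda>y. Xh (fst (F2 y)))"
    by (rule smooth_on_compose[OF E(3) smooth_on_fstI[OF sF E2] _ E2 E(1)]) (auto simp: E2_def)
  \<comment> \<open>The Euclidean product with \<open>Xh\<close> divided by its square: a smooth
    function of any vector that returns \<open>t\<close> on multiples \<open>t\<close> of
    \<open>Xh\<close>.\<close>
  define P where "P y = (fst (F2 y), (snd (F2 y) \<bullet> Xh (fst (F2 y))) * inverse (Xh (fst (F2 y)) \<bullet> Xh (fst (F2 y))))" for y
  have "smooth_on E2 P" unfolding P_def
    by (intro smooth_on_Pair smooth_on_mult smooth_on_inner smooth_on_inverse smooth_on_fstI smooth_on_sndI sF sX E2)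
      (use E(4) in \<open>auto simp: E2_def\<close>)
  moreover have main: "q \<in> fst c \<and> F2 (snd d (Phi (q, t'))) = (snd c q, to_chart M c q (t' *\<^sub>R \<xi> q))"
    if q: "(q, t') \<in> Fd" "Phi (q, t') \<in> fst d" "snd d (Phi (q, t')) \<in> D2" for q t'
  proof -
    have "(q, t' *\<^sub>R \<xi> q) \<in> V" using q(1) by (simp add: Fd_iff)
    from VB[OF this] have "Phi (q, t') \<in> B" "inv_into V ?e (Phi (q, t')) = (q, t' *\<^sub>R \<xi> q)" by (simp_all add: Phi_exp)
    then show ?thesis using F2(4)[OF _ q(2,3)] by (auto simp: tangent_chart_simps)
  qed
  moreover have "snd d (Phi (p, t)) \<in> E2" using main[OF pt d(2) F2(2)] F2(2) E(2) by (simp add: E2_def)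
  moreover have "q \<in> fst c \<and> P (snd d (Phi (q, t'))) = (snd c q, t')"
    if q: "(q, t') \<in> Fd" "Phi (q, t') \<in> fst d" "snd d (Phi (q, t')) \<in> E2" for q t'
  proof -
    have q2: "snd d (Phi (q, t')) \<in> D2" using q(3) by (simp add: E2_def)
    note m = main[OF q(1,2) q2]
    have qE: "snd c q \<in> E" using q(3) m by (simp add: E2_def)
    have "to_chart M c q (t' *\<^sub>R \<xi> q) = t' *\<^sub>R Xh (snd c q)"
      using E(5)[OF Fd_S[OF q(1)] _ qE] m to_chart_simps(3)[OF c(1)] by simp
    then show ?thesis using m E(4)[OF qE] by (simp add: P_def)
  qed
  ultimately have "Psi_rep c d p t E2 P" unfolding Psi_rep_def using E2 by blast
  then show ?thesis by blast
qed

lemma Phi_mpoints: "(p, t) \<in> Fd \<Longrightarrow> Phi (p, t) \<in> mpoints M"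
proof -
  assume pt: "(p, t) \<in> Fd"
  obtain B where B: "smooth_map (tangent_bundle M) M V (exp_map M g)" by (rule exp_diffeo)
  then show ?thesis using smooth_map_mpoints[OF B] pt by (auto simp: Fd_iff Phi_exp)
qed

lemma Phi_inj: "inj_on Phi Fd"
proof (rule inj_onI)
  fix z w assume zw: "z \<in> Fd" "w \<in> Fd" "Phi z = Phi w"
  obtain p s q t where e: "z = (p, s)" "w = (q, t)" by (metis surj_pair)
  obtain B where "bij_betw (exp_map M g) V B" by (rule exp_diffeo)
  then have "(p, s *\<^sub>R \<xi> p) = (q, t *\<^sub>R \<xi> q)"
    using zw unfolding e Fd_iff Phi_exp bij_betw_def by (meson inj_onD)
  then show "z = w" using xi_nonzero[of p] zw(1) by (auto simp: e Fd_iff)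
qed

lemma Phi_zero: "p \<in> S \<Longrightarrow> Phi (p, 0) = p"
  by (simp add: Phi_exp exp_map_zero S_mpoints)

lemma Phi_smooth_map:
  fixes a :: "'v::euclidean_space \<Rightarrow> 'm"
  assumes a: "smooth_map euclid M W a" "open W" and \<tau>: "smooth_on W \<tau>" and Fd: "\<And>u. u \<in> W \<Longrightarrow> (a u, \<tau> u) \<in> Fd"
  shows "smooth_map euclid M W (\<lambda>u. Phi (a u, \<tau> u))"
proof (rule smooth_map_euclidI[OF charts_compatible])
  fix u assume u: "u \<in> W"
  note pt = Fd[OF u]
  note c = chart_at_in[OF S_mpoints[OF Fd_S[OF pt]]] and d = chart_at_in[OF Phi_mpoints[OF pt]]
  let ?c = "chart_at M (a u)" and ?d = "chart_at M (Phi (a u, \<tau> u))"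
  obtain D F where rep: "Phi_rep ?c ?d (a u) (\<tau> u) D F" using Phi_rep_exists[OF pt c d] by blast
  obtain N where N: "open N" "u \<in> N" "N \<subseteq> W" "a ` N \<subseteq> fst ?c" "smooth_on N (\<lambda>s. snd ?c (a s))"
    using smooth_map_euclidD[OF a u c] .
  have sm: "smooth_on N (\<lambda>s. (snd ?c (a s), \<tau> s))"
    by (intro smooth_on_Pair N smooth_on_subset[OF \<tau>])
  define N' where "N' = N \<inter> (\<lambda>s. (snd ?c (a s), \<tau> s)) -` D"
  have D: "open D" "(snd ?c (a u), \<tau> u) \<in> D" "smooth_on D F" using rep by (auto simp: Phi_rep_def)
  have N': "open N'" unfolding N'_def
    by (rule continuous_open_preimage[OF smooth_on_continuous_on[OF sm] N(1) D(1)])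
  have k: "Phi (a s, \<tau> s) \<in> fst ?d \<and> snd ?d (Phi (a s, \<tau> s)) = F (snd ?c (a s), \<tau> s)" if s: "s \<in> N'" for s
  proof -
    have "a s \<in> S" "a s \<in> fst ?c" "(snd ?c (a s), \<tau> s) \<in> D" using s N(3,4) Fd_S[OF Fd] by (auto simp: N'_def)
    then show ?thesis using rep unfolding Phi_rep_def by blast
  qed
  have "smooth_on N' (\<lambda>s. F (snd ?c (a s), \<tau> s))"
    by (rule smooth_on_compose[OF D(3) smooth_on_subset[OF sm] _ N' D(1)]) (auto simp: N'_def)
  then have "smooth_on N' (\<lambda>s. snd ?d (Phi (a s, \<tau> s)))"
    by (rule smooth_on_cong[OF _ N']) (simp add: k)
  moreover have "u \<in> N'" using N(2) D(2) by (simp add: N'_def)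
  ultimately show "\<exists>d\<in>charts M. \<exists>D. open D \<and> u \<in> D \<and> (\<lambda>u. Phi (a u, \<tau> u)) ` D \<subseteq> fst d \<and> smooth_on D (\<lambda>s. snd d (Phi (a s, \<tau> s)))"
    using d(1) N' k by (intro bexI[of _ ?d] exI[of _ N']) auto
qed

subsection \<open>The differential of the flow map\<close>

text \<open>Realises the tangent vector \<open>(x, a)\<close> of the product by moving the foot
  point along \<alpha> and the time at speed \<open>a\<close>; relative openness keeps this curve in
  the flow domain for a short while.\<close>

lemma flow_curve:
  assumes pt: "(p, t) \<in> Fd" and \<alpha>: "curve_through M S p x \<alpha>"
  shows "curve_through MR Fd (p, t) (x, a) (\<lambda>s. (\<alpha> s, t + a * s))"
proof -
  have p: "p \<in> S" by (rule Fd_S[OF pt])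
  let ?c = "chart_at M p"
  note c = chart_at_in[OF S_mpoints[OF p]]
  interpret r: atlas MR by (rule atlas_MR)
  obtain e where e: "e > 0" "\<alpha> ` {-e<..<e} \<subseteq> S" "\<alpha> ` {-e<..<e} \<subseteq> fst ?c"
    "smooth_on {-e<..<e} (\<lambda>s. snd ?c (\<alpha> s))" "((\<lambda>s. snd ?c (\<alpha> s)) has_vector_derivative to_chart M ?c p x) (at 0)" "\<alpha> 0 = p"
    using curve_throughD[OF \<alpha> c] .
  obtain D where D: "open D" "(snd ?c p, t) \<in> D"
    "\<And>q t'. q \<in> S \<Longrightarrow> q \<in> fst ?c \<Longrightarrow> (snd ?c q, t') \<in> D \<Longrightarrow> (q, t') \<in> Fd"
    by (rule Fd_open[OF pt c]) (rule that)
  let ?b = "\<lambda>s. (snd ?c (\<alpha> s), t + a * s)"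
  have sb: "smooth_on {-e<..<e} ?b"
    by (intro smooth_on_Pair e smooth_on_add smooth_on_mult smooth_on_const smooth_on_ident open_greaterThanLessThan)
  have "open ({-e<..<e} \<inter> ?b -` D)"
    by (rule continuous_open_preimage[OF smooth_on_continuous_on[OF sb] open_greaterThanLessThan D(1)])
  moreover have "0 \<in> {-e<..<e} \<inter> ?b -` D" using e D by simp
  ultimately obtain \<epsilon> where \<epsilon>: "\<epsilon> > 0" "ball 0 \<epsilon> \<subseteq> {-e<..<e} \<inter> ?b -` D" using openE by blast
  have b: "ball (0::real) \<epsilon> = {-\<epsilon><..<\<epsilon>}" by (auto simp: ball_def dist_real_def)
  have in_e: "s \<in> {-e<..<e}" "?b s \<in> D" if "s \<in> {-\<epsilon><..<\<epsilon>}" for s using \<epsilon>(2) that unfolding b by auto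
  show ?thesis
  proof (rule r.curve_throughI[of "rchart ?c", OF _ \<epsilon>(1)])
    show "rchart ?c \<in> charts MR" using c by (simp add: rcharts)
    show "(\<lambda>s. (\<alpha> s, t + a * s)) ` {-\<epsilon><..<\<epsilon>} \<subseteq> Fd"
    proof
      fix z assume "z \<in> (\<lambda>s. (\<alpha> s, t + a * s)) ` {-\<epsilon><..<\<epsilon>}"
      then obtain s where s: "s \<in> {-\<epsilon><..<\<epsilon>}" "z = (\<alpha> s, t + a * s)" by blast
      have "\<alpha> s \<in> S" "\<alpha> s \<in> fst ?c" using e(2,3) in_e(1)[OF s(1)] by blast+
      then show "z \<in> Fd" using D(3) in_e(2)[OF s(1)] s(2) by blast
    qed
    show "(\<lambda>s. (\<alpha> s, t + a * s)) ` {-\<epsilon><..<\<epsilon>} \<subseteq> fst (rchart ?c)"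
      using e(3) in_e(1) by (auto simp: rchart_simps image_subset_iff)
    have "smooth_on {-\<epsilon><..<\<epsilon>} ?b" by (rule smooth_on_subset[OF sb]) (use in_e(1) in blast)
    then show "smooth_on {-\<epsilon><..<\<epsilon>} (\<lambda>s. snd (rchart ?c) (\<alpha> s, t + a * s))" by (simp add: rchart_simps)
    have "(?b has_vector_derivative (to_chart M ?c p x, a)) (at 0)"
      by (intro has_vector_derivative_Pair e(5)) (auto intro!: derivative_eq_intros)
    then show "((\<lambda>s. snd (rchart ?c) (\<alpha> s, t + a * s)) has_vector_derivative to_chart MR (rchart ?c) (p, t) (x, a)) (at 0)"
      by (simp add: rchart_simps to_chart_rchart[OF c])
    show "(\<alpha> 0, t + a * 0) = (p, t)" using e(6) by simp
  qed
qed

text \<open>The first claim shows that the image velocity depends only on \<open>(x, a)\<close>, so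
  the description of the differential is proper. The second recovers \<open>(x, a)\<close> from the
  image velocity, which is injectivity of the differential in the making.\<close>

lemma flow_curve_velocity:
  assumes pt: "(p, t) \<in> Fd" and c: "c \<in> charts M" "p \<in> fst c" and d: "d \<in> charts M" "Phi (p, t) \<in> fst d"
    and \<beta>: "curve_through MR Fd (p, t) (x, a) \<beta>"
  shows "Phi_rep c d p t D F \<Longrightarrow> to_chart M d (Phi (p, t)) (velocity M (Phi \<circ> \<beta>) 0) = FD F (snd c p, t) (to_chart M c p x, a)"
    and "Psi_rep c d p t E P \<Longrightarrow> FD P (snd d (Phi (p, t))) (to_chart M d (Phi (p, t)) (velocity M (Phi \<circ> \<beta>) 0)) = (to_chart M c p x, a)"
proof -
  interpret r: atlas MR by (rule atlas_MR)
  have rc: "rchart c \<in> charts MR" "(p, t) \<in> fst (rchart c)" using c by (simp_all add: rcharts rchart_simps)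
  obtain e where e: "e > 0" "\<beta> ` {-e<..<e} \<subseteq> Fd" "\<beta> ` {-e<..<e} \<subseteq> fst (rchart c)"
    "smooth_on {-e<..<e} (\<lambda>s. snd (rchart c) (\<beta> s))"
    "((\<lambda>s. snd (rchart c) (\<beta> s)) has_vector_derivative to_chart MR (rchart c) (p, t) (x, a)) (at 0)" "\<beta> 0 = (p, t)"
    using r.curve_throughD[OF \<beta> rc] .
  let ?b = "\<lambda>s. (snd c (fst (\<beta> s)), snd (\<beta> s))"
  have b: "snd (rchart c) (\<beta> s) = ?b s" for s using rchart_simps(2)[of c "fst (\<beta> s)" "snd (\<beta> s)"] by simp
  have sb: "smooth_on {-e<..<e} ?b" using e(4) by (simp add: b)
  have bd: "(?b has_vector_derivative (to_chart M c p x, a)) (at 0)"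
    using e(5) by (simp add: b to_chart_rchart[OF c])
  have bS: "fst (\<beta> s) \<in> S \<and> fst (\<beta> s) \<in> fst c \<and> \<beta> s \<in> Fd" if "s \<in> {-e<..<e}" for s
  proof -
    have "\<beta> s \<in> Fd" "\<beta> s \<in> fst (rchart c)" using e(2,3) that by blast+
    then show ?thesis using Fd_S[of "fst (\<beta> s)" "snd (\<beta> s)"] by (auto simp: rchart_simps)
  qed
  obtain D0 F0 where rep0: "Phi_rep c d p t D0 F0" using Phi_rep_exists[OF pt c d] by blast
  have vel: "to_chart M d (Phi (p, t)) (velocity M (Phi \<circ> \<beta>) 0) = FD F (snd c p, t) (to_chart M c p x, a) \<and>
     ((\<lambda>s. snd d ((Phi \<circ> \<beta>) s)) has_vector_derivative FD F (snd c p, t) (to_chart M c p x, a)) (at 0) \<and>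
     (\<exists>N. open N \<and> 0 \<in> N \<and> N \<subseteq> {-e<..<e} \<and> (Phi \<circ> \<beta>) ` N \<subseteq> fst d)"
    if rep: "Phi_rep c d p t D F" for D F
  proof -
    have D: "open D" "(snd c p, t) \<in> D" "smooth_on D F"
      and ext: "\<And>q t'. q \<in> S \<Longrightarrow> q \<in> fst c \<Longrightarrow> (snd c q, t') \<in> D \<Longrightarrow>
        Phi (q, t') \<in> fst d \<and> snd d (Phi (q, t')) = F (snd c q, t')" using rep unfolding Phi_rep_def by blast+
    define N where "N = {-e<..<e} \<inter> ?b -` D"
    have N: "open N" "0 \<in> N" unfolding N_def
      using continuous_open_preimage[OF smooth_on_continuous_on[OF sb] open_greaterThanLessThan D(1)] e D(2) by auto
    have k: "(Phi \<circ> \<beta>) s \<in> fst d \<and> snd d ((Phi \<circ> \<beta>) s) = F (?b s)" if s: "s \<in> N" for s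
    proof -
      have "s \<in> {-e<..<e}" "?b s \<in> D" using s by (simp_all add: N_def)
      then show ?thesis using ext[of "fst (\<beta> s)" "snd (\<beta> s)"] bS[of s] by simp
    qed
    have b0: "?b 0 = (snd c p, t)" by (simp add: e(6))
    have "((\<lambda>s. F (?b s)) has_vector_derivative FD F (?b 0) (to_chart M c p x, a)) (at 0)"
      by (rule has_vector_derivative_chain_FD[OF _ bd]) (simp only: b0 smooth_on_imp_differentiable[OF D(3,2)])
    then have "((\<lambda>s. F (?b s)) has_vector_derivative FD F (snd c p, t) (to_chart M c p x, a)) (at 0)"
      by (simp only: b0)
    then have vd: "((\<lambda>s. snd d ((Phi \<circ> \<beta>) s)) has_vector_derivative FD F (snd c p, t) (to_chart M c p x, a)) (at 0)"
      by (rule has_vector_derivative_transform_within_open[OF _ N]) (rule k[THEN conjunct2, symmetric])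
    have im: "(Phi \<circ> \<beta>) ` N \<subseteq> fst d" using k by blast
    have "to_chart M d (Phi (p, t)) (velocity M (Phi \<circ> \<beta>) 0) = FD F (snd c p, t) (to_chart M c p x, a)"
      using velocity_chart(1)[OF d(1) N im vd] by (simp only: comp_def e(6))
    moreover have "N \<subseteq> {-e<..<e}" by (simp add: N_def)
    ultimately show ?thesis using vd N im by blast
  qed
  show "Phi_rep c d p t D F \<Longrightarrow> to_chart M d (Phi (p, t)) (velocity M (Phi \<circ> \<beta>) 0) = FD F (snd c p, t) (to_chart M c p x, a)"
    by (rule vel[THEN conjunct1])
  assume rep: "Psi_rep c d p t E P"
  have E: "open E" "snd d (Phi (p, t)) \<in> E" "smooth_on E P"
    and ext: "\<And>q t'. (q, t') \<in> Fd \<Longrightarrow> Phi (q, t') \<in> fst d \<Longrightarrow> snd d (Phi (q, t')) \<in> E \<Longrightarrow> P (snd d (Phi (q, t'))) = (snd c q, t')"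
    using rep unfolding Psi_rep_def by blast+
  obtain N where N: "open N" "0 \<in> N" "N \<subseteq> {-e<..<e}" "(Phi \<circ> \<beta>) ` N \<subseteq> fst d" using vel[OF rep0] by blast
  let ?v = "to_chart M d (Phi (p, t)) (velocity M (Phi \<circ> \<beta>) 0)"
  have vd: "((\<lambda>s. snd d ((Phi \<circ> \<beta>) s)) has_vector_derivative ?v) (at 0)" using vel[OF rep0] by metis
  have "isCont (\<lambda>s. snd d ((Phi \<circ> \<beta>) s)) 0" by (rule has_vector_derivative_continuous[OF vd])
  from topological_tendstoD[OF this[unfolded isCont_def] E(1)] 
  obtain N1 where N1: "open N1" "0 \<in> N1" "\<forall>s\<in>N1. s \<noteq> 0 \<longrightarrow> s \<in> UNIV \<longrightarrow> snd d ((Phi \<circ> \<beta>) s) \<in> E"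
    using E(2) e(6) unfolding eventually_at_topological by auto
  have N2: "open (N \<inter> N1)" "0 \<in> N \<inter> N1" using N N1 by auto
  have "((\<lambda>s. P (snd d ((Phi \<circ> \<beta>) s))) has_vector_derivative FD P (snd d ((Phi \<circ> \<beta>) 0)) ?v) (at 0)"
    by (rule has_vector_derivative_chain_FD[OF _ vd]) (use smooth_on_imp_differentiable[OF E(3,2)] e(6) in simp)
  then have "(?b has_vector_derivative FD P (snd d ((Phi \<circ> \<beta>) 0)) ?v) (at 0)"
  proof (rule has_vector_derivative_transform_within_open[OF _ N2])
    fix s assume s: "s \<in> N \<inter> N1"
    have "snd d (Phi (\<beta> s)) \<in> E" using s N1(3) E(2) e(6) by (cases "s = 0") auto
    moreover have "Phi (\<beta> s) \<in> fst d" using s N(4) by auto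
    moreover have "\<beta> s \<in> Fd" using bS[of s] s N(3) by blast
    ultimately show "P (snd d ((Phi \<circ> \<beta>) s)) = ?b s" using ext[of "fst (\<beta> s)" "snd (\<beta> s)"] by simp
  qed
  then have "FD P (snd d ((Phi \<circ> \<beta>) 0)) ?v = (to_chart M c p x, a)" using vector_derivative_unique_at[OF _ bd] by blast
  then show "FD P (snd d (Phi (p, t))) (to_chart M d (Phi (p, t)) (velocity M (Phi \<circ> \<beta>) 0)) = (to_chart M c p x, a)"
    using e(6) by simp
qed

lemma dPhi_curve:
  assumes pt: "(p, t) \<in> Fd" and \<beta>: "curve_through MR Fd (p, t) (x, a) \<beta>"
  shows "dPhi (p, t) (x, a) = velocity M (Phi \<circ> \<beta>) 0"
  unfolding flow_differential_def differential_def
proof (rule the_equality)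
  note c = chart_at_in[OF S_mpoints[OF Fd_S[OF pt]]] and d = chart_at_in[OF Phi_mpoints[OF pt]]
  obtain D F where rep: "Phi_rep (chart_at M p) (chart_at M (Phi (p, t))) p t D F" using Phi_rep_exists[OF pt c d] by blast
  show "\<forall>\<alpha>. curve_through MR Fd (p, t) (x, a) \<alpha> \<longrightarrow> velocity M (Phi \<circ> \<alpha>) 0 = velocity M (Phi \<circ> \<beta>) 0"
  proof (intro allI impI)
    fix \<alpha> assume \<alpha>: "curve_through MR Fd (p, t) (x, a) \<alpha>"
    show "velocity M (Phi \<circ> \<alpha>) 0 = velocity M (Phi \<circ> \<beta>) 0"
      by (rule to_chart_inj[OF d, THEN iffD1])
        (simp only: flow_curve_velocity(1)[OF pt c d \<alpha> rep] flow_curve_velocity(1)[OF pt c d \<beta> rep])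
  qed
  fix w assume "\<forall>\<alpha>. curve_through MR Fd (p, t) (x, a) \<alpha> \<longrightarrow> velocity M (Phi \<circ> \<alpha>) 0 = w"
  then show "w = velocity M (Phi \<circ> \<beta>) 0" using \<beta> by blast
qed

lemma dPhi_chart:
  assumes pt: "(p, t) \<in> Fd" and c: "c \<in> charts M" "p \<in> fst c" and d: "d \<in> charts M" "Phi (p, t) \<in> fst d"
    and x: "x \<in> TS p"
  shows "Phi_rep c d p t D F \<Longrightarrow> to_chart M d (Phi (p, t)) (dPhi (p, t) (x, a)) = FD F (snd c p, t) (to_chart M c p x, a)"
    and "Psi_rep c d p t E P \<Longrightarrow> FD P (snd d (Phi (p, t))) (to_chart M d (Phi (p, t)) (dPhi (p, t) (x, a))) = (to_chart M c p x, a)"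
proof -
  obtain \<alpha> where "curve_through M S p x \<alpha>" using x by (auto simp: tangent_space_def)
  note \<beta> = flow_curve[OF pt this, of a]
  show "Phi_rep c d p t D F \<Longrightarrow> to_chart M d (Phi (p, t)) (dPhi (p, t) (x, a)) = FD F (snd c p, t) (to_chart M c p x, a)"
    and "Psi_rep c d p t E P \<Longrightarrow> FD P (snd d (Phi (p, t))) (to_chart M d (Phi (p, t)) (dPhi (p, t) (x, a))) = (to_chart M c p x, a)"
    unfolding dPhi_curve[OF pt \<beta>] by (rule flow_curve_velocity[OF pt c d \<beta>], assumption)+
qed

text \<open>The derivative of the left inverse \<open>P\<close> sends the zero vector to zero, and
  it sends the image of \<open>(x, a)\<close> back to the components of
  \<open>(x, a)\<close>.\<close>

lemma dPhi_inj:
  assumes pt: "(p, t) \<in> Fd" and x: "x \<in> TS p" and z: "dPhi (p, t) (x, a) = 0"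
  shows "x = 0 \<and> a = 0"
proof -
  note c = chart_at_in[OF S_mpoints[OF Fd_S[OF pt]]] and d = chart_at_in[OF Phi_mpoints[OF pt]]
  obtain E P where rep: "Psi_rep (chart_at M p) (chart_at M (Phi (p, t))) p t E P" using Psi_rep_exists[OF pt c d] by blast
  have "smooth_on E P" "snd (chart_at M (Phi (p, t))) (Phi (p, t)) \<in> E" using rep by (auto simp: Psi_rep_def)
  then have "FD P (snd (chart_at M (Phi (p, t))) (Phi (p, t))) 0 = 0" by (intro linear_0 smooth_on_linear_FD)
  then have "(to_chart M (chart_at M p) p x, a) = 0"
    using dPhi_chart(2)[OF pt c d x rep, of a] z to_chart_simps(5)[OF d] by simp
  then show ?thesis using to_chart_0_iff[OF c] by (simp add: zero_prod_def)
qed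

lemma dPhi_combination:
  assumes pt: "(p, t) \<in> Fd" and x: "x \<in> TS p" "y \<in> TS p"
  shows "dPhi (p, t) (r *\<^sub>R x + s *\<^sub>R y, r * a + s * b) = r *\<^sub>R dPhi (p, t) (x, a) + s *\<^sub>R dPhi (p, t) (y, b)"
proof -
  note p = Fd_S[OF pt]
  note c = chart_at_in[OF S_mpoints[OF p]] and d = chart_at_in[OF Phi_mpoints[OF pt]]
  let ?c = "chart_at M p"
  obtain D F where rep: "Phi_rep ?c (chart_at M (Phi (p, t))) p t D F" using Phi_rep_exists[OF pt c d] by blast
  have "smooth_on D F" "(snd ?c p, t) \<in> D" using rep by (auto simp: Phi_rep_def)
  then have lin: "linear (FD F (snd ?c p, t))" by (rule smooth_on_linear_FD)
  have xy: "r *\<^sub>R x + s *\<^sub>R y \<in> TS p" using x TS_subspace[OF p] by (simp add: subspace_add subspace_scale)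
  have e: "(to_chart M ?c p (r *\<^sub>R x + s *\<^sub>R y), r * a + s * b) = r *\<^sub>R (to_chart M ?c p x, a) + s *\<^sub>R (to_chart M ?c p y, b)"
    by (simp add: to_chart_simps[OF c])
  have "to_chart M (chart_at M (Phi (p, t))) (Phi (p, t)) (dPhi (p, t) (r *\<^sub>R x + s *\<^sub>R y, r * a + s * b)) =
     to_chart M (chart_at M (Phi (p, t))) (Phi (p, t)) (r *\<^sub>R dPhi (p, t) (x, a) + s *\<^sub>R dPhi (p, t) (y, b))"
    unfolding to_chart_simps[OF d] dPhi_chart(1)[OF pt c d xy rep] dPhi_chart(1)[OF pt c d x(1) rep] dPhi_chart(1)[OF pt c d x(2) rep]
    by (simp only: e linear_add[OF lin] linear_scale[OF lin])
  then show ?thesis by (simp add: to_chart_inj[OF d])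
qed

end

lemma smooth_map_cong: "smooth_map M N A f \<Longrightarrow> (\<And>q. q \<in> A \<Longrightarrow> f q = f' q) \<Longrightarrow> smooth_map M N A f'"
  unfolding smooth_map_def by (metis IntD1)

context lightlike_flow
begin

subsection \<open>Generators\<close>

lemma generator_domain_open: "open {t. (p, t) \<in> Fd}"
proof (subst open_subopen, intro ballI)
  fix t assume "t \<in> {t. (p, t) \<in> Fd}"
  then have pt: "(p, t) \<in> Fd" by simp
  note p = Fd_S[OF pt] note c = chart_at_in[OF S_mpoints[OF p]]
  obtain D where D: "open D" "(snd (chart_at M p) p, t) \<in> D"
    "\<And>q t'. q \<in> S \<Longrightarrow> q \<in> fst (chart_at M p) \<Longrightarrow> (snd (chart_at M p) q, t') \<in> D \<Longrightarrow> (q, t') \<in> Fd"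
    by (rule Fd_open[OF pt c]) (rule that)
  have "open ((\<lambda>t. (snd (chart_at M p) p, t)) -` D)" by (intro open_vimage D(1) continuous_intros)
  then show "\<exists>T. open T \<and> t \<in> T \<and> T \<subseteq> {t. (p, t) \<in> Fd}"
    using D(2) D(3)[OF p c(2)] by (intro exI[of _ "(\<lambda>t. (snd (chart_at M p) p, t)) -` D"]) auto
qed

text \<open>Star-shapedness of \<open>V\<close>: a time between two admissible ones is zero or lies
  between zero and one of them.\<close>

lemma generator_domain_interval: "is_interval {t. (p, t) \<in> Fd}"
  unfolding is_interval_1
proof (intro ballI allI impI)
  fix a b x assume ab: "a \<in> {t. (p, t) \<in> Fd}" "b \<in> {t. (p, t) \<in> Fd}" and x: "a \<le> x \<and> x \<le> b"
  show "x \<in> {t. (p, t) \<in> Fd}"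
  proof (cases x "0::real" rule: linorder_cases)
    case less
    then have "0 \<le> x / a" "x / a \<le> 1" "x / a * a = x" using x by (auto simp: divide_simps)
    then show ?thesis using Fd_star[of p a "x / a"] ab by auto
  next
    case equal
    then show ?thesis using Fd_zero ab Fd_S[of p a] by auto
  next
    case greater
    then have "0 \<le> x / b" "x / b \<le> 1" "x / b * b = x" using x by (auto simp: divide_simps)
    then show ?thesis using Fd_star[of p b "x / b"] ab by auto
  qed
qed

lemma generator_smooth: "smooth_map euclid M {t. (p, t) \<in> Fd} (\<lambda>t. Phi (p, t))"
proof (cases "p \<in> S")
  case True
  note c = chart_at_in[OF S_mpoints[OF True]]
  have "smooth_map euclid M {t. (p, t) \<in> Fd} (\<lambda>_. p)"
    by (rule smooth_map_euclidI[OF charts_compatible], rule bexI[OF _ c(1)], rule exI[of _ "{t. (p, t) \<in> Fd}"])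
      (use c generator_domain_open in \<open>auto simp: smooth_on_const\<close>)
  then show ?thesis by (rule Phi_smooth_map[OF _ generator_domain_open smooth_on_ident]) simp
next
  case False
  then have "{t. (p, t) \<in> Fd} = {}" using Fd_S by blast
  then show ?thesis by (simp add: smooth_map_def)
qed

text \<open>For each multiple \<open>k\<close> of \<xi> in the exponential domain there is a
  geodesic \<gamma> on a neighbourhood of [0,1], and \<gamma> at \<open>s / k\<close> is the
  generator. With \<open>k = t\<close> this covers times near a nonzero \<open>t\<close>; near
  \<open>t = 0\<close> any small nonzero \<open>k\<close> will do, and half the radius of a ball of
  admissible times is taken.\<close>

lemma generator_near:
  assumes p: "p \<in> S" and t: "(p, t) \<in> Fd"
  obtains N \<delta> where "open N" "t \<in> N" "N \<subseteq> {t. (p, t) \<in> Fd}" "\<And>s. s \<in> N \<Longrightarrow> Phi (p, s) = \<delta> s"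
    "\<And>s. s \<in> N \<Longrightarrow> cov_along M g \<delta> (velocity M \<delta>) s = 0" "t = 0 \<Longrightarrow> velocity M \<delta> 0 = \<xi> p"
proof -
  have "\<exists>k. k \<noteq> 0 \<and> (p, k) \<in> Fd \<and> (t = 0 \<or> t = k)"
  proof (cases "t = 0")
    case True
    have "0 \<in> {t. (p, t) \<in> Fd}" using Fd_zero[OF p] by simp
    then obtain e where e: "e > 0" "ball 0 e \<subseteq> {t. (p, t) \<in> Fd}" using generator_domain_open openE by metis
    have "e / 2 \<in> ball 0 e" using e by (simp add: dist_real_def)
    then have "e / 2 \<in> {t. (p, t) \<in> Fd}" using e(2) by blast
    then show ?thesis using e True by (intro exI[of _ "e / 2"]) auto
  qed (use t in auto)
  then obtain k where k: "k \<noteq> 0" "(p, k) \<in> Fd" "t = 0 \<or> t = k" by blast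
  have "(p, k *\<^sub>R \<xi> p) \<in> exp_domain M g" using V k(2) unfolding Fd_iff normal_exp_neighborhood_def by blast
  then obtain \<gamma> I where \<gamma>: "geodesic M g I \<gamma>" "{0..1} \<subseteq> I" "\<gamma> 0 = p" "velocity M \<gamma> 0 = k *\<^sub>R \<xi> p"
    unfolding exp_domain_def unit_geodesic_def by blast
  have i: "1 / k \<noteq> 0" using k by simp
  define \<delta> where "\<delta> s = \<gamma> (1 / k * s)" for s
  have geo: "geodesic M g {s. 1 / k * s \<in> I} \<delta>" unfolding \<delta>_def by (rule geodesic_rescale(1)[OF \<gamma>(1) i])
  define N where "N = {s. 1 / k * s \<in> I} \<inter> {t. (p, t) \<in> Fd}"
  show ?thesis
  proof (rule that[of N \<delta>])
    show "open N" unfolding N_def using geodesicD(1)[OF geo] generator_domain_open by blast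
    show "t \<in> N" using k t \<gamma>(2) by (auto simp: N_def)
    show "N \<subseteq> {t. (p, t) \<in> Fd}" by (simp add: N_def)
    show "Phi (p, s) = \<delta> s" if "s \<in> N" for s
      using exp_map_ray[OF \<gamma> k(1), of s] that by (simp add: N_def \<delta>_def Phi_exp)
    show "cov_along M g \<delta> (velocity M \<delta>) s = 0" if "s \<in> N" for s
      using geodesicD(5)[OF geo, of s] that by (simp add: N_def)
    have "0 \<in> I" using \<gamma>(2) by auto
    then show "velocity M \<delta> 0 = \<xi> p"
      unfolding \<delta>_def using geodesic_rescale(2)[OF \<gamma>(1) i, of 0] \<gamma>(4) k(1) by simp
  qed
qed

lemma generator_geodesic:
  assumes p: "p \<in> S"
  shows "geodesic M g {t. (p, t) \<in> Fd} (\<lambda>t. Phi (p, t))" "velocity M (\<lambda>t. Phi (p, t)) 0 = \<xi> p"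
proof -
  have "cov_along M g (\<lambda>t. Phi (p, t)) (velocity M (\<lambda>t. Phi (p, t))) t = 0" if t: "(p, t) \<in> Fd" for t
  proof -
    obtain N \<delta> where N: "open N" "t \<in> N" "\<And>s. s \<in> N \<Longrightarrow> Phi (p, s) = \<delta> s"
      "\<And>s. s \<in> N \<Longrightarrow> cov_along M g \<delta> (velocity M \<delta>) s = 0"
      by (rule generator_near[OF p t]) (rule that)
    have "cov_along M g (\<lambda>t. Phi (p, t)) (velocity M (\<lambda>t. Phi (p, t))) t = cov_along M g \<delta> (velocity M \<delta>) t"
      by (rule cov_along_cong[OF N(1,2)]) (auto simp: N(3) intro: velocity_cong[OF N(1)])
    then show ?thesis using N(2,4) by simp
  qed
  then show "geodesic M g {t. (p, t) \<in> Fd} (\<lambda>t. Phi (p, t))"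
    unfolding geodesic_def using generator_domain_open generator_domain_interval generator_smooth by simp
  obtain N \<delta> where N: "open N" "0 \<in> N" "\<And>s. s \<in> N \<Longrightarrow> Phi (p, s) = \<delta> s" "0 = (0::real) \<Longrightarrow> velocity M \<delta> 0 = \<xi> p"
    by (rule generator_near[OF p Fd_zero[OF p]]) (rule that)
  have "velocity M (\<lambda>t. Phi (p, t)) 0 = velocity M \<delta> 0" by (rule velocity_cong[OF N(1,2)]) (rule N(3))
  then show "velocity M (\<lambda>t. Phi (p, t)) 0 = \<xi> p" using N(4) by simp
qed

lemma constant_curve: assumes p: "p \<in> S" shows "curve_through M S p 0 (\<lambda>_. p)"
proof -
  note c = chart_at_in[OF S_mpoints[OF p]]
  show ?thesis
    by (rule curve_throughI[OF c(1) zero_less_one]) (use p c in \<open>auto simp: smooth_on_const to_chart_simps[OF c]\<close>)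
qed

lemma generator_velocity:
  assumes pt: "(p, t) \<in> Fd"
  shows "velocity M (\<lambda>t. Phi (p, t)) t = dPhi (p, t) (0, 1)" "U (Phi (p, t)) = dPhi (p, t) (0, 1)"
proof -
  note p = Fd_S[OF pt] note d = chart_at_in[OF Phi_mpoints[OF pt]]
  let ?d = "chart_at M (Phi (p, t))" and ?H = "\<lambda>t. Phi (p, t)"
  have tI: "t \<in> {t. (p, t) \<in> Fd}" using pt by simp
  obtain N where N: "open N" "t \<in> N" "?H ` N \<subseteq> fst ?d" "smooth_on N (\<lambda>s. snd ?d (?H s))"
    by (rule smooth_map_euclidD[OF generator_smooth generator_domain_open tI d]) (rule that)
  have l: "continuous_on UNIV (\<lambda>s::real. s)" "((\<lambda>s. s) has_vector_derivative 1) (at t)"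
    and l': "continuous_on UNIV (\<lambda>s::real. t + 1 * s)" "((\<lambda>s. t + 1 * s) has_vector_derivative 1) (at 0)"
    by (auto intro!: continuous_intros derivative_eq_intros)
  have z: "t + 1 * 0 = t" by simp
  then have l0: "t + 1 * 0 \<in> N" using N(2) by simp
  have "dPhi (p, t) (0, 1) = velocity M (\<lambda>s. ?H (t + 1 * s)) 0"
    using dPhi_curve[OF pt flow_curve[OF pt constant_curve[OF p], of 1]] by (simp add: o_def)
  also have "\<dots> = velocity M ?H t"
    by (rule to_chart_inj[OF d, THEN iffD1])
      (rule trans[OF slice_chart(1)[OF d(1) N(1,3,4) l' l0, unfolded z] slice_chart(1)[OF d(1) N(1,3,4) l N(2), symmetric]])
  finally show "velocity M (\<lambda>t. Phi (p, t)) t = dPhi (p, t) (0, 1)" ..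
  show "U (Phi (p, t)) = dPhi (p, t) (0, 1)"
    by (simp add: generator_field_def inv_into_f_f[OF Phi_inj pt])
qed

lemma U_velocity: "(p, t) \<in> Fd \<Longrightarrow> U (Phi (p, t)) = velocity M (\<lambda>t. Phi (p, t)) t"
  using generator_velocity by simp

text \<open>The square of the velocity is constant along a geodesic and vanishes at its start \<xi>;
  the velocity itself is nonzero because the differential is injective.\<close>

lemma U_lightlike: assumes pt: "(p, t) \<in> Fd" shows "lightlike g (Phi (p, t)) (U (Phi (p, t)))"
proof -
  note p = Fd_S[OF pt]
  have "g (Phi (p, t)) (velocity M (\<lambda>t. Phi (p, t)) t) (velocity M (\<lambda>t. Phi (p, t)) t) = g p (\<xi> p) (\<xi> p)"
    using geodesic_speed_constant[OF generator_geodesic(1)[OF p], of t 0] generator_geodesic(2)[OF p] pt Fd_zero[OF p]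
    by (simp add: Phi_zero[OF p])
  moreover have "dPhi (p, t) (0, 1) \<noteq> 0" using dPhi_inj[OF pt subspace_0[OF TS_subspace[OF p]], of 1] by auto
  ultimately show ?thesis
    using xi_null[OF p] generator_velocity[OF pt] by (simp add: lightlike_def)
qed

lemma generator_lightlike_geodesic: "p \<in> S \<Longrightarrow> lightlike_geodesic M g {t. (p, t) \<in> Fd} (\<lambda>t. Phi (p, t))"
  unfolding lightlike_geodesic_def using generator_geodesic(1) U_lightlike U_velocity by simp

text \<open>In coordinates \<open>U\<close> at a point of \<Sigma> with coordinates \<open>y\<close>
  is \<open>FD F (P y) (0, 1)\<close>, a formula that also makes sense off \<Sigma> and hence is the
  required smooth extension.\<close>

lemma U_smooth: "smooth_field_on M Sig U"
proof (rule smooth_fieldI)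
  fix q assume "q \<in> Sig"
  then obtain p t where pt: "(p, t) \<in> Fd" and q: "q = Phi (p, t)" by auto
  note p = Fd_S[OF pt]
  let ?c = "chart_at M p" and ?d = "chart_at M (Phi (p, t))"
  note c = chart_at_in[OF S_mpoints[OF p]] and d = chart_at_in[OF Phi_mpoints[OF pt]]
  obtain D F where rep: "Phi_rep ?c ?d p t D F" using Phi_rep_exists[OF pt c d] by blast
  obtain E P where psi: "Psi_rep ?c ?d p t E P" using Psi_rep_exists[OF pt c d] by blast
  have D: "open D" "(snd ?c p, t) \<in> D" "smooth_on D F" using rep by (auto simp: Phi_rep_def)
  have E: "open E" "snd ?d (Phi (p, t)) \<in> E" "smooth_on E P" using psi by (auto simp: Psi_rep_def)
  have ext: "p' \<in> fst ?c \<and> P (snd ?d (Phi (p', t'))) = (snd ?c p', t')"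
    if "(p', t') \<in> Fd" "Phi (p', t') \<in> fst ?d" "snd ?d (Phi (p', t')) \<in> E" for p' t'
    using psi that unfolding Psi_rep_def by blast
  define E' where "E' = E \<inter> P -` D"
  have E': "open E'" unfolding E'_def
    by (rule continuous_open_preimage[OF smooth_on_continuous_on[OF E(3)] E(1) D(1)])
  have sP: "smooth_on E' P" by (rule smooth_on_subset[OF E(3)]) (auto simp: E'_def)
  have "smooth_on E' (\<lambda>y. FD F (P y) (0, 1))"
    by (rule smooth_on_FD_compose[OF D(3,1) E' sP smooth_on_const]) (auto simp: E'_def)
  moreover have "snd ?d q \<in> E'" using ext[OF pt d(2) E(2)] E(2) D(2) by (simp add: E'_def q)
  moreover have "to_chart M ?d q' (U q') = FD F (P (snd ?d q')) (0, 1)"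
    if q': "q' \<in> Sig \<inter> fst ?d" "snd ?d q' \<in> E'" for q'
  proof -
    obtain p' t' where pt': "(p', t') \<in> Fd" and e: "q' = Phi (p', t')" using q'(1) by auto
    have d': "Phi (p', t') \<in> fst ?d" "snd ?d (Phi (p', t')) \<in> E" "P (snd ?d (Phi (p', t'))) \<in> D"
      using q' by (auto simp: e E'_def)
    note x = ext[OF pt' d'(1,2)]
    have c': "p' \<in> fst ?c" using x by blast
    \<comment> \<open>A representative at \<open>(p, t)\<close> serves equally at every nearby pair
      whose coordinates lie in \<open>D\<close>.\<close>
    have "Phi_rep ?c ?d p' t' D F" using rep x d'(3) unfolding Phi_rep_def by simp
    from dPhi_chart(1)[OF pt' c(1) c' d(1) d'(1) subspace_0[OF TS_subspace[OF Fd_S[OF pt']]] this, of 1]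
    show ?thesis by (simp add: e x generator_velocity(2)[OF pt'] to_chart_simps(5)[OF c(1) c'])
  qed
  ultimately show "\<exists>d\<in>charts M. \<exists>D Yh. q \<in> fst d \<and> open D \<and> snd d q \<in> D \<and> smooth_on D Yh \<and>
    (\<forall>q'\<in>Sig \<inter> fst d. snd d q' \<in> D \<longrightarrow> to_chart M d q' (U q') = Yh (snd d q'))"
    using d E' q by blast
qed

subsection \<open>Variations through generators\<close>

lemma push_curve:
  assumes pt: "(p, t) \<in> Fd" and \<alpha>: "curve_through M S p x \<alpha>"
  shows "curve_through M Sig (Phi (p, t)) (dPhi (p, t) (x, a)) (\<lambda>s. Phi (\<alpha> s, t + a * s))"
proof -
  note \<beta> = flow_curve[OF pt \<alpha>, of a]
  obtain e where e: "e > 0" "smooth_map euclid M {-e<..<e} \<alpha>" "\<alpha> 0 = p"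
    using \<alpha> unfolding curve_through_def by blast
  obtain r where r: "r > 0" "(\<lambda>s. (\<alpha> s, t + a * s)) ` {-r<..<r} \<subseteq> Fd"
    using \<beta> unfolding curve_through_def by blast
  define \<epsilon> where "\<epsilon> = min e r"
  have \<epsilon>: "\<epsilon> > 0" "{-\<epsilon><..<\<epsilon>} \<subseteq> {-e<..<e}" "{-\<epsilon><..<\<epsilon>} \<subseteq> {-r<..<r}" using e r by (auto simp: \<epsilon>_def)
  have Fd: "(\<alpha> s, t + a * s) \<in> Fd" if "s \<in> {-\<epsilon><..<\<epsilon>}" for s using r(2) \<epsilon>(3) that by blast
  have st: "smooth_on {-\<epsilon><..<\<epsilon>} (\<lambda>s. t + a * s)"
    by (intro smooth_on_add smooth_on_mult smooth_on_const smooth_on_ident open_greaterThanLessThan)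
  have "smooth_map euclid M {-\<epsilon><..<\<epsilon>} (\<lambda>s. Phi (\<alpha> s, t + a * s))"
    by (rule Phi_smooth_map[OF smooth_map_subset[OF e(2) \<epsilon>(2)] open_greaterThanLessThan st Fd])
  moreover have "velocity M (\<lambda>s. Phi (\<alpha> s, t + a * s)) 0 = dPhi (p, t) (x, a)"
    using dPhi_curve[OF pt \<beta>] by (simp add: o_def)
  ultimately show ?thesis unfolding curve_through_def using \<epsilon>(1) Fd e(3) by (intro exI[of _ \<epsilon>]) auto
qed

lemma dPhi_tangent: "(p, t) \<in> Fd \<Longrightarrow> x \<in> TS p \<Longrightarrow> dPhi (p, t) (x, a) \<in> tangent_space M Sig (Phi (p, t))"
  using push_curve unfolding tangent_space_def by blast

definition family :: "(real \<Rightarrow> 'm) \<Rightarrow> real \<times> real \<Rightarrow> 'm" where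
  "family \<alpha> z = Phi (\<alpha> (fst z), snd z)"

text \<open>Every generator keeps its full parameter interval, which varies with the foot point;
  thus the slice at 0 is exactly the domain of the given generator, as the definition of a variation
  requires.\<close>

definition family_domain :: "real \<Rightarrow> (real \<Rightarrow> 'm) \<Rightarrow> (real \<times> real) set" where
  "family_domain e \<alpha> = {z. fst z \<in> {-e<..<e} \<and> (\<alpha> (fst z), snd z) \<in> Fd}"

lemma family_smooth:
  assumes \<alpha>: "smooth_map euclid M {-e<..<e} \<alpha>" "\<alpha> ` {-e<..<e} \<subseteq> S"
  shows "open (family_domain e \<alpha>)" "smooth_map euclid M (family_domain e \<alpha>) (family \<alpha>)"
proof -
  show o: "open (family_domain e \<alpha>)"
  proof (subst open_subopen, intro ballI)
    fix z assume z: "z \<in> family_domain e \<alpha>"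
    then have s: "fst z \<in> {-e<..<e}" and pt: "(\<alpha> (fst z), snd z) \<in> Fd" by (auto simp: family_domain_def)
    let ?c = "chart_at M (\<alpha> (fst z))"
    note c = chart_at_in[OF S_mpoints[OF Fd_S[OF pt]]]
    obtain D where D: "open D" "(snd ?c (\<alpha> (fst z)), snd z) \<in> D"
      "\<And>q t'. q \<in> S \<Longrightarrow> q \<in> fst ?c \<Longrightarrow> (snd ?c q, t') \<in> D \<Longrightarrow> (q, t') \<in> Fd"
      by (rule Fd_open[OF pt c]) (rule that)
    obtain N where N: "open N" "fst z \<in> N" "N \<subseteq> {-e<..<e}" "\<alpha> ` N \<subseteq> fst ?c" "smooth_on N (\<lambda>s. snd ?c (\<alpha> s))"
      using smooth_map_euclidD[OF \<alpha>(1) open_greaterThanLessThan s c] .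
    have oN: "open (N \<times> (UNIV::real set))" using N(1) by (simp add: open_Times)
    have "smooth_on (N \<times> (UNIV::real set)) (\<lambda>w. snd ?c (\<alpha> (fst w)))"
      by (rule smooth_on_compose[OF N(5) smooth_on_fst _ oN N(1)]) auto
    then have sm: "smooth_on (N \<times> (UNIV::real set)) (\<lambda>w. (snd ?c (\<alpha> (fst w)), snd w))"
      by (rule smooth_on_Pair[OF _ smooth_on_snd oN])
    have "open ((N \<times> UNIV) \<inter> (\<lambda>w. (snd ?c (\<alpha> (fst w)), snd w)) -` D)"
      by (rule continuous_open_preimage[OF smooth_on_continuous_on[OF sm] oN D(1)])
    moreover have "(N \<times> UNIV) \<inter> (\<lambda>w. (snd ?c (\<alpha> (fst w)), snd w)) -` D \<subseteq> family_domain e \<alpha>"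
    proof
      fix w assume w: "w \<in> (N \<times> UNIV) \<inter> (\<lambda>w. (snd ?c (\<alpha> (fst w)), snd w)) -` D"
      then have wN: "fst w \<in> N" "(snd ?c (\<alpha> (fst w)), snd w) \<in> D" by auto
      then have "\<alpha> (fst w) \<in> S" "\<alpha> (fst w) \<in> fst ?c" using N(3,4) \<alpha>(2) by blast+
      then show "w \<in> family_domain e \<alpha>" using D(3) wN N(3) by (auto simp: family_domain_def)
    qed
    moreover have "z \<in> (N \<times> UNIV) \<inter> (\<lambda>w. (snd ?c (\<alpha> (fst w)), snd w)) -` D" using N(2) D(2) by (cases z) auto
    ultimately show "\<exists>T. open T \<and> z \<in> T \<and> T \<subseteq> family_domain e \<alpha>" by blast
  qed
  have "smooth_map euclid M (family_domain e \<alpha>) (\<lambda>z. \<alpha> (fst z))"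
  proof (rule smooth_map_euclidI[OF charts_compatible])
    fix z assume z: "z \<in> family_domain e \<alpha>"
    then have s: "fst z \<in> {-e<..<e}" and pt: "(\<alpha> (fst z), snd z) \<in> Fd" by (auto simp: family_domain_def)
    let ?c = "chart_at M (\<alpha> (fst z))"
    note c = chart_at_in[OF S_mpoints[OF Fd_S[OF pt]]]
    obtain N where N: "open N" "fst z \<in> N" "N \<subseteq> {-e<..<e}" "\<alpha> ` N \<subseteq> fst ?c" "smooth_on N (\<lambda>s. snd ?c (\<alpha> s))"
      using smooth_map_euclidD[OF \<alpha>(1) open_greaterThanLessThan s c] .
    have oN: "open (N \<times> (UNIV::real set))" using N(1) by (simp add: open_Times)
    have "smooth_on (N \<times> (UNIV::real set)) (\<lambda>z. snd ?c (\<alpha> (fst z)))"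
      by (rule smooth_on_compose[OF N(5) smooth_on_fst _ oN N(1)]) auto
    then show "\<exists>d\<in>charts M. \<exists>D. open D \<and> z \<in> D \<and> (\<lambda>z. \<alpha> (fst z)) ` D \<subseteq> fst d \<and> smooth_on D (\<lambda>z. snd d (\<alpha> (fst z)))"
      using c(1) oN N(2,4) by (intro bexI[of _ ?c] exI[of _ "N \<times> UNIV"]) (auto simp: mem_Times_iff)
  qed
  then show "smooth_map euclid M (family_domain e \<alpha>) (family \<alpha>)"
    unfolding family_def[abs_def] by (rule Phi_smooth_map[OF _ o smooth_on_snd]) (simp add: family_domain_def)
qed

lemma family_d_t: "(\<alpha> s, t) \<in> Fd \<Longrightarrow> d_t (family \<alpha>) (s, t) = U (family \<alpha> (s, t))"
  by (simp add: d_t_def family_def U_velocity)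

lemma family_d_s:
  assumes pt: "(p, t) \<in> Fd" and \<alpha>: "curve_through M S p x \<alpha>"
  shows "d_s (family \<alpha>) (0, t) = dPhi (p, t) (x, 0)"
  using dPhi_curve[OF pt flow_curve[OF pt \<alpha>, of 0]] by (simp add: d_s_def family_def o_def)

lemma family_geodesic:
  assumes "(s, t) \<in> family_domain e \<alpha>"
  shows "cov_along M g (\<lambda>t. family \<alpha> (s, t)) (\<lambda>t. d_t (family \<alpha>) (s, t)) t = 0"
proof -
  have pt: "(\<alpha> s, t) \<in> Fd" using assms by (simp add: family_domain_def)
  have "(\<lambda>t. d_t (family \<alpha>) (s, t)) = velocity M (\<lambda>t. Phi (\<alpha> s, t))" by (auto simp: d_t_def family_def)
  then show ?thesis
    using geodesicD(5)[OF generator_geodesic(1)[OF Fd_S[OF pt]], of t] pt by (simp add: family_def)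
qed

text \<open>Everything is read off one family, built from any curve in \<open>S\<close> with
  velocity \<open>x\<close>. \<open>J\<close> agrees with the variation field only on
  \<open>I\<close>; since \<open>I\<close> is open, covariant derivatives may be exchanged
  there.\<close>

lemma invariant_field_along:
  assumes p: "p \<in> S" and x: "x \<in> TS p" and J: "\<And>t. (p, t) \<in> Fd \<Longrightarrow> J t = dPhi (p, t) (x, 0)"
  defines "I \<equiv> {t. (p, t) \<in> Fd}" and "\<gamma> \<equiv> \<lambda>t. Phi (p, t)"
  shows "smooth_along M I \<gamma> J"
    and "\<And>t. t \<in> I \<Longrightarrow> cov_along M g \<gamma> (cov_along M g \<gamma> J) t + curvature M g (\<gamma> t) (J t) (velocity M \<gamma> t) (velocity M \<gamma> t) = 0"
    and "\<And>t. t \<in> I \<Longrightarrow> cov_along M g \<gamma> J t = nabla M g Sig U (\<gamma> t) (J t)"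
    and "J 0 = x" and "cov_along M g \<gamma> J 0 = nabla M g S \<xi> p x"
    and "variation_through_normal_lightlike_geodesics M g S I \<gamma> J"
proof -
  obtain \<alpha> where \<alpha>: "curve_through M S p x \<alpha>" using x by (auto simp: tangent_space_def)
  obtain e where e: "e > 0" "smooth_map euclid M {-e<..<e} \<alpha>" "\<alpha> ` {-e<..<e} \<subseteq> S" "\<alpha> 0 = p" "velocity M \<alpha> 0 = x"
    using \<alpha> unfolding curve_through_def by blast
  let ?D = "family_domain e \<alpha>" and ?H = "family \<alpha>"
  note H = family_smooth(2,1)[OF e(2,3)]
  have I: "{t. (0, t) \<in> ?D} = I" using e(1,4) by (auto simp: family_domain_def I_def)
  have oI: "open I" unfolding I_def by (rule generator_domain_open)
  have H0: "(\<lambda>t. ?H (0, t)) = \<gamma>" by (simp add: family_def \<gamma>_def e(4))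
  have tD: "(0, t) \<in> ?D" if "t \<in> I" for t using that I by blast
  have Js: "d_s ?H (0, t) = J t" if "t \<in> I" for t using family_d_s[OF _ \<alpha>] J that by (simp add: I_def)
  have cov: "cov_along M g \<gamma> (\<lambda>t. d_s ?H (0, t)) t = cov_along M g \<gamma> J t" if "t \<in> I" for t
    by (rule cov_along_cong[OF oI that]) (simp_all add: Js)
  have sym: "cov_along M g \<gamma> J t = cov_along M g (\<lambda>s. ?H (s, t)) (\<lambda>s. d_t ?H (s, t)) 0" if "t \<in> I" for t
    using two_parameter_symmetry[OF H tD[OF that]] cov[OF that] by (simp add: H0)
  have "smooth_along M I \<gamma> (\<lambda>t. d_s ?H (0, t))" using two_parameter_along[OF H, of 0] by (simp add: I H0)
  then show "smooth_along M I \<gamma> J" unfolding smooth_along_def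
    by (rule smooth_map_cong) (simp add: Js)
  show "cov_along M g \<gamma> (cov_along M g \<gamma> J) t + curvature M g (\<gamma> t) (J t) (velocity M \<gamma> t) (velocity M \<gamma> t) = 0"
    if t: "t \<in> I" for t
  proof -
    have "cov_along M g \<gamma> (cov_along M g \<gamma> (\<lambda>t. d_s ?H (0, t))) t = cov_along M g \<gamma> (cov_along M g \<gamma> J) t"
      by (rule cov_along_cong[OF oI t]) (simp_all add: cov)
    moreover have "?H (0, t) = \<gamma> t" by (simp add: family_def \<gamma>_def e(4))
    moreover have "d_t ?H (0, t) = velocity M \<gamma> t" by (simp add: d_t_def H0)
    ultimately show ?thesis
      using two_parameter_jacobi[OF H tD[OF t] family_geodesic] Js[OF t] by (simp add: H0)
  qed
  \<comment> \<open>The neighbouring generators reach time \<open>t\<close> only for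
    \<open>s\<close> close to 0, and how close depends on \<open>t\<close>.\<close>
  have ev: "\<exists>r>0. \<forall>s\<in>{-r<..<r}. (\<alpha> s, t) \<in> Fd" if t: "t \<in> I" for t
  proof -
    have pt: "(p, t) \<in> Fd" using t by (simp add: I_def)
    obtain r where "r > 0" "(\<lambda>s. (\<alpha> s, t + 0 * s)) ` {-r<..<r} \<subseteq> Fd"
      using flow_curve[OF pt \<alpha>, of 0] unfolding curve_through_def by blast
    then show ?thesis by (intro exI[of _ r]) auto
  qed
  show "cov_along M g \<gamma> J t = nabla M g Sig U (\<gamma> t) (J t)" if t: "t \<in> I" for t
  proof -
    have pt: "(p, t) \<in> Fd" using t by (simp add: I_def)
    obtain r where r: "r > 0" "\<And>s. s \<in> {-r<..<r} \<Longrightarrow> (\<alpha> s, t) \<in> Fd" using ev[OF t] by blast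
    have c: "curve_through M Sig (\<gamma> t) (J t) (\<lambda>s. Phi (\<alpha> s, t))"
      using push_curve[OF pt \<alpha>, of 0] J[OF pt] by (simp add: \<gamma>_def)
    have "nabla M g Sig U (\<gamma> t) (J t) = cov_along M g (\<lambda>s. Phi (\<alpha> s, t)) (U \<circ> (\<lambda>s. Phi (\<alpha> s, t))) 0"
      by (rule nabla_curve[OF U_smooth _ _ c]) (use pt Phi_mpoints in \<open>auto simp: \<gamma>_def\<close>)
    also have "\<dots> = cov_along M g (\<lambda>s. ?H (s, t)) (\<lambda>s. d_t ?H (s, t)) 0"
    proof (rule cov_along_cong[OF open_greaterThanLessThan])
      show "0 \<in> {-r<..<r}" using r by simp
      fix s assume "s \<in> {-r<..<r}"
      then show "(U \<circ> (\<lambda>s. Phi (\<alpha> s, t))) s = d_t ?H (s, t)" using family_d_t[OF r(2)] by (simp add: family_def)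
    qed (simp add: family_def)
    finally show ?thesis using sym[OF t] by simp
  qed
  have p0: "(p, 0) \<in> Fd" "0 \<in> I" using Fd_zero[OF p] by (simp_all add: I_def)
  have e0: "0 \<in> {-e<..<e}" using e(1) by simp
  have H00: "?H (s, 0) = \<alpha> s" if "s \<in> {-e<..<e}" for s
  proof -
    have "\<alpha> s \<in> S" using e(3) that by blast
    then show ?thesis by (simp add: family_def Phi_zero)
  qed
  have "velocity M (\<lambda>s. ?H (s, 0)) 0 = velocity M \<alpha> 0"
    by (rule velocity_cong[OF open_greaterThanLessThan e0]) (rule H00)
  then show J0: "J 0 = x" using Js[OF p0(2)] e(5) by (simp add: d_s_def)
  \<comment> \<open>At time zero the family is \<alpha> and its generator velocity is \<xi> along
    \<alpha>, so the symmetry at \<open>t = 0\<close> identifies the initial derivative of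
    \<open>J\<close> with the derivative of \<xi> along \<open>S\<close>.\<close>
  have dt0: "d_t ?H (s, 0) = \<xi> (\<alpha> s)" if "s \<in> {-e<..<e}" for s
  proof -
    have "\<alpha> s \<in> S" using e(3) that by blast
    then show ?thesis using generator_geodesic(2) by (simp add: d_t_def family_def)
  qed
  have "nabla M g S \<xi> p x = cov_along M g \<alpha> (\<xi> \<circ> \<alpha>) 0" by (rule nabla_curve[OF xi_smooth p S_mpoints[OF p] \<alpha>])
  also have "\<dots> = cov_along M g (\<lambda>s. ?H (s, 0)) (\<lambda>s. d_t ?H (s, 0)) 0"
    by (rule cov_along_cong[OF open_greaterThanLessThan e0]) (simp_all add: H00 dt0)
  finally show "cov_along M g \<gamma> J 0 = nabla M g S \<xi> p x" using sym[OF p0(2)] by simp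
  show "variation_through_normal_lightlike_geodesics M g S I \<gamma> J"
    unfolding variation_through_normal_lightlike_geodesics_def
  proof (rule exI[of _ e], intro conjI e(1), rule exI[of _ ?D], rule exI[of _ ?H], intro conjI ballI)
    show "open ?D" "smooth_map euclid M ?D ?H" using H by simp_all
    show "?D \<subseteq> {-e<..<e} \<times> UNIV" by (auto simp: family_domain_def)
    show "{t. (0, t) \<in> ?D} = I" by (rule I)
    show "?H (0, t) = \<gamma> t" for t by (simp add: family_def \<gamma>_def e(4))
    show "velocity M (\<lambda>s. ?H (s, t)) 0 = J t" if "t \<in> I" for t using Js[OF that] by (simp add: d_s_def)
    fix s assume s: "s \<in> {-e<..<e}"
    then have aS: "\<alpha> s \<in> S" using e(3) by blast
    show "(s, 0) \<in> ?D" using s Fd_zero[OF aS] by (simp add: family_domain_def)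
    have "{t. (s, t) \<in> ?D} = {t. (\<alpha> s, t) \<in> Fd}" using s by (auto simp: family_domain_def)
    then show "lightlike_geodesic M g {t. (s, t) \<in> ?D} (\<lambda>t. ?H (s, t))"
      using generator_lightlike_geodesic[OF aS] by (simp add: family_def)
    show "?H (s, 0) \<in> S" using H00[OF s] aS by simp
    show "velocity M (\<lambda>t. ?H (s, t)) 0 \<in> normal_space M g S (?H (s, 0))"
      using dt0[OF s] xi_normal[OF aS] H00[OF s] by (simp add: d_t_def)
  qed
qed

lemma invariant_field_S_jacobi:
  assumes p: "p \<in> S" and x: "x \<in> TS p" and J: "\<And>t. (p, t) \<in> Fd \<Longrightarrow> J t = dPhi (p, t) (x, 0)"
  shows "S_jacobi_field M g S {t. (p, t) \<in> Fd} (\<lambda>t. Phi (p, t)) J"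
proof -
  note a = invariant_field_along[OF p x J]
  show ?thesis
    unfolding S_jacobi_field_def jacobi_field_def
  proof (intro conjI ballI a(1,2))
    show "J 0 \<in> TS (Phi (p, 0))" using a(4) x by (simp add: Phi_zero[OF p])
    show "cov_along M g (\<lambda>t. Phi (p, t)) J 0 + shape_operator M g S (Phi (p, 0)) (velocity M (\<lambda>t. Phi (p, t)) 0) (J 0)
       \<in> normal_space M g S (Phi (p, 0))"
      using shape_operator[OF p x xi_smooth xi_normal] a(4,5) generator_geodesic(2)[OF p] by (simp add: Phi_zero[OF p])
  qed
qed

end

subsection \<open>Null transversals of a definite subspace\<close>

text \<open>\<open>z + b z V *\<^sub>R U\<close> is orthogonal to \<open>U\<close> and
  \<open>V\<close>, hence lies in \<open>W\<close>. It is also orthogonal to \<open>W\<close>, so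
  definiteness makes it zero.\<close>

lemma null_pair_orthogonal:
  fixes b :: "'a::euclidean_space \<Rightarrow> 'a \<Rightarrow> real"
  assumes b: "bilinear b" and sym: "\<And>x y. b x y = b y x"
    and UV: "b U U = 0" "b V V = 0" "b U V = -1"
    and W: "subspace W" "\<And>w. w \<in> W \<Longrightarrow> w \<noteq> 0 \<Longrightarrow> b w w > 0" "\<And>w. w \<in> W \<Longrightarrow> b w U = 0" "\<And>w. w \<in> W \<Longrightarrow> b w V = 0"
    and dim: "dim W + 2 = DIM('a)" and z: "b z U = 0" "\<And>w. w \<in> W \<Longrightarrow> b z w = 0"
  shows "z = (- b z V) *\<^sub>R U"
proof -
  note bs = bilinear_ladd[OF b] bilinear_radd[OF b] bilinear_lmul[OF b] bilinear_rmul[OF b]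
  define d where "d = z + b z V *\<^sub>R U"
  have "d \<in> W"
    by (rule null_pair_complement[OF b sym UV W(1,3,4) dim]) (simp_all add: d_def bs UV z)
  then have "b d d = 0"
    using z(2) W(3) sym[of U] by (subst (1) d_def) (simp add: bs)
  then have "d = 0" using W(2)[OF \<open>d \<in> W\<close>] by fastforce
  then show ?thesis by (simp add: d_def eq_neg_iff_add_eq_0)
qed

text \<open>Nondegeneracy gives some \<open>v1\<close> not orthogonal to \<open>U\<close>. Removing
  its component in \<open>W\<close>, normalising the product with \<open>U\<close> and adding a
  multiple of \<open>U\<close> gives the null vector.\<close>

lemma null_transversal_unique:
  fixes b :: "'a::euclidean_space \<Rightarrow> 'a \<Rightarrow> real"
  assumes b: "bilinear b" and sym: "\<And>x y. b x y = b y x" and nondeg: "\<And>v. (\<And>w. b v w = 0) \<Longrightarrow> v = 0"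
    and U: "U \<noteq> 0" "b U U = 0"
    and W: "subspace W" "\<And>w. w \<in> W \<Longrightarrow> w \<noteq> 0 \<Longrightarrow> b w w > 0" "\<And>w. w \<in> W \<Longrightarrow> b w U = 0"
    and dim: "dim W + 2 = DIM('a)"
  shows "\<exists>!v. (v \<noteq> 0 \<and> b v v = 0) \<and> (\<forall>w\<in>W. b v w = 0) \<and> b U v = -1"
proof -
  note bs = bilinear_ladd[OF b] bilinear_radd[OF b] bilinear_lmul[OF b] bilinear_rmul[OF b] bilinear_lsub[OF b] bilinear_rsub[OF b]
    bilinear_lzero[OF b] bilinear_rzero[OF b]
  obtain v1 where v1: "b U v1 \<noteq> 0" using nondeg U(1) by blast
  obtain a where a: "a \<in> W" "\<forall>z\<in>W. b a z = b v1 z"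
    using definite_subspace_Riesz[OF b W(1,2) bilinear_linear_right[OF b, of v1]] by blast
  define v0 where "v0 = v1 - a"
  define k where "k = b U v0"
  have k: "k \<noteq> 0" using v1 W(3)[OF a(1)] sym[of U a] by (simp add: k_def v0_def bs)
  \<comment> \<open>The factor \<open>- 1 / k\<close> normalises the product with \<open>U\<close>.
    As \<open>U\<close> is null, the square is affine in the coefficient of \<open>U\<close>, and
    the coefficient chosen here is its zero.\<close>
  define v where "v = (- 1 / k) *\<^sub>R v0 + (b v0 v0 / (2 * k * k)) *\<^sub>R U"
  have v0W: "b v0 w = 0" if "w \<in> W" for w using a(2) that by (simp add: v0_def bs)
  have Uv: "b U v = -1" using k U(2) by (simp add: v_def bs k_def[symmetric])
  have "b v v = (- 1 / k) * (- 1 / k) * b v0 v0 + 2 * ((- 1 / k) * (b v0 v0 / (2 * k * k)) * k)"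
    using sym[of v0 U] U(2) by (simp add: v_def bs k_def[symmetric])
  also have "\<dots> = 0" using k by (simp add: field_simps)
  finally have vv: "b v v = 0" .
  have vW: "b v w = 0" if "w \<in> W" for w using v0W[OF that] W(3)[OF that] sym[of U w] by (simp add: v_def bs)
  have "v \<noteq> 0" using Uv by (auto simp: bs)
  have uniq: "v' = v" if v': "b v' v' = 0" "\<forall>w\<in>W. b v' w = 0" "b U v' = -1" for v'
  proof -
    have wv: "b w v = 0" if "w \<in> W" for w using vW[OF that] sym[of w v] by simp
    \<comment> \<open>The difference is orthogonal to \<open>U\<close> and to \<open>W\<close>,
      hence a multiple \<open>r\<close> of \<open>U\<close>. Then \<open>b v' v'\<close> equals
      \<open>- 2 * r\<close> and must vanish.\<close>
    have "v' - v = (- b (v' - v) v) *\<^sub>R U"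
      by (rule null_pair_orthogonal[OF b sym U(2) vv Uv W wv dim])
        (use v' vW Uv sym[of v' U] sym[of v U] in \<open>simp_all add: bs\<close>)
    then obtain r where "v' - v = r *\<^sub>R U" by blast
    then have r: "v' = v + r *\<^sub>R U" by (metis add.commute diff_add_cancel)
    have "b v' v' = 2 * (r * b U v)" unfolding r using sym[of v U] by (simp add: bs vv U(2))
    then show ?thesis using r v'(1) Uv by simp
  qed
  show ?thesis
  proof (rule ex1I[of _ v])
    show "(v \<noteq> 0 \<and> b v v = 0) \<and> (\<forall>w\<in>W. b v w = 0) \<and> b U v = -1"
      using \<open>v \<noteq> 0\<close> Uv vv vW by simp
  qed (blast intro: uniq)
qed

context lightlike_flow
begin

subsection \<open>The screen distribution\<close>

text \<open>Differentiate \<open>g (U, U) = 0\<close> along a curve in \<Sigma>. For a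
  flow-invariant direction this is the product of \<open>J'\<close> with \<open>U\<close> that has
  to vanish in the Gauss lemma.\<close>

lemma U_geodesic_orthogonal:
  assumes pt: "(p, t) \<in> Fd" and \<sigma>: "curve_through M Sig (Phi (p, t)) v \<sigma>"
  shows "g (Phi (p, t)) (nabla M g Sig U (Phi (p, t)) v) (U (Phi (p, t))) = 0"
proof -
  let ?q = "Phi (p, t)"
  note qm = Phi_mpoints[OF pt]
  have q: "?q \<in> Sig" using pt by blast
  obtain e where e: "e > 0" "smooth_map euclid M {-e<..<e} \<sigma>" "\<sigma> ` {-e<..<e} \<subseteq> Sig" "\<sigma> 0 = ?q"
    using \<sigma> unfolding curve_through_def by blast
  have e0: "0 \<in> {-e<..<e}" using e(1) by simp
  have im: "\<sigma> ` {-e<..<e} \<subseteq> mpoints M" using smooth_map_mpoints[OF e(2)] .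
  have sU: "smooth_along M {-e<..<e} \<sigma> (U \<circ> \<sigma>)"
    unfolding smooth_along_def o_def by (rule smooth_field_along_curve[OF U_smooth e(2) open_greaterThanLessThan e(3)])
  note n = nabla_curve[OF U_smooth q qm \<sigma>]
  have "((\<lambda>s. g (\<sigma> s) ((U \<circ> \<sigma>) s) ((U \<circ> \<sigma>) s)) has_real_derivative
     g (\<sigma> 0) (cov_along M g \<sigma> (U \<circ> \<sigma>) 0) ((U \<circ> \<sigma>) 0) + g (\<sigma> 0) ((U \<circ> \<sigma>) 0) (cov_along M g \<sigma> (U \<circ> \<sigma>) 0)) (at 0)"
    by (rule metric_along_derivative[OF sU sU open_greaterThanLessThan im e0])
  moreover have "((\<lambda>s. g (\<sigma> s) ((U \<circ> \<sigma>) s) ((U \<circ> \<sigma>) s)) has_real_derivative 0) (at 0)"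
  proof (rule has_field_derivative_transform_within_open[OF DERIV_const open_greaterThanLessThan e0])
    fix s assume "s \<in> {-e<..<e}"
    then have "\<sigma> s \<in> Sig" using e(3) by blast
    then show "0 = g (\<sigma> s) ((U \<circ> \<sigma>) s) ((U \<circ> \<sigma>) s)" using U_lightlike by (auto simp: lightlike_def)
  qed
  ultimately have "g (\<sigma> 0) (cov_along M g \<sigma> (U \<circ> \<sigma>) 0) ((U \<circ> \<sigma>) 0) + g (\<sigma> 0) ((U \<circ> \<sigma>) 0) (cov_along M g \<sigma> (U \<circ> \<sigma>) 0) = 0"
    using DERIV_unique by blast
  then show ?thesis using g_sym[OF qm, of "U ?q"] by (simp add: n e(4))
qed

text \<open>The Gauss lemma: \<open>g (J, U)\<close> is constant along the generator and vanishes at its start.\<close>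

lemma screen_orthogonal_U:
  assumes pt: "(p, t) \<in> Fd" and x: "x \<in> TS p"
  shows "g (Phi (p, t)) (dPhi (p, t) (x, 0)) (U (Phi (p, t))) = 0"
proof -
  note p = Fd_S[OF pt]
  let ?I = "{t. (p, t) \<in> Fd}" and ?\<gamma> = "\<lambda>t. Phi (p, t)" and ?J = "\<lambda>t. dPhi (p, t) (x, 0)"
  note J = invariant_field_along[OF p x refl]
  note geo = geodesicD[OF generator_geodesic(1)[OF p]]
  note sv = smooth_along_velocity[OF geo(3,1,4)]
  have "((\<lambda>t. g (?\<gamma> t) (?J t) (velocity M ?\<gamma> t)) has_real_derivative 0) (at s)" if s: "s \<in> ?I" for s
  proof -
    have ps: "(p, s) \<in> Fd" using s by simp
    note qm = Phi_mpoints[OF ps]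
    obtain \<alpha> where "curve_through M S p x \<alpha>" using x by (auto simp: tangent_space_def)
    from U_geodesic_orthogonal[OF ps push_curve[OF ps this, of 0]]
    have "g (?\<gamma> s) (cov_along M g ?\<gamma> ?J s) (velocity M ?\<gamma> s) = 0"
      using J(3)[OF s] U_velocity[OF ps] by simp
    then show ?thesis
      using metric_along_derivative[OF J(1) sv geo(1,4) s] geo(5)[OF s] by (simp add: g_simps[OF qm])
  qed
  then obtain c where c: "\<forall>t\<in>?I. g (?\<gamma> t) (?J t) (velocity M ?\<gamma> t) = c"
    using has_field_derivative_zero_constant[of ?I "\<lambda>t. g (?\<gamma> t) (?J t) (velocity M ?\<gamma> t)"]
      is_interval_convex[OF geo(2)] has_field_derivative_at_within by blast
  have "g p x (\<xi> p) = 0"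
    using xi_normal[OF p] x g_sym[OF S_mpoints[OF p], of x] by (simp add: normal_space_def)
  then have "c = 0" using c Fd_zero[OF p] J(4) generator_geodesic(2)[OF p] by (auto simp: Phi_zero[OF p])
  then show ?thesis using c pt U_velocity[OF pt] by simp
qed

lemma screen_eq: "(p, t) \<in> Fd \<Longrightarrow> screen M S Fd Phi (Phi (p, t)) = (\<lambda>x. dPhi (p, t) (x, 0)) ` TS p"
  by (simp add: screen_def inv_into_f_f[OF Phi_inj])

lemma screen_subspace:
  assumes pt: "(p, t) \<in> Fd"
  shows "subspace (screen M S Fd Phi (Phi (p, t)))" "dim (screen M S Fd Phi (Phi (p, t))) = n"
proof -
  note p = Fd_S[OF pt]
  let ?c = "chart_at M p" and ?d = "chart_at M (Phi (p, t))"
  note c = chart_at_in[OF S_mpoints[OF p]] and d = chart_at_in[OF Phi_mpoints[OF pt]]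
  obtain D F where rep: "Phi_rep ?c ?d p t D F" using Phi_rep_exists[OF pt c d] by blast
  have "smooth_on D F" "(snd ?c p, t) \<in> D" using rep by (auto simp: Phi_rep_def)
  then have lF: "linear (FD F (snd ?c p, t))" by (rule smooth_on_linear_FD)
  define L where "L x = from_chart M ?d (Phi (p, t)) (FD F (snd ?c p, t) (to_chart M ?c p x, 0))" for x
  have L: "dPhi (p, t) (x, 0) = L x" if "x \<in> TS p" for x
    unfolding L_def dPhi_chart(1)[OF pt c d that rep, symmetric] by (rule from_to_chart[OF d, symmetric])
  have lP: "linear (\<lambda>x. (to_chart M ?c p x, 0::real))"
    by (intro linearI) (simp_all add: to_chart_simps[OF c])
  have lL: "linear L"
    using linear_compose[OF linear_compose[OF lP lF] from_chart_linear[OF d]] by (simp add: L_def[abs_def] o_def)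
  have W: "screen M S Fd Phi (Phi (p, t)) = L ` TS p" unfolding screen_eq[OF pt] using L by auto
  have "x = 0" if "x \<in> TS p" "L x = 0" for x using dPhi_inj[OF pt that(1), of 0] L[OF that(1)] that(2) by simp
  then have inj: "inj_on L (TS p)" using linear_inj_on_iff_eq_0[OF lL TS_subspace[OF p]] by simp
  show "subspace (screen M S Fd Phi (Phi (p, t)))" unfolding W by (rule linear_subspace_image[OF lL TS_subspace[OF p]])
  have "dim (L ` TS p) = dim (TS p)"
    by (rule dim_image_eq[OF lL]) (use inj in \<open>simp add: span_eq_iff[THEN iffD2, OF TS_subspace[OF p]]\<close>)
  then show "dim (screen M S Fd Phi (Phi (p, t))) = n" by (simp add: W TS_dim[OF p])
qed

text \<open>In a Lorentzian form a vector orthogonal to the null vector \<open>U\<close> has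
  nonnegative square, and square zero only on the line of \<open>U\<close>. A screen vector on that
  line would give a vector \<open>(x, - c)\<close> in the kernel of the injective
  differential.\<close>

lemma screen_pos:
  assumes pt: "(p, t) \<in> Fd" and w: "w \<in> screen M S Fd Phi (Phi (p, t))" "w \<noteq> 0"
  shows "g (Phi (p, t)) w w > 0"
proof -
  let ?q = "Phi (p, t)"
  note p = Fd_S[OF pt] note qm = Phi_mpoints[OF pt]
  obtain x where x: "x \<in> TS p" "w = dPhi (p, t) (x, 0)" using w(1) screen_eq[OF pt] by auto
  have U: "U ?q \<noteq> 0" "g ?q (U ?q) (U ?q) = 0" using U_lightlike[OF pt] unfolding lightlike_def by simp_all
  have "g ?q w (U ?q) = 0" unfolding x(2) by (rule screen_orthogonal_U[OF pt x(1)])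
  from lorentz_form_null_orthogonal[OF g_lorentz[OF qm] U this]
  obtain c where c: "g ?q w w \<ge> 0 \<and> (g ?q w w = 0 \<longrightarrow> w = c *\<^sub>R U ?q)" ..
  have "g ?q w w \<noteq> 0"
  proof
    assume "g ?q w w = 0"
    then have e: "dPhi (p, t) (x, 0) = c *\<^sub>R dPhi (p, t) (0, 1)"
      using c unfolding generator_velocity(2)[OF pt] x(2) by blast
    have "dPhi (p, t) (1 *\<^sub>R x + (- c) *\<^sub>R 0, 1 * 0 + (- c) * 1) = 1 *\<^sub>R dPhi (p, t) (x, 0) + (- c) *\<^sub>R dPhi (p, t) (0, 1)"
      by (rule dPhi_combination[OF pt x(1) subspace_0[OF TS_subspace[OF p]]])
    then have "dPhi (p, t) (x, - c) = 0" unfolding e by simp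
    from dPhi_inj[OF pt x(1) this] have "c = 0" by simp
    then show False using w(2) unfolding x(2) e by simp
  qed
  then show ?thesis using c by linarith
qed

lemma screen_U: "(p, t) \<in> Fd \<Longrightarrow> w \<in> screen M S Fd Phi (Phi (p, t)) \<Longrightarrow> g (Phi (p, t)) w (U (Phi (p, t))) = 0"
  by (simp only: screen_eq, erule imageE, simp only: screen_orthogonal_U)

lemma transversal:
  assumes pt: "(p, t) \<in> Fd" and dim: "DIM('e) = n + 2"
  shows "g (Phi (p, t)) (transversal_field M g S Fd Phi (Phi (p, t))) (transversal_field M g S Fd Phi (Phi (p, t))) = 0"
    "\<And>w. w \<in> screen M S Fd Phi (Phi (p, t)) \<Longrightarrow> g (Phi (p, t)) w (transversal_field M g S Fd Phi (Phi (p, t))) = 0"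
    "g (Phi (p, t)) (U (Phi (p, t))) (transversal_field M g S Fd Phi (Phi (p, t))) = -1"
proof -
  let ?q = "Phi (p, t)" and ?W = "screen M S Fd Phi (Phi (p, t))"
  note qm = Phi_mpoints[OF pt]
  have U: "U ?q \<noteq> 0" "g ?q (U ?q) (U ?q) = 0" using U_lightlike[OF pt] by (auto simp: lightlike_def)
  have "\<exists>!v. (v \<noteq> 0 \<and> g ?q v v = 0) \<and> (\<forall>w\<in>?W. g ?q v w = 0) \<and> g ?q (U ?q) v = -1"
    by (rule null_transversal_unique[OF g_bilinear[OF qm] g_sym[OF qm] g_nondeg[OF qm] U screen_subspace(1)[OF pt] screen_pos[OF pt] screen_U[OF pt]])
      (simp_all add: screen_subspace(2)[OF pt] dim)
  from theI'[OF this] have v: "g ?q (transversal_field M g S Fd Phi ?q) (transversal_field M g S Fd Phi ?q) = 0"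
    "g ?q (U ?q) (transversal_field M g S Fd Phi ?q) = -1"
    "\<forall>w\<in>?W. g ?q (transversal_field M g S Fd Phi ?q) w = 0"
    unfolding transversal_field_def lightlike_def by blast+
  show "g ?q (transversal_field M g S Fd Phi ?q) (transversal_field M g S Fd Phi ?q) = 0"
    "g ?q (U ?q) (transversal_field M g S Fd Phi ?q) = -1" by (rule v)+
  show "g ?q w (transversal_field M g S Fd Phi ?q) = 0" if "w \<in> ?W" for w
    using bspec[OF v(3) that] g_sym[OF qm, of w "transversal_field M g S Fd Phi ?q"] by argo
qed

subsection \<open>Umbilicity\<close>

text \<open>The coefficient is a Euclidean quotient of chart components. It gives smoothness of the
  rotation form along a generator without any smoothness statement for the transversal
  field.\<close>

lemma smooth_coefficient:
  assumes K: "smooth_along M I \<gamma> K" and Y: "smooth_along M I \<gamma> Y" and I: "open I" "\<gamma> ` I \<subseteq> mpoints M"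
    and eq: "\<And>t. t \<in> I \<Longrightarrow> K t = h t *\<^sub>R Y t" "\<And>t. t \<in> I \<Longrightarrow> Y t \<noteq> 0"
  shows "smooth_on I h"
proof (rule smooth_on_local)
  fix t assume t: "t \<in> I"
  then have pm: "\<gamma> t \<in> mpoints M" using I by blast
  let ?c = "chart_at M (\<gamma> t)"
  note c = chart_at_in[OF pm]
  obtain D where D: "open D" "t \<in> D" "D \<subseteq> I" "\<gamma> ` D \<subseteq> fst ?c" "smooth_on D (\<lambda>s. to_chart M ?c (\<gamma> s) (K s))"
    by (rule smooth_alongD[OF K[unfolded smooth_along_def] I(1) t c]) (rule that)
  obtain D' where D': "open D'" "t \<in> D'" "smooth_on D' (\<lambda>s. to_chart M ?c (\<gamma> s) (Y s))"
    by (rule smooth_alongD[OF Y[unfolded smooth_along_def] I(1) t c]) (rule that)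
  let ?k = "\<lambda>s. to_chart M ?c (\<gamma> s) (K s)" and ?y = "\<lambda>s. to_chart M ?c (\<gamma> s) (Y s)"
  have o: "open (D \<inter> D')" using D D' by blast
  have y: "?y s \<noteq> 0" "?k s = h s *\<^sub>R ?y s" if "s \<in> D \<inter> D'" for s
  proof -
    have "\<gamma> s \<in> fst ?c" "s \<in> I" using that D(3,4) by blast+
    then show "?y s \<noteq> 0" "?k s = h s *\<^sub>R ?y s"
      using eq to_chart_0_iff[OF c(1)] to_chart_simps(3)[OF c(1)] by auto
  qed
  have s: "smooth_on (D \<inter> D') ?k" "smooth_on (D \<inter> D') ?y"
    by (rule smooth_on_subset[OF D(5)], simp, rule smooth_on_subset[OF D'(3)], simp)
  have "smooth_on (D \<inter> D') (\<lambda>s. (?k s \<bullet> ?y s) * inverse (?y s \<bullet> ?y s))"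
    by (intro smooth_on_mult smooth_on_inner smooth_on_inverse s o) (use y(1) in simp)
  then have "smooth_on (D \<inter> D') h"
    by (rule smooth_on_cong[OF _ o]) (use y in simp)
  then show "\<exists>U. t \<in> U \<and> open U \<and> smooth_on U h" using o D(2) D'(2) by blast
qed

lemma smooth_function_along:
  fixes \<mu> :: "'m \<Rightarrow> real"
  assumes \<mu>: "smooth_map M euclid A \<mu>" and \<gamma>: "smooth_map euclid M I \<gamma>" "open I" "\<gamma> ` I \<subseteq> A"
  shows "smooth_on I (\<lambda>t. \<mu> (\<gamma> t))"
proof (rule smooth_on_local)
  fix t assume t: "t \<in> I"
  have pm: "\<gamma> t \<in> mpoints M" using smooth_map_mpoints[OF \<gamma>(1)] t by blast
  have tA: "\<gamma> t \<in> A" using \<gamma>(3) t by blast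
  let ?c = "chart_at M (\<gamma> t)"
  note c = chart_at_in[OF pm]
  have id: "(UNIV, \<lambda>x. x) \<in> charts euclid" by (simp add: charts_euclid)
  obtain D F where "open D" "snd ?c (\<gamma> t) \<in> D" "smooth_on D F" 
    "\<And>q. q \<in> A \<Longrightarrow> q \<in> fst ?c \<Longrightarrow> snd ?c q \<in> D \<Longrightarrow> \<mu> q \<in> fst (UNIV, \<lambda>x. x) \<and> snd (UNIV, \<lambda>x. x) (\<mu> q) = F (snd ?c q)"
    by (rule smooth_mapD[OF \<mu> tA c(1) chart_inj[OF c(1)] c(2) id]) (simp_all add: that)
  then have D: "open D" "snd ?c (\<gamma> t) \<in> D" "smooth_on D F"
    "\<And>q. q \<in> A \<Longrightarrow> q \<in> fst ?c \<Longrightarrow> snd ?c q \<in> D \<Longrightarrow> \<mu> q = F (snd ?c q)" by simp_all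
  obtain N where N: "open N" "t \<in> N" "N \<subseteq> I" "\<gamma> ` N \<subseteq> fst ?c" "smooth_on N (\<lambda>s. snd ?c (\<gamma> s))"
    using smooth_map_euclidD[OF \<gamma>(1,2) t c] .
  define E where "E = N \<inter> (\<lambda>s. snd ?c (\<gamma> s)) -` D"
  have E: "open E" unfolding E_def by (rule continuous_open_preimage[OF smooth_on_continuous_on[OF N(5)] N(1) D(1)])
  have "smooth_on E (\<lambda>s. F (snd ?c (\<gamma> s)))"
    by (rule smooth_on_compose[OF D(3) smooth_on_subset[OF N(5)] _ E D(1)]) (auto simp: E_def)
  then have "smooth_on E (\<lambda>s. \<mu> (\<gamma> s))"
  proof (rule smooth_on_cong[OF _ E])
    fix s assume "s \<in> E"
    then have "\<gamma> s \<in> A" "\<gamma> s \<in> fst ?c" "snd ?c (\<gamma> s) \<in> D" using N(3,4) \<gamma>(3) by (auto simp: E_def)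
    then show "F (snd ?c (\<gamma> s)) = \<mu> (\<gamma> s)" using D(4) by simp
  qed
  then show "\<exists>U. t \<in> U \<and> open U \<and> smooth_on U (\<lambda>s. \<mu> (\<gamma> s))" using E N(2) D(2) by (intro exI[of _ E]) (simp add: E_def)
qed

lemma umbilic_nabla:
  assumes pt: "(p, t) \<in> Fd" and dim: "DIM('e) = n + 2" and \<mu>: "umbilicity_function M g Fd Phi \<mu>" and x: "x \<in> TS p"
  shows "nabla M g Sig U (Phi (p, t)) (dPhi (p, t) (x, 0)) =
    (- \<mu> (Phi (p, t))) *\<^sub>R dPhi (p, t) (x, 0)
    + rotation_form M g S Fd Phi (Phi (p, t)) (dPhi (p, t) (x, 0)) *\<^sub>R U (Phi (p, t))"
proof -
  let ?q = "Phi (p, t)" and ?j = "dPhi (p, t) (x, 0)" and ?V = "transversal_field M g S Fd Phi (Phi (p, t))"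
    and ?W = "screen M S Fd Phi (Phi (p, t))"
  note p = Fd_S[OF pt] note qm = Phi_mpoints[OF pt]
  let ?N = "nabla M g Sig U ?q ?j"
  define z where "z = ?N + \<mu> ?q *\<^sub>R ?j"
  have jT: "?j \<in> tangent_space M Sig ?q" by (rule dPhi_tangent[OF pt x])
  have zT: "g ?q z y = 0" if "y \<in> tangent_space M Sig ?q" for y
    using \<mu> pt jT that unfolding umbilicity_function_def B_form_def z_def by (force simp: g_simps[OF qm])
  have zW: "g ?q z w = 0" if "w \<in> ?W" for w using zT dPhi_tangent[OF pt] that screen_eq[OF pt] by auto
  have zU: "g ?q z (U ?q) = 0"
    using zT dPhi_tangent[OF pt subspace_0[OF TS_subspace[OF p]], of 1] generator_velocity(2)[OF pt] by simp
  have UU: "g ?q (U ?q) (U ?q) = 0" using U_lightlike[OF pt] by (simp add: lightlike_def)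
  note tv = transversal[OF pt dim]
  have "z = (- g ?q z ?V) *\<^sub>R U ?q"
    by (rule null_pair_orthogonal[OF g_bilinear[OF qm] g_sym[OF qm] UU tv(1,3) screen_subspace(1)[OF pt]
          screen_pos[OF pt] screen_U[OF pt] tv(2)])
      (simp_all add: screen_subspace(2)[OF pt] dim zU zW)
  \<comment> \<open>The transversal is orthogonal to the screen, so the \<mu>-term does not
    contribute to the coefficient of \<open>U\<close>, which is thereby the rotation form.\<close>
  moreover have "g ?q ?j ?V = 0" using tv(2) screen_eq[OF pt] x by blast
  ultimately have "z = rotation_form M g S Fd Phi ?q ?j *\<^sub>R U ?q"
    by (simp add: z_def rotation_form_def g_simps[OF qm])
  then show ?thesis by (simp add: z_def algebra_simps)
qed

text \<open>The first-order equation for \<open>J\<close> holds on all of \<open>I\<close>, and its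
  coefficients have to be smooth there before it can be differentiated again; in that second
  differentiation the velocity is parallel.\<close>

lemma umbilic_along:
  assumes p: "p \<in> S" and x: "x \<in> TS p" and dim: "DIM('e) = n + 2" and \<mu>: "umbilicity_function M g Fd Phi \<mu>"
    and J: "\<And>t. (p, t) \<in> Fd \<Longrightarrow> J t = dPhi (p, t) (x, 0)"
  defines "I \<equiv> {t. (p, t) \<in> Fd}" and "\<gamma> \<equiv> \<lambda>t. Phi (p, t)"
  defines "\<tau> \<equiv> \<lambda>t. rotation_form M g S Fd Phi (\<gamma> t) (J t)"
  shows "smooth_on I (\<lambda>t. \<mu> (\<gamma> t))" "smooth_on I \<tau>" "smooth_on I (\<lambda>t. deriv \<tau> t - \<mu> (\<gamma> t) * \<tau> t)"
    and "\<And>t. t \<in> I \<Longrightarrow> cov_along M g \<gamma> (cov_along M g \<gamma> J) t =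
      (\<mu> (\<gamma> t) * \<mu> (\<gamma> t) - deriv (\<lambda>t. \<mu> (\<gamma> t)) t) *\<^sub>R J t + (deriv \<tau> t - \<mu> (\<gamma> t) * \<tau> t) *\<^sub>R velocity M \<gamma> t"
proof -
  have oI: "open I" unfolding I_def by (rule generator_domain_open)
  have sJ: "smooth_along M I \<gamma> J"
    unfolding I_def \<gamma>_def by (rule invariant_field_along(1)[OF p x J])
  have nJ: "cov_along M g \<gamma> J t = nabla M g Sig U (\<gamma> t) (J t)" if "t \<in> I" for t
    unfolding \<gamma>_def by (rule invariant_field_along(3)[OF p x J]) (use that in \<open>simp_all add: I_def\<close>)
  have geo: "smooth_map euclid M I \<gamma>" "\<gamma> ` I \<subseteq> mpoints M" "\<And>t. t \<in> I \<Longrightarrow> cov_along M g \<gamma> (velocity M \<gamma>) t = 0"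
    using geodesicD[OF generator_geodesic(1)[OF p]] by (simp_all add: I_def \<gamma>_def)
  note sv = smooth_along_velocity[OF geo(1) oI geo(2)]
  have U: "U (\<gamma> t) = velocity M \<gamma> t" "velocity M \<gamma> t \<noteq> 0" if "t \<in> I" for t
    using U_velocity[of p t] U_lightlike[of p t] that by (auto simp: \<gamma>_def I_def lightlike_def)
  have cJ: "cov_along M g \<gamma> J t = (- \<mu> (\<gamma> t)) *\<^sub>R J t + \<tau> t *\<^sub>R velocity M \<gamma> t" if t: "t \<in> I" for t
  proof -
    have pt: "(p, t) \<in> Fd" using t by (simp add: I_def)
    show ?thesis
      using nJ[OF t] umbilic_nabla[OF pt dim \<mu> x] J[OF pt] U(1)[OF t] by (simp add: \<gamma>_def \<tau>_def)
  qed
  have "\<gamma> ` I \<subseteq> Sig" by (auto simp: \<gamma>_def I_def)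
  then show s\<mu>: "smooth_on I (\<lambda>t. \<mu> (\<gamma> t))"
    using \<mu> smooth_function_along[OF _ geo(1) oI] unfolding umbilicity_function_def by blast
  \<comment> \<open>\<tau> is read off as the coefficient of the nowhere vanishing velocity in
    \<open>J' + \<mu> J\<close>, a field already known to be smooth.\<close>
  show s\<tau>: "smooth_on I \<tau>"
  proof (rule smooth_coefficient[OF _ sv oI geo(2)])
    show "smooth_along M I \<gamma> (\<lambda>t. 1 *\<^sub>R cov_along M g \<gamma> J t + \<mu> (\<gamma> t) *\<^sub>R J t)"
      by (rule smooth_along_combination[OF smooth_along_cov[OF sJ oI geo(2)] sJ oI geo(2) smooth_on_const s\<mu>])
  qed (simp_all add: cJ U)
  have drv: "(h has_real_derivative deriv h t) (at t)" if "smooth_on I h" "t \<in> I" for h t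
  proof -
    have "(h has_real_derivative FD h t 1) (at t)"
      unfolding has_real_derivative_iff_has_vector_derivative
      by (rule has_vector_derivative_FD_real[OF smooth_on_imp_differentiable[OF that]])
    then show ?thesis using DERIV_imp_deriv by metis
  qed
  have FDd: "FD h t 1 = deriv h t" if "smooth_on I h" "t \<in> I" for h t
    using vector_derivative_unique_at[OF has_vector_derivative_FD_real[OF smooth_on_imp_differentiable[OF that]]]
      drv[OF that] unfolding has_real_derivative_iff_has_vector_derivative by blast
  have "smooth_on I (\<lambda>t. FD \<tau> t 1 - \<mu> (\<gamma> t) * \<tau> t)"
    by (intro smooth_on_diff smooth_on_FD smooth_on_mult s\<tau> s\<mu> oI)
  then show "smooth_on I (\<lambda>t. deriv \<tau> t - \<mu> (\<gamma> t) * \<tau> t)"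
    by (rule smooth_on_cong[OF _ oI]) (simp add: FDd[OF s\<tau>])
  show "cov_along M g \<gamma> (cov_along M g \<gamma> J) t =
      (\<mu> (\<gamma> t) * \<mu> (\<gamma> t) - deriv (\<lambda>t. \<mu> (\<gamma> t)) t) *\<^sub>R J t + (deriv \<tau> t - \<mu> (\<gamma> t) * \<tau> t) *\<^sub>R velocity M \<gamma> t"
    if t: "t \<in> I" for t
  proof -
    have "((\<lambda>t. - \<mu> (\<gamma> t)) has_real_derivative - deriv (\<lambda>t. \<mu> (\<gamma> t)) t) (at t)"
      by (rule DERIV_minus[OF drv[OF s\<mu> t]])
    note comb = cov_along_combination[OF sJ sv oI geo(2) t this drv[OF s\<tau> t]]
    have "cov_along M g \<gamma> (cov_along M g \<gamma> J) t =
        cov_along M g \<gamma> (\<lambda>t. (- \<mu> (\<gamma> t)) *\<^sub>R J t + \<tau> t *\<^sub>R velocity M \<gamma> t) t"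
      by (rule cov_along_cong[OF oI t]) (simp_all add: cJ)
    then show ?thesis unfolding comb cJ[OF t] geo(3)[OF t] by (simp add: algebra_simps)
  qed
qed

text \<open>Every screen vector \<open>w\<close> at \<open>Phi (p, t)\<close> is the value of a
  flow-invariant field along the generator, so the Jacobi equation and the formula for
  \<open>J''\<close> determine \<open>A w\<close>. The factor \<open>?lam\<close> is the same for
  all \<open>w\<close>. The multiple of \<open>U\<close> does depend on \<open>w\<close>, but its
  trace vanishes because the projection onto the screen annihilates \<open>U\<close>.\<close>

lemma umbilic_ricci:
  assumes pt: "(p, t) \<in> Fd" and dim: "DIM('e) = n + 2" and \<mu>: "umbilicity_function M g Fd Phi \<mu>"
  defines "\<gamma> \<equiv> \<lambda>t. Phi (p, t)"
  shows "ricci M g (\<gamma> t) (velocity M \<gamma> t) (velocity M \<gamma> t) =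
    (deriv (\<lambda>t. \<mu> (\<gamma> t)) t - \<mu> (\<gamma> t) * \<mu> (\<gamma> t)) * n"
proof -
  let ?q = "Phi (p, t)" and ?W = "screen M S Fd Phi (Phi (p, t))" and ?V = "transversal_field M g S Fd Phi (Phi (p, t))"
  let ?lam = "deriv (\<lambda>t. \<mu> (\<gamma> t)) t - \<mu> (\<gamma> t) * \<mu> (\<gamma> t)"
  note p = Fd_S[OF pt] note qm = Phi_mpoints[OF pt]
  note tv = transversal[OF pt dim]
  have UU: "g ?q (U ?q) (U ?q) = 0" using U_lightlike[OF pt] by (simp add: lightlike_def)
  have vU: "velocity M \<gamma> t = U ?q" using U_velocity[OF pt] by (simp add: \<gamma>_def)
  define A where "A y = curvature M g ?q y (U ?q) (U ?q)" for y
  have lA: "linear A" unfolding A_def[abs_def] by (rule curvature_linear[OF qm])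
  \<comment> \<open>The symmetries of the curvature tensor settle the two directions outside the
    screen: R(U, U)U is zero, and R(V, U)U has no component along \<open>V\<close> because it is
    orthogonal to \<open>U\<close>.\<close>
  have AU: "A (U ?q) = 0" "g ?q (A ?V) (U ?q) = 0"
    unfolding A_def by (rule curvature_same[OF qm], rule curvature_skew[OF qm])
  have W: "z \<in> ?W" if z: "g ?q z (U ?q) = 0" "g ?q z ?V = 0" for z
  proof (rule null_pair_complement[where b="g ?q" and U="U ?q" and V="?V"])
    show "dim ?W + 2 = DIM('e)" unfolding screen_subspace(2)[OF pt] dim ..
  qed (rule g_bilinear[OF qm] g_sym[OF qm] UU tv screen_subspace(1)[OF pt] screen_U[OF pt] z, assumption?)+
  have AW: "\<exists>f. A w = ?lam *\<^sub>R w - f *\<^sub>R U ?q" if w: "w \<in> ?W" for w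
  proof -
    obtain x where x: "x \<in> TS p" "w = dPhi (p, t) (x, 0)" using w unfolding screen_eq[OF pt] by blast
    have solve: "a = l *\<^sub>R y - u" if "c + a = 0" "c = (- l) *\<^sub>R y + u" for a c y u :: 'e and l
    proof -
      have "a = - c" using that(1) unfolding add_eq_0_iff .
      then show ?thesis unfolding that(2) by simp
    qed
    have tI: "t \<in> {t. (p, t) \<in> Fd}" using pt by simp
    let ?J = "\<lambda>t. dPhi (p, t) (x, 0)" and ?\<tau> = "\<lambda>t. rotation_form M g S Fd Phi (Phi (p, t)) (dPhi (p, t) (x, 0))"
    have "cov_along M g \<gamma> (cov_along M g \<gamma> ?J) t + A w = 0"
      using invariant_field_along(2)[OF p x(1) refl tI] unfolding A_def x(2) \<gamma>_def vU[unfolded \<gamma>_def] .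
    moreover have "cov_along M g \<gamma> (cov_along M g \<gamma> ?J) t = (- ?lam) *\<^sub>R w + (deriv ?\<tau> t - \<mu> (\<gamma> t) * ?\<tau> t) *\<^sub>R U ?q"
      using umbilic_along(4)[OF p x(1) dim \<mu> refl tI] unfolding x(2) \<gamma>_def vU[unfolded \<gamma>_def] minus_diff_eq .
    ultimately have eq: "A w = ?lam *\<^sub>R w - (deriv ?\<tau> t - \<mu> (\<gamma> t) * ?\<tau> t) *\<^sub>R U ?q"
      by (rule solve)
    show ?thesis by (rule exI) (rule eq)
  qed
  have "(\<Sum>e\<in>Basis. A e \<bullet> e) = ?lam * (real DIM('e) - 2)"
    by (rule trace_null_decomposition[OF g_bilinear[OF qm] g_sym[OF qm] UU tv(1,3) W lA AU tv(2) AW])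
  then show ?thesis unfolding ricci_def vU A_def by (simp add: dim \<gamma>_def)
qed

end

theorem theorem7p16:
  fixes M :: "('m, 'e::euclidean_space) manifold"
    and g :: "('m, 'e) metric_tensor"
    and T \<xi> X :: "'m \<Rightarrow> 'e"
    and S :: "'m set" and n :: nat and \<V> :: "('m \<times> 'e) set" and p :: 'm
  assumes "spacetime M g T" and "DIM('e) = n + 2" and "n + 2 \<ge> 4"
    and "embedded_submanifold M S n" and "connectedin (mtopology M) S" and "spacelike M g S"
    and "lightlike_normal_field M g S \<xi>"
    and "normal_exp_neighborhood M g S \<V>"
    and "X \<in> flow_invariant_fields M S (flow_domain S \<xi> \<V>) (flow_map M g \<xi>)"
    and "p \<in> S"
  shows "let \<O> = flow_domain S \<xi> \<V>; \<Phi> = flow_map M g \<xi>;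
             I = {t. (p, t) \<in> \<O>}; \<gamma> = (\<lambda>t. \<Phi> (p, t)); J = X \<circ> \<gamma>
         in S_jacobi_field M g S I \<gamma> J \<and>
            variation_through_normal_lightlike_geodesics M g S I \<gamma> J \<and>
            (\<forall>\<mu>. umbilicity_function M g \<O> \<Phi> \<mu> \<longrightarrow>
               (let \<tau>J = (\<lambda>t. rotation_form M g S \<O> \<Phi> (\<gamma> t) (J t));
                    f = (\<lambda>t. deriv \<tau>J t - \<mu> (\<gamma> t) * \<tau>J t)
                in smooth_on I \<tau>J \<and> smooth_on I f \<and>
                   (\<forall>t\<in>I. cov_along M g \<gamma> (cov_along M g \<gamma> J) t
                        + (ricci M g (\<gamma> t) (velocity M \<gamma> t) (velocity M \<gamma> t) / n) *\<^sub>R J t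
                      = f t *\<^sub>R velocity M \<gamma> t)))"
proof -
  interpret lightlike_flow M g S n \<xi> \<V>
    by unfold_locales (use assms in \<open>auto simp: spacetime_def smooth_manifold_def\<close>)
  obtain X0 where X0: "X0 \<in> vector_fields M S" "\<forall>(p, t)\<in>Fd. X (Phi (p, t)) = dPhi (p, t) (X0 p, 0)"
    using assms(9) unfolding flow_invariant_fields_def by blast
  define J where "J = X \<circ> (\<lambda>t. Phi (p, t))"
  have x: "X0 p \<in> TS p" using X0(1) assms(10) by (simp add: vector_fields_def)
  have J: "J t = dPhi (p, t) (X0 p, 0)" if "(p, t) \<in> Fd" for t using X0(2) that by (auto simp: J_def)
  \<comment> \<open>The trace is \<open>n\<close> times the coefficient of \<open>J\<close>, so the
    Ricci term can be divided by \<open>n\<close>.\<close>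
  have n: "real n \<noteq> 0" using assms(3) by simp
  have "cov_along M g (\<lambda>t. Phi (p, t)) (cov_along M g (\<lambda>t. Phi (p, t)) J) t
        + (ricci M g (Phi (p, t)) (velocity M (\<lambda>t. Phi (p, t)) t) (velocity M (\<lambda>t. Phi (p, t)) t) / n) *\<^sub>R J t
      = (deriv (\<lambda>t. rotation_form M g S Fd Phi (Phi (p, t)) (J t)) t
          - \<mu> (Phi (p, t)) * rotation_form M g S Fd Phi (Phi (p, t)) (J t)) *\<^sub>R velocity M (\<lambda>t. Phi (p, t)) t"
    if \<mu>: "umbilicity_function M g Fd Phi \<mu>" and t: "t \<in> {t. (p, t) \<in> Fd}" for \<mu> t
  proof -
    have pt: "(p, t) \<in> Fd" using t by simp
    have "ricci M g (Phi (p, t)) (velocity M (\<lambda>t. Phi (p, t)) t) (velocity M (\<lambda>t. Phi (p, t)) t) / n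
       = deriv (\<lambda>t. \<mu> (Phi (p, t))) t - \<mu> (Phi (p, t)) * \<mu> (Phi (p, t))"
      unfolding umbilic_ricci[OF pt assms(2) \<mu>] using n by simp
    moreover have "cov_along M g (\<lambda>t. Phi (p, t)) (cov_along M g (\<lambda>t. Phi (p, t)) J) t =
      (\<mu> (Phi (p, t)) * \<mu> (Phi (p, t)) - deriv (\<lambda>t. \<mu> (Phi (p, t))) t) *\<^sub>R J t
      + (deriv (\<lambda>t. rotation_form M g S Fd Phi (Phi (p, t)) (J t)) t
          - \<mu> (Phi (p, t)) * rotation_form M g S Fd Phi (Phi (p, t)) (J t)) *\<^sub>R velocity M (\<lambda>t. Phi (p, t)) t"
      by (rule umbilic_along(4)[OF assms(10) x assms(2) \<mu> J t])
    ultimately show ?thesis by (simp add: scaleR_diff_left)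
  qed
  moreover have "smooth_on {t. (p, t) \<in> Fd} (\<lambda>t. rotation_form M g S Fd Phi (Phi (p, t)) (J t))"
    "smooth_on {t. (p, t) \<in> Fd} (\<lambda>t. deriv (\<lambda>t. rotation_form M g S Fd Phi (Phi (p, t)) (J t)) t
       - \<mu> (Phi (p, t)) * rotation_form M g S Fd Phi (Phi (p, t)) (J t))"
    if \<mu>: "umbilicity_function M g Fd Phi \<mu>" for \<mu>
    by (rule umbilic_along(2,3)[OF assms(10) x assms(2) \<mu> J]; assumption)+
  moreover have "S_jacobi_field M g S {t. (p, t) \<in> Fd} (\<lambda>t. Phi (p, t)) J"
    by (rule invariant_field_S_jacobi[OF assms(10) x J])
  moreover have "variation_through_normal_lightlike_geodesics M g S {t. (p, t) \<in> Fd} (\<lambda>t. Phi (p, t)) J"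
    by (rule invariant_field_along(6)[OF assms(10) x J])
  ultimately show ?thesis unfolding Let_def J_def[symmetric] by blast
qed

end
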